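(* Let $T\in(0,\infty)$ and let $(X(t),U(t))_{0\le t\le T}$ be a two-dimensional centered continuous Gaussian process. Let $(B(t))_{0\le t\le T}$ be a one-dimensional Brownian motion independent of $(X,U)$, let $l(t,s)$ be a bounded measurable function on $[0,T]^2$ with $l(t,s)=0$ for $s>t$, and let $\mu$ be a bounded measurable deterministic function on $[0,T]$ with $\mu(t)\ne0$ for $0\le t\le T$. Put, for $0\le t\le T$, $$\alpha(t)=\int_0^t l(t,s)\,dB(s),\quad V(t)=B(t)-\int_0^t\alpha(s)\,ds,\quad Y(t)=\int_0^t\mu(s)X(s)\,ds+V(t),$$ $$Z(t)=(X(t),U(t),\alpha(t))^{*},\qquad \widehat Z(t)=\mathbb{E}[Z(t)\,|\,\mathcal{F}^Y(t)],$$ and define the error matrix $P(t,s)=\mathbb{E}[Z(t)(Z(s)-\widehat Z(s))^{*}]\in\mathbf{R}^{3\times3}$ for $0\le s\le t\le T$. Let $\Gamma_{ZZ}(t,s)=\mathbb{E}[Z(t)Z^{*}(s)]$ and $$D(t,s)=\begin{pmatrix}0&0&0\\0&0&0\\ l(t,s)/\mu(s)&0&0\end{pmatrix},\qquad a(s)=\begin{pmatrix}\mu(s)\\0\\-1\end{pmatrix}.$$ Then the filter $\widehat Z$ satisfies the stochastic integral equation $$\widehat Z(t)=\int_0^t\{P(t,s)+D(t,s)\}a(s)\{dY(s)-a^{*}(s)\widehat Z(s)\,ds\}\qquad(0\le t\le T),$$ and the error matrix $P(t,s)$ is the unique solution to the matrix Riccati-type integral equation $$P(t,s)=-\int_0^s\{P(t,r)+D(t,r)\}a(r)a^{*}(r)\{P(s,r)+D(s,r)\}^{*}dr+\Gamma_{ZZ}(t,s)\qquad(0\le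 s\le t\le T)$$ such that $P(t,t)$ is symmetric and nonnegative definite for $0\le t\le T$.
   Context: $*$ denotes transposition. $\mathcal{F}^Y(t)$ is the $\mathbb{P}$-augmentation (by null sets) of $\sigma(Y(s):0\le s\le t)$ on the underlying complete probability space $(\Omega,\mathcal{F},\mathbb{P})$. *)

theory Defs
  imports "HOL-Probability.Probability"
begin

text \<open>
  A process on \<open>[0, T]\<close> is a function \<open>W\<close> with \<open>W t \<omega>\<close> its value at time \<open>t\<close>; its values at
  times outside \<open>[0, T]\<close> are never used. Continuity of paths is only required almost surely.
\<close>

definition square_integrable :: "'b measure \<Rightarrow> ('b \<Rightarrow> real) \<Rightarrow> bool" where
  "square_integrable M f \<longleftrightarrow> f \<in> borel_measurable M \<and> integrable M (\<lambda>x. (f x)\<^sup>2)"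

definition measurable_process ::
    "'w measure \<Rightarrow> real \<Rightarrow> (real \<Rightarrow> 'w \<Rightarrow> 'b::topological_space) \<Rightarrow> bool" where
  "measurable_process M T W \<longleftrightarrow>
     (\<lambda>(t, \<omega>). W t \<omega>) \<in> borel_measurable (restrict_space borel {0..T} \<Otimes>\<^sub>M M)"

definition continuous_process ::
    "'w measure \<Rightarrow> real \<Rightarrow> (real \<Rightarrow> 'w \<Rightarrow> 'b::topological_space) \<Rightarrow> bool" where
  "continuous_process M T W \<longleftrightarrow> (AE \<omega> in M. continuous_on {0..T} (\<lambda>t. W t \<omega>))"

text \<open>The variance may vanish, a case that \<open>normal_density\<close> does not cover.\<close>

definition centered_gaussian :: "'w measure \<Rightarrow> ('w \<Rightarrow> real) \<Rightarrow> bool" where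
  "centered_gaussian M \<xi> \<longleftrightarrow> \<xi> \<in> borel_measurable M \<and>
     ((AE \<omega> in M. \<xi> \<omega> = 0) \<or>
      (\<exists>\<sigma>>0. distributed M lborel \<xi> (\<lambda>x. ennreal (normal_density 0 \<sigma> x))))"

definition centered_gaussian_process ::
    "'w measure \<Rightarrow> real \<Rightarrow> (real \<Rightarrow> 'w \<Rightarrow> 'b::euclidean_space) \<Rightarrow> bool" where
  "centered_gaussian_process M T W \<longleftrightarrow>
     (\<forall>J c. finite J \<and> J \<subseteq> {0..T} \<longrightarrow> centered_gaussian M (\<lambda>\<omega>. \<Sum>t\<in>J. c t \<bullet> W t \<omega>))"

definition brownian_motion :: "'w measure \<Rightarrow> real \<Rightarrow> (real \<Rightarrow> 'w \<Rightarrow> real) \<Rightarrow> bool" where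
  "brownian_motion M T B \<longleftrightarrow>
     (\<forall>t\<in>{0..T}. B t \<in> borel_measurable M) \<and>
     (AE \<omega> in M. B 0 \<omega> = 0) \<and>
     continuous_process M T B \<and>
     (\<forall>s t. 0 \<le> s \<and> s < t \<and> t \<le> T \<longrightarrow>
        distributed M lborel (\<lambda>\<omega>. B t \<omega> - B s \<omega>)
          (\<lambda>x. ennreal (normal_density 0 (sqrt (t - s)) x))) \<and>
     (\<forall>(n::nat) p. mono p \<and> range p \<subseteq> {0..T} \<longrightarrow>
        prob_space.indep_vars M (\<lambda>_. borel) (\<lambda>i \<omega>. B (p (Suc i)) \<omega> - B (p i) \<omega>) {..<n})"

definition generated_sets ::
    "'w measure \<Rightarrow> real \<Rightarrow> (real \<Rightarrow> 'w \<Rightarrow> 'b::topological_space) \<Rightarrow> 'w set set" where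
  "generated_sets M t W =
     sigma_sets (space M) {W s -` A \<inter> space M | s A. s \<in> {0..t} \<and> A \<in> sets borel}"

text \<open>Only the \<sigma>-algebra of \<open>augmented_filtration M W t\<close> matters, not its measure.\<close>

definition augmented_filtration ::
    "'w measure \<Rightarrow> (real \<Rightarrow> 'w \<Rightarrow> real) \<Rightarrow> real \<Rightarrow> 'w measure" where
  "augmented_filtration M W t = sigma (space M) (generated_sets M t W \<union> null_sets M)"

text \<open>
  A list entry \<open>(u, v, c)\<close> encodes the step function \<open>c * indicator {u<..v}\<close>; the entries of a
  list are added up, and their intervals may overlap.
\<close>

definition step_fun :: "(real \<times> real \<times> real) list \<Rightarrow> real \<Rightarrow> real" where
  "step_fun L r = (\<Sum>(u, v, c)\<leftarrow>L. c * indicator {u<..v} r)"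

definition step_integral ::
    "(real \<Rightarrow> 'w \<Rightarrow> real) \<Rightarrow> (real \<times> real \<times> real) list \<Rightarrow> 'w \<Rightarrow> real" where
  "step_integral W L \<omega> = (\<Sum>(u, v, c)\<leftarrow>L. c * (W v \<omega> - W u \<omega>))"

text \<open>
  \<open>is_wiener_integral M W t h J\<close>: the random variable \<open>J\<close> is a version of the stochastic integral
  of the deterministic function \<open>h\<close> with respect to \<open>W\<close> over \<open>[0, t]\<close>, i.e. the mean-square limit
  of the integrals of step functions that approximate \<open>h\<close> in \<open>L\<^sup>2[0, t]\<close>. Since step functions are
  dense, \<open>J\<close> is determined almost surely.
\<close>

definition is_wiener_integral ::
    "'w measure \<Rightarrow> (real \<Rightarrow> 'w \<Rightarrow> real) \<Rightarrow> real \<Rightarrow> (real \<Rightarrow> real) \<Rightarrow> ('w \<Rightarrow> real) \<Rightarrow> bool" where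
  "is_wiener_integral M W t h J \<longleftrightarrow>
     square_integrable (lebesgue_on {0..t}) h \<and>
     (\<forall>u\<in>{0..t}. square_integrable M (W u)) \<and>
     square_integrable M J \<and>
     (\<forall>L :: nat \<Rightarrow> (real \<times> real \<times> real) list.
        (\<forall>n. \<forall>(u, v, c)\<in>set (L n). 0 \<le> u \<and> u \<le> v \<and> v \<le> t) \<and>
        (\<lambda>n. LINT r|lebesgue_on {0..t}. (step_fun (L n) r - h r)\<^sup>2) \<longlonglongrightarrow> 0 \<longrightarrow>
        (\<lambda>n. LINT \<omega>|M. (step_integral W (L n) \<omega> - J \<omega>)\<^sup>2) \<longlonglongrightarrow> 0)"

definition outer :: "real ^ 'm \<Rightarrow> real ^ 'n \<Rightarrow> real ^ 'n ^ 'm" where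
  "outer v w = (\<chi> i j. v $ i * w $ j)"

definition nonneg_definite :: "real ^ 'n ^ 'n \<Rightarrow> bool" where
  "nonneg_definite A \<longleftrightarrow> (\<forall>v. 0 \<le> v \<bullet> (A *v v))"

text \<open>
  Solutions are only considered on \<open>0 \<le> s \<le> t \<le> T\<close>. Beyond the existence of the integrals as
  Lebesgue integrals no regularity of \<open>Q\<close> is imposed.
\<close>

definition riccati_solution ::
    "real \<Rightarrow> (real \<Rightarrow> real ^ 'n) \<Rightarrow> (real \<Rightarrow> real \<Rightarrow> real ^ 'n ^ 'n) \<Rightarrow>
     (real \<Rightarrow> real \<Rightarrow> real ^ 'n ^ 'n) \<Rightarrow> (real \<Rightarrow> real \<Rightarrow> real ^ 'n ^ 'n) \<Rightarrow> bool" where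
  "riccati_solution T a D \<Gamma> Q \<longleftrightarrow>
     (\<forall>s t. 0 \<le> s \<and> s \<le> t \<and> t \<le> T \<longrightarrow>
        integrable (lebesgue_on {0..s})
          (\<lambda>r. (Q t r + D t r) ** outer (a r) (a r) ** transpose (Q s r + D s r)) \<and>
        Q t s = - (LINT r|lebesgue_on {0..s}.
                     (Q t r + D t r) ** outer (a r) (a r) ** transpose (Q s r + D s r)) + \<Gamma> t s)"

end

theory Submission
  imports Defs
begin

text \<open>
  Everything happens in the Hilbert space of square-integrable random variables. Write
  \<open>dY = \<theta> ds + dB\<close> with \<open>\<theta> = a\<^sup>* Z\<close>. All variables lie in the Gaussian space
  spanned by \<open>X\<close>, \<open>U\<close>, \<open>B\<close>, so the conditional expectation given the observations is the orthogonal
  projection onto their closed span, and Gram-Schmidt yields a jointly measurable version of it.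
  The innovation \<open>\<nu> = Y - \<integral> a\<^sup>* Zhat ds\<close> has orthogonal increments with the covariance of
  Brownian motion. It spans the same spaces as \<open>Y\<close>: the norm of \<open>\<integral> k dY\<close> dominates that of \<open>k\<close>, because
  \<open>B\<close> enters \<open>Y\<close> through an invertible Volterra transform, so a functional that vanishes on the
  innovations solves a homogeneous Volterra inequality. Hence \<open>Zhat(t)\<close> is the Wiener integral over
  \<open>[0, t]\<close> of the density of \<open>s \<mapsto> E (Z(t) \<nu>(s))\<close>, which is \<open>(P(t,s) + D(t,s)) a(s)\<close>. Parseval's identity
  for \<open>E (Z(t) Zhat(s)\<^sup>*)\<close> is the Riccati equation. In the other direction, nonnegativity on the diagonal bounds
  \<open>\<integral> \<bar>(Q(s,r) + D(s,r)) a(r)\<bar>\<^sup>2 dr\<close>, hence \<open>Q\<close>, and two bounded solutions agree by Gronwall iteration.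
\<close>

section \<open>Square-integrable functions\<close>

text \<open>For each t the conditional expectation is fixed only up to a null set that depends on t,
  so the time integral of a* Zhat makes sense only for jointly measurable versions. Hence
  projections carry a measurable parameter t, and the filter equation is proved for every measurable
  version. The argument is of second order. If W has the covariance of Brownian motion, a Wiener
  integral J of h over [0, t] is recognised by two facts: J lies in the closed span of W on [0, t],
  and s -> E (J W(s)) has density h. For the filter this density can be computed: d\<nu> = dB + e ds
  with e = a* (Z - Zhat), so it is the sum of the direct correlation of Z(t) with dB(s), which is
  D(t,s) a(s), and of E (Z(t) e(s)) = P(t,s) a(s). The variance of \<nu> comes from a local
  estimate: on an interval of length h it is h + O(h^(3/2)), and orthogonality makes it additive. In
  the uniqueness part a solution Q is an arbitrary function, and the distance of two solutions may
  fail to be measurable in time; the Gronwall iteration therefore integrates explicit upper bounds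
  instead of that distance.\<close>

lemma square_integrableD:
  assumes "square_integrable M f"
  shows "f \<in> borel_measurable M" "integrable M (\<lambda>x. (f x)\<^sup>2)" "integrable M (\<lambda>x. f x * f x)"
  using assms by (auto simp: square_integrable_def power2_eq_square)

lemma square_integrable_mult:
  fixes f g :: "'a \<Rightarrow> real"
  assumes "square_integrable M f" "square_integrable M g"
  shows "integrable M (\<lambda>x. f x * g x)"
proof (rule Bochner_Integration.integrable_bound)
  show "integrable M (\<lambda>x. (f x)\<^sup>2 + (g x)\<^sup>2)"
    using assms by (auto simp: square_integrable_def)
  show "(\<lambda>x. f x * g x) \<in> borel_measurable M"
    using assms by (auto simp: square_integrable_def)
  have "\<bar>f x * g x\<bar> \<le> (f x)\<^sup>2 + (g x)\<^sup>2" for x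
  proof -
    have "0 \<le> (\<bar>f x\<bar> - \<bar>g x\<bar>)\<^sup>2" by simp
    then have "2 * (\<bar>f x\<bar> * \<bar>g x\<bar>) \<le> (f x)\<^sup>2 + (g x)\<^sup>2"
      by (simp add: power2_diff)
    moreover have "0 \<le> \<bar>f x\<bar> * \<bar>g x\<bar>" by simp
    ultimately show ?thesis unfolding abs_mult by linarith
  qed
  then show "AE x in M. norm (f x * g x) \<le> norm ((f x)\<^sup>2 + (g x)\<^sup>2)"
    by simp
qed

lemma square_integrable_cmult [intro]:
  "square_integrable M f \<Longrightarrow> square_integrable M (\<lambda>x. c * f x)"
  by (auto simp: square_integrable_def power_mult_distrib)

lemma square_integrable_uminus [intro]:
  "square_integrable M f \<Longrightarrow> square_integrable M (\<lambda>x. - f x)"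
  by (auto simp: square_integrable_def)

lemma square_integrable_zero [simp, intro]: "square_integrable M (\<lambda>x. 0)"
  by (auto simp: square_integrable_def)

lemma square_integrable_add [intro]:
  assumes "square_integrable M f" "square_integrable M g"
  shows "square_integrable M (\<lambda>x. f x + g x)"
  using assms square_integrable_mult[OF assms]
  by (auto simp: square_integrable_def power2_sum mult.assoc)

lemma square_integrable_diff [intro]:
  assumes "square_integrable M f" "square_integrable M g"
  shows "square_integrable M (\<lambda>x. f x - g x)"
  using square_integrable_add[OF assms(1) square_integrable_uminus[OF assms(2)]] by simp

lemma square_integrable_sum [intro]:
  "(\<And>i. i \<in> I \<Longrightarrow> square_integrable M (f i)) \<Longrightarrow> square_integrable M (\<lambda>x. \<Sum>i\<in>I. f i x)"
  by (induction I rule: infinite_finite_induct) auto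

lemma square_integrable_AE:
  assumes "square_integrable M f" "g \<in> borel_measurable M" "AE x in M. f x = g x"
  shows "square_integrable M g"
proof -
  have "integrable M (\<lambda>x. (g x)\<^sup>2)"
    using assms by (subst integrable_cong_AE[of _ _ "\<lambda>x. (f x)\<^sup>2"]) (auto simp: square_integrable_def)
  then show ?thesis using assms by (simp add: square_integrable_def)
qed

lemma (in finite_measure) square_integrable_imp_integrable:
  "square_integrable M f \<Longrightarrow> integrable M f"
  using square_integrable_mult[of M f "\<lambda>_. 1"] by (simp add: square_integrable_def)

lemma (in finite_measure) square_integrable_bounded:
  assumes "f \<in> borel_measurable M" "\<And>x. x \<in> space M \<Longrightarrow> \<bar>f x\<bar> \<le> K"
  shows "square_integrable M f"
proof -
  have "integrable M (\<lambda>x. (f x)\<^sup>2)"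
  proof (rule integrable_const_bound[where B="K\<^sup>2"])
    show "AE x in M. norm ((f x)\<^sup>2) \<le> K\<^sup>2"
      using assms(2) power_mono[of "\<bar>f _\<bar>" K 2] by (intro AE_I2) simp
  qed (use assms in auto)
  then show ?thesis using assms by (auto simp: square_integrable_def)
qed

lemma Cauchy_Schwarz_integral:
  fixes f g :: "'a \<Rightarrow> real"
  assumes f: "square_integrable M f" and g: "square_integrable M g"
  shows "(LINT x|M. f x * g x)\<^sup>2 \<le> (LINT x|M. (f x)\<^sup>2) * (LINT x|M. (g x)\<^sup>2)"
proof -
  let ?a = "LINT x|M. (f x)\<^sup>2" and ?b = "LINT x|M. f x * g x" and ?c = "LINT x|M. (g x)\<^sup>2"
  have q: "0 \<le> r\<^sup>2 * ?a - 2 * r * s * ?b + s\<^sup>2 * ?c" for r s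
  proof -
    have "0 \<le> (LINT x|M. (r * f x - s * g x)\<^sup>2)" by simp
    also have "\<dots> = (LINT x|M. r\<^sup>2 * (f x)\<^sup>2 - 2 * r * s * (f x * g x) + s\<^sup>2 * (g x)\<^sup>2)"
      by (simp add: power2_diff power_mult_distrib algebra_simps)
    also have "\<dots> = r\<^sup>2 * ?a - 2 * r * s * ?b + s\<^sup>2 * ?c"
      using square_integrable_mult[OF f g] square_integrableD[OF f] square_integrableD[OF g]
      by simp
    finally show ?thesis .
  qed
  have ac: "0 \<le> ?a" "0 \<le> ?c" by auto
  show ?thesis
  proof (cases "?c = 0")
    case True
    have "?b = 0"
    proof (rule ccontr)
      assume b: "?b \<noteq> 0"
      \<comment> \<open>As \<open>?c = 0\<close>, the form is affine in s; this s gives it the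
        negative value \<open>- ?a - 2\<close>.\<close>
      have "0 \<le> 1\<^sup>2 * ?a - 2 * 1 * ((?a + 1) / ?b) * ?b + ((?a + 1) / ?b)\<^sup>2 * ?c" by (rule q)
      then show False using b True ac by simp
    qed
    then show ?thesis using ac by simp
  next
    case False
    \<comment> \<open>The choice r = \<open>?c\<close>, s = \<open>?b\<close> makes the form equal
      to \<open>?c * (?a * ?c - ?b\<^sup>2)\<close>.\<close>
    have "0 \<le> ?c\<^sup>2 * ?a - 2 * ?c * ?b * ?b + ?b\<^sup>2 * ?c" by (rule q)
    then have "0 \<le> ?c * (?a * ?c - ?b\<^sup>2)" by (simp add: power2_eq_square algebra_simps)
    then show ?thesis using False ac by (simp add: zero_le_mult_iff)
  qed
qed

lemma Cauchy_Schwarz_abs: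
  fixes f g :: "'a \<Rightarrow> real"
  assumes f: "square_integrable M f" and g: "square_integrable M g"
  shows "\<bar>LINT x|M. f x * g x\<bar> \<le> sqrt (LINT x|M. (f x)\<^sup>2) * sqrt (LINT x|M. (g x)\<^sup>2)"
  using real_sqrt_le_mono[OF Cauchy_Schwarz_integral[OF assms]] by (simp add: real_sqrt_mult)

lemma (in prob_space) expectation_abs_le_L2:
  assumes f: "square_integrable M f"
  shows "expectation (\<lambda>x. \<bar>f x\<bar>) \<le> sqrt (expectation (\<lambda>x. (f x)\<^sup>2))"
proof -
  have "square_integrable M (\<lambda>x. \<bar>f x\<bar>)" "square_integrable M (\<lambda>x. 1)"
    using f by (auto simp: square_integrable_def)
  from Cauchy_Schwarz_abs[OF this] show ?thesis by (simp add: prob_space)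
qed

lemma integral_square_diff:
  assumes f: "square_integrable M f" and g: "square_integrable M g"
  shows "(LINT x|M. (f x - g x)\<^sup>2)
     = (LINT x|M. (f x)\<^sup>2) - 2 * (LINT x|M. f x * g x) + (LINT x|M. (g x)\<^sup>2)"
proof -
  have "(LINT x|M. (f x - g x)\<^sup>2) = (LINT x|M. (f x)\<^sup>2 - 2 * (f x * g x) + (g x)\<^sup>2)"
    by (simp add: power2_diff algebra_simps)
  then show ?thesis
    using square_integrable_mult[OF f g] square_integrableD[OF f] square_integrableD[OF g] by simp
qed

lemma integral_square_add:
  assumes f: "square_integrable M f" and g: "square_integrable M g"
  shows "(LINT x|M. (f x + g x)\<^sup>2)
     = (LINT x|M. (f x)\<^sup>2) + 2 * (LINT x|M. f x * g x) + (LINT x|M. (g x)\<^sup>2)"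
  using integral_square_diff[OF f square_integrable_uminus[OF g]] by simp

lemma integral_square_add_le:
  fixes f g :: "'a \<Rightarrow> real"
  assumes f: "square_integrable M f" and g: "square_integrable M g"
  shows "(LINT x|M. (f x + g x)\<^sup>2) \<le> 2 * (LINT x|M. (f x)\<^sup>2) + 2 * (LINT x|M. (g x)\<^sup>2)"
proof -
  have "0 \<le> (LINT x|M. (f x - g x)\<^sup>2)" by simp
  then show ?thesis
    unfolding integral_square_add[OF assms] integral_square_diff[OF assms] by simp
qed

lemma integral_square_diff_le:
  fixes f g :: "'a \<Rightarrow> real"
  assumes f: "square_integrable M f" and g: "square_integrable M g"
  shows "(LINT x|M. (f x - g x)\<^sup>2) \<le> 2 * (LINT x|M. (f x)\<^sup>2) + 2 * (LINT x|M. (g x)\<^sup>2)"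
  using integral_square_add_le[OF f square_integrable_uminus[OF g]] by simp

lemma integral_square_eq_0_imp_AE:
  assumes "square_integrable M f" "(LINT x|M. (f x)\<^sup>2) = 0"
  shows "AE x in M. f x = 0"
  using assms integral_nonneg_eq_0_iff_AE[of M "\<lambda>x. (f x)\<^sup>2"]
  by (auto simp: square_integrable_def)

text \<open>Square integrability is built in because the integral of a non-integrable square is 0 by
  convention and would otherwise count as convergence.\<close>

definition L2_tendsto :: "'a measure \<Rightarrow> (nat \<Rightarrow> 'a \<Rightarrow> real) \<Rightarrow> ('a \<Rightarrow> real) \<Rightarrow> bool" where
  "L2_tendsto M f g \<longleftrightarrow> (\<forall>n. square_integrable M (f n)) \<and> square_integrable M g \<and>
     (\<lambda>n. LINT x|M. (f n x - g x)\<^sup>2) \<longlonglongrightarrow> 0"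

lemma L2_tendstoD:
  assumes "L2_tendsto M f g"
  shows "square_integrable M (f n)" "square_integrable M g"
    "(\<lambda>n. LINT x|M. (f n x - g x)\<^sup>2) \<longlonglongrightarrow> 0"
  using assms by (auto simp: L2_tendsto_def)

lemma L2_tendsto_inner:
  assumes fg: "L2_tendsto M f g" and h: "square_integrable M h"
  shows "(\<lambda>n. LINT x|M. f n x * h x) \<longlonglongrightarrow> (LINT x|M. g x * h x)"
proof -
  note f = L2_tendstoD(1)[OF fg] and g = L2_tendstoD(2)[OF fg]
  have "(\<lambda>n. (LINT x|M. f n x * h x) - (LINT x|M. g x * h x)) \<longlonglongrightarrow> 0"
  proof (rule Lim_null_comparison)
    show "\<forall>\<^sub>F n in sequentially. norm ((LINT x|M. f n x * h x) - (LINT x|M. g x * h x))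
        \<le> sqrt (LINT x|M. (f n x - g x)\<^sup>2) * sqrt (LINT x|M. (h x)\<^sup>2)"
    proof (intro always_eventually allI)
      fix n
      have "(LINT x|M. f n x * h x) - (LINT x|M. g x * h x) = (LINT x|M. (f n x - g x) * h x)"
        using square_integrable_mult[OF f h] square_integrable_mult[OF g h]
        by (simp add: left_diff_distrib)
      then show "norm ((LINT x|M. f n x * h x) - (LINT x|M. g x * h x))
        \<le> sqrt (LINT x|M. (f n x - g x)\<^sup>2) * sqrt (LINT x|M. (h x)\<^sup>2)"
        using Cauchy_Schwarz_abs[OF square_integrable_diff[OF f g] h] by simp
    qed
    show "(\<lambda>n. sqrt (LINT x|M. (f n x - g x)\<^sup>2) * sqrt (LINT x|M. (h x)\<^sup>2)) \<longlonglongrightarrow> 0"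
      using tendsto_mult_left_zero[OF tendsto_real_sqrt[OF L2_tendstoD(3)[OF fg], simplified]] by simp
  qed
  then show ?thesis by (rule LIM_zero_cancel)
qed

lemma L2_tendsto_square:
  assumes fg: "L2_tendsto M f g"
  shows "(\<lambda>n. LINT x|M. (f n x)\<^sup>2) \<longlonglongrightarrow> (LINT x|M. (g x)\<^sup>2)"
proof -
  note f = L2_tendstoD(1)[OF fg] and g = L2_tendstoD(2)[OF fg]
  have "(LINT x|M. (f n x)\<^sup>2)
      = (LINT x|M. (f n x - g x)\<^sup>2) + 2 * (LINT x|M. f n x * g x) - (LINT x|M. (g x)\<^sup>2)" for n
    using integral_square_diff[OF f g, of n] by simp
  moreover have "(\<lambda>n. (LINT x|M. (f n x - g x)\<^sup>2) + 2 * (LINT x|M. f n x * g x) - (LINT x|M. (g x)\<^sup>2))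
     \<longlonglongrightarrow> 0 + 2 * (LINT x|M. g x * g x) - (LINT x|M. (g x)\<^sup>2)"
    by (intro tendsto_intros L2_tendsto_inner fg g L2_tendstoD(3)[OF fg])
  ultimately show ?thesis by (simp add: power2_eq_square)
qed

lemma L2_tendsto_const: "square_integrable M f \<Longrightarrow> L2_tendsto M (\<lambda>_. f) f"
  by (simp add: L2_tendsto_def)

lemma L2_tendsto_diff:
  assumes "L2_tendsto M f f'" "L2_tendsto M g g'"
  shows "L2_tendsto M (\<lambda>n x. f n x - g n x) (\<lambda>x. f' x - g' x)"
proof -
  note * = L2_tendstoD[OF assms(1)] L2_tendstoD[OF assms(2)]
  have "(\<lambda>n. LINT x|M. ((f n x - g n x) - (f' x - g' x))\<^sup>2) \<longlonglongrightarrow> 0"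
  proof (rule Lim_null_comparison)
    show "\<forall>\<^sub>F n in sequentially. norm (LINT x|M. ((f n x - g n x) - (f' x - g' x))\<^sup>2)
       \<le> 2 * (LINT x|M. (f n x - f' x)\<^sup>2) + 2 * (LINT x|M. (g n x - g' x)\<^sup>2)"
    proof (intro always_eventually allI)
      fix n
      have "(LINT x|M. ((f n x - g n x) - (f' x - g' x))\<^sup>2)
          = (LINT x|M. ((f n x - f' x) - (g n x - g' x))\<^sup>2)"
        by (simp add: algebra_simps)
      also have "\<dots> \<le> 2 * (LINT x|M. (f n x - f' x)\<^sup>2) + 2 * (LINT x|M. (g n x - g' x)\<^sup>2)"
        using * by (intro integral_square_diff_le) auto
      finally show "norm (LINT x|M. ((f n x - g n x) - (f' x - g' x))\<^sup>2)
       \<le> 2 * (LINT x|M. (f n x - f' x)\<^sup>2) + 2 * (LINT x|M. (g n x - g' x)\<^sup>2)" by simp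
    qed
    show "(\<lambda>n. 2 * (LINT x|M. (f n x - f' x)\<^sup>2) + 2 * (LINT x|M. (g n x - g' x)\<^sup>2)) \<longlonglongrightarrow> 0"
      using *(3,6) by (auto intro!: tendsto_add_zero tendsto_mult_right_zero)
  qed
  then show ?thesis using * by (auto simp: L2_tendsto_def)
qed

lemma L2_tendsto_add:
  assumes "L2_tendsto M f f'" "L2_tendsto M g g'"
  shows "L2_tendsto M (\<lambda>n x. f n x + g n x) (\<lambda>x. f' x + g' x)"
proof -
  have "L2_tendsto M (\<lambda>n x. - g n x) (\<lambda>x. - g' x)"
    using L2_tendsto_diff[OF L2_tendsto_const[OF square_integrable_zero] assms(2)] by simp
  from L2_tendsto_diff[OF assms(1) this] show ?thesis by simp
qed

section \<open>Orthogonal projections with a measurable parameter\<close>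

text \<open>Riesz-Fischer with an explicit limit. Along \<open>idx\<close> the increments have L1
  norms dominated by a geometric series, so the values converge almost everywhere; Fatou's lemma
  then turns the Cauchy bound into a bound on the distance to the limit. Writing the limit as a
  pointwise \<open>lim\<close> along \<open>idx\<close> keeps it measurable in any parameter on
  which \<open>f\<close> and \<open>idx\<close> depend measurably.\<close>

lemma (in finite_measure) L2_complete_subseq:
  fixes f :: "nat \<Rightarrow> 'a \<Rightarrow> real" and idx :: "nat \<Rightarrow> nat"
  assumes f: "\<And>n. square_integrable M (f n)"
    and idx: "\<And>k m. idx k \<le> m \<Longrightarrow> (LINT x|M. (f m x - f (idx k) x)\<^sup>2) \<le> (1/4)^k"
  shows "L2_tendsto M f (\<lambda>x. lim (\<lambda>k. f (idx k) x))"
proof -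
  define g where "g x = lim (\<lambda>k. f (idx k) x)" for x
  define c where "c = sqrt (measure M (space M))"
  have f_meas [measurable]: "f n \<in> borel_measurable M" for n
    using f by (auto simp: square_integrable_def)
  have g_meas [measurable]: "g \<in> borel_measurable M"
    unfolding g_def by measurable
  \<comment> \<open>\<open>idx\<close> is not assumed monotone, so the two indices may come in
    either order; the distance is symmetric and the rate at the larger argument is the smaller
    one.\<close>
  have idx2: "(LINT x|M. (f (idx m) x - f (idx k) x)\<^sup>2) \<le> (1/4)^k" if "k \<le> m" for k m
  proof (cases "idx k \<le> idx m")
    case True
    then show ?thesis by (rule idx)
  next
    case False
    have "(LINT x|M. (f (idx m) x - f (idx k) x)\<^sup>2) = (LINT x|M. (f (idx k) x - f (idx m) x)\<^sup>2)"
      by (simp add: power2_commute)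
    also have "\<dots> \<le> (1/4)^m" using False by (intro idx) simp
    also have "\<dots> \<le> (1/4)^k" using that by (intro power_decreasing) auto
    finally show ?thesis .
  qed
  have one: "square_integrable M (\<lambda>x. 1)" by (rule square_integrable_bounded[where K=1]) auto
  define D where "D k x = \<bar>f (idx (Suc k)) x - f (idx k) x\<bar>" for k x
  have D_sq: "square_integrable M (D k)" for k
    using square_integrable_diff[OF f f, of "idx (Suc k)" "idx k"]
    by (simp add: square_integrable_def D_def[abs_def])
  have D_int: "integrable M (D k)" for k
    by (rule square_integrable_imp_integrable[OF D_sq])
  have D_le: "(LINT x|M. D k x) \<le> (1/2)^k * c" for k
  proof -
    have "(LINT x|M. D k x) \<le> sqrt (LINT x|M. (D k x)\<^sup>2) * c"
      using Cauchy_Schwarz_abs[OF D_sq one, of k] by (simp add: c_def)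
    also have "sqrt (LINT x|M. (D k x)\<^sup>2) \<le> sqrt ((1/4)^k)"
      unfolding D_def using idx2[of k "Suc k"] by simp
    also have "sqrt ((1/4)^k) = (1/2::real)^k"
      by (rule real_sqrt_unique) (auto simp flip: power_mult_distrib simp: power2_eq_square)
    finally show ?thesis by (simp add: c_def mult_right_mono)
  qed
  have "AE x in M. summable (\<lambda>k. D k x)"
  proof -
    have "(\<integral>\<^sup>+x. (\<Sum>k. ennreal (D k x)) \<partial>M) = (\<Sum>k. \<integral>\<^sup>+x. ennreal (D k x) \<partial>M)"
      by (rule nn_integral_suminf) (use square_integrableD(1)[OF D_sq] in simp)
    also have "\<dots> = (\<Sum>k. ennreal (LINT x|M. D k x))"
      by (intro suminf_cong nn_integral_eq_integral D_int) (auto simp: D_def)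
    also have "\<dots> \<le> (\<Sum>k. ennreal ((1/2)^k * c))"
      by (intro suminf_le) (auto intro!: ennreal_leI D_le)
    also have "\<dots> = ennreal (\<Sum>k. (1/2)^k * c)"
      by (intro suminf_ennreal2) (auto simp: c_def intro!: summable_mult2)
    also have "\<dots> < \<infinity>" by simp
    finally have "AE x in M. (\<Sum>k. ennreal (D k x)) \<noteq> \<infinity>"
      by (intro nn_integral_noteq_infinite) (use square_integrableD(1)[OF D_sq] in auto)
    then show ?thesis
    proof eventually_elim
      case (elim x)
      then show ?case by (intro summable_suminf_not_top) (auto simp: D_def)
    qed
  qed
  then have conv: "AE x in M. (\<lambda>k. f (idx k) x) \<longlonglongrightarrow> g x"
  proof eventually_elim
    case (elim x)
    then have "summable (\<lambda>k. f (idx (Suc k)) x - f (idx k) x)"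
      unfolding D_def by (rule summable_rabs_cancel)
    then have "convergent (\<lambda>n. \<Sum>k<n. f (idx (Suc k)) x - f (idx k) x)"
      by (simp add: summable_iff_convergent)
    then have "convergent (\<lambda>n. (\<Sum>k<n. f (idx (Suc k)) x - f (idx k) x) + f (idx 0) x)"
      by (intro convergent_add convergent_const)
    then have "convergent (\<lambda>n. f (idx n) x)"
      by (simp add: sum_lessThan_telescope[of "\<lambda>k. f (idx k) x"])
    then show ?case by (simp add: g_def convergent_LIMSEQ_iff)
  qed
  have bound: "square_integrable M (\<lambda>x. g x - f (idx k) x)
      \<and> (LINT x|M. (g x - f (idx k) x)\<^sup>2) \<le> (1/4)^k" for k
  proof -
    have "(\<integral>\<^sup>+x. ennreal ((g x - f (idx k) x)\<^sup>2) \<partial>M)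
        = (\<integral>\<^sup>+x. liminf (\<lambda>m. ennreal ((f (idx m) x - f (idx k) x)\<^sup>2)) \<partial>M)"
    proof (rule nn_integral_cong_AE, use conv in eventually_elim)
      case (elim x)
      then have "(\<lambda>m. ennreal ((f (idx m) x - f (idx k) x)\<^sup>2)) \<longlonglongrightarrow> ennreal ((g x - f (idx k) x)\<^sup>2)"
        by (intro tendsto_intros)
      then show ?case by (metis lim_imp_Liminf trivial_limit_sequentially)
    qed
    also have "\<dots> \<le> liminf (\<lambda>m. \<integral>\<^sup>+x. ennreal ((f (idx m) x - f (idx k) x)\<^sup>2) \<partial>M)"
      by (rule nn_integral_liminf) measurable
    also have "\<dots> \<le> liminf (\<lambda>m::nat. ennreal ((1/4)^k))"
    proof (rule Liminf_mono, rule eventually_sequentiallyI[of k])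
      fix m assume "k \<le> m"
      have "(\<integral>\<^sup>+x. ennreal ((f (idx m) x - f (idx k) x)\<^sup>2) \<partial>M)
          = ennreal (LINT x|M. (f (idx m) x - f (idx k) x)\<^sup>2)"
        using square_integrable_diff[OF f f]
        by (intro nn_integral_eq_integral) (auto simp: square_integrable_def)
      also have "\<dots> \<le> ennreal ((1/4)^k)"
        using idx2[OF \<open>k \<le> m\<close>] by (rule ennreal_leI)
      finally show "(\<integral>\<^sup>+x. ennreal ((f (idx m) x - f (idx k) x)\<^sup>2) \<partial>M) \<le> ennreal ((1/4)^k)" .
    qed
    also have "\<dots> = ennreal ((1/4)^k)" by (simp add: Liminf_const)
    finally have le: "(\<integral>\<^sup>+x. ennreal ((g x - f (idx k) x)\<^sup>2) \<partial>M) \<le> ennreal ((1/4)^k)" .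
    have int: "integrable M (\<lambda>x. (g x - f (idx k) x)\<^sup>2)"
      by (rule integrableI_nonneg) (use le in \<open>auto intro: le_less_trans\<close>)
    have "ennreal (LINT x|M. (g x - f (idx k) x)\<^sup>2) \<le> ennreal ((1/4)^k)"
      using le by (subst (asm) nn_integral_eq_integral[OF int]) auto
    then show ?thesis using int by (auto simp: square_integrable_def)
  qed
  have g: "square_integrable M g"
    using square_integrable_add[OF bound[of 0, THEN conjunct1] f[of "idx 0"]] by simp
  have "(\<lambda>n. LINT x|M. (f n x - g x)\<^sup>2) \<longlonglongrightarrow> 0"
  proof (rule metric_LIMSEQ_I)
    fix e :: real assume "0 < e"
    then obtain k where k: "(1/4)^k < e / 4"
      using real_arch_pow_inv[of "e/4" "1/4"] by auto
    have "dist (LINT x|M. (f n x - g x)\<^sup>2) 0 < e" if "idx k \<le> n" for n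
    proof -
      have "(LINT x|M. (f n x - g x)\<^sup>2) = (LINT x|M. ((f n x - f (idx k) x) - (g x - f (idx k) x))\<^sup>2)"
        by simp
      also have "\<dots> \<le> 2 * (LINT x|M. (f n x - f (idx k) x)\<^sup>2) + 2 * (LINT x|M. (g x - f (idx k) x)\<^sup>2)"
        using f g by (intro integral_square_diff_le) auto
      also have "\<dots> < e" using idx[OF that] bound[of k] k by simp
      finally show ?thesis by simp
    qed
    then show "\<exists>no. \<forall>n\<ge>no. dist (LINT x|M. (f n x - g x)\<^sup>2) 0 < e" by blast
  qed
  then show ?thesis using f g by (simp add: L2_tendsto_def g_def[abs_def])
qed

text \<open>The vectors are left unnormalised. A member that depends on its predecessors leaves a
  residue of norm 0, and division by zero then gives it the coefficient 0. So degenerate members can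
  stay in the sequence, and every coefficient is given by one formula that is measurable in an
  additional parameter.\<close>

fun gram_schmidt :: "'w measure \<Rightarrow> (nat \<Rightarrow> 'w \<Rightarrow> real) \<Rightarrow> nat \<Rightarrow> 'w \<Rightarrow> real" where
  "gram_schmidt M W n = (\<lambda>x. W n x - (\<Sum>k\<in>{..<n}.
     (LINT y|M. W n y * gram_schmidt M W k y) / (LINT y|M. (gram_schmidt M W k y)\<^sup>2)
       * gram_schmidt M W k x))"

declare gram_schmidt.simps [simp del]

definition gs_coeff :: "'w measure \<Rightarrow> (nat \<Rightarrow> 'w \<Rightarrow> real) \<Rightarrow> ('w \<Rightarrow> real) \<Rightarrow> nat \<Rightarrow> real" where
  "gs_coeff M W f k = (LINT y|M. f y * gram_schmidt M W k y) / (LINT y|M. (gram_schmidt M W k y)\<^sup>2)"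

definition gs_proj :: "'w measure \<Rightarrow> (nat \<Rightarrow> 'w \<Rightarrow> real) \<Rightarrow> ('w \<Rightarrow> real) \<Rightarrow> nat \<Rightarrow> 'w \<Rightarrow> real" where
  "gs_proj M W f n x = (\<Sum>k<n. gs_coeff M W f k * gram_schmidt M W k x)"

text \<open>The Bessel term: the squared norm of the component of \<open>f\<close> along the k-th
  vector.\<close>

definition gs_energy :: "'w measure \<Rightarrow> (nat \<Rightarrow> 'w \<Rightarrow> real) \<Rightarrow> ('w \<Rightarrow> real) \<Rightarrow> nat \<Rightarrow> real" where
  "gs_energy M W f k = gs_coeff M W f k * (LINT y|M. f y * gram_schmidt M W k y)"

lemma gram_schmidt_eq: "gram_schmidt M W n x = W n x - gs_proj M W (W n) n x"
  by (subst gram_schmidt.simps) (simp add: gs_proj_def gs_coeff_def)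

context
  fixes M :: "'w measure" and W :: "nat \<Rightarrow> 'w \<Rightarrow> real"
  assumes W: "\<And>n. square_integrable M (W n)"
begin

lemma square_integrable_gram_schmidt: "square_integrable M (gram_schmidt M W n)"
proof (induction n rule: less_induct)
  case (less n)
  then show ?case
    using W by (subst gram_schmidt.simps)
      (intro square_integrable_diff square_integrable_sum square_integrable_cmult, auto)
qed

lemma square_integrable_gs_proj: "square_integrable M (gs_proj M W f n)"
  unfolding gs_proj_def[abs_def]
  by (intro square_integrable_sum square_integrable_cmult square_integrable_gram_schmidt)

text \<open>For a degenerate vector the left side is 0, and Cauchy-Schwarz makes the inner product
  on the right vanish as well.\<close>

lemma gs_coeff_times_square:
  assumes f: "square_integrable M f"
  shows "gs_coeff M W f k * (LINT y|M. (gram_schmidt M W k y)\<^sup>2) = (LINT y|M. f y * gram_schmidt M W k y)"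
proof (cases "(LINT y|M. (gram_schmidt M W k y)\<^sup>2) = 0")
  case True
  then show ?thesis
    using Cauchy_Schwarz_integral[OF f square_integrable_gram_schmidt[of k]] by simp
qed (simp add: gs_coeff_def)

lemma integral_gs_proj_mult:
  assumes f: "square_integrable M h"
  shows "(LINT x|M. gs_proj M W f n x * h x)
    = (\<Sum>k<n. gs_coeff M W f k * (LINT x|M. gram_schmidt M W k x * h x))"
proof -
  have "(LINT x|M. gs_proj M W f n x * h x)
      = (LINT x|M. (\<Sum>k<n. gs_coeff M W f k * (gram_schmidt M W k x * h x)))"
    by (simp add: gs_proj_def sum_distrib_right mult.assoc)
  also have "\<dots> = (\<Sum>k<n. (LINT x|M. gs_coeff M W f k * (gram_schmidt M W k x * h x)))"
    by (intro Bochner_Integration.integral_sum integrable_mult_right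
        square_integrable_mult square_integrable_gram_schmidt f)
  finally show ?thesis by simp
qed

lemma gram_schmidt_orthogonal_less:
  "k < n \<Longrightarrow> (LINT x|M. gram_schmidt M W n x * gram_schmidt M W k x) = 0"
proof (induction n arbitrary: k rule: less_induct)
  case (less n)
  note G = square_integrable_gram_schmidt
  have "(LINT x|M. gs_proj M W (W n) n x * gram_schmidt M W k x)
      = (\<Sum>j<n. gs_coeff M W (W n) j * (LINT x|M. gram_schmidt M W j x * gram_schmidt M W k x))"
    by (rule integral_gs_proj_mult[OF G])
  also have "\<dots> = (\<Sum>j<n. if j = k then (LINT x|M. W n x * gram_schmidt M W k x) else 0)"
  proof (rule sum.cong[OF refl])
    fix j assume "j \<in> {..<n}"
    then consider "j = k" | "j < k" | "k < j" "j < n" by fastforce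
    then show "gs_coeff M W (W n) j * (LINT x|M. gram_schmidt M W j x * gram_schmidt M W k x)
       = (if j = k then (LINT x|M. W n x * gram_schmidt M W k x) else 0)"
    proof cases
      case 1
      then show ?thesis using gs_coeff_times_square[OF W, of n k] by (simp add: power2_eq_square)
    next
      case 2
      then show ?thesis using less.IH[OF less.prems 2] by (simp add: mult.commute)
    next
      case 3
      then show ?thesis using less.IH by simp
    qed
  qed
  also have "\<dots> = (LINT x|M. W n x * gram_schmidt M W k x)"
    using less.prems by simp
  finally show ?case
    using square_integrable_mult[OF W[of n] G[of k]]
      square_integrable_mult[OF square_integrable_gs_proj G[of k], of "W n" n]
    by (simp add: gram_schmidt_eq[of M W n] left_diff_distrib)
qed

lemma gram_schmidt_orthogonal:
  "j \<noteq> k \<Longrightarrow> (LINT x|M. gram_schmidt M W j x * gram_schmidt M W k x) = 0"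
  using gram_schmidt_orthogonal_less[of j k] gram_schmidt_orthogonal_less[of k j]
  by (cases "j < k") (auto simp: mult.commute)

lemma integral_gs_proj_gram_schmidt:
  assumes "square_integrable M f"
  shows "(LINT x|M. gs_proj M W f n x * gram_schmidt M W k x)
     = (if k < n then (LINT x|M. f x * gram_schmidt M W k x) else 0)"
proof -
  have "(LINT x|M. gs_proj M W f n x * gram_schmidt M W k x)
      = (\<Sum>j<n. if j = k then (LINT x|M. f x * gram_schmidt M W k x) else 0)"
    unfolding integral_gs_proj_mult[OF square_integrable_gram_schmidt]
    using gs_coeff_times_square[OF assms, of k] gram_schmidt_orthogonal
    by (intro sum.cong) (auto simp: power2_eq_square)
  then show ?thesis by simp
qed

lemma gs_energy_nonneg: "0 \<le> gs_energy M W f k"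
proof -
  have "gs_energy M W f k = (LINT x|M. f x * gram_schmidt M W k x)\<^sup>2 / (LINT y|M. (gram_schmidt M W k y)\<^sup>2)"
    by (simp add: gs_energy_def gs_coeff_def power2_eq_square)
  then show ?thesis by simp
qed

lemma integral_gs_proj_gs_proj:
  assumes f: "square_integrable M f"
  shows "(LINT x|M. gs_proj M W f n x * gs_proj M W f m x) = (\<Sum>k<min n m. gs_energy M W f k)"
proof -
  have "(LINT x|M. gs_proj M W f n x * gs_proj M W f m x)
     = (\<Sum>k<n. if k < m then gs_energy M W f k else 0)"
    unfolding integral_gs_proj_mult[OF square_integrable_gs_proj] gs_energy_def
    using integral_gs_proj_gram_schmidt[OF f, of m]
    by (intro sum.cong) (auto simp: mult.commute)
  also have "\<dots> = (\<Sum>k<min n m. gs_energy M W f k)"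
    by (intro sum.mono_neutral_cong_right) auto
  finally show ?thesis .
qed

lemma integral_gs_proj_diff:
  assumes f: "square_integrable M f" and "n \<le> m"
  shows "(LINT x|M. (gs_proj M W f m x - gs_proj M W f n x)\<^sup>2) = (\<Sum>k\<in>{n..<m}. gs_energy M W f k)"
proof -
  have "(LINT x|M. (gs_proj M W f m x - gs_proj M W f n x)\<^sup>2)
    = (\<Sum>k<m. gs_energy M W f k) - (\<Sum>k<n. gs_energy M W f k)"
    unfolding integral_square_diff[OF square_integrable_gs_proj square_integrable_gs_proj]
    using integral_gs_proj_gs_proj[OF f, of m m] integral_gs_proj_gs_proj[OF f, of n n]
      integral_gs_proj_gs_proj[OF f, of m n] \<open>n \<le> m\<close>
    by (simp add: power2_eq_square)
  also have "\<dots> = (\<Sum>k\<in>{n..<m}. gs_energy M W f k)"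
    using sum_diff_nat_ivl[of 0 n m "gs_energy M W f"] \<open>n \<le> m\<close> by (simp add: atLeast0LessThan)
  finally show ?thesis .
qed

text \<open>Bessel's inequality: the squared distance of \<open>f\<close> from its n-th projection
  is nonnegative and equals the squared norm of \<open>f\<close> minus the partial sum of
  energies.\<close>

lemma summable_gs_energy:
  assumes f: "square_integrable M f"
  shows "summable (gs_energy M W f)"
proof (rule bounded_imp_summable)
  fix n
  have "(LINT x|M. f x * gs_proj M W f (Suc n) x) = (\<Sum>k<Suc n. gs_energy M W f k)"
    using integral_gs_proj_mult[OF f, of f "Suc n"] by (simp add: gs_energy_def mult.commute)
  moreover have "0 \<le> (LINT x|M. (f x - gs_proj M W f (Suc n) x)\<^sup>2)" by simp
  ultimately show "(\<Sum>k\<le>n. gs_energy M W f k) \<le> (LINT x|M. (f x)\<^sup>2)"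
    unfolding integral_square_diff[OF f square_integrable_gs_proj]
    using integral_gs_proj_gs_proj[OF f, of "Suc n" "Suc n"]
    by (simp add: power2_eq_square lessThan_Suc_atMost)
qed (rule gs_energy_nonneg)

lemma gram_schmidt_finite_span: "\<exists>c. \<forall>x. gram_schmidt M W n x = (\<Sum>j\<le>n. c j * W j x)"
proof (induction n rule: less_induct)
  case (less n)
  have "\<exists>c. \<forall>k\<in>{..<n}. \<forall>x. gram_schmidt M W k x = (\<Sum>j\<le>k. c k j * W j x)"
    using less by (intro bchoice) auto
  then obtain c where c: "\<And>k x. k < n \<Longrightarrow> gram_schmidt M W k x = (\<Sum>j\<le>k. c k j * W j x)" by auto
  define d where "d j = (if j = n then 1 else - (\<Sum>k<n. gs_coeff M W (W n) k * (if j \<le> k then c k j else 0)))" for j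
  have "gram_schmidt M W n x = (\<Sum>j\<le>n. d j * W j x)" for x
  proof -
    have "gs_proj M W (W n) n x = (\<Sum>k<n. \<Sum>j\<le>k. gs_coeff M W (W n) k * (c k j * W j x))"
      unfolding gs_proj_def using c by (intro sum.cong) (auto simp: sum_distrib_left)
    also have "\<dots> = (\<Sum>k<n. \<Sum>j<n. gs_coeff M W (W n) k * (if j \<le> k then c k j else 0) * W j x)"
      by (intro sum.cong refl sum.mono_neutral_cong_left) auto
    also have "\<dots> = (\<Sum>j<n. - d j * W j x)"
      unfolding d_def by (subst sum.swap) (auto simp: sum_distrib_right intro!: sum.cong)
    finally have "gs_proj M W (W n) n x = - (\<Sum>j<n. d j * W j x)" by (simp add: sum_negf)
    moreover have "(\<Sum>j\<le>n. d j * W j x) = (\<Sum>j<n. d j * W j x) + W n x"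
      by (subst lessThan_Suc_atMost[symmetric]) (simp add: d_def)
    ultimately show ?thesis by (simp add: gram_schmidt_eq)
  qed
  then show ?case by blast
qed

lemma gs_proj_finite_span: "\<exists>c. \<forall>x. gs_proj M W f n x = (\<Sum>j<n. c j * W j x)"
proof -
  obtain c where c: "\<And>k x. gram_schmidt M W k x = (\<Sum>j\<le>k. c k j * W j x)"
    using gram_schmidt_finite_span by metis
  have "gs_proj M W f n x = (\<Sum>j<n. (\<Sum>k<n. gs_coeff M W f k * (if j \<le> k then c k j else 0)) * W j x)" for x
  proof -
    have "gs_proj M W f n x = (\<Sum>k<n. \<Sum>j\<le>k. gs_coeff M W f k * (c k j * W j x))"
      unfolding gs_proj_def using c by (intro sum.cong) (auto simp: sum_distrib_left)
    also have "\<dots> = (\<Sum>k<n. \<Sum>j<n. gs_coeff M W f k * (if j \<le> k then c k j else 0) * W j x)"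
      by (intro sum.cong refl sum.mono_neutral_cong_left) auto
    finally show ?thesis by (subst (asm) sum.swap) (simp add: sum_distrib_right)
  qed
  then show ?thesis by (intro exI allI)
qed

lemma orthogonal_gram_schmidt_imp:
  assumes h: "square_integrable M h" and *: "\<And>k. (LINT x|M. gram_schmidt M W k x * h x) = 0"
  shows "(LINT x|M. W n x * h x) = 0"
proof -
  have "(LINT x|M. W n x * h x) = (LINT x|M. gram_schmidt M W n x * h x + gs_proj M W (W n) n x * h x)"
    by (simp add: gram_schmidt_eq algebra_simps)
  also have "\<dots> = 0"
    using * integral_gs_proj_mult[OF h, of "W n" n]
      square_integrable_mult[OF square_integrable_gram_schmidt h, of n]
      square_integrable_mult[OF square_integrable_gs_proj h, of "W n" n]
    by simp
  finally show ?thesis .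
qed

text \<open>The inner product of the n-th projection with the k-th vector equals that of
  \<open>f\<close> as soon as n exceeds k, so the limit inherits it.\<close>

lemma gs_limit_orthogonal:
  assumes f: "square_integrable M f" and lim: "L2_tendsto M (gs_proj M W f) g"
  shows "(LINT x|M. W n x * (f x - g x)) = 0"
proof (rule orthogonal_gram_schmidt_imp)
  note G = square_integrable_gram_schmidt
  show "square_integrable M (\<lambda>x. f x - g x)"
    using f L2_tendstoD(2)[OF lim] by auto
  fix k
  have "(\<lambda>n. LINT x|M. gs_proj M W f n x * gram_schmidt M W k x) \<longlonglongrightarrow> (LINT x|M. g x * gram_schmidt M W k x)"
    by (rule L2_tendsto_inner[OF lim G])
  moreover have "\<forall>\<^sub>F n in sequentially. (LINT x|M. gs_proj M W f n x * gram_schmidt M W k x)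
      = (LINT x|M. f x * gram_schmidt M W k x)"
    using eventually_gt_at_top[of k] by eventually_elim (simp add: integral_gs_proj_gram_schmidt[OF f])
  ultimately have "(LINT x|M. g x * gram_schmidt M W k x) = (LINT x|M. f x * gram_schmidt M W k x)"
    by (intro LIMSEQ_unique[of "\<lambda>n. LINT x|M. gs_proj M W f n x * gram_schmidt M W k x"])
       (auto intro: tendsto_eventually)
  then show "(LINT x|M. gram_schmidt M W k x * (f x - g x)) = 0"
    using square_integrable_mult[OF f G[of k]] square_integrable_mult[OF L2_tendstoD(2)[OF lim] G[of k]]
    by (simp add: left_diff_distrib right_diff_distrib mult.commute)
qed

end

text \<open>Choosing a projection separately for each t would lose joint measurability. Here
  coefficients, energies and energy tails are measurable functions of t, and the limit is taken
  along indices that are themselves measurable in t. The last conclusion yields adaptedness: each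
  value is a pointwise limit of finite combinations of the \<open>W n t\<close>.\<close>

theorem (in finite_measure) ex_measurable_projection:
  fixes N :: "'t measure" and W :: "nat \<Rightarrow> 't \<Rightarrow> 'a \<Rightarrow> real" and Z :: "'t \<Rightarrow> 'a \<Rightarrow> real"
  assumes W_meas: "\<And>n. (\<lambda>(t, x). W n t x) \<in> borel_measurable (N \<Otimes>\<^sub>M M)"
    and Z_meas: "(\<lambda>(t, x). Z t x) \<in> borel_measurable (N \<Otimes>\<^sub>M M)"
    and W: "\<And>n t. t \<in> space N \<Longrightarrow> square_integrable M (W n t)"
    and Z: "\<And>t. t \<in> space N \<Longrightarrow> square_integrable M (Z t)"
  obtains proj where "(\<lambda>(t, x). proj t x) \<in> borel_measurable (N \<Otimes>\<^sub>M M)"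
    and "\<And>t. t \<in> space N \<Longrightarrow> \<exists>c. L2_tendsto M (\<lambda>n x. \<Sum>j<n. c n j * W j t x) (proj t)"
    and "\<And>t n. t \<in> space N \<Longrightarrow> (LINT x|M. W n t x * (Z t x - proj t x)) = 0"
    and "\<And>t F. \<lbrakk>t \<in> space N; \<And>n. W n t \<in> borel_measurable F\<rbrakk> \<Longrightarrow> proj t \<in> borel_measurable F"
proof -
  define G where "G n t = gram_schmidt M (\<lambda>n. W n t) n" for n t
  define Q where "Q n t = gs_proj M (\<lambda>n. W n t) (Z t) n" for n t
  define e where "e k t = gs_energy M (\<lambda>n. W n t) (Z t) k" for k t
  note [measurable] = W_meas Z_meas
  have G_meas [measurable]: "(\<lambda>(t, x). G n t x) \<in> borel_measurable (N \<Otimes>\<^sub>M M)" for n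
  proof (induction n rule: less_induct)
    case (less n)
    have [measurable]: "(\<lambda>(t, x). G k t x) \<in> borel_measurable (N \<Otimes>\<^sub>M M)" if "k \<in> {..<n}" for k
      using less that by simp
    have [measurable]: "(\<lambda>t. LINT y|M. W n t y * G k t y) \<in> borel_measurable N" if "k \<in> {..<n}" for k
      using that by measurable
    have [measurable]: "(\<lambda>t. LINT y|M. (G k t y)\<^sup>2) \<in> borel_measurable N" if "k \<in> {..<n}" for k
      using that by measurable
    have "(\<lambda>p. W n (fst p) (snd p) - (\<Sum>k\<in>{..<n}. (LINT y|M. W n (fst p) y * G k (fst p) y) /
        (LINT y|M. (G k (fst p) y)\<^sup>2) * G k (fst p) (snd p))) \<in> borel_measurable (N \<Otimes>\<^sub>M M)"
      by measurable
    then show ?case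
      unfolding G_def by (subst gram_schmidt.simps) (simp add: split_beta')
  qed
  have coeff_meas [measurable]: "(\<lambda>t. gs_coeff M (\<lambda>n. W n t) (Z t) k) \<in> borel_measurable N" for k
    unfolding gs_coeff_def G_def[symmetric] by measurable
  have Q_meas [measurable]: "(\<lambda>(t, x). Q n t x) \<in> borel_measurable (N \<Otimes>\<^sub>M M)" for n
    unfolding Q_def gs_proj_def G_def[symmetric] by measurable
  have e_meas [measurable]: "e k \<in> borel_measurable N" for k
    unfolding e_def gs_energy_def G_def[symmetric] by measurable
  define \<tau> where "\<tau> n t = (\<Sum>k. e (k + n) t)" for n t
  have [measurable]: "\<tau> n \<in> borel_measurable N" for n
    unfolding \<tau>_def[abs_def] by measurable
  \<comment> \<open>The first index at which the energy tail is at most (1/4)^k. A least natural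
    number with a measurable property is measurable in t, and the tail bounds all later squared
    distances, which is the rate that \<open>L2_complete_subseq\<close> requires.\<close>
  define idx where "idx k t = (LEAST n. \<tau> n t \<le> (1/4)^k)" for k t
  have [measurable]: "idx k \<in> measurable N (count_space UNIV)" for k
    unfolding idx_def[abs_def] by measurable
  define proj where "proj t x = lim (\<lambda>k. Q (idx k t) t x)" for t x
  have Q_idx [measurable]: "(\<lambda>p. Q (idx k (fst p)) (fst p) (snd p)) \<in> borel_measurable (N \<Otimes>\<^sub>M M)" for k
    by (rule measurable_compose_countable[where f="\<lambda>n p. Q n (fst p) (snd p)"]) measurable
  have "(\<lambda>(t, x). proj t x) \<in> borel_measurable (N \<Otimes>\<^sub>M M)"
    unfolding proj_def split_beta' by measurable
  moreover have lim: "L2_tendsto M (\<lambda>n. Q n t) (proj t)" if t: "t \<in> space N" for t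
  proof -
    note W = W[OF t] and Z = Z[OF t]
    have e_nonneg: "0 \<le> e k t" for k
      unfolding e_def by (rule gs_energy_nonneg[OF W])
    have summable: "summable (\<lambda>k. e k t)"
      unfolding e_def by (rule summable_gs_energy[OF W Z])
    have idx: "\<tau> (idx k t) t \<le> (1/4)^k" for k
    proof -
      have "(\<lambda>n. \<tau> n t) \<longlonglongrightarrow> 0"
        unfolding \<tau>_def by (rule suminf_exist_split2[OF summable])
      then have "\<forall>\<^sub>F n in sequentially. \<tau> n t < (1/4)^k" by (rule order_tendstoD) simp
      then obtain n where "\<tau> n t \<le> (1/4)^k"
        by (auto simp: eventually_sequentially intro: less_imp_le)
      then show ?thesis unfolding idx_def by (rule LeastI)
    qed
    have "(LINT x|M. (Q m t x - Q (idx k t) t x)\<^sup>2) \<le> (1/4)^k" if "idx k t \<le> m" for k m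
    proof -
      have "(LINT x|M. (Q m t x - Q (idx k t) t x)\<^sup>2) = (\<Sum>j\<in>{idx k t..<m}. e j t)"
        unfolding Q_def e_def by (rule integral_gs_proj_diff[OF W Z that])
      also have "\<dots> = (\<Sum>j\<in>{..<m - idx k t}. e (j + idx k t) t)"
        using sum.shift_bounds_nat_ivl[of "\<lambda>j. e j t" 0 "idx k t" "m - idx k t"] that
        by (simp add: atLeast0LessThan)
      also have "\<dots> \<le> \<tau> (idx k t) t"
        unfolding \<tau>_def using summable e_nonneg
        by (intro sum_le_suminf) (auto intro: summable_ignore_initial_segment)
      finally show ?thesis using idx[of k] by linarith
    qed
    then show ?thesis
      unfolding proj_def by (intro L2_complete_subseq) (auto simp: Q_def square_integrable_gs_proj[OF W])
  qed
  moreover have "\<exists>c. L2_tendsto M (\<lambda>n x. \<Sum>j<n. c n j * W j t x) (proj t)" if t: "t \<in> space N" for t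
  proof -
    obtain c where "\<And>n x. Q n t x = (\<Sum>j<n. c n j * W j t x)"
      unfolding Q_def using gs_proj_finite_span[of M "\<lambda>n. W n t" "Z t", OF W[OF t]] by metis
    then have "(\<lambda>n. Q n t) = (\<lambda>n x. \<Sum>j<n. c n j * W j t x)" by auto
    with lim[OF t] show ?thesis by (intro exI[of _ c]) simp
  qed
  moreover have "(LINT x|M. W n t x * (Z t x - proj t x)) = 0" if t: "t \<in> space N" for t n
    using gs_limit_orthogonal[of M "\<lambda>n. W n t", OF W[OF t] Z[OF t]] lim[OF t] by (simp add: Q_def)
  moreover have "proj t \<in> borel_measurable F"
    if t: "t \<in> space N" and F: "\<And>n. W n t \<in> borel_measurable F" for t F
  proof -
    have [measurable]: "Q n t \<in> borel_measurable F" for n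
    proof -
      obtain c where "\<And>x. Q n t x = (\<Sum>j<n. c j * W j t x)"
        unfolding Q_def using gs_proj_finite_span[of M "\<lambda>n. W n t" "Z t", OF W[OF t]] by metis
      then have "Q n t = (\<lambda>x. \<Sum>j<n. c j * W j t x)" by auto
      then show ?thesis using F by simp
    qed
    show ?thesis unfolding proj_def[abs_def] by measurable
  qed
  ultimately show ?thesis using that by blast
qed

section \<open>Closed spans\<close>

text \<open>The double orthogonal complement, which in a Hilbert space is the closure of the linear
  span. Membership is proved by testing against functions orthogonal to \<open>S\<close>, so limits,
  time integrals and almost sure modifications all reduce to statements about inner
  products.\<close>

definition closed_span :: "'a measure \<Rightarrow> ('a \<Rightarrow> real) set \<Rightarrow> ('a \<Rightarrow> real) set" where
  "closed_span M S = {f. square_integrable M f \<and>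
     (\<forall>h. square_integrable M h \<longrightarrow> (\<forall>g\<in>S. (LINT x|M. g x * h x) = 0) \<longrightarrow> (LINT x|M. f x * h x) = 0)}"

lemma closed_spanD:
  assumes "f \<in> closed_span M S"
  shows "square_integrable M f"
    and "\<lbrakk>square_integrable M h; \<And>g. g \<in> S \<Longrightarrow> (LINT x|M. g x * h x) = 0\<rbrakk> \<Longrightarrow> (LINT x|M. f x * h x) = 0"
  using assms by (auto simp: closed_span_def)

lemma closed_spanI:
  assumes "square_integrable M f"
    and "\<And>h. \<lbrakk>square_integrable M h; \<And>g. g \<in> S \<Longrightarrow> (LINT x|M. g x * h x) = 0\<rbrakk> \<Longrightarrow> (LINT x|M. f x * h x) = 0"
  shows "f \<in> closed_span M S"
  using assms by (auto simp: closed_span_def)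

lemma closed_span_base: "f \<in> S \<Longrightarrow> square_integrable M f \<Longrightarrow> f \<in> closed_span M S"
  by (auto simp: closed_span_def)

lemma closed_span_trans: "f \<in> closed_span M S \<Longrightarrow> S \<subseteq> closed_span M S' \<Longrightarrow> f \<in> closed_span M S'"
  unfolding closed_span_def by blast

lemma closed_span_mono: "S \<subseteq> S' \<Longrightarrow> closed_span M S \<subseteq> closed_span M S'"
  unfolding closed_span_def by blast

lemma closed_span_add:
  assumes f: "f \<in> closed_span M S" and g: "g \<in> closed_span M S"
  shows "(\<lambda>x. f x + g x) \<in> closed_span M S"
proof (rule closed_spanI)
  note fg = closed_spanD(1)[OF f] closed_spanD(1)[OF g]
  then show "square_integrable M (\<lambda>x. f x + g x)" by blast
  fix h assume h: "square_integrable M h" "\<And>g. g \<in> S \<Longrightarrow> (LINT x|M. g x * h x) = 0"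
  then show "(LINT x|M. (f x + g x) * h x) = 0"
    using closed_spanD(2)[OF f h] closed_spanD(2)[OF g h] square_integrable_mult[OF fg(1) h(1)]
      square_integrable_mult[OF fg(2) h(1)]
    by (simp add: distrib_right)
qed

lemma closed_span_cmult:
  assumes f: "f \<in> closed_span M S"
  shows "(\<lambda>x. c * f x) \<in> closed_span M S"
proof (rule closed_spanI)
  show "square_integrable M (\<lambda>x. c * f x)" using closed_spanD(1)[OF f] by blast
  fix h assume h: "square_integrable M h" "\<And>g. g \<in> S \<Longrightarrow> (LINT x|M. g x * h x) = 0"
  then show "(LINT x|M. (c * f x) * h x) = 0"
    using closed_spanD(2)[OF f h] by (simp add: mult.assoc)
qed

lemma closed_span_diff:
  assumes "f \<in> closed_span M S" "g \<in> closed_span M S"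
  shows "(\<lambda>x. f x - g x) \<in> closed_span M S"
  using closed_span_add[OF assms(1) closed_span_cmult[OF assms(2), of "-1"]] by simp

lemma closed_span_zero: "(\<lambda>x. 0) \<in> closed_span M S"
  by (auto simp: closed_span_def)

lemma closed_span_sum:
  "(\<And>i. i \<in> I \<Longrightarrow> f i \<in> closed_span M S) \<Longrightarrow> (\<lambda>x. \<Sum>i\<in>I. f i x) \<in> closed_span M S"
  by (induction I rule: infinite_finite_induct) (auto intro: closed_span_add closed_span_zero)

lemma closed_span_AE:
  assumes f: "f \<in> closed_span M S" and g: "g \<in> borel_measurable M" and eq: "AE x in M. f x = g x"
  shows "g \<in> closed_span M S"
proof (rule closed_spanI)
  note f' = closed_spanD(1)[OF f]
  show g': "square_integrable M g" by (rule square_integrable_AE[OF f' g eq])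
  fix h assume h: "square_integrable M h" "\<And>g. g \<in> S \<Longrightarrow> (LINT x|M. g x * h x) = 0"
  have "(LINT x|M. g x * h x) = (LINT x|M. f x * h x)"
    using eq f' g' h(1) by (intro integral_cong_AE) (auto simp: square_integrable_def)
  then show "(LINT x|M. g x * h x) = 0"
    using closed_spanD(2)[OF f h] by simp
qed

lemma closed_span_limit:
  assumes f: "\<And>n. f n \<in> closed_span M S" and lim: "L2_tendsto M f g"
  shows "g \<in> closed_span M S"
proof (rule closed_spanI[OF L2_tendstoD(2)[OF lim]])
  fix h assume h: "square_integrable M h" "\<And>g. g \<in> S \<Longrightarrow> (LINT x|M. g x * h x) = 0"
  have "(\<lambda>n. LINT x|M. f n x * h x) \<longlonglongrightarrow> (LINT x|M. g x * h x)"
    by (rule L2_tendsto_inner[OF lim h(1)])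
  then show "(LINT x|M. g x * h x) = 0"
    using closed_spanD(2)[OF f h] by (simp add: LIMSEQ_const_iff)
qed

text \<open>Recovers approximating combinations from the dual description: with p the projection of
  \<open>f\<close>, the difference f - p is orthogonal to the family and also lies in its span,
  hence is orthogonal to itself.\<close>

lemma (in finite_measure) closed_span_range_approx:
  fixes W :: "nat \<Rightarrow> 'a \<Rightarrow> real"
  assumes W: "\<And>n. square_integrable M (W n)" and f: "f \<in> closed_span M (range W)"
  obtains c where "L2_tendsto M (\<lambda>n x. \<Sum>j<n. c n j * W j x) f"
proof -
  \<comment> \<open>A one-point parameter space, so that the parametrised projection theorem applies
    to a single function.\<close>
  define N where "N = count_space (UNIV :: unit set)"
  have meas: "(\<lambda>(t, x). h x) \<in> borel_measurable (N \<Otimes>\<^sub>M M)" if "h \<in> borel_measurable M" for h :: "'a \<Rightarrow> real"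
    using measurable_compose[OF measurable_snd that] by (simp add: split_beta')
  have f': "square_integrable M f" by (rule closed_spanD(1)[OF f])
  obtain p where p: "\<And>t. t \<in> space N \<Longrightarrow> \<exists>c. L2_tendsto M (\<lambda>n x. \<Sum>j<n. c n j * W j x) (p t)"
      "\<And>t n. t \<in> space N \<Longrightarrow> (LINT x|M. W n x * (f x - p t x)) = 0"
  proof (rule ex_measurable_projection[of "\<lambda>n _. W n" N "\<lambda>_. f",
          OF meas[OF square_integrableD(1)[OF W]] meas[OF square_integrableD(1)[OF f']] W f'])
    fix q
    assume "\<And>t. t \<in> space N \<Longrightarrow> \<exists>c. L2_tendsto M (\<lambda>n x. \<Sum>j<n. c n j * W j x) (q t)"
      and "\<And>t n. t \<in> space N \<Longrightarrow> (LINT x|M. W n x * (f x - q t x)) = 0"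
    then show thesis by (rule that)
  qed
  have t: "() \<in> space N" by (simp add: N_def)
  obtain c where c: "L2_tendsto M (\<lambda>n x. \<Sum>j<n. c n j * W j x) (p ())" using p(1)[OF t] by blast
  have p_cs: "p () \<in> closed_span M (range W)"
    by (rule closed_span_limit[OF _ c]) (intro closed_span_sum closed_span_cmult closed_span_base W rangeI)
  have d: "(\<lambda>x. f x - p () x) \<in> closed_span M (range W)"
    by (rule closed_span_diff[OF f p_cs])
  note d' = closed_spanD(1)[OF d]
  have "(LINT x|M. (f x - p () x) * (f x - p () x)) = 0"
    by (rule closed_spanD(2)[OF d d']) (use p(2)[OF t] in auto)
  then have "AE x in M. f x - p () x = 0"
    by (intro integral_square_eq_0_imp_AE[OF d']) (simp add: power2_eq_square)
  then have "AE x in M. p () x = f x" by eventually_elim simp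
  then have "(LINT x|M. ((\<Sum>j<n. c n j * W j x) - p () x)\<^sup>2) = (LINT x|M. ((\<Sum>j<n. c n j * W j x) - f x)\<^sup>2)" for n
    using W[THEN square_integrableD(1)] square_integrableD(1)[OF f']
      square_integrableD(1)[OF L2_tendstoD(2)[OF c]]
    by (intro integral_cong_AE) auto
  with c f' have "L2_tendsto M (\<lambda>n x. \<Sum>j<n. c n j * W j x) f" by (simp add: L2_tendsto_def)
  then show ?thesis using that by blast
qed

section \<open>Mean-square continuity and density of step functions\<close>

definition L2_continuous_on :: "'a measure \<Rightarrow> real set \<Rightarrow> (real \<Rightarrow> 'a \<Rightarrow> real) \<Rightarrow> bool" where
  "L2_continuous_on M A V \<longleftrightarrow>
     (\<forall>s r. (\<forall>k. r k \<in> A) \<and> s \<in> A \<and> r \<longlonglongrightarrow> s \<longrightarrow> L2_tendsto M (\<lambda>k. V (r k)) (V s))"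

lemma L2_continuous_onD:
  "\<lbrakk>L2_continuous_on M A V; \<And>k. r k \<in> A; s \<in> A; r \<longlonglongrightarrow> s\<rbrakk> \<Longrightarrow> L2_tendsto M (\<lambda>k. V (r k)) (V s)"
  by (simp add: L2_continuous_on_def)

lemma L2_continuous_on_subset: "L2_continuous_on M A V \<Longrightarrow> B \<subseteq> A \<Longrightarrow> L2_continuous_on M B V"
  unfolding L2_continuous_on_def by blast

lemma L2_continuous_on_imp_square_integrable:
  assumes "L2_continuous_on M A V" "s \<in> A"
  shows "square_integrable M (V s)"
  by (rule L2_tendstoD(2)[OF L2_continuous_onD[OF assms(1), of "\<lambda>_. s"]]) (use assms in auto)

text \<open>A dense sequence in [0, 1]. Its multiples \<open>t * unit_rat n\<close> are dense in
  [0, t] and depend measurably on t, so one sequence of time points serves all horizons at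
  once.\<close>

definition unit_rat :: "nat \<Rightarrow> real" where
  "unit_rat = from_nat_into (\<rat> \<inter> {0..1})"

lemma range_unit_rat: "range unit_rat = \<rat> \<inter> {0..1}"
  unfolding unit_rat_def
  by (rule range_from_nat_into) (auto intro: countable_subset[OF _ countable_rat] exI[of _ 0])

lemma unit_rat_bounds: "0 \<le> unit_rat n" "unit_rat n \<le> 1"
  using range_unit_rat by auto

lemma ex_unit_rat_seq:
  assumes "0 \<le> s" "s \<le> t"
  obtains j where "(\<lambda>k. t * unit_rat (j k)) \<longlonglongrightarrow> s"
proof -
  have "\<exists>n. \<bar>t * unit_rat n - s\<bar> \<le> (1/2)^k" for k
  proof (cases "s = 0")
    case True
    have "0 \<in> range unit_rat" by (simp add: range_unit_rat)
    then obtain n where "unit_rat n = 0" by force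
    then show ?thesis using True by (intro exI[of _ n]) simp
  next
    case False
    then have st: "0 < s" "0 < t" using assms by auto
    have "max 0 (s - (1/2)^k) / t < s / t" using st by (intro divide_strict_right_mono) auto
    then obtain q where q: "q \<in> \<rat>" "max 0 (s - (1/2)^k) / t < q" "q < s / t"
      using Rats_dense_in_real by blast
    have "0 \<le> max 0 (s - (1/2)^k) / t" using st by simp
    moreover have "s / t \<le> 1" using st assms by simp
    ultimately have "q \<in> range unit_rat" using q by (auto simp: range_unit_rat)
    then obtain n where n: "unit_rat n = q" by force
    have "max 0 (s - (1/2)^k) < t * q" "t * q < s" using q(2,3) st by (simp_all add: field_simps)
    then show ?thesis using n by (intro exI[of _ n]) auto
  qed
  then obtain j where j: "\<And>k. \<bar>t * unit_rat (j k) - s\<bar> \<le> (1/2)^k" by metis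
  have "(\<lambda>k. t * unit_rat (j k) - s) \<longlonglongrightarrow> 0"
    by (rule Lim_null_comparison[of _ "\<lambda>k. (1/2)^k"]) (use j in \<open>auto intro: LIMSEQ_realpow_zero\<close>)
  then have "(\<lambda>k. t * unit_rat (j k)) \<longlonglongrightarrow> s" by (rule LIM_zero_cancel)
  then show ?thesis by (rule that)
qed

lemma unit_rat_mult_mem:
  "0 \<le> t \<Longrightarrow> t * unit_rat n \<in> {0..t}"
  using unit_rat_bounds[of n] by (auto simp: mult_left_le)

lemma L2_continuous_on_closed_span:
  assumes V: "L2_continuous_on M {0..t} V" and s: "s \<in> {0..t}"
  shows "V s \<in> closed_span M (range (\<lambda>n. V (t * unit_rat n)))"
proof -
  obtain j where j: "(\<lambda>k. t * unit_rat (j k)) \<longlonglongrightarrow> s"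
    using ex_unit_rat_seq[of s t] s by auto
  have mem: "t * unit_rat n \<in> {0..t}" for n using s by (intro unit_rat_mult_mem) auto
  show ?thesis
    by (rule closed_span_limit[OF _ L2_continuous_onD[OF V mem s j]])
      (auto intro!: closed_span_base L2_continuous_on_imp_square_integrable[OF V mem])
qed

lemma finite_measure_lebesgue_on_Icc [simp]: "finite_measure (lebesgue_on {a..b::real})"
  by (rule finite_measure_lebesgue_on) simp

lemma integral_lebesgue_on_Ioc:
  assumes "0 \<le> u" "u \<le> v" "v \<le> t"
  shows "(LINT r|lebesgue_on {0..t}. indicator {u<..v} r) = v - (u::real)"
proof -
  have "{u<..v} \<inter> {0..t} = {u<..v}" "{u<..v} \<subseteq> {0..t}" using assms by auto
  moreover from this(2) have "measure (lebesgue_on {0..t}) {u<..v} = measure lebesgue {u<..v}"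
    by (intro measure_restrict_space) auto
  ultimately show ?thesis using assms by simp
qed

lemma borel_measurable_lebesgue_onI:
  "f \<in> borel_measurable borel \<Longrightarrow> f \<in> borel_measurable (lebesgue_on A)"
  by (intro measurable_restrict_space1 measurable_completion) simp

lemma square_integrable_indicator_lebesgue_on:
  "square_integrable (lebesgue_on {0..t}) (indicator {u<..v::real} :: real \<Rightarrow> real)"
  by (intro finite_measure.square_integrable_bounded[where K=1] finite_measure_lebesgue_on_Icc
      borel_measurable_lebesgue_onI) (auto simp: indicator_def)

lemma L2_continuous_on_indicator:
  "L2_continuous_on (lebesgue_on {0..t}) {0..t} (\<lambda>s. indicator {0<..s::real})"
  unfolding L2_continuous_on_def L2_tendsto_def
proof (intro allI impI conjI square_integrable_indicator_lebesgue_on)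
  fix s and r :: "nat \<Rightarrow> real" assume *: "(\<forall>k. r k \<in> {0..t}) \<and> s \<in> {0..t} \<and> r \<longlonglongrightarrow> s"
  have "(LINT x|lebesgue_on {0..t}. (indicator {0<..r k} x - indicator {0<..s} x)\<^sup>2) = \<bar>r k - s\<bar>" for k
  proof -
    have "(indicator {0<..r k} x - indicator {0<..s} x :: real)\<^sup>2 = indicator {min (r k) s<..max (r k) s} x" for x
      using * by (auto simp: indicator_def min_def max_def not_le dest: spec[of _ k])
    moreover have "0 \<le> r k" "r k \<le> t" "0 \<le> s" "s \<le> t" using * by auto
    then have "(LINT x|lebesgue_on {0..t}. indicator {min (r k) s<..max (r k) s} x) = max (r k) s - min (r k) s"
      by (intro integral_lebesgue_on_Ioc) auto
    ultimately show ?thesis by (simp only:)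
  qed
  moreover have "(\<lambda>k. \<bar>r k - s\<bar>) \<longlonglongrightarrow> 0"
    using * tendsto_rabs_zero LIM_zero by blast
  ultimately show "(\<lambda>k. LINT x|lebesgue_on {0..t}. (indicator {0<..r k} x - indicator {0<..s} x)\<^sup>2) \<longlonglongrightarrow> (0::real)"
    by (simp only:)
qed

text \<open>The sets over which \<open>h\<close> integrates to 0 contain the half-lines and form a
  Dynkin system, hence contain all Borel sets; completion adds the Lebesgue sets, among them those
  where \<open>h\<close> is positive or negative.\<close>

lemma AE_zero_if_integrals_zero:
  fixes h :: "real \<Rightarrow> real"
  assumes h: "integrable (lebesgue_on {0..t}) h" and "0 \<le> t"
    and zero: "\<And>s. s \<in> {0..t} \<Longrightarrow> (LINT r|lebesgue_on {0..t}. indicator {0<..s} r * h r) = 0"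
  shows "AE r in lebesgue_on {0..t}. h r = 0"
proof -
  let ?L = "lebesgue_on {0..t}"
  have ind: "integrable ?L (\<lambda>r. indicator A r * h r)" if "A \<in> sets lebesgue" for A
    using integrable_mult_indicator[OF _ h, of "A \<inter> {0..t}"] that
    by (subst Bochner_Integration.integrable_cong[OF refl, of _ _ "\<lambda>r. indicator (A \<inter> {0..t}) r *\<^sub>R h r"])
       (auto simp: sets_restrict_space indicator_def)
  have borel_sigma: "sigma_sets UNIV (range (\<lambda>a::real. {..a})) = sets borel"
    by (simp add: borel_eq_atMost)
  have null0: "AE r in ?L. r \<noteq> 0"
    by (rule AE_restrict_space_iff[THEN iffD2])
       (use AE_completion[OF AE_lborel_singleton[of "0::real"]] in \<open>auto elim: eventually_mono\<close>)
  have borel: "(LINT r|?L. indicator A r * h r) = 0" if "A \<in> sets borel" for A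
  proof -
    have "Int_stable (range (\<lambda>a::real. {..a}))"
      by (auto simp: Int_stable_def)
    moreover have "range (\<lambda>a::real. {..a}) \<subseteq> Pow UNIV" by simp
    moreover have "A \<in> sigma_sets UNIV (range (\<lambda>a::real. {..a}))"
      using that by (simp add: borel_sigma)
    ultimately show ?thesis
    proof (induction rule: sigma_sets_induct_disjoint)
      case (basic A)
      then obtain a where A: "A = {..a}" by blast
      \<comment> \<open>Up to the null point 0, a half-line meets [0, t] in a left-open interval
        that starts at 0; the maximum with 0 makes it empty for negative a.\<close>
      have "(LINT r|?L. indicator A r * h r) = (LINT r|?L. indicator {0<..max 0 (min a t)} r * h r)"
      proof (rule integral_cong_AE)
        show "(\<lambda>r. indicator A r * h r) \<in> borel_measurable ?L"
             "(\<lambda>r. indicator {0<..max 0 (min a t)} r * h r) \<in> borel_measurable ?L"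
          using A by (auto intro!: borel_measurable_integrable ind)
        have "AE r in ?L. r \<in> {0..t}" by (rule AE_I2) simp
        then show "AE r in ?L. indicator A r * h r = indicator {0<..max 0 (min a t)} r * h r"
          using null0 by eventually_elim (auto simp: A indicator_def)
      qed
      then show ?case using zero[of "max 0 (min a t)"] \<open>0 \<le> t\<close> by simp
    next
      case empty
      then show ?case by simp
    next
      case (compl A)
      then have A: "A \<in> sets lebesgue" by (simp add: borel_sigma)
      have all: "(LINT r|?L. h r) = 0"
      proof -
        have "(LINT r|?L. h r) = (LINT r|?L. indicator {0<..t} r * h r)"
        proof (rule integral_cong_AE)
          have "AE r in ?L. r \<in> {0..t}" by (rule AE_I2) simp
          then show "AE r in ?L. h r = indicator {0<..t} r * h r"
            using null0 by eventually_elim auto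
        qed (use h ind in \<open>auto intro!: borel_measurable_integrable\<close>)
        then show ?thesis using zero[of t] \<open>0 \<le> t\<close> by simp
      qed
      have "(LINT r|?L. indicator (UNIV - A) r * h r) = (LINT r|?L. h r - indicator A r * h r)"
        by (rule Bochner_Integration.integral_cong) (auto simp: indicator_def)
      then show ?case using compl all h ind[OF A] by simp
    next
      case (union A)
      then have A: "A i \<in> sets lebesgue" for i unfolding borel_sigma by auto
      have "(\<lambda>i. LINT r|?L. indicator (A i) r * h r) sums (LINT r|?L. indicator (\<Union>i. A i) r * h r)"
      proof -
        have "(\<lambda>n. LINT r|?L. (\<Sum>i<n. indicator (A i) r * h r)) \<longlonglongrightarrow> (LINT r|?L. indicator (\<Union>i. A i) r * h r)"
        proof (rule integral_dominated_convergence[where w="\<lambda>r. \<bar>h r\<bar>"])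
          show "(\<lambda>r. indicator (\<Union>i. A i) r * h r) \<in> borel_measurable ?L"
            by (rule borel_measurable_integrable[OF ind]) (rule sets.countable_UN, use A in blast)
          show "(\<lambda>r. \<Sum>i<n. indicator (A i) r * h r) \<in> borel_measurable ?L" for n
            by (rule borel_measurable_sum, rule borel_measurable_integrable[OF ind[OF A]])
          have sum_ind: "(\<Sum>i<n. indicator (A i) r) = (indicator (\<Union>i<n. A i) r :: real)" for n r
            using union(1) by (subst indicator_UN_disjoint) (auto simp: disjoint_family_on_def)
          have "(\<lambda>n. \<Sum>i<n. indicator (A i) r * h r) \<longlonglongrightarrow> indicator (\<Union>i. A i) r * h r" for r
            unfolding sum_distrib_right[symmetric] sum_ind
            by (intro tendsto_intros LIMSEQ_indicator_UN)
          then show "AE r in ?L. (\<lambda>n. \<Sum>i<n. indicator (A i) r * h r) \<longlonglongrightarrow> indicator (\<Union>i. A i) r * h r"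
            by simp
          have "norm (\<Sum>i<n. indicator (A i) r * h r) \<le> \<bar>h r\<bar>" for n r
            unfolding sum_distrib_right[symmetric] sum_ind by (simp add: abs_mult indicator_def)
          then show "AE r in ?L. norm (\<Sum>i<n. indicator (A i) r * h r) \<le> \<bar>h r\<bar>" for n by simp
        qed (use h in simp)
        then show ?thesis
          unfolding sums_def Bochner_Integration.integral_sum[OF ind[OF A]] .
      qed
      then show ?case using union(3) by (simp add: sums_unique[symmetric] sums_0 sums_iff)
    qed
  qed
  have leb: "(LINT r|?L. indicator A r * h r) = 0" if A_leb: "A \<in> sets lebesgue" for A
  proof -
    obtain S N N' where S: "A = S \<union> N" "N \<subseteq> N'" "N' \<in> null_sets lborel" "S \<in> sets lborel"
      by (rule sets_completionE[OF A_leb])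
    have "AE r in ?L. r \<notin> N'"
      by (rule AE_restrict_space_iff[THEN iffD2])
         (use AE_completion[OF AE_not_in[OF S(3)]] in \<open>auto elim: eventually_mono\<close>)
    then have "(LINT r|?L. indicator A r * h r) = (LINT r|?L. indicator S r * h r)"
    proof (intro integral_cong_AE)
      assume "AE r in ?L. r \<notin> N'"
      then show "AE r in ?L. indicator A r * h r = indicator S r * h r"
        by eventually_elim (use S in \<open>auto simp: indicator_def\<close>)
      have "S \<in> sets lebesgue" using S by auto
      then show "(\<lambda>r. indicator S r * h r) \<in> borel_measurable ?L"
        by (rule borel_measurable_integrable[OF ind])
    qed (rule borel_measurable_integrable[OF ind[OF A_leb]])
    then show ?thesis using borel S by simp
  qed
  \<comment> \<open>With s = 1 and s = -1 this gives the vanishing of the positive and of the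
    negative part: each is nonnegative and has integral 0.\<close>
  have pos: "AE r in ?L. indicator {r\<in>{0..t}. 0 < s * h r} r * (s * h r) = 0" for s
  proof -
    have meas: "{r\<in>{0..t}. 0 < s * h r} \<in> sets lebesgue"
    proof -
      have [measurable]: "h \<in> borel_measurable ?L" using h by simp
      have "{r\<in>space ?L. 0 < s * h r} \<in> sets ?L" by measurable
      then show ?thesis by (simp add: sets_restrict_space_iff)
    qed
    have "(LINT r|?L. indicator {r\<in>{0..t}. 0 < s * h r} r * (s * h r)) = s * (LINT r|?L. indicator {r\<in>{0..t}. 0 < s * h r} r * h r)"
      by (simp add: mult.left_commute)
    also have "\<dots> = 0" using leb[OF meas] by simp
    finally show ?thesis
      using ind[OF meas]
      by (subst (asm) integral_nonneg_eq_0_iff_AE) (auto simp: indicator_def mult.left_commute)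
  qed
  have "AE r in ?L. r \<in> {0..t}" by (rule AE_I2) simp
  with pos[of 1] pos[of "-1"] show ?thesis
    by eventually_elim (auto simp: indicator_def split: if_splits)
qed

definition steps_within :: "real \<Rightarrow> (real \<times> real \<times> real) list \<Rightarrow> bool" where
  "steps_within t L \<longleftrightarrow> (\<forall>(u, v, c)\<in>set L. 0 \<le> u \<and> u \<le> v \<and> v \<le> t)"

text \<open>A function orthogonal to all indicators of (0, s] has vanishing primitive, hence is 0
  almost everywhere; so these indicators span the whole space.\<close>

lemma step_fun_dense:
  assumes h: "square_integrable (lebesgue_on {0..t}) h" and "0 \<le> t"
  obtains L where "\<And>n. steps_within t (L n)"
    "L2_tendsto (lebesgue_on {0..t}) (\<lambda>n. step_fun (L n)) h"
proof -
  let ?L = "lebesgue_on {0..t}"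
  interpret L: finite_measure ?L by simp
  have "h \<in> closed_span ?L ((\<lambda>s. indicator {0<..s}) ` {0..t})"
  proof (rule closed_spanI[OF h])
    fix g assume g: "square_integrable ?L g"
      and orth: "\<And>f. f \<in> (\<lambda>s. indicator {0<..s}) ` {0..t} \<Longrightarrow> (LINT r|?L. f r * g r) = 0"
    have "AE r in ?L. g r = 0"
      by (rule AE_zero_if_integrals_zero[OF L.square_integrable_imp_integrable[OF g] \<open>0 \<le> t\<close>])
         (use orth in auto)
    then show "(LINT r|?L. h r * g r) = 0"
      by (intro integral_eq_zero_AE) auto
  qed
  then have "h \<in> closed_span ?L (range (\<lambda>n. indicator {0<..t * unit_rat n}))"
    by (rule closed_span_trans)
       (use L2_continuous_on_closed_span[OF L2_continuous_on_indicator] in blast)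
  then obtain c where c: "L2_tendsto ?L (\<lambda>n x. \<Sum>j<n. c n j * indicator {0<..t * unit_rat j} x) h"
    using L.closed_span_range_approx[of "\<lambda>n. indicator {0<..t * unit_rat n}",
        OF square_integrable_indicator_lebesgue_on] by blast
  define L :: "nat \<Rightarrow> (real \<times> real \<times> real) list" where "L n = map (\<lambda>j. (0, t * unit_rat j, c n j)) [0..<n]" for n
  have eq: "step_fun (L n) = (\<lambda>x. \<Sum>j<n. c n j * indicator {0<..t * unit_rat j} x)" for n
    by (auto simp: step_fun_def L_def comp_def interv_sum_list_conv_sum_set_nat atLeast0LessThan)
  have "L2_tendsto ?L (\<lambda>n. step_fun (L n)) h"
    using c by (simp only: eq)
  moreover have "steps_within t (L n)" for n
    using unit_rat_mult_mem[OF \<open>0 \<le> t\<close>] by (auto simp: steps_within_def L_def)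
  ultimately show ?thesis using that by blast
qed

section \<open>Processes with the covariance of Brownian motion\<close>

text \<open>Holds for arbitrary \<open>h\<close>: the two integrands on the line differ at the point
  0 only, so either both are measurable or both integrals are 0 by convention. This permits
  rewriting path integrals for every \<omega>, also where a path is irregular.\<close>

lemma integral_lebesgue_on_eq_indicator:
  fixes h :: "real \<Rightarrow> real"
  assumes "0 \<le> s" "s \<le> t"
  shows "(LINT r|lebesgue_on {0..s}. h r) = (LINT r|lebesgue_on {0..t}. indicator {0<..s} r * h r)"
proof -
  have null: "AE r in lebesgue. r \<noteq> (0::real)"
    using AE_completion[OF AE_lborel_singleton[of "0::real"]] by simp
  have ind [measurable]: "(indicator A :: real \<Rightarrow> real) \<in> borel_measurable lebesgue" if "A \<in> sets borel" for A
    by (rule borel_measurable_indicator) (use that in auto)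
  have "(LINT r|lebesgue_on {0..t}. indicator {0<..s} r * h r)
      = (LINT r|lebesgue. indicator {0..t} r *\<^sub>R (indicator {0<..s} r * h r))"
    by (intro integral_restrict_space) simp
  also have "\<dots> = (LINT r|lebesgue. indicator {0<..s} r * h r)"
    using assms by (intro Bochner_Integration.integral_cong) (auto simp: indicator_def)
  also have "\<dots> = (LINT r|lebesgue. indicator {0..s} r *\<^sub>R h r)"
  proof (cases "(\<lambda>r. indicator {0..s} r * h r) \<in> borel_measurable lebesgue")
    case True
    have "(\<lambda>r. indicator {0<..s} r * (indicator {0..s} r * h r)) \<in> borel_measurable lebesgue"
      by (intro borel_measurable_times True ind) simp
    moreover have "indicator {0<..s} r * (indicator {0..s} r * h r) = indicator {0<..s} r * h r" for r
      by (auto simp: indicator_def)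
    ultimately have "(\<lambda>r. indicator {0<..s} r * h r) \<in> borel_measurable lebesgue" by simp
    with True show ?thesis
      using null by (intro integral_cong_AE) (auto simp: indicator_def elim: eventually_mono)
  next
    case False
    have "(\<lambda>r. indicator {0<..s} r * h r) \<notin> borel_measurable lebesgue"
    proof
      assume "(\<lambda>r. indicator {0<..s} r * h r) \<in> borel_measurable lebesgue"
      then have "(\<lambda>r. indicator {0<..s} r * h r + indicator {0} r * h 0) \<in> borel_measurable lebesgue"
        by (intro borel_measurable_add) (simp_all add: ind)
      moreover have "indicator {0<..s} r * h r + indicator {0} r * h 0 = indicator {0..s} r * h r" for r
        using assms by (auto simp: indicator_def)
      ultimately show False using False by simp
    qed
    then have n1: "\<not> integrable lebesgue (\<lambda>r. indicator {0<..s} r * h r)"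
      using borel_measurable_integrable by blast
    have n2: "\<not> integrable lebesgue (\<lambda>r. indicator {0..s} r *\<^sub>R h r)"
      using False borel_measurable_integrable by fastforce
    show ?thesis
      unfolding not_integrable_integral_eq[OF n1] not_integrable_integral_eq[OF n2] ..
  qed
  also have "\<dots> = (LINT r|lebesgue_on {0..s}. h r)"
    by (intro integral_restrict_space[symmetric]) simp
  finally show ?thesis by simp
qed

lemma integrable_lebesgue_on_subset:
  fixes f :: "real \<Rightarrow> real"
  assumes f: "integrable (lebesgue_on {0..t}) f" and "s \<le> t"
  shows "integrable (lebesgue_on {0..s}) f"
proof -
  have "integrable lebesgue (\<lambda>r. indicator {0..t} r *\<^sub>R f r)"
    using integrable_restrict_space[of "{0..t}" lebesgue f] f by simp
  then have "integrable lebesgue (\<lambda>r. indicator {0..s} r *\<^sub>R (indicator {0..t} r *\<^sub>R f r))"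
    by (rule integrable_mult_indicator[rotated]) simp
  also have "(\<lambda>r. indicator {0..s} r *\<^sub>R (indicator {0..t} r *\<^sub>R f r)) = (\<lambda>r. indicator {0..s} r *\<^sub>R f r)"
    using assms(2) by (auto simp: indicator_def fun_eq_iff)
  finally show ?thesis using integrable_restrict_space[of "{0..s}" lebesgue f] by simp
qed

lemma square_integrable_lebesgue_on_subset:
  fixes f :: "real \<Rightarrow> real"
  assumes f: "square_integrable (lebesgue_on {0..t}) f" and "s \<le> t"
  shows "square_integrable (lebesgue_on {0..s}) f"
proof -
  have "f \<in> borel_measurable (lebesgue_on {0..s})"
    by (rule measurable_restrict_mono[OF square_integrableD(1)[OF f]]) (use assms in auto)
  then show ?thesis
    using integrable_lebesgue_on_subset[OF square_integrableD(2)[OF f] assms(2)] by (simp add: square_integrable_def)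
qed

text \<open>The property that the noise and the innovation share; the isometry below is derived from
  it alone.\<close>

definition brownian_covariance :: "'w measure \<Rightarrow> real \<Rightarrow> (real \<Rightarrow> 'w \<Rightarrow> real) \<Rightarrow> bool" where
  "brownian_covariance M T W \<longleftrightarrow> (\<forall>s\<in>{0..T}. square_integrable M (W s)) \<and>
     (\<forall>s\<in>{0..T}. \<forall>t\<in>{0..T}. (LINT x|M. W s x * W t x) = min s t)"

lemma step_fun_Nil [simp]: "step_fun [] = (\<lambda>r. 0)"
  by (simp add: step_fun_def fun_eq_iff)

lemma step_fun_Cons [simp]:
  "step_fun ((u, v, c) # L) = (\<lambda>r. c * indicator {u<..v} r + step_fun L r)"
  by (simp add: step_fun_def fun_eq_iff)

lemma step_integral_Nil [simp]: "step_integral W [] = (\<lambda>x. 0)"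
  by (simp add: step_integral_def fun_eq_iff)

lemma step_integral_Cons [simp]:
  "step_integral W ((u, v, c) # L) = (\<lambda>x. c * (W v x - W u x) + step_integral W L x)"
  by (simp add: step_integral_def fun_eq_iff)

lemma steps_within_Nil [simp]: "steps_within t []"
  by (simp add: steps_within_def)

lemma steps_within_Cons [simp]:
  "steps_within t ((u, v, c) # L) \<longleftrightarrow> 0 \<le> u \<and> u \<le> v \<and> v \<le> t \<and> steps_within t L"
  by (auto simp: steps_within_def)

lemma steps_within_mono: "steps_within s L \<Longrightarrow> s \<le> t \<Longrightarrow> steps_within t L"
  by (force simp: steps_within_def)

lemma square_integrable_step_fun: "square_integrable (lebesgue_on {0..t}) (step_fun L)"
proof (induction L)
  case (Cons a L)
  then show ?case
    by (cases a) (auto intro!: square_integrable_add square_integrable_cmult square_integrable_indicator_lebesgue_on)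
qed simp

lemma borel_measurable_step_fun [measurable]: "step_fun L \<in> borel_measurable borel"
proof (induction L)
  case (Cons a L)
  then show ?case by (cases a) simp
qed simp

lemma step_integral_closed_span:
  assumes "\<And>s. s \<in> {0..t} \<Longrightarrow> square_integrable M (W s)" "steps_within t L"
  shows "step_integral W L \<in> closed_span M (W ` {0..t})"
  using assms(2)
proof (induction L)
  case (Cons a L)
  obtain u v c where a: "a = (u, v, c)" by (cases a)
  then have "u \<in> {0..t}" "v \<in> {0..t}" using Cons.prems by auto
  with Cons assms(1) show ?case
    unfolding a step_integral_Cons
    by (intro closed_span_add closed_span_cmult closed_span_diff) (auto intro: closed_span_base)
qed (simp add: closed_span_zero)

lemma square_integrable_step_integral:
  assumes "\<And>s. s \<in> {0..t} \<Longrightarrow> square_integrable M (W s)" "steps_within t L"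
  shows "square_integrable M (step_integral W L)"
  by (rule closed_spanD(1)[OF step_integral_closed_span[OF assms]])

text \<open>Because W vanishes at time 0, a multiple of W(v) is a multiple of the increment over (0,
  v], so linear combinations of values are step integrals.\<close>

lemma L2_continuous_step_approx:
  assumes M: "finite_measure M" and W: "L2_continuous_on M {0..t} W" and "0 \<le> t"
    and W0: "AE x in M. W 0 x = 0" and f: "f \<in> closed_span M (W ` {0..t})"
  obtains L where "\<And>n. steps_within t (L n)" "L2_tendsto M (\<lambda>n. step_integral W (L n)) f"
proof -
  interpret finite_measure M by fact
  have mem: "t * unit_rat n \<in> {0..t}" for n using \<open>0 \<le> t\<close> by (intro unit_rat_mult_mem)
  have W_sq: "square_integrable M (W s)" if "s \<in> {0..t}" for s
    by (rule L2_continuous_on_imp_square_integrable[OF W that])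
  have "f \<in> closed_span M (range (\<lambda>n. W (t * unit_rat n)))"
    by (rule closed_span_trans[OF f]) (use L2_continuous_on_closed_span[OF W] in blast)
  then obtain c where c: "L2_tendsto M (\<lambda>n x. \<Sum>j<n. c n j * W (t * unit_rat j) x) f"
    using closed_span_range_approx[of "\<lambda>n. W (t * unit_rat n)", OF W_sq[OF mem]] by blast
  define L :: "nat \<Rightarrow> (real \<times> real \<times> real) list" where "L n = map (\<lambda>j. (0, t * unit_rat j, c n j)) [0..<n]" for n
  have L: "steps_within t (L n)" for n
    using mem by (auto simp: steps_within_def L_def)
  have I_sq: "square_integrable M (step_integral W (L n))" for n
    by (rule square_integrable_step_integral[OF W_sq L])
  have eq: "AE x in M. (\<Sum>j<n. c n j * W (t * unit_rat j) x) = step_integral W (L n) x" for n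
    using W0
    by (auto simp: step_integral_def L_def comp_def interv_sum_list_conv_sum_set_nat atLeast0LessThan)
  have "(LINT x|M. (step_integral W (L n) x - f x)\<^sup>2)
     = (LINT x|M. ((\<Sum>j<n. c n j * W (t * unit_rat j) x) - f x)\<^sup>2)" for n
  proof (rule integral_cong_AE)
    note [measurable] = square_integrableD(1)[OF L2_tendstoD(2)[OF c]]
      square_integrableD(1)[OF L2_tendstoD(1)[OF c, of n]] square_integrableD(1)[OF I_sq]
    show "(\<lambda>x. (step_integral W (L n) x - f x)\<^sup>2) \<in> borel_measurable M" by measurable
    show "(\<lambda>x. ((\<Sum>j<n. c n j * W (t * unit_rat j) x) - f x)\<^sup>2) \<in> borel_measurable M" by measurable
    show "AE x in M. (step_integral W (L n) x - f x)\<^sup>2 = ((\<Sum>j<n. c n j * W (t * unit_rat j) x) - f x)\<^sup>2"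
      using eq[of n] by eventually_elim simp
  qed
  with c have "L2_tendsto M (\<lambda>n. step_integral W (L n)) f"
    using I_sq by (simp add: L2_tendsto_def)
  with L show ?thesis by (rule that)
qed

text \<open>Here \<open>h\<close> is the density of s -> E (J W(s)). No covariance of W enters, so
  the formula also serves the observation process, whose covariance is not that of Brownian
  motion.\<close>

lemma integral_mult_step_integral:
  assumes W: "\<And>s. s \<in> {0..t} \<Longrightarrow> square_integrable M (W s)"
    and J: "square_integrable M J" and h: "square_integrable (lebesgue_on {0..t}) h"
    and repr: "\<And>s. s \<in> {0..t} \<Longrightarrow> (LINT x|M. J x * W s x) = (LINT r|lebesgue_on {0..s}. h r)"
    and L: "steps_within t L"
  shows "(LINT x|M. J x * step_integral W L x) = (LINT r|lebesgue_on {0..t}. h r * step_fun L r)"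
  using L
proof (induction L)
  case (Cons a L)
  obtain u v c where a: "a = (u, v, c)" by (cases a)
  then have uv: "0 \<le> u" "u \<le> v" "v \<le> t" and L: "steps_within t L" using Cons.prems by auto
  let ?L = "lebesgue_on {0..t}"
  have ind: "integrable ?L (\<lambda>r. indicator {p<..q} r * h r)" for p q
    by (rule square_integrable_mult[OF square_integrable_indicator_lebesgue_on h])
  have int: "integrable M (\<lambda>x. J x * W u x)" "integrable M (\<lambda>x. J x * W v x)"
      "integrable M (\<lambda>x. J x * step_integral W L x)"
    using uv by (auto intro!: square_integrable_mult[OF J] W square_integrable_step_integral[OF W L])
  have "(LINT x|M. J x * (c * (W v x - W u x)))
      = c * ((LINT x|M. J x * W v x) - (LINT x|M. J x * W u x))"
    using int by (simp add: right_diff_distrib mult.left_commute[of _ c])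
  also have "\<dots> = c * (LINT r|?L. indicator {0<..v} r * h r - indicator {0<..u} r * h r)"
    using uv repr[of u] repr[of v] ind
    by (simp add: integral_lebesgue_on_eq_indicator[of u t] integral_lebesgue_on_eq_indicator[of v t])
  also have "\<dots> = (LINT r|?L. h r * (c * indicator {u<..v} r))"
    unfolding Bochner_Integration.integral_mult_right_zero[symmetric]
    using uv by (intro Bochner_Integration.integral_cong) (auto simp: indicator_def)
  finally have 1: "(LINT x|M. J x * (c * (W v x - W u x))) = (LINT r|?L. h r * (c * indicator {u<..v} r))" .
  have int1: "integrable M (\<lambda>x. J x * (c * (W v x - W u x)))"
    using uv by (intro square_integrable_mult[OF J] square_integrable_cmult square_integrable_diff W) auto
  have "(LINT x|M. J x * step_integral W (a # L) x)
      = (LINT x|M. J x * (c * (W v x - W u x)) + J x * step_integral W L x)"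
    by (simp only: a step_integral_Cons distrib_left)
  also have "\<dots> = (LINT r|?L. h r * (c * indicator {u<..v} r)) + (LINT r|?L. h r * step_fun L r)"
    unfolding Bochner_Integration.integral_add[OF int1 int(3)] 1 Cons.IH[OF L] ..
  also have "\<dots> = (LINT r|?L. h r * (c * indicator {u<..v} r) + h r * step_fun L r)"
    by (intro Bochner_Integration.integral_add[symmetric] square_integrable_mult[OF h]
        square_integrable_cmult square_integrable_step_fun square_integrable_indicator_lebesgue_on)
  also have "\<dots> = (LINT r|?L. h r * step_fun (a # L) r)"
    by (simp only: a step_fun_Cons distrib_left)
  finally show ?case .
qed simp

context
  fixes M :: "'w measure" and T :: real and W :: "real \<Rightarrow> 'w \<Rightarrow> real"
  assumes W: "brownian_covariance M T W"
begin

lemma bc_square_integrable: "s \<in> {0..T} \<Longrightarrow> square_integrable M (W s)"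
  using W by (auto simp: brownian_covariance_def)

lemma bc_cov: "s \<in> {0..T} \<Longrightarrow> t \<in> {0..T} \<Longrightarrow> (LINT x|M. W s x * W t x) = min s t"
  using W by (auto simp: brownian_covariance_def)

lemma bc_increment:
  assumes "0 \<le> s" "s \<le> t" "t \<le> T"
  shows "(LINT x|M. (W t x - W s x)\<^sup>2) = t - s"
proof -
  have m: "s \<in> {0..T}" "t \<in> {0..T}" using assms by auto
  have "(LINT x|M. (W t x - W s x)\<^sup>2) = min t t - 2 * min t s + min s s"
    unfolding integral_square_diff[OF bc_square_integrable[OF m(2)] bc_square_integrable[OF m(1)]]
    using bc_cov[OF m(2) m(2)] bc_cov[OF m(2) m(1)] bc_cov[OF m(1) m(1)] by (simp add: power2_eq_square)
  then show ?thesis using assms by simp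
qed

lemma bc_L2_continuous: "L2_continuous_on M {0..T} W"
  unfolding L2_continuous_on_def L2_tendsto_def
proof (intro allI impI conjI)
  fix s and r :: "nat \<Rightarrow> real" assume *: "(\<forall>k. r k \<in> {0..T}) \<and> s \<in> {0..T} \<and> r \<longlonglongrightarrow> s"
  show "square_integrable M (W s)" "square_integrable M (W (r k))" for k
    using * bc_square_integrable by auto
  have "(LINT x|M. (W (r k) x - W s x)\<^sup>2) = \<bar>r k - s\<bar>" for k
  proof (cases "s \<le> r k")
    case True
    then show ?thesis using bc_increment[of s "r k"] * by auto
  next
    case False
    have "(LINT x|M. (W (r k) x - W s x)\<^sup>2) = (LINT x|M. (W s x - W (r k) x)\<^sup>2)"
      by (simp add: power2_commute)
    also have "\<dots> = s - r k" using False * by (intro bc_increment) auto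
    finally show ?thesis using False by simp
  qed
  moreover have "(\<lambda>k. \<bar>r k - s\<bar>) \<longlonglongrightarrow> 0"
    using * tendsto_rabs_zero LIM_zero by blast
  ultimately show "(\<lambda>k. LINT x|M. (W (r k) x - W s x)\<^sup>2) \<longlonglongrightarrow> 0"
    by (simp only:)
qed

lemma bc_AE_zero: "0 \<le> T \<Longrightarrow> AE x in M. W 0 x = 0"
  by (rule integral_square_eq_0_imp_AE) (use bc_square_integrable[of 0] bc_cov[of 0 0] in \<open>auto simp: power2_eq_square\<close>)

context
  fixes t :: real
  assumes t: "0 \<le> t" "t \<le> T"
begin

lemma bc_square_integrable': "s \<in> {0..t} \<Longrightarrow> square_integrable M (W s)"
  using bc_square_integrable t by auto

lemma bc_square_integrable_step_integral:
  "steps_within t L \<Longrightarrow> square_integrable M (step_integral W L)"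
  using bc_square_integrable' by (rule square_integrable_step_integral)

lemma integral_mult_bc_step_integral:
  assumes "s \<in> {0..t}" "steps_within t L"
  shows "(LINT x|M. W s x * step_integral W L x) = (LINT r|lebesgue_on {0..s}. step_fun L r)"
proof -
  have "(LINT x|M. W s x * step_integral W L x)
      = (LINT r|lebesgue_on {0..t}. indicator {0<..s} r * step_fun L r)"
  proof (rule integral_mult_step_integral[OF bc_square_integrable' _ square_integrable_indicator_lebesgue_on _ assms(2)])
    show "square_integrable M (W s)" using assms bc_square_integrable' by simp
    fix s' assume s': "s' \<in> {0..t}"
    have "(LINT r|lebesgue_on {0..s'}. indicator {0<..s} r)
        = (LINT r|lebesgue_on {0..t}. indicator {0<..s'} r * (indicator {0<..s} r :: real))"
      using s' by (intro integral_lebesgue_on_eq_indicator) auto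
    also have "\<dots> = (LINT r|lebesgue_on {0..t}. indicator {0<..min s s'} r)"
      by (intro Bochner_Integration.integral_cong) (auto simp: indicator_def)
    also have "\<dots> = min s s'"
      using integral_lebesgue_on_Ioc[of 0 "min s s'" t] assms s' by auto
    also have "\<dots> = (LINT x|M. W s x * W s' x)"
      using bc_cov[of s s'] assms s' t by auto
    finally show "(LINT x|M. W s x * W s' x) = (LINT r|lebesgue_on {0..s'}. indicator {0<..s} r)" by simp
  qed
  then show ?thesis using assms by (simp add: integral_lebesgue_on_eq_indicator[of s t])
qed

lemma integral_bc_step_integral_step_integral:
  assumes "steps_within t L" "steps_within t L'"
  shows "(LINT x|M. step_integral W L x * step_integral W L' x)
     = (LINT r|lebesgue_on {0..t}. step_fun L r * step_fun L' r)"
  by (rule integral_mult_step_integral[OF bc_square_integrable'])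
     (use assms in \<open>auto intro!: bc_square_integrable_step_integral bc_square_integrable' square_integrable_step_fun
        simp: mult.commute[of "step_integral W L _"] integral_mult_bc_step_integral\<close>)

text \<open>The two squared distances differ by the norm defect of J against h, which does not
  depend on L. Bessel's inequality and Parseval's identity arise from two different choices of
  L.\<close>

lemma integral_bc_step_integral_diff:
  assumes J: "square_integrable M J" and h: "square_integrable (lebesgue_on {0..t}) h"
    and repr: "\<And>s. s \<in> {0..t} \<Longrightarrow> (LINT x|M. J x * W s x) = (LINT r|lebesgue_on {0..s}. h r)"
    and L: "steps_within t L"
  shows "(LINT x|M. (J x - step_integral W L x)\<^sup>2)
     = (LINT x|M. (J x)\<^sup>2) - (LINT r|lebesgue_on {0..t}. (h r)\<^sup>2)
        + (LINT r|lebesgue_on {0..t}. (step_fun L r - h r)\<^sup>2)"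
  unfolding integral_square_diff[OF J bc_square_integrable_step_integral[OF L]]
    integral_square_diff[OF square_integrable_step_fun h]
  using integral_mult_step_integral[OF bc_square_integrable' J h repr L]
    integral_bc_step_integral_step_integral[OF L L]
  by (simp add: power2_eq_square mult.commute)

text \<open>Step functions that approximate \<open>h\<close> make the last term vanish in the limit,
  so the norm defect is a limit of nonnegative numbers.\<close>

lemma bc_bessel:
  assumes J: "square_integrable M J" and h: "square_integrable (lebesgue_on {0..t}) h"
    and repr: "\<And>s. s \<in> {0..t} \<Longrightarrow> (LINT x|M. J x * W s x) = (LINT r|lebesgue_on {0..s}. h r)"
  shows "(LINT r|lebesgue_on {0..t}. (h r)\<^sup>2) \<le> (LINT x|M. (J x)\<^sup>2)"
proof -
  obtain L where L: "\<And>n. steps_within t (L n)"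
      "L2_tendsto (lebesgue_on {0..t}) (\<lambda>n. step_fun (L n)) h"
    using step_fun_dense[OF h] t by blast
  have "(\<lambda>n. (LINT x|M. (J x)\<^sup>2) - (LINT r|lebesgue_on {0..t}. (h r)\<^sup>2)
        + (LINT r|lebesgue_on {0..t}. (step_fun (L n) r - h r)\<^sup>2))
      \<longlonglongrightarrow> (LINT x|M. (J x)\<^sup>2) - (LINT r|lebesgue_on {0..t}. (h r)\<^sup>2) + 0"
    by (intro tendsto_intros L2_tendstoD(3)[OF L(2)])
  moreover have "0 \<le> (LINT x|M. (J x)\<^sup>2) - (LINT r|lebesgue_on {0..t}. (h r)\<^sup>2)
        + (LINT r|lebesgue_on {0..t}. (step_fun (L n) r - h r)\<^sup>2)" for n
  proof -
    have "0 \<le> (LINT x|M. (J x - step_integral W (L n) x)\<^sup>2)" by simp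
    then show ?thesis by (simp only: integral_bc_step_integral_diff[OF J h repr L(1)])
  qed
  ultimately show ?thesis
    using LIMSEQ_le_const[of _ "(LINT x|M. (J x)\<^sup>2) - (LINT r|lebesgue_on {0..t}. (h r)\<^sup>2) + 0" 0] by fastforce
qed

text \<open>For J in the span, L can be chosen such that its integrals approximate J, which forces
  the norm defect to be at most 0. After that, distances in probability space and in L2[0, t]
  coincide, so every approximation of \<open>h\<close> is one of J and conversely. In the last
  clause only J has to lie in the span; K enters through its density.\<close>

lemma bc_parseval:
  assumes M: "finite_measure M"
    and J: "J \<in> closed_span M (W ` {0..t})" and h: "square_integrable (lebesgue_on {0..t}) h"
    and repr: "\<And>s. s \<in> {0..t} \<Longrightarrow> (LINT x|M. J x * W s x) = (LINT r|lebesgue_on {0..s}. h r)"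
  shows "(LINT x|M. (J x)\<^sup>2) = (LINT r|lebesgue_on {0..t}. (h r)\<^sup>2)"
    and "is_wiener_integral M W t h J"
    and "\<And>K k. \<lbrakk>square_integrable M K; square_integrable (lebesgue_on {0..t}) k;
       \<And>s. s \<in> {0..t} \<Longrightarrow> (LINT x|M. K x * W s x) = (LINT r|lebesgue_on {0..s}. k r)\<rbrakk> \<Longrightarrow>
       (LINT x|M. K x * J x) = (LINT r|lebesgue_on {0..t}. k r * h r)"
proof -
  interpret finite_measure M by fact
  note J' = closed_spanD(1)[OF J]
  have cont: "L2_continuous_on M {0..t} W"
    by (rule L2_continuous_on_subset[OF bc_L2_continuous]) (use t in auto)
  obtain L where L: "\<And>n. steps_within t (L n)" and "L2_tendsto M (\<lambda>n. step_integral W (L n)) J"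
    using L2_continuous_step_approx[OF M cont t(1) _ J] bc_AE_zero t by auto
  then have lim: "(\<lambda>n. LINT x|M. (J x - step_integral W (L n) x)\<^sup>2) \<longlonglongrightarrow> 0"
    by (simp add: L2_tendsto_def power2_commute)
  have "(LINT x|M. (J x - step_integral W (L n) x)\<^sup>2) \<ge> (LINT x|M. (J x)\<^sup>2) - (LINT r|lebesgue_on {0..t}. (h r)\<^sup>2)" for n
    using integral_bc_step_integral_diff[OF J' h repr L, of n] by simp
  then have "(LINT x|M. (J x)\<^sup>2) - (LINT r|lebesgue_on {0..t}. (h r)\<^sup>2) \<le> 0"
    using LIMSEQ_le_const[OF lim] by blast
  with bc_bessel[OF J' h repr] show eq: "(LINT x|M. (J x)\<^sup>2) = (LINT r|lebesgue_on {0..t}. (h r)\<^sup>2)"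
    by simp
  have dist: "(LINT x|M. (step_integral W L x - J x)\<^sup>2) = (LINT r|lebesgue_on {0..t}. (step_fun L r - h r)\<^sup>2)"
    if "steps_within t L" for L
    using integral_bc_step_integral_diff[OF J' h repr that] eq by (simp add: power2_commute)
  show "is_wiener_integral M W t h J"
    unfolding is_wiener_integral_def
  proof (intro conjI allI impI ballI h J' bc_square_integrable', simp)
    fix L :: "nat \<Rightarrow> (real \<times> real \<times> real) list"
    assume L: "(\<forall>n. \<forall>(u, v, c)\<in>set (L n). 0 \<le> u \<and> u \<le> v \<and> v \<le> t) \<and>
       (\<lambda>n. LINT r|lebesgue_on {0..t}. (step_fun (L n) r - h r)\<^sup>2) \<longlonglongrightarrow> 0"
    then have "steps_within t (L n)" for n by (simp add: steps_within_def)
    with L show "(\<lambda>n. LINT x|M. (step_integral W (L n) x - J x)\<^sup>2) \<longlonglongrightarrow> 0" by (simp add: dist)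
  qed
  fix K k assume K: "square_integrable M K" "square_integrable (lebesgue_on {0..t}) k"
    "\<And>s. s \<in> {0..t} \<Longrightarrow> (LINT x|M. K x * W s x) = (LINT r|lebesgue_on {0..s}. k r)"
  have 1: "L2_tendsto M (\<lambda>n. step_integral W (L n)) J"
    using lim J' bc_square_integrable_step_integral[OF L]
    by (simp add: L2_tendsto_def power2_commute)
  have 2: "L2_tendsto (lebesgue_on {0..t}) (\<lambda>n. step_fun (L n)) h"
    using L2_tendstoD(3)[OF 1] h square_integrable_step_fun dist[OF L]
    by (simp add: L2_tendsto_def)
  have "(\<lambda>n. LINT x|M. step_integral W (L n) x * K x) \<longlonglongrightarrow> (LINT x|M. J x * K x)"
    by (rule L2_tendsto_inner[OF 1 K(1)])
  moreover have "(\<lambda>n. LINT r|lebesgue_on {0..t}. step_fun (L n) r * k r) \<longlonglongrightarrow> (LINT r|lebesgue_on {0..t}. h r * k r)"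
    by (rule L2_tendsto_inner[OF 2 K(2)])
  moreover have "(LINT x|M. step_integral W (L n) x * K x) = (LINT r|lebesgue_on {0..t}. step_fun (L n) r * k r)" for n
    using integral_mult_step_integral[OF bc_square_integrable' K L] by (simp add: mult.commute)
  ultimately show "(LINT x|M. K x * J x) = (LINT r|lebesgue_on {0..t}. k r * h r)"
    by (simp add: mult.commute LIMSEQ_unique)
qed

text \<open>The definition speaks of all approximating sequences; density of step functions supplies
  one, and the isometry for step integrals passes to its limit.\<close>

lemma is_wiener_integral_bcD:
  assumes J: "is_wiener_integral M W t h J"
  shows "J \<in> closed_span M (W ` {0..t})"
    and "\<And>s. s \<in> {0..t} \<Longrightarrow> (LINT x|M. J x * W s x) = (LINT r|lebesgue_on {0..s}. h r)"
    and "\<And>s. s \<in> {t..T} \<Longrightarrow> (LINT x|M. J x * W s x) = (LINT r|lebesgue_on {0..t}. h r)"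
    and "(LINT x|M. (J x)\<^sup>2) = (LINT r|lebesgue_on {0..t}. (h r)\<^sup>2)"
proof -
  have h: "square_integrable (lebesgue_on {0..t}) h" and J': "square_integrable M J"
    using J by (auto simp: is_wiener_integral_def)
  obtain L where L: "\<And>n. steps_within t (L n)"
      "L2_tendsto (lebesgue_on {0..t}) (\<lambda>n. step_fun (L n)) h"
    using step_fun_dense[OF h] t by blast
  have "(\<lambda>n. LINT x|M. (step_integral W (L n) x - J x)\<^sup>2) \<longlonglongrightarrow> 0"
    using J L unfolding is_wiener_integral_def L2_tendsto_def steps_within_def by blast
  then have lim: "L2_tendsto M (\<lambda>n. step_integral W (L n)) J"
    using J' bc_square_integrable_step_integral[OF L(1)] by (simp add: L2_tendsto_def)
  show span: "J \<in> closed_span M (W ` {0..t})"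
    by (rule closed_span_limit[OF step_integral_closed_span[OF bc_square_integrable' L(1)] lim])
  show repr: "(LINT x|M. J x * W s x) = (LINT r|lebesgue_on {0..s}. h r)" if s: "s \<in> {0..t}" for s
  proof -
    have "(\<lambda>n. LINT x|M. step_integral W (L n) x * W s x) \<longlonglongrightarrow> (LINT x|M. J x * W s x)"
      by (rule L2_tendsto_inner[OF lim bc_square_integrable'[OF s]])
    moreover have "(\<lambda>n. LINT r|lebesgue_on {0..t}. step_fun (L n) r * indicator {0<..s} r)
        \<longlonglongrightarrow> (LINT r|lebesgue_on {0..t}. h r * indicator {0<..s} r)"
      by (rule L2_tendsto_inner[OF L(2) square_integrable_indicator_lebesgue_on])
    moreover have "(LINT x|M. step_integral W (L n) x * W s x)
        = (LINT r|lebesgue_on {0..t}. step_fun (L n) r * indicator {0<..s} r)" for n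
      using integral_mult_bc_step_integral[OF s L(1), of n] s
      by (simp add: integral_lebesgue_on_eq_indicator[of s t] mult.commute)
    ultimately have "(LINT x|M. J x * W s x) = (LINT r|lebesgue_on {0..t}. h r * indicator {0<..s} r)"
      by (simp add: LIMSEQ_unique)
    then show ?thesis using s by (simp add: integral_lebesgue_on_eq_indicator[of s t] mult.commute)
  qed
  show "(LINT x|M. J x * W s x) = (LINT r|lebesgue_on {0..t}. h r)" if s: "s \<in> {t..T}" for s
  proof -
    have s': "s \<in> {0..T}" "t \<in> {0..T}" using s t by auto
    \<comment> \<open>Beyond t the covariance with W stays constant, since later increments are
      orthogonal to the span of W on [0, t].\<close>
    have "(LINT x|M. J x * (W s x - W t x)) = 0"
    proof (rule closed_spanD(2)[OF span])
      show "square_integrable M (\<lambda>x. W s x - W t x)"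
        using bc_square_integrable s' by blast
      fix g assume "g \<in> W ` {0..t}"
      then obtain r where g: "g = W r" "r \<in> {0..t}" by blast
      then have r: "r \<in> {0..T}" using t by auto
      have "(LINT x|M. W r x * (W s x - W t x)) = min r s - min r t"
        using square_integrable_mult[OF bc_square_integrable[OF r] bc_square_integrable[OF s'(1)]]
          square_integrable_mult[OF bc_square_integrable[OF r] bc_square_integrable[OF s'(2)]]
        by (simp only: right_diff_distrib Bochner_Integration.integral_diff bc_cov[OF r s'(1)] bc_cov[OF r s'(2)])
      then show "(LINT x|M. g x * (W s x - W t x)) = 0" using g s by auto
    qed
    then have "(LINT x|M. J x * W s x) = (LINT x|M. J x * W t x)"
      using square_integrable_mult[OF J' bc_square_integrable[OF s'(1)]]
          square_integrable_mult[OF J' bc_square_integrable[OF s'(2)]]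
      by (simp add: right_diff_distrib)
    then show ?thesis using repr[of t] t by simp
  qed
  have "(LINT x|M. (step_integral W (L n) x)\<^sup>2) = (LINT r|lebesgue_on {0..t}. (step_fun (L n) r)\<^sup>2)" for n
    using integral_bc_step_integral_step_integral[OF L(1) L(1)] by (simp add: power2_eq_square)
  then show "(LINT x|M. (J x)\<^sup>2) = (LINT r|lebesgue_on {0..t}. (h r)\<^sup>2)"
    using L2_tendsto_square[OF lim] L2_tendsto_square[OF L(2)] by (simp add: LIMSEQ_unique)
qed

end

end

section \<open>Time integrals of measurable processes\<close>

lemma measurable_id_lebesgue_on:
  assumes "s \<le> T"
  shows "(\<lambda>r. r) \<in> lebesgue_on {0..s} \<rightarrow>\<^sub>M restrict_space borel {0..T::real}"
proof (rule measurable_restrict_space2)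
  show "(\<lambda>r. r) \<in> space (lebesgue_on {0..s}) \<rightarrow> {0..T}" using assms by auto
qed (rule borel_measurable_lebesgue_onI, simp)

lemma borel_measurable_on_lebesgue_on:
  assumes "f \<in> borel_measurable (restrict_space borel {0..T::real})" "s \<le> T"
  shows "f \<in> borel_measurable (lebesgue_on {0..s})"
  using measurable_compose[OF measurable_id_lebesgue_on[OF assms(2)] assms(1)] by simp

lemma measurable_process_lebesgue_on:
  fixes W :: "real \<Rightarrow> 'w \<Rightarrow> real"
  assumes "measurable_process M T W" "s \<le> T"
  shows "(\<lambda>(r, x). W r x) \<in> borel_measurable (lebesgue_on {0..s} \<Otimes>\<^sub>M M)"
proof -
  have "(\<lambda>p. (fst p, snd p)) \<in> lebesgue_on {0..s} \<Otimes>\<^sub>M M \<rightarrow>\<^sub>M restrict_space borel {0..T} \<Otimes>\<^sub>M M"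
    by (intro measurable_Pair measurable_compose[OF measurable_fst measurable_id_lebesgue_on[OF assms(2)]]
        measurable_snd)
  from measurable_compose[OF this assms(1)[unfolded measurable_process_def]] show ?thesis by simp
qed

lemma measurable_process_section:
  fixes W :: "real \<Rightarrow> 'w \<Rightarrow> real"
  assumes "measurable_process M T W" "t \<in> {0..T}"
  shows "W t \<in> borel_measurable M"
proof -
  have "(\<lambda>x. (t, x)) \<in> M \<rightarrow>\<^sub>M restrict_space borel {0..T} \<Otimes>\<^sub>M M"
    using assms(2) by (intro measurable_Pair measurable_const) (auto simp: space_restrict_space)
  from measurable_compose[OF this assms(1)[unfolded measurable_process_def]] show ?thesis by simp
qed

lemma measurable_process_mult_fun:
  fixes W :: "real \<Rightarrow> 'w \<Rightarrow> real"
  assumes W: "measurable_process M T W" and k: "k \<in> borel_measurable (restrict_space borel {0..T})"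
  shows "measurable_process M T (\<lambda>t x. k t * W t x)"
  using borel_measurable_times[OF measurable_compose[OF measurable_fst k] W[unfolded measurable_process_def]]
  by (simp add: measurable_process_def split_beta')

lemma measurable_process_add:
  fixes W V :: "real \<Rightarrow> 'w \<Rightarrow> real"
  assumes W: "measurable_process M T W" and V: "measurable_process M T V"
  shows "measurable_process M T (\<lambda>t x. W t x + V t x)"
  using borel_measurable_add[OF W[unfolded measurable_process_def] V[unfolded measurable_process_def]]
  by (simp add: measurable_process_def split_beta')

lemma measurable_process_diff:
  fixes W V :: "real \<Rightarrow> 'w \<Rightarrow> real"
  assumes W: "measurable_process M T W" and V: "measurable_process M T V"
  shows "measurable_process M T (\<lambda>t x. W t x - V t x)"
  using borel_measurable_diff[OF W[unfolded measurable_process_def] V[unfolded measurable_process_def]]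
  by (simp add: measurable_process_def split_beta')

text \<open>The path is sampled at t rounded down to a multiple of 1/(n+1) and capped at T. This
  sample is a countable selection among fixed-time variables, hence jointly measurable, and
  continuity gives its convergence.\<close>

lemma measurable_process_if_continuous:
  fixes W :: "real \<Rightarrow> 'w \<Rightarrow> real"
  assumes cont: "\<And>x. x \<in> space M \<Longrightarrow> continuous_on {0..T} (\<lambda>t. W t x)"
    and meas: "\<And>t. t \<in> {0..T} \<Longrightarrow> W t \<in> borel_measurable M" and "0 \<le> T"
  shows "measurable_process M T W"
proof -
  define g where "g n t = min T (real (nat \<lfloor>t * real (Suc n)\<rfloor>) / real (Suc n))" for n t
  have g_mem: "g n t \<in> {0..T}" for n t using \<open>0 \<le> T\<close> by (auto simp: g_def)
  have g_lim: "(\<lambda>n. g n t) \<longlonglongrightarrow> t" if "t \<in> {0..T}" for t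
  proof -
    have "\<bar>g n t - t\<bar> \<le> 1 / real (Suc n)" for n
    proof -
      have f: "real (nat \<lfloor>t * real (Suc n)\<rfloor>) = of_int \<lfloor>t * real (Suc n)\<rfloor>"
        using that by (intro of_nat_nat) auto
      have "t * real (Suc n) - 1 \<le> real (nat \<lfloor>t * real (Suc n)\<rfloor>)" "real (nat \<lfloor>t * real (Suc n)\<rfloor>) \<le> t * real (Suc n)"
        unfolding f by linarith+
      then have "(t * real (Suc n) - 1) / real (Suc n) \<le> real (nat \<lfloor>t * real (Suc n)\<rfloor>) / real (Suc n)"
        "real (nat \<lfloor>t * real (Suc n)\<rfloor>) / real (Suc n) \<le> t * real (Suc n) / real (Suc n)"
        by (intro divide_right_mono; simp)+
      then have "t - 1 / real (Suc n) \<le> real (nat \<lfloor>t * real (Suc n)\<rfloor>) / real (Suc n)"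
        "real (nat \<lfloor>t * real (Suc n)\<rfloor>) / real (Suc n) \<le> t"
        by (simp_all add: diff_divide_distrib)
      then show ?thesis using that unfolding g_def by (auto simp: min_def)
    qed
    then have "(\<lambda>n. g n t - t) \<longlonglongrightarrow> 0"
      by (intro Lim_null_comparison[OF _ LIMSEQ_Suc[OF lim_1_over_n]]) auto
    then show ?thesis by (rule LIM_zero_cancel)
  qed
  let ?N = "restrict_space borel {0..T} \<Otimes>\<^sub>M M"
  have "(\<lambda>p. W (fst p) (snd p)) \<in> borel_measurable ?N"
  proof (rule borel_measurable_LIMSEQ_real)
    fix p assume "p \<in> space ?N"
    then have p: "fst p \<in> {0..T}" "snd p \<in> space M"
      by (auto simp: space_pair_measure space_restrict_space)
    show "(\<lambda>n. W (g n (fst p)) (snd p)) \<longlonglongrightarrow> W (fst p) (snd p)"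
      using continuous_on_tendsto_compose[OF cont[OF p(2)] g_lim[OF p(1)] p(1)] g_mem by simp
  next
    fix n
    have idx: "(\<lambda>p. nat \<lfloor>fst p * real (Suc n)\<rfloor>) \<in> ?N \<rightarrow>\<^sub>M count_space UNIV"
    proof -
      have [measurable]: "fst \<in> ?N \<rightarrow>\<^sub>M borel"
        using measurable_compose[OF measurable_fst measurable_restrict_space1[OF measurable_ident]]
        by simp
      show ?thesis by measurable
    qed
    have "(\<lambda>p. W (min T (real i / real (Suc n))) (snd p)) \<in> borel_measurable ?N" for i
      using \<open>0 \<le> T\<close> by (intro measurable_compose[OF measurable_snd meas]) auto
    from measurable_compose_countable[OF this idx]
    show "(\<lambda>p. W (g n (fst p)) (snd p)) \<in> borel_measurable ?N" by (simp add: g_def)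
  qed
  then show ?thesis by (simp add: measurable_process_def split_beta')
qed

context prob_space
begin

lemma measurable_process_expectation:
  fixes W :: "real \<Rightarrow> 'a \<Rightarrow> real"
  assumes W: "measurable_process M T W" and \<xi>: "\<xi> \<in> borel_measurable M"
  shows "(\<lambda>t. expectation (\<lambda>x. W t x * \<xi> x)) \<in> borel_measurable (restrict_space borel {0..T})"
proof -
  note [measurable] = W[unfolded measurable_process_def] \<xi>
  have "(\<lambda>(t, x). W t x * \<xi> x) \<in> borel_measurable (restrict_space borel {0..T} \<Otimes>\<^sub>M M)"
    by measurable
  then show ?thesis by (rule borel_measurable_lebesgue_integral)
qed

lemma measurable_process_integral:
  fixes W :: "real \<Rightarrow> 'a \<Rightarrow> real"
  assumes W: "measurable_process M T W"
  shows "measurable_process M T (\<lambda>t x. LINT r|lebesgue_on {0..t}. W r x)"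
proof -
  let ?N = "restrict_space borel {0..T} \<Otimes>\<^sub>M M"
  let ?L = "lebesgue_on {0..T}"
  interpret L: finite_measure ?L by simp
  have W': "(\<lambda>(r, x). W r x) \<in> borel_measurable (?L \<Otimes>\<^sub>M M)"
    by (rule measurable_process_lebesgue_on[OF W order.refl])
  have a: "(\<lambda>q. fst (fst q)) \<in> ?N \<Otimes>\<^sub>M ?L \<rightarrow>\<^sub>M borel"
    by (intro measurable_compose[OF measurable_fst] measurable_compose[OF measurable_fst[of "restrict_space borel {0..T}"]])
       (simp add: measurable_restrict_space1)
  have b: "(\<lambda>q. snd q) \<in> ?N \<Otimes>\<^sub>M ?L \<rightarrow>\<^sub>M borel"
    by (intro measurable_compose[OF measurable_snd] borel_measurable_lebesgue_onI) simp
  have c: "(\<lambda>q. W (snd q) (snd (fst q))) \<in> borel_measurable (?N \<Otimes>\<^sub>M ?L)"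
  proof -
    have "(\<lambda>q. (snd q, snd (fst q))) \<in> ?N \<Otimes>\<^sub>M ?L \<rightarrow>\<^sub>M ?L \<Otimes>\<^sub>M M"
      by measurable
    from measurable_compose[OF this W'] show ?thesis by simp
  qed
  \<comment> \<open>The variable upper limit becomes a cutoff inside an integral over the fixed
    interval [0, T], and the cutoff is jointly measurable.\<close>
  have "(\<lambda>(p, r). (if 0 < r \<and> r \<le> fst p then 1 else 0) * W r (snd p)) \<in> borel_measurable (?N \<Otimes>\<^sub>M ?L)"
    using a b c by (simp add: split_beta') measurable
  then have "(\<lambda>p. LINT r|?L. (if 0 < r \<and> r \<le> fst p then 1 else 0) * W r (snd p)) \<in> borel_measurable ?N"
    by (rule L.borel_measurable_lebesgue_integral)
  moreover have eq: "(LINT r|?L. (if 0 < r \<and> r \<le> fst p then 1 else 0) * W r (snd p)) = (LINT r|lebesgue_on {0..fst p}. W r (snd p))"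
    if "p \<in> space ?N" for p
  proof -
    have p: "0 \<le> fst p" "fst p \<le> T" using that by (auto simp: space_pair_measure space_restrict_space)
    show ?thesis
      unfolding integral_lebesgue_on_eq_indicator[OF p]
      by (intro Bochner_Integration.integral_cong) (auto simp: indicator_def)
  qed
  ultimately show ?thesis
    unfolding measurable_process_def split_beta' by (simp only: measurable_cong[OF eq])
qed

context
  fixes T K :: real and W :: "real \<Rightarrow> 'a \<Rightarrow> real"
  assumes W: "measurable_process M T W"
    and W_sq: "\<And>t. t \<in> {0..T} \<Longrightarrow> square_integrable M (W t)"
    and W_bound: "\<And>t. t \<in> {0..T} \<Longrightarrow> expectation (\<lambda>x. (W t x)\<^sup>2) \<le> K"
begin

lemma process_expectation_abs_bound:
  assumes \<xi>: "square_integrable M \<xi>" and r: "r \<in> {0..T}"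
  shows "expectation (\<lambda>x. \<bar>W r x * \<xi> x\<bar>) \<le> sqrt K * sqrt (expectation (\<lambda>x. (\<xi> x)\<^sup>2))"
proof -
  have "square_integrable M (\<lambda>x. \<bar>W r x\<bar>)" "square_integrable M (\<lambda>x. \<bar>\<xi> x\<bar>)"
    using \<xi> W_sq[OF r] by (auto simp: square_integrable_def)
  from Cauchy_Schwarz_abs[OF this]
  have "expectation (\<lambda>x. \<bar>W r x * \<xi> x\<bar>) \<le> sqrt (expectation (\<lambda>x. (W r x)\<^sup>2)) * sqrt (expectation (\<lambda>x. (\<xi> x)\<^sup>2))"
    by (simp add: abs_mult)
  also have "\<dots> \<le> sqrt K * sqrt (expectation (\<lambda>x. (\<xi> x)\<^sup>2))"
    using W_bound[OF r] by (intro mult_right_mono) auto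
  finally show ?thesis .
qed

lemma process_integrable_pair:
  assumes "s \<le> T" and \<xi>: "square_integrable M \<xi>"
  shows "integrable (lebesgue_on {0..s} \<Otimes>\<^sub>M M) (\<lambda>(r, x). W r x * \<xi> x)"
proof -
  let ?L = "lebesgue_on {0..s}"
  interpret L: finite_measure ?L by simp
  interpret P: pair_sigma_finite ?L M by unfold_locales
  note [measurable] = measurable_process_lebesgue_on[OF W assms(1)] square_integrableD(1)[OF \<xi>]
  have [measurable]: "(\<lambda>(r, x). W r x * \<xi> x) \<in> borel_measurable (?L \<Otimes>\<^sub>M M)" by measurable
  show ?thesis
  proof (rule P.Fubini_integrable)
    show "integrable ?L (\<lambda>r. LINT x|M. norm (case (r, x) of (r, x) \<Rightarrow> W r x * \<xi> x))"
    proof (rule L.integrable_const_bound[where B="sqrt K * sqrt (expectation (\<lambda>x. (\<xi> x)\<^sup>2))"])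
      show "AE r in ?L. norm (LINT x|M. norm (case (r, x) of (r, x) \<Rightarrow> W r x * \<xi> x))
          \<le> sqrt K * sqrt (expectation (\<lambda>x. (\<xi> x)\<^sup>2))"
        using process_expectation_abs_bound[OF \<xi>] assms(1) by (intro AE_I2) (auto simp: abs_mult)
    qed measurable
    show "AE r in ?L. integrable M (\<lambda>x. case (r, x) of (r, x) \<Rightarrow> W r x * \<xi> x)"
      using assms(1) by (intro AE_I2) (auto intro!: square_integrable_mult \<xi> W_sq)
  qed measurable
qed

lemma process_square_integrable_pair:
  "integrable (lebesgue_on {0..T} \<Otimes>\<^sub>M M) (\<lambda>(r, x). (W r x)\<^sup>2)"
proof -
  let ?L = "lebesgue_on {0..T}"
  interpret L: finite_measure ?L by simp
  interpret P: pair_sigma_finite ?L M by unfold_locales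
  note [measurable] = measurable_process_lebesgue_on[OF W order.refl]
  show ?thesis
  proof (rule P.Fubini_integrable)
    show "integrable ?L (\<lambda>r. LINT x|M. norm (case (r, x) of (r, x) \<Rightarrow> (W r x)\<^sup>2))"
      by (rule L.integrable_const_bound[where B=K]) (use W_bound in \<open>auto\<close>)
    show "AE r in ?L. integrable M (\<lambda>x. case (r, x) of (r, x) \<Rightarrow> (W r x)\<^sup>2)"
      using W_sq by (intro AE_I2) (auto simp: square_integrable_def)
  qed measurable
qed

lemma process_AE_square_integrable_path:
  "AE x in M. square_integrable (lebesgue_on {0..T}) (\<lambda>r. W r x)"
proof -
  let ?L = "lebesgue_on {0..T}"
  interpret L: finite_measure ?L by simp
  interpret P: pair_sigma_finite ?L M by unfold_locales
  note [measurable] = measurable_process_lebesgue_on[OF W order.refl]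
  have "AE x in M. integrable ?L (\<lambda>r. (W r x)\<^sup>2)"
    using P.AE_integrable_snd[of "\<lambda>r x. (W r x)\<^sup>2"] process_square_integrable_pair by simp
  moreover have "AE x in M. (\<lambda>r. W r x) \<in> borel_measurable ?L"
    by (intro AE_I2) measurable
  ultimately show ?thesis by eventually_elim (simp add: square_integrable_def)
qed

lemma process_integral_mult:
  assumes "s \<le> T" and \<xi>: "square_integrable M \<xi>"
  shows "expectation (\<lambda>x. (LINT r|lebesgue_on {0..s}. W r x) * \<xi> x)
    = (LINT r|lebesgue_on {0..s}. expectation (\<lambda>x. W r x * \<xi> x))"
proof -
  let ?L = "lebesgue_on {0..s}"
  interpret L: finite_measure ?L by simp
  interpret P: pair_sigma_finite ?L M by unfold_locales
  have "(\<integral>x. (\<integral>r. W r x * \<xi> x \<partial>?L) \<partial>M) = (\<integral>r. (\<integral>x. W r x * \<xi> x \<partial>M) \<partial>?L)"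
    by (rule P.Fubini_integral[OF process_integrable_pair[OF assms]])
  then show ?thesis by simp
qed

end

text \<open>Cauchy-Schwarz on each path, then Fubini for the expected energy of the path.\<close>

lemma process_integral_weighted:
  fixes W :: "real \<Rightarrow> 'a \<Rightarrow> real"
  assumes W: "measurable_process M T W"
    and W_sq: "\<And>t. t \<in> {0..T} \<Longrightarrow> square_integrable M (W t)"
    and W_bound: "\<And>t. t \<in> {0..T} \<Longrightarrow> expectation (\<lambda>x. (W t x)\<^sup>2) \<le> K"
    and k: "square_integrable (lebesgue_on {0..T}) k"
    and meas: "(\<lambda>x. LINT r|lebesgue_on {0..T}. k r * W r x) \<in> borel_measurable M"
  shows "square_integrable M (\<lambda>x. LINT r|lebesgue_on {0..T}. k r * W r x)"
    and "expectation (\<lambda>x. (LINT r|lebesgue_on {0..T}. k r * W r x)\<^sup>2)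
      \<le> (LINT r|lebesgue_on {0..T}. (k r)\<^sup>2) * (LINT r|lebesgue_on {0..T}. expectation (\<lambda>x. (W r x)\<^sup>2))"
proof -
  let ?L = "lebesgue_on {0..T}"
  interpret L: finite_measure ?L by simp
  interpret P: pair_sigma_finite ?L M by unfold_locales
  note [measurable] = measurable_process_lebesgue_on[OF W order.refl] meas
  have pair: "integrable (?L \<Otimes>\<^sub>M M) (\<lambda>(r, x). (W r x)\<^sup>2)"
    by (rule process_square_integrable_pair[OF W W_sq W_bound])
  have int: "integrable M (\<lambda>x. LINT r|?L. (W r x)\<^sup>2)"
    using P.integrable_snd[of "\<lambda>r x. (W r x)\<^sup>2", OF pair] by simp
  have "AE x in M. square_integrable ?L (\<lambda>r. W r x)"
    by (rule process_AE_square_integrable_path[OF W W_sq W_bound])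
  then have le: "AE x in M. (LINT r|?L. k r * W r x)\<^sup>2 \<le> (LINT r|?L. (k r)\<^sup>2) * (LINT r|?L. (W r x)\<^sup>2)"
    by eventually_elim (intro Cauchy_Schwarz_integral k)
  have int2: "integrable M (\<lambda>x. (LINT r|?L. k r * W r x)\<^sup>2)"
  proof (rule Bochner_Integration.integrable_bound)
    show "integrable M (\<lambda>x. (LINT r|?L. (k r)\<^sup>2) * (LINT r|?L. (W r x)\<^sup>2))"
      using int by simp
    show "AE x in M. norm ((LINT r|?L. k r * W r x)\<^sup>2) \<le> norm ((LINT r|?L. (k r)\<^sup>2) * (LINT r|?L. (W r x)\<^sup>2))"
      using le by eventually_elim simp
  qed measurable
  then show "square_integrable M (\<lambda>x. LINT r|?L. k r * W r x)"
    using meas by (simp add: square_integrable_def)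
  have "expectation (\<lambda>x. (LINT r|?L. k r * W r x)\<^sup>2)
      \<le> expectation (\<lambda>x. (LINT r|?L. (k r)\<^sup>2) * (LINT r|?L. (W r x)\<^sup>2))"
    by (intro integral_mono_AE int2 le) (use int in simp)
  also have "\<dots> = (LINT r|?L. (k r)\<^sup>2) * (\<integral>x. (\<integral>r. (W r x)\<^sup>2 \<partial>?L) \<partial>M)" by simp
  also have "(\<integral>x. (\<integral>r. (W r x)\<^sup>2 \<partial>?L) \<partial>M) = (\<integral>r. (\<integral>x. (W r x)\<^sup>2 \<partial>M) \<partial>?L)"
    by (rule P.Fubini_integral[OF pair])
  finally show "expectation (\<lambda>x. (LINT r|?L. k r * W r x)\<^sup>2)
      \<le> (LINT r|?L. (k r)\<^sup>2) * (LINT r|?L. expectation (\<lambda>x. (W r x)\<^sup>2))" .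
qed

context
  fixes T K :: real and W :: "real \<Rightarrow> 'a \<Rightarrow> real"
  assumes W: "measurable_process M T W"
    and W_sq: "\<And>t. t \<in> {0..T} \<Longrightarrow> square_integrable M (W t)"
    and W_bound: "\<And>t. t \<in> {0..T} \<Longrightarrow> expectation (\<lambda>x. (W t x)\<^sup>2) \<le> K"
begin

lemma process_AE_path: "AE x in M. square_integrable (lebesgue_on {0..T}) (\<lambda>r. W r x)"
  by (rule process_AE_square_integrable_path[OF W W_sq W_bound])

lemma process_integral_Ioc:
  assumes "0 \<le> s" "s \<le> t" "t \<le> T"
  shows "AE x in M. (LINT r|lebesgue_on {0..t}. W r x) - (LINT r|lebesgue_on {0..s}. W r x)
    = (LINT r|lebesgue_on {0..T}. indicator {s<..t} r * W r x)"
  using process_AE_path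
proof eventually_elim
  case (elim x)
  let ?L = "lebesgue_on {0..T}"
  have st: "0 \<le> t" "s \<le> T" using assms by auto
  have ind: "integrable ?L (\<lambda>r. indicator {p<..q} r * W r x)" for p q
    by (rule square_integrable_mult[OF square_integrable_indicator_lebesgue_on elim])
  have "(LINT r|lebesgue_on {0..t}. W r x) - (LINT r|lebesgue_on {0..s}. W r x)
      = (LINT r|?L. indicator {0<..t} r * W r x - indicator {0<..s} r * W r x)"
    unfolding integral_lebesgue_on_eq_indicator[OF assms(1) st(2)]
      integral_lebesgue_on_eq_indicator[OF st(1) assms(3)]
    by (rule Bochner_Integration.integral_diff[OF ind ind, symmetric])
  also have "\<dots> = (LINT r|?L. indicator {s<..t} r * W r x)"
    using assms by (intro Bochner_Integration.integral_cong) (auto simp: indicator_def)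
  finally show ?case .
qed

lemma process_integral_borel_measurable:
  "s \<in> {0..T} \<Longrightarrow> (\<lambda>x. LINT r|lebesgue_on {0..s}. W r x) \<in> borel_measurable M"
  by (rule measurable_process_section[OF measurable_process_integral[OF W]])

lemma process_integral_square_integrable:
  assumes s: "s \<in> {0..T}"
  shows "square_integrable M (\<lambda>x. LINT r|lebesgue_on {0..s}. W r x)"
proof -
  have W': "measurable_process M T (\<lambda>r x. indicator {0<..s} r * W r x)"
    by (intro measurable_process_mult_fun W measurable_restrict_space1) simp
  have eq: "(\<lambda>x. LINT r|lebesgue_on {0..s}. W r x) = (\<lambda>x. LINT r|lebesgue_on {0..T}. indicator {0<..s} r * W r x)"
    using s by (auto simp: integral_lebesgue_on_eq_indicator[of s T])
  show ?thesis
    unfolding eq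
    using process_integral_borel_measurable[OF s] eq
    by (intro process_integral_weighted(1)[OF W W_sq W_bound square_integrable_indicator_lebesgue_on]) auto
qed

text \<open>The increment of a time integral is of second order in the length of the interval in
  mean square, one order smaller than that of the noise. This gap is what makes the innovation
  inherit the variance of the noise.\<close>

lemma process_integral_increment_le:
  assumes "0 \<le> s" "s \<le> t" "t \<le> T"
  shows "expectation (\<lambda>x. ((LINT r|lebesgue_on {0..t}. W r x) - (LINT r|lebesgue_on {0..s}. W r x))\<^sup>2) \<le> K * (t - s)\<^sup>2"
    (is "?lhs \<le> _")
proof -
  let ?L = "lebesgue_on {0..T}"
  interpret L: finite_measure ?L by simp
  let ?k = "indicator {s<..t} :: real \<Rightarrow> real"
  \<comment> \<open>Cutting the process itself to (s, t] as well lets both factors of Cauchy-Schwarz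
    contribute a factor t - s.\<close>
  define V where "V r x = ?k r * W r x" for r x
  have kV: "?k r * V r x = ?k r * W r x" for r x by (simp add: V_def indicator_def)
  have V: "measurable_process M T V"
    unfolding V_def by (intro measurable_process_mult_fun W measurable_restrict_space1) simp
  have V_sq: "square_integrable M (V r)" if "r \<in> {0..T}" for r
    unfolding V_def[abs_def] by (intro square_integrable_cmult W_sq that)
  have "0 \<le> expectation (\<lambda>x. (W 0 x)\<^sup>2)" by simp
  also have "\<dots> \<le> K" using assms by (intro W_bound) auto
  finally have K: "0 \<le> K" .
  have V_bound: "expectation (\<lambda>x. (V r x)\<^sup>2) \<le> ?k r * K" if "r \<in> {0..T}" for r
    using W_bound[OF that] by (simp add: V_def indicator_def)
  then have V_bound': "expectation (\<lambda>x. (V r x)\<^sup>2) \<le> K" if "r \<in> {0..T}" for r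
    using order.trans[OF V_bound[OF that], of K] K by (cases "r \<in> {s<..t}") auto
  have st: "0 \<le> t" "s \<le> T" using assms by auto
  have meas: "(\<lambda>x. LINT r|?L. ?k r * V r x) \<in> borel_measurable M"
    using measurable_process_section[OF measurable_process_integral[OF V], of T] assms
    by (simp add: V_def mult.assoc[symmetric] flip: indicator_inter_arith)
  have "expectation (\<lambda>x. ((LINT r|lebesgue_on {0..t}. W r x) - (LINT r|lebesgue_on {0..s}. W r x))\<^sup>2)
      = expectation (\<lambda>x. (LINT r|?L. ?k r * V r x)\<^sup>2)"
  proof (rule integral_cong_AE)
    have [measurable]: "(\<lambda>x. LINT r|lebesgue_on {0..s}. W r x) \<in> borel_measurable M"
        "(\<lambda>x. LINT r|lebesgue_on {0..t}. W r x) \<in> borel_measurable M"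
      using assms by (auto intro!: process_integral_borel_measurable)
    show "(\<lambda>x. ((LINT r|lebesgue_on {0..t}. W r x) - (LINT r|lebesgue_on {0..s}. W r x))\<^sup>2) \<in> borel_measurable M"
      by measurable
    show "(\<lambda>x. (LINT r|?L. ?k r * V r x)\<^sup>2) \<in> borel_measurable M" using meas by simp
    show "AE x in M. ((LINT r|lebesgue_on {0..t}. W r x) - (LINT r|lebesgue_on {0..s}. W r x))\<^sup>2
        = (LINT r|?L. ?k r * V r x)\<^sup>2"
      using process_integral_Ioc[OF assms] unfolding kV by eventually_elim (simp only:)
  qed
  also have "\<dots> \<le> (LINT r|?L. (?k r)\<^sup>2) * (LINT r|?L. expectation (\<lambda>x. (V r x)\<^sup>2))"
    by (rule process_integral_weighted(2)[OF V V_sq V_bound' square_integrable_indicator_lebesgue_on meas])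
  also have "(LINT r|?L. (?k r)\<^sup>2) = (LINT r|?L. ?k r)"
    by (intro Bochner_Integration.integral_cong) (auto simp: indicator_def)
  also have "\<dots> = t - s" by (rule integral_lebesgue_on_Ioc[OF assms])
  finally have bound: "?lhs \<le> (t - s) * (LINT r|?L. expectation (\<lambda>x. (V r x)\<^sup>2))" .
  have "(LINT r|?L. expectation (\<lambda>x. (V r x)\<^sup>2)) \<le> (LINT r|?L. ?k r * K)"
  proof (rule integral_mono_AE)
    show "integrable ?L (\<lambda>r. ?k r * K)"
      by (intro integrable_mult_left L.square_integrable_imp_integrable square_integrable_indicator_lebesgue_on)
    have "(\<lambda>r. expectation (\<lambda>x. (V r x)\<^sup>2)) \<in> borel_measurable ?L"
    proof -
      note [measurable] = measurable_process_lebesgue_on[OF V order.refl]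
      show ?thesis by measurable
    qed
    then show "integrable ?L (\<lambda>r. expectation (\<lambda>x. (V r x)\<^sup>2))"
      by (intro L.integrable_const_bound[where B=K]) (use V_bound' in auto)
    show "AE r in ?L. expectation (\<lambda>x. (V r x)\<^sup>2) \<le> ?k r * K"
      using V_bound by (intro AE_I2) simp
  qed
  also have "(LINT r|?L. ?k r * K) = (t - s) * K"
    using integral_lebesgue_on_Ioc[OF assms] by (subst Bochner_Integration.integral_mult_left_zero) (simp only:)
  finally have "(LINT r|?L. expectation (\<lambda>x. (V r x)\<^sup>2)) \<le> (t - s) * K" .
  then have "(t - s) * (LINT r|?L. expectation (\<lambda>x. (V r x)\<^sup>2)) \<le> (t - s) * ((t - s) * K)"
    using assms by (intro mult_left_mono) auto
  with bound show ?thesis by (simp add: power2_eq_square mult.commute mult.left_commute)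
qed

text \<open>Against a test function orthogonal to \<open>S\<close>, Fubini leaves the time integral
  of inner products that all vanish.\<close>

lemma process_integral_closed_span:
  assumes s: "s \<in> {0..T}" and span: "\<And>r. r \<in> {0..s} \<Longrightarrow> W r \<in> closed_span M S"
  shows "(\<lambda>x. LINT r|lebesgue_on {0..s}. W r x) \<in> closed_span M S"
proof (rule closed_spanI[OF process_integral_square_integrable[OF s]])
  fix h assume h: "square_integrable M h" "\<And>g. g \<in> S \<Longrightarrow> expectation (\<lambda>x. g x * h x) = 0"
  have "expectation (\<lambda>x. (LINT r|lebesgue_on {0..s}. W r x) * h x)
      = (LINT r|lebesgue_on {0..s}. expectation (\<lambda>x. W r x * h x))"
    using s by (intro process_integral_mult[OF W W_sq W_bound _ h(1)]) auto
  also have "\<dots> = (LINT r|lebesgue_on {0..s}. 0)"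
    by (intro Bochner_Integration.integral_cong refl closed_spanD(2)[OF span h]) auto
  finally show "expectation (\<lambda>x. (LINT r|lebesgue_on {0..s}. W r x) * h x) = 0" by simp
qed

end

end

section \<open>Gaussian variables and Fourier uniqueness\<close>

text \<open>The characteristic function of a centred normal law at the argument 1, with zero
  variance included. On a linear space it applies to all multiples and so covers every argument; in
  this form the property is stable under mean-square limits.\<close>

definition gaussian :: "'w measure \<Rightarrow> ('w \<Rightarrow> real) \<Rightarrow> bool" where
  "gaussian M \<xi> \<longleftrightarrow> square_integrable M \<xi> \<and>
     (CLINT x|M. iexp (\<xi> x)) = complex_of_real (exp (- (LINT x|M. (\<xi> x)\<^sup>2) / 2))"

lemma norm_iexp [simp]: "norm (iexp r) = 1"
  by (simp add: norm_exp_eq_Re)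

lemma iexp_add: "iexp (a + b) = iexp a * iexp b"
  by (simp add: exp_add distrib_left)

lemma norm_iexp_diff_le: "norm (iexp a - iexp b) \<le> \<bar>a - b\<bar>"
proof -
  have "iexp a - iexp b = iexp b * (iexp (a - b) - 1)"
    by (simp add: right_diff_distrib flip: exp_add distrib_left)
  then have "norm (iexp a - iexp b) = norm (iexp (a - b) - 1)"
    by (simp add: norm_mult del: of_real_diff)
  also have "\<dots> \<le> \<bar>a - b\<bar>" using iexp_approx1[of "a - b" 0] by simp
  finally show ?thesis .
qed

lemma (in finite_measure) integrable_iexp': "f \<in> borel_measurable M \<Longrightarrow> integrable M (\<lambda>x. iexp (f x))"
  by (rule integrable_const_bound[where B=1]) (auto)

lemma integrable_mult_iexp:
  fixes D :: "'a \<Rightarrow> real"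
  assumes "integrable M D" "f \<in> borel_measurable M"
  shows "integrable M (\<lambda>x. complex_of_real (D x) * iexp (f x))"
proof (rule Bochner_Integration.integrable_bound[OF assms(1)])
  show "(\<lambda>x. complex_of_real (D x) * iexp (f x)) \<in> borel_measurable M"
    using assms by measurable
qed (simp add: norm_mult)

context prob_space
begin

text \<open>The map r -> exp(i r) is 1-Lipschitz, so mean-square convergence carries over to the
  characteristic functions, and the variances converge too.\<close>

lemma gaussian_limit:
  assumes g: "\<And>n. gaussian M (f n)" and lim: "L2_tendsto M f h"
  shows "gaussian M h"
proof -
  note f = L2_tendstoD(1)[OF lim] and h = L2_tendstoD(2)[OF lim]
  have "(\<lambda>n. (CLINT x|M. iexp (f n x)) - (CLINT x|M. iexp (h x))) \<longlonglongrightarrow> 0"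
  proof (rule Lim_null_comparison)
    show "\<forall>\<^sub>F n in sequentially. norm ((CLINT x|M. iexp (f n x)) - (CLINT x|M. iexp (h x)))
        \<le> sqrt (expectation (\<lambda>x. (f n x - h x)\<^sup>2))"
    proof (intro always_eventually allI)
      fix n
      note meas = square_integrableD(1)[OF f[of n]] square_integrableD(1)[OF h]
      note int = integrable_iexp'[OF meas(1)] integrable_iexp'[OF meas(2)]
      note d = square_integrable_diff[OF f[of n] h]
      have "norm ((CLINT x|M. iexp (f n x)) - (CLINT x|M. iexp (h x)))
          = norm (CLINT x|M. iexp (f n x) - iexp (h x))"
        using int by simp
      also have "\<dots> \<le> expectation (\<lambda>x. norm (iexp (f n x) - iexp (h x)))"
        by (rule integral_norm_bound)
      also have "\<dots> \<le> expectation (\<lambda>x. \<bar>f n x - h x\<bar>)"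
        using int square_integrable_imp_integrable[OF d]
        by (intro integral_mono norm_iexp_diff_le integrable_norm Bochner_Integration.integrable_diff) auto
      also have "\<dots> \<le> sqrt (expectation (\<lambda>x. (f n x - h x)\<^sup>2))"
        by (rule expectation_abs_le_L2[OF d])
      finally show "norm ((CLINT x|M. iexp (f n x)) - (CLINT x|M. iexp (h x)))
        \<le> sqrt (expectation (\<lambda>x. (f n x - h x)\<^sup>2))" .
    qed
    show "(\<lambda>n. sqrt (expectation (\<lambda>x. (f n x - h x)\<^sup>2))) \<longlonglongrightarrow> 0"
      using tendsto_real_sqrt[OF L2_tendstoD(3)[OF lim]] by simp
  qed
  then have "(\<lambda>n. CLINT x|M. iexp (f n x)) \<longlonglongrightarrow> (CLINT x|M. iexp (h x))"
    by (rule LIM_zero_cancel)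
  moreover have "(\<lambda>n. complex_of_real (exp (- expectation (\<lambda>x. (f n x)\<^sup>2) / 2)))
      \<longlonglongrightarrow> complex_of_real (exp (- expectation (\<lambda>x. (h x)\<^sup>2) / 2))"
    by (intro tendsto_intros L2_tendsto_square[OF lim]) simp
  ultimately show ?thesis
    using g h by (simp add: gaussian_def LIMSEQ_unique)
qed

lemma gaussian_add_indep:
  assumes g: "gaussian M f" "gaussian M h" and ind: "indep_var borel f borel h"
    and orth: "expectation (\<lambda>x. f x * h x) = 0"
  shows "gaussian M (\<lambda>x. f x + h x)"
proof -
  have f: "square_integrable M f" and h: "square_integrable M h" using g by (auto simp: gaussian_def)
  have [measurable]: "f \<in> borel_measurable M" "h \<in> borel_measurable M"
    using f h by (auto simp: square_integrable_def)
  have "(CLINT x|M. iexp (f x + h x)) = (CLINT x|M. iexp (f x)) * (CLINT x|M. iexp (h x))"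
    using char_distr_add[OF ind, of 1] by (simp add: char_def integral_distr)
  also have "\<dots> = complex_of_real (exp (- (expectation (\<lambda>x. (f x)\<^sup>2) + expectation (\<lambda>x. (h x)\<^sup>2)) / 2))"
    using g by (simp add: gaussian_def exp_add[symmetric] add_divide_distrib flip: of_real_mult)
  finally show ?thesis
    using f h orth by (auto simp: gaussian_def integral_square_add[OF f h])
qed

lemma gaussian_AE_zero:
  assumes "f \<in> borel_measurable M" "AE x in M. f x = 0"
  shows "gaussian M f"
proof -
  have "square_integrable M f"
    by (rule square_integrable_AE[of M "\<lambda>_. 0"]) (use assms in auto)
  moreover have "(CLINT x|M. iexp (f x)) = (CLINT x|M. 1)"
    using assms by (intro integral_cong_AE) (auto elim: eventually_mono)
  moreover have "expectation (\<lambda>x. (f x)\<^sup>2) = 0"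
    using assms by (intro integral_eq_zero_AE) (auto elim: eventually_mono)
  ultimately show ?thesis by (simp add: gaussian_def prob_space)
qed

lemma normal_distributed_imp_gaussian:
  assumes \<sigma>: "0 < \<sigma>" and D: "distributed M lborel f (normal_density 0 \<sigma>)"
  shows "gaussian M f" "expectation f = 0" "expectation (\<lambda>x. (f x)\<^sup>2) = \<sigma>\<^sup>2"
proof -
  have [measurable]: "f \<in> borel_measurable M"
    using distributed_measurable[OF D] by simp
  show e: "expectation f = 0" by (rule normal_distributed_expectation[OF \<sigma> D])
  show v: "expectation (\<lambda>x. (f x)\<^sup>2) = \<sigma>\<^sup>2"
    using normal_distributed_variance[OF \<sigma> D] e by simp
  have "integrable M (\<lambda>x. (f x)\<^sup>2)"
    using distributed_integrable[OF D, of "\<lambda>x. x\<^sup>2"] integrable_normal_moment[OF \<sigma>, of 0 2] by simp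
  then have sq: "square_integrable M f" by (simp add: square_integrable_def)
  have S: "distributed M lborel (\<lambda>x. f x / \<sigma>) std_normal_density"
    using D normal_standard_normal_convert[OF \<sigma>, of f 0] by simp
  have "distr M borel (\<lambda>x. f x / \<sigma>) = std_normal_distribution"
    using distributed_distr_eq_density[OF S] by (simp cong: distr_cong)
  then have "char (distr M borel (\<lambda>x. f x / \<sigma>)) \<sigma> = complex_of_real (exp (- \<sigma>\<^sup>2 / 2))"
    using fun_cong[OF char_std_normal_distribution, of \<sigma>] by simp
  moreover have "char (distr M borel (\<lambda>x. f x / \<sigma>)) \<sigma> = (CLINT x|M. iexp (f x))"
    using \<sigma> by (simp add: char_def integral_distr)
  ultimately have "(CLINT x|M. iexp (f x)) = complex_of_real (exp (- \<sigma>\<^sup>2 / 2))" by simp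
  then show "gaussian M f" using sq v \<sigma> by (simp add: gaussian_def)
qed

lemma centered_gaussian_imp_gaussian:
  assumes "centered_gaussian M f"
  shows "gaussian M f" "expectation f = 0"
proof -
  consider "AE x in M. f x = 0" "f \<in> borel_measurable M"
    | \<sigma> where "0 < \<sigma>" "distributed M lborel f (\<lambda>x. ennreal (normal_density 0 \<sigma> x))"
    using assms by (auto simp: centered_gaussian_def)
  then have "gaussian M f \<and> expectation f = 0"
  proof cases
    case 1
    then show ?thesis using gaussian_AE_zero by (auto intro: integral_eq_zero_AE)
  next
    case 2
    then show ?thesis using normal_distributed_imp_gaussian by blast
  qed
  then show "gaussian M f" "expectation f = 0" by auto
qed

text \<open>Differentiating \<open>u \<mapsto> E (exp (i (u \<xi> + \<eta>)))\<close> at \<open>0\<close>.\<close>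

lemma gaussian_uncorrelated_iexp:
  assumes \<xi>: "square_integrable M \<xi>" and \<eta>: "square_integrable M \<eta>"
    and g: "\<And>u. gaussian M (\<lambda>x. u * \<xi> x + \<eta> x)"
    and orth: "expectation (\<lambda>x. \<xi> x * \<eta> x) = 0"
  shows "(CLINT x|M. complex_of_real (\<xi> x) * iexp (\<eta> x)) = 0"
proof -
  note [measurable] = square_integrableD(1)[OF \<xi>] square_integrableD(1)[OF \<eta>]
  define a where "a = expectation (\<lambda>x. (\<xi> x)\<^sup>2)"
  define b where "b = expectation (\<lambda>x. (\<eta> x)\<^sup>2)"
  \<comment> \<open>By orthogonality the variance of u \<xi> + \<eta> is u^2 a + b, which has no
    linear term in u; therefore the derivative of F at 0 vanishes.\<close>
  define F where "F u = exp (- (u\<^sup>2 * a + b) / 2)" for u :: real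
  have E: "(CLINT x|M. iexp (u * \<xi> x + \<eta> x)) = complex_of_real (F u)" for u
    using g[of u] orth
    by (simp add: gaussian_def F_def a_def b_def integral_square_add[OF square_integrable_cmult[OF \<xi>] \<eta>]
        power_mult_distrib mult.assoc del: of_real_add of_real_mult)
  define u where "u n = 1 / real (Suc n)" for n
  have u: "u n \<noteq> 0" for n by (simp add: u_def)
  have u_0: "u \<longlonglongrightarrow> 0"
    using LIMSEQ_Suc[OF lim_1_over_n[where 'a=real]] by (simp add: u_def[abs_def])
  have u_lim: "filterlim u (at 0) sequentially"
    unfolding filterlim_at using u u_0 by simp
  have "(F has_field_derivative 0) (at 0)"
    unfolding F_def[abs_def] by (auto intro!: derivative_eq_intros)
  then have "((\<lambda>h. (F (0 + h) - F 0) / h) \<longlongrightarrow> 0) (at 0)"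
    by (simp only: DERIV_def)
  from filterlim_compose[OF this u_lim]
  have F_lim: "(\<lambda>n. complex_of_real ((F (u n) - F 0) / u n)) \<longlonglongrightarrow> complex_of_real 0"
    by (intro tendsto_of_real) simp
  have diff: "complex_of_real ((F (u n) - F 0) / u n)
      = (CLINT x|M. (iexp (u n * \<xi> x) - 1) / complex_of_real (u n) * iexp (\<eta> x))" for n
  proof -
    have "complex_of_real ((F (u n) - F 0) / u n)
        = ((CLINT x|M. iexp (u n * \<xi> x + \<eta> x)) - (CLINT x|M. iexp (\<eta> x))) / complex_of_real (u n)"
      using E[of "u n"] E[of 0] by (simp del: of_real_add of_real_mult)
    also have "\<dots> = (CLINT x|M. (iexp (u n * \<xi> x + \<eta> x) - iexp (\<eta> x)) / complex_of_real (u n))"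
      by (subst Bochner_Integration.integral_divide_zero, subst Bochner_Integration.integral_diff)
         (auto intro!: integrable_iexp' simp del: of_real_add of_real_mult)
    also have "\<dots> = (CLINT x|M. (iexp (u n * \<xi> x) - 1) / complex_of_real (u n) * iexp (\<eta> x))"
      by (intro Bochner_Integration.integral_cong) (simp_all add: exp_add left_diff_distrib distrib_left)
    finally show ?thesis .
  qed
  have "(\<lambda>n. CLINT x|M. (iexp (u n * \<xi> x) - 1) / complex_of_real (u n) * iexp (\<eta> x))
      \<longlonglongrightarrow> (CLINT x|M. \<i> * complex_of_real (\<xi> x) * iexp (\<eta> x))"
  proof (rule integral_dominated_convergence[where w="\<lambda>x. \<bar>\<xi> x\<bar>"])
    show "integrable M (\<lambda>x. \<bar>\<xi> x\<bar>)"
      using square_integrable_imp_integrable[OF \<xi>] by simp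
    have "(\<lambda>n. (iexp (u n * \<xi> x) - 1) / complex_of_real (u n)) \<longlonglongrightarrow> \<i> * complex_of_real (\<xi> x)" for x
    proof -
      have "((\<lambda>h. exp (\<i> * complex_of_real (\<xi> x) * h)) has_field_derivative \<i> * complex_of_real (\<xi> x)) (at 0)"
        by (auto intro!: derivative_eq_intros)
      then have l1: "((\<lambda>h. (exp (\<i> * complex_of_real (\<xi> x) * (0 + h)) - exp (\<i> * complex_of_real (\<xi> x) * 0)) / h)
          \<longlongrightarrow> \<i> * complex_of_real (\<xi> x)) (at 0)"
        by (simp only: DERIV_def)
      have l2: "filterlim (\<lambda>n. complex_of_real (u n)) (at 0) sequentially"
        unfolding filterlim_at using u tendsto_of_real[OF u_0, where 'a=complex] by simp
      from filterlim_compose[OF l1 l2] show ?thesis by (simp add: mult_ac)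
    qed
    then show "AE x in M. (\<lambda>n. (iexp (u n * \<xi> x) - 1) / complex_of_real (u n) * iexp (\<eta> x))
        \<longlonglongrightarrow> \<i> * complex_of_real (\<xi> x) * iexp (\<eta> x)"
      by (intro AE_I2 tendsto_intros)
    have "norm ((iexp (u n * \<xi> x) - 1) / complex_of_real (u n) * iexp (\<eta> x)) \<le> \<bar>\<xi> x\<bar>" for n x
    proof -
      have "norm (iexp (u n * \<xi> x) - 1) \<le> \<bar>u n\<bar> * \<bar>\<xi> x\<bar>"
        using norm_iexp_diff_le[of "u n * \<xi> x" 0] by (simp add: abs_mult)
      then show ?thesis
        using u[of n] by (simp add: norm_mult norm_divide divide_le_eq mult.commute)
    qed
    then show "AE x in M. norm ((iexp (u n * \<xi> x) - 1) / complex_of_real (u n) * iexp (\<eta> x)) \<le> \<bar>\<xi> x\<bar>" for n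
      by simp
  qed measurable
  then have "(\<lambda>n. complex_of_real ((F (u n) - F 0) / u n))
      \<longlonglongrightarrow> \<i> * (CLINT x|M. complex_of_real (\<xi> x) * iexp (\<eta> x))"
    unfolding diff by (simp only: mult.assoc integral_mult_right_zero)
  from LIMSEQ_unique[OF this F_lim] show ?thesis by simp
qed

end

text \<open>The argument v = 0 shows that both weights have the same total mass c. For c > 0,
  dividing by c gives probability densities whose images under \<open>f\<close> have equal
  characteristic functions; for c = 0 both weights vanish almost everywhere.\<close>

lemma weighted_Levy_uniqueness:
  fixes D1 D2 f :: "'a \<Rightarrow> real"
  assumes D: "integrable M D1" "integrable M D2" and pos: "\<And>x. 0 \<le> D1 x" "\<And>x. 0 \<le> D2 x"
    and f [measurable]: "f \<in> borel_measurable M"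
    and eq: "\<And>v. (CLINT x|M. complex_of_real (D1 x) * iexp (v * f x))
                = (CLINT x|M. complex_of_real (D2 x) * iexp (v * f x))"
    and A [measurable]: "A \<in> sets borel"
  shows "(LINT x|M. D1 x * indicator A (f x)) = (LINT x|M. D2 x * indicator A (f x))"
proof -
  have [measurable]: "D1 \<in> borel_measurable M" "D2 \<in> borel_measurable M" using D by auto
  define c where "c = (LINT x|M. D1 x)"
  have c2: "c = (LINT x|M. D2 x)"
    using eq[of 0] by (simp add: c_def)
  show ?thesis
  proof (cases "c = 0")
    case True
    have *: "(LINT x|M. Di x * indicator A (f x)) = 0"
      if "integrable M Di" "\<And>x. 0 \<le> Di x" "(LINT x|M. Di x) = 0" for Di :: "'a \<Rightarrow> real"
    proof -
      have "AE x in M. Di x = 0"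
        using integral_nonneg_eq_0_iff_AE[OF that(1)] that by simp
      then show ?thesis by (intro integral_eq_zero_AE) (auto elim: eventually_mono)
    qed
    show ?thesis
      using *[OF D(1) pos(1)] *[OF D(2) pos(2)] True c2 by (simp add: c_def)
  next
    case False
    then have c: "0 < c" using pos(1) by (simp add: c_def order.not_eq_order_implies_strict)
    define N where "N Di = distr (density M (\<lambda>x. ennreal (Di x / c))) borel f" for Di
    have N: "real_distribution (N Di) \<and> (\<forall>v. char (N Di) v = (CLINT x|M. complex_of_real (Di x) * iexp (v * f x)) / c)
        \<and> measure (N Di) A = (LINT x|M. Di x * indicator A (f x)) / c"
      if Di: "integrable M Di" "\<And>x. 0 \<le> Di x" "(LINT x|M. Di x) = c" for Di :: "'a \<Rightarrow> real"
    proof -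
      have [measurable]: "Di \<in> borel_measurable M" using Di by auto
      have "emeasure (density M (\<lambda>x. ennreal (Di x / c))) (space (density M (\<lambda>x. ennreal (Di x / c)))) = 1"
      proof -
        have "(\<integral>\<^sup>+x. ennreal (Di x / c) \<partial>M) = ennreal (LINT x|M. Di x / c)"
          using Di c by (intro nn_integral_eq_integral) auto
        then show ?thesis using Di c by (simp add: emeasure_density cong: nn_integral_cong)
      qed
      then interpret P: prob_space "density M (\<lambda>x. ennreal (Di x / c))" by (rule prob_spaceI)
      have 1: "real_distribution (N Di)"
        unfolding N_def by (rule P.real_distribution_distr) simp
      have 2: "char (N Di) v = (CLINT x|M. complex_of_real (Di x) * iexp (v * f x)) / c" for v
      proof -
        have "char (N Di) v = (CLINT x|M. (Di x / c) *\<^sub>R iexp (v * f x))"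
          unfolding N_def char_def using Di c
          by (simp add: integral_distr integral_density del: of_real_mult)
        also have "\<dots> = (CLINT x|M. complex_of_real (Di x) * iexp (v * f x) / c)"
          by (intro Bochner_Integration.integral_cong) (simp_all add: scaleR_conv_of_real)
        finally show ?thesis by simp
      qed
      have 3: "measure (N Di) A = (LINT x|M. Di x * indicator A (f x)) / c"
      proof -
        have "measure (N Di) A = (LINT y|N Di. indicator A y)"
          by (simp add: N_def)
        also have "\<dots> = (LINT x|M. (Di x / c) *\<^sub>R indicator A (f x))"
          unfolding N_def using Di c
          by (simp add: integral_distr integral_density del: integral_indicator Bochner_Integration.integral_indicator)
        also have "\<dots> = (LINT x|M. Di x * indicator A (f x) / c)"
          by (intro Bochner_Integration.integral_cong) simp_all
        finally show ?thesis by simp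
      qed
      from 1 2 3 show ?thesis by simp
    qed
    note N1 = N[OF D(1) pos(1) c_def[symmetric]] and N2 = N[OF D(2) pos(2) c2[symmetric]]
    have "N D1 = N D2"
      using N1 N2 eq by (intro Levy_uniqueness) (auto simp: fun_eq_iff)
    then show ?thesis using N1 N2 c by (auto simp: divide_cancel_right)
  qed
qed

text \<open>The inductive step towards several variables: an exponential in \<open>f\<close> is
  traded for an indicator while the exponential in \<phi> is kept. A complex factor is no admissible
  weight, but 1 + cos \<phi> and 1 + sin \<phi> are nonnegative, so the one-dimensional result
  applies to the weights multiplied by them; subtracting the case without the factor isolates cosine
  and sine.\<close>

lemma integral_mult_trig_indicator_eq:
  fixes D1 D2 f \<phi> :: "'a \<Rightarrow> real"
  assumes D: "integrable M D1" "integrable M D2" and pos: "\<And>x. 0 \<le> D1 x" "\<And>x. 0 \<le> D2 x"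
    and f [measurable]: "f \<in> borel_measurable M" and \<phi> [measurable]: "\<phi> \<in> borel_measurable M"
    and eq: "\<And>s v. (CLINT x|M. complex_of_real (D1 x) * iexp (s * \<phi> x + v * f x))
                = (CLINT x|M. complex_of_real (D2 x) * iexp (s * \<phi> x + v * f x))"
    and A [measurable]: "A \<in> sets borel"
  shows "(CLINT x|M. complex_of_real (D1 x * indicator A (f x)) * iexp (\<phi> x))
       = (CLINT x|M. complex_of_real (D2 x * indicator A (f x)) * iexp (\<phi> x))"
proof -
  have [measurable]: "D1 \<in> borel_measurable M" "D2 \<in> borel_measurable M" using D by auto
  have base: "(LINT x|M. D1 x * indicator A (f x)) = (LINT x|M. D2 x * indicator A (f x))"
    using eq[of 0] by (intro weighted_Levy_uniqueness D pos f A) simp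
  have int: "integrable M (\<lambda>x. Di x * h x)" if "integrable M Di" "h \<in> borel_measurable M" "\<And>x. \<bar>h x\<bar> \<le> 2"
    for Di h :: "'a \<Rightarrow> real"
  proof (rule Bochner_Integration.integrable_bound)
    show "integrable M (\<lambda>x. 2 * Di x)" using that by simp
    have "\<bar>Di x\<bar> * \<bar>h x\<bar> \<le> \<bar>Di x\<bar> * 2" for x using that(3) by (intro mult_left_mono) auto
    then show "AE x in M. norm (Di x * h x) \<le> norm (2 * Di x)" by (simp add: abs_mult mult.commute)
  qed (use that in auto)
  \<comment> \<open>The coefficients are p = q = 1/2 for the cosine and p = -i/2, q = i/2 for the
    sine.\<close>
  have trig: "(LINT x|M. D1 x * indicator A (f x) * tr (\<phi> x)) = (LINT x|M. D2 x * indicator A (f x) * tr (\<phi> x))"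
    if tr: "tr \<in> borel_measurable borel" "\<And>r. \<bar>tr r\<bar> \<le> 1"
      and rep: "\<And>r. complex_of_real (tr r) = p * iexp r + q * iexp (- r)" for tr :: "real \<Rightarrow> real" and p q
  proof -
    have [measurable]: "(\<lambda>x. tr (\<phi> x)) \<in> borel_measurable M" using tr(1) by measurable
    have tr_pos: "0 \<le> 1 + tr r" for r using tr(2)[of r] by linarith
    have b: "\<bar>1 + tr r\<bar> \<le> 2" for r using tr(2)[of r] by linarith
    have expand: "(CLINT x|M. complex_of_real (Di x * (1 + tr (\<phi> x))) * iexp (v * f x))
        = (CLINT x|M. complex_of_real (Di x) * iexp (0 * \<phi> x + v * f x))
          + p * (CLINT x|M. complex_of_real (Di x) * iexp (1 * \<phi> x + v * f x))
          + q * (CLINT x|M. complex_of_real (Di x) * iexp (-1 * \<phi> x + v * f x))"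
      if Di: "integrable M Di" for Di :: "'a \<Rightarrow> real" and v
    proof -
      have i: "integrable M (\<lambda>x. complex_of_real (Di x) * iexp (s * \<phi> x + v * f x))" for s
        by (intro integrable_mult_iexp Di) measurable
      have "(CLINT x|M. complex_of_real (Di x * (1 + tr (\<phi> x))) * iexp (v * f x))
          = (CLINT x|M. complex_of_real (Di x) * iexp (0 * \<phi> x + v * f x)
          + p * (complex_of_real (Di x) * iexp (1 * \<phi> x + v * f x))
          + q * (complex_of_real (Di x) * iexp (-1 * \<phi> x + v * f x)))"
        by (intro Bochner_Integration.integral_cong refl)
           (unfold iexp_add, simp add: rep algebra_simps)
      also have "\<dots> = (CLINT x|M. complex_of_real (Di x) * iexp (0 * \<phi> x + v * f x))
          + p * (CLINT x|M. complex_of_real (Di x) * iexp (1 * \<phi> x + v * f x))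
          + q * (CLINT x|M. complex_of_real (Di x) * iexp (-1 * \<phi> x + v * f x))"
        by (simp only: Bochner_Integration.integral_add[OF Bochner_Integration.integrable_add[OF i integrable_mult_right[OF i]] integrable_mult_right[OF i]]
            Bochner_Integration.integral_add[OF i integrable_mult_right[OF i]] integral_mult_right_zero)
      finally show ?thesis .
    qed
    have "(LINT x|M. (D1 x * (1 + tr (\<phi> x))) * indicator A (f x)) = (LINT x|M. (D2 x * (1 + tr (\<phi> x))) * indicator A (f x))"
    proof (rule weighted_Levy_uniqueness[OF _ _ _ _ f _ A])
      show "integrable M (\<lambda>x. D1 x * (1 + tr (\<phi> x)))" by (rule int[OF D(1) _ b]) measurable
      show "integrable M (\<lambda>x. D2 x * (1 + tr (\<phi> x)))" by (rule int[OF D(2) _ b]) measurable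
      show "(CLINT x|M. complex_of_real (D1 x * (1 + tr (\<phi> x))) * iexp (v * f x))
          = (CLINT x|M. complex_of_real (D2 x * (1 + tr (\<phi> x))) * iexp (v * f x))" for v
        unfolding expand[OF D(1)] expand[OF D(2)] eq ..
    qed (use pos tr_pos in auto)
    moreover have "(LINT x|M. (Di x * (1 + tr (\<phi> x))) * indicator A (f x))
        = (LINT x|M. Di x * indicator A (f x)) + (LINT x|M. Di x * indicator A (f x) * tr (\<phi> x))"
      if Di: "integrable M Di" for Di :: "'a \<Rightarrow> real"
    proof -
      have [measurable]: "Di \<in> borel_measurable M" using Di by auto
      have 1: "integrable M (\<lambda>x. Di x * indicator A (f x))"
        by (rule int[OF Di]) (auto simp: indicator_def)
      have 2: "integrable M (\<lambda>x. Di x * (indicator A (f x) * tr (\<phi> x)))"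
        using order.trans[OF tr(2), of 2] by (intro int[OF Di]) (auto simp: indicator_def)
      show ?thesis
        unfolding mult.assoc[of "Di _" "indicator A (f _)"] Bochner_Integration.integral_add[OF 1 2, symmetric]
        by (intro Bochner_Integration.integral_cong) (simp_all add: algebra_simps)
    qed
    ultimately show ?thesis using base D by simp
  qed
  have cos: "(LINT x|M. D1 x * indicator A (f x) * cos (\<phi> x)) = (LINT x|M. D2 x * indicator A (f x) * cos (\<phi> x))"
    by (rule trig[of cos "1/2" "1/2"]) (auto simp: complex_eq_iff Re_exp Im_exp)
  have sin: "(LINT x|M. D1 x * indicator A (f x) * sin (\<phi> x)) = (LINT x|M. D2 x * indicator A (f x) * sin (\<phi> x))"
    by (rule trig[of sin "-\<i>/2" "\<i>/2"]) (auto simp: complex_eq_iff Re_exp Im_exp)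
  have split: "(CLINT x|M. complex_of_real (Di x * indicator A (f x)) * iexp (\<phi> x))
      = complex_of_real (LINT x|M. Di x * indicator A (f x) * cos (\<phi> x))
        + \<i> * complex_of_real (LINT x|M. Di x * indicator A (f x) * sin (\<phi> x))"
    if Di: "integrable M Di" for Di :: "'a \<Rightarrow> real"
  proof -
    have [measurable]: "Di \<in> borel_measurable M" using Di by auto
    have "integrable M (\<lambda>x. Di x * (indicator A (f x) * cos (\<phi> x)))"
         "integrable M (\<lambda>x. Di x * (indicator A (f x) * sin (\<phi> x)))"
      by (rule int[OF Di]; auto simp: indicator_def intro: order.trans[OF abs_cos_le_one] order.trans[OF abs_sin_le_one])+
    then have i: "integrable M (\<lambda>x. complex_of_real (Di x * indicator A (f x) * cos (\<phi> x)))"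
      "integrable M (\<lambda>x. \<i> * complex_of_real (Di x * indicator A (f x) * sin (\<phi> x)))"
      by (simp_all add: mult.assoc del: of_real_mult)
    have "(CLINT x|M. complex_of_real (Di x * indicator A (f x)) * iexp (\<phi> x))
       = (CLINT x|M. complex_of_real (Di x * indicator A (f x) * cos (\<phi> x)) + \<i> * complex_of_real (Di x * indicator A (f x) * sin (\<phi> x)))"
      by (intro Bochner_Integration.integral_cong refl) (simp add: complex_eq_iff Re_exp Im_exp)
    also have "\<dots> = complex_of_real (LINT x|M. Di x * indicator A (f x) * cos (\<phi> x))
        + \<i> * complex_of_real (LINT x|M. Di x * indicator A (f x) * sin (\<phi> x))"
      unfolding Bochner_Integration.integral_add[OF i] integral_mult_right_zero integral_complex_of_real ..
    finally show ?thesis .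
  qed
  show ?thesis unfolding split[OF D(1)] split[OF D(2)] cos sin ..
qed

text \<open>Uniqueness of the joint Fourier transform on rectangles, one coordinate at a time: the
  indicator of the new coordinate is absorbed into the weight, which is why the weights are general
  in the induction.\<close>

lemma multivariate_weighted_uniqueness:
  fixes D1 D2 :: "'a \<Rightarrow> real" and f :: "'i \<Rightarrow> 'a \<Rightarrow> real"
  assumes "finite J" and "integrable M D1" "integrable M D2" and "\<And>x. 0 \<le> D1 x" "\<And>x. 0 \<le> D2 x"
    and "\<And>j. j \<in> J \<Longrightarrow> f j \<in> borel_measurable M"
    and "\<And>c. (CLINT x|M. complex_of_real (D1 x) * iexp (\<Sum>j\<in>J. c j * f j x))
                = (CLINT x|M. complex_of_real (D2 x) * iexp (\<Sum>j\<in>J. c j * f j x))"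
    and "\<And>j. j \<in> J \<Longrightarrow> A j \<in> sets borel"
  shows "(LINT x|M. D1 x * (\<Prod>j\<in>J. indicator (A j) (f j x))) = (LINT x|M. D2 x * (\<Prod>j\<in>J. indicator (A j) (f j x)))"
  using assms
proof (induction J arbitrary: D1 D2 rule: finite_induct)
  case empty
  then show ?case using empty.prems(6)[of "\<lambda>_. 0"] by simp
next
  case (insert i J)
  have A [measurable]: "A i \<in> sets borel" and f [measurable]: "f i \<in> borel_measurable M" using insert.prems by auto
  have fJ [measurable]: "f j \<in> borel_measurable M" if "j \<in> J" for j using insert.prems that by auto
  have int: "integrable M (\<lambda>x. D x * indicator (A i) (f i x))" if "integrable M D" for D :: "'a \<Rightarrow> real"
    by (rule Bochner_Integration.integrable_bound[OF that]) (use that in \<open>auto simp: indicator_def\<close>)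
  have "(LINT x|M. (D1 x * indicator (A i) (f i x)) * (\<Prod>j\<in>J. indicator (A j) (f j x)))
      = (LINT x|M. (D2 x * indicator (A i) (f i x)) * (\<Prod>j\<in>J. indicator (A j) (f j x)))"
  proof (rule insert.IH)
    fix c :: "'i \<Rightarrow> real"
    show "(CLINT x|M. complex_of_real (D1 x * indicator (A i) (f i x)) * iexp (\<Sum>j\<in>J. c j * f j x))
        = (CLINT x|M. complex_of_real (D2 x * indicator (A i) (f i x)) * iexp (\<Sum>j\<in>J. c j * f j x))"
    proof (rule integral_mult_trig_indicator_eq[OF insert.prems(1-4) f _ _ A])
      show "(\<lambda>x. \<Sum>j\<in>J. c j * f j x) \<in> borel_measurable M" by measurable
      fix s v
      have "s * (\<Sum>j\<in>J. c j * f j x) + v * f i x = (\<Sum>j\<in>insert i J. (if j = i then v else s * c j) * f j x)" for x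
      proof -
        have "(\<Sum>j\<in>J. (if j = i then v else s * c j) * f j x) = (\<Sum>j\<in>J. s * (c j * f j x))"
          using insert.hyps by (intro sum.cong) auto
        then show ?thesis using insert.hyps by (simp add: sum_distrib_left)
      qed
      then show "(CLINT x|M. complex_of_real (D1 x) * iexp (s * (\<Sum>j\<in>J. c j * f j x) + v * f i x))
          = (CLINT x|M. complex_of_real (D2 x) * iexp (s * (\<Sum>j\<in>J. c j * f j x) + v * f i x))"
        by (simp only: insert.prems(6))
    qed
  qed (use insert.prems int in auto)
  then show ?case using insert.hyps by (simp add: mult.assoc)
qed

section \<open>Gaussian spaces and conditional expectation\<close>

context prob_space
begin

text \<open>The positive and the negative part of \<xi> are taken as weights. In a Gaussian space E
  (\<xi> exp(i \<eta>)) = 0 for every combination \<eta> of the \<open>Y j\<close>, so both weights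
  have the same joint Fourier transform.\<close>

lemma gaussian_space_orthogonal_imp_product:
  assumes G: "\<And>f. f \<in> closed_span M S \<Longrightarrow> gaussian M f"
    and \<xi>: "\<xi> \<in> closed_span M S" and Y: "\<And>j. j \<in> J \<Longrightarrow> Y j \<in> closed_span M S"
    and orth: "\<And>j. j \<in> J \<Longrightarrow> expectation (\<lambda>x. \<xi> x * Y j x) = 0"
    and J: "finite J" and A: "\<And>j. j \<in> J \<Longrightarrow> A j \<in> sets borel"
  shows "expectation (\<lambda>x. \<xi> x * (\<Prod>j\<in>J. indicator (A j) (Y j x))) = 0"
proof -
  note \<xi>' = closed_spanD(1)[OF \<xi>]
  have \<xi>_int: "integrable M \<xi>" by (rule square_integrable_imp_integrable[OF \<xi>'])
  have Y': "square_integrable M (Y j)" if "j \<in> J" for j by (rule closed_spanD(1)[OF Y[OF that]])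
  have Y_meas [measurable]: "Y j \<in> borel_measurable M" if "j \<in> J" for j
    by (rule square_integrableD(1)[OF Y'[OF that]])
  define D1 where "D1 x = max 0 (\<xi> x)" for x
  define D2 where "D2 x = max 0 (- \<xi> x)" for x
  have D_diff: "\<xi> x = D1 x - D2 x" for x by (simp add: D1_def D2_def)
  have D: "integrable M D1" "integrable M D2"
    using \<xi>_int unfolding D1_def[abs_def] D2_def[abs_def] by auto
  have "expectation (\<lambda>x. D1 x * (\<Prod>j\<in>J. indicator (A j) (Y j x))) = expectation (\<lambda>x. D2 x * (\<Prod>j\<in>J. indicator (A j) (Y j x)))"
  proof (rule multivariate_weighted_uniqueness[OF J D])
    fix c :: "'b \<Rightarrow> real"
    let ?\<eta> = "\<lambda>x. \<Sum>j\<in>J. c j * Y j x"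
    have \<eta>: "?\<eta> \<in> closed_span M S"
      by (intro closed_span_sum closed_span_cmult Y)
    note \<eta>' = closed_spanD(1)[OF \<eta>]
    have "expectation (\<lambda>x. \<xi> x * ?\<eta> x) = (\<Sum>j\<in>J. c j * expectation (\<lambda>x. \<xi> x * Y j x))"
    proof -
      have "expectation (\<lambda>x. \<xi> x * ?\<eta> x) = expectation (\<lambda>x. \<Sum>j\<in>J. c j * (\<xi> x * Y j x))"
        by (simp add: sum_distrib_left mult.left_commute)
      also have "\<dots> = (\<Sum>j\<in>J. expectation (\<lambda>x. c j * (\<xi> x * Y j x)))"
        by (intro Bochner_Integration.integral_sum integrable_mult_right square_integrable_mult \<xi>' Y')
      finally show ?thesis by simp
    qed
    then have o: "expectation (\<lambda>x. \<xi> x * ?\<eta> x) = 0" using orth by simp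
    have "(CLINT x|M. complex_of_real (\<xi> x) * iexp (?\<eta> x)) = 0"
      by (rule gaussian_uncorrelated_iexp[OF \<xi>' \<eta>' _ o])
         (intro G closed_span_add closed_span_cmult \<xi> \<eta>)
    moreover have "(CLINT x|M. complex_of_real (\<xi> x) * iexp (?\<eta> x))
        = (CLINT x|M. complex_of_real (D1 x) * iexp (?\<eta> x)) - (CLINT x|M. complex_of_real (D2 x) * iexp (?\<eta> x))"
      unfolding D_diff of_real_diff left_diff_distrib
      by (intro Bochner_Integration.integral_diff integrable_mult_iexp D square_integrableD(1)[OF \<eta>'])
    ultimately show "(CLINT x|M. complex_of_real (D1 x) * iexp (?\<eta> x)) = (CLINT x|M. complex_of_real (D2 x) * iexp (?\<eta> x))"
      by simp
  qed (auto simp: D1_def D2_def A Y_meas)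
  moreover have int: "integrable M (\<lambda>x. D x * (\<Prod>j\<in>J. indicator (A j) (Y j x)))" if D: "integrable M D" for D :: "'a \<Rightarrow> real"
  proof (rule Bochner_Integration.integrable_bound[OF D])
    have [measurable]: "D \<in> borel_measurable M" using D by auto
    show "(\<lambda>x. D x * (\<Prod>j\<in>J. indicator (A j) (Y j x))) \<in> borel_measurable M"
      using A by (intro borel_measurable_times borel_measurable_prod) (auto intro!: measurable_compose[OF Y_meas])
    have "\<bar>\<Prod>j\<in>J. indicator (A j) (Y j x) :: real\<bar> \<le> 1" for x
      by (auto simp: abs_prod intro!: prod_le_1)
    then show "AE x in M. norm (D x * (\<Prod>j\<in>J. indicator (A j) (Y j x))) \<le> norm (D x)"
      by (auto simp: abs_mult intro!: mult_left_le)
  qed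
  ultimately show ?thesis
    unfolding D_diff left_diff_distrib using int[OF D(1)] int[OF D(2)] by simp
qed

text \<open>Finite-dimensional cylinder sets together with the null sets are stable under
  intersection and generate the augmented \<sigma>-algebra, so a Dynkin argument extends the
  statement for products of indicators.\<close>

lemma gaussian_space_orthogonal_imp_integral_zero:
  fixes Y :: "real \<Rightarrow> 'a \<Rightarrow> real"
  assumes G: "\<And>f. f \<in> closed_span M S \<Longrightarrow> gaussian M f"
    and \<xi>: "\<xi> \<in> closed_span M S" and Y: "\<And>s. s \<in> {0..t} \<Longrightarrow> Y s \<in> closed_span M S"
    and orth: "\<And>s. s \<in> {0..t} \<Longrightarrow> expectation (\<lambda>x. \<xi> x * Y s x) = 0"
    and A: "A \<in> sigma_sets (space M) (generated_sets M t Y \<union> null_sets M)"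
  shows "expectation (\<lambda>x. \<xi> x * indicator A x) = 0"
proof -
  have \<xi>_int: "integrable M \<xi>"
    by (rule square_integrable_imp_integrable[OF closed_spanD(1)[OF \<xi>]])
  have Y_meas: "Y s \<in> borel_measurable M" if "s \<in> {0..t}" for s
    by (rule square_integrableD(1)[OF closed_spanD(1)[OF Y[OF that]]])
  define cyl where "cyl J As = {x\<in>space M. \<forall>j\<in>J. Y j x \<in> As j}" for J and As :: "real \<Rightarrow> real set"
  define C where "C = {cyl J As | J As. finite J \<and> J \<subseteq> {0..t} \<and> (\<forall>j\<in>J. As j \<in> sets borel)}"
  define P where "P = C \<union> null_sets M"
  have C_sets: "C \<subseteq> sets M"
  proof
    fix A assume "A \<in> C"
    then obtain J As where A: "A = cyl J As" "finite J" "J \<subseteq> {0..t}" "\<forall>j\<in>J. As j \<in> sets borel"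
      by (auto simp: C_def)
    have "{x\<in>space M. Y j x \<in> As j} \<in> sets M" if "j \<in> J" for j
      using measurable_sets[OF Y_meas, of j "As j"] A that by (auto simp: vimage_def Int_def conj_commute)
    then have "{x\<in>space M. \<forall>j\<in>J. Y j x \<in> As j} \<in> sets M"
      using A by (intro sets.sets_Collect_finite_All) auto
    then show "A \<in> sets M" by (simp add: A cyl_def)
  qed
  have P_sets: "P \<subseteq> sets M" using C_sets by (auto simp: P_def)
  have C_Int: "a \<inter> b \<in> C" if ab: "a \<in> C" "b \<in> C" for a b
  proof -
    obtain J As where a: "a = cyl J As" "finite J" "J \<subseteq> {0..t}" "\<forall>j\<in>J. As j \<in> sets borel"
      using ab(1) by (auto simp: C_def)
    obtain K Bs where b: "b = cyl K Bs" "finite K" "K \<subseteq> {0..t}" "\<forall>j\<in>K. Bs j \<in> sets borel"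
      using ab(2) by (auto simp: C_def)
    define Cs where "Cs j = (if j \<in> J then As j else UNIV) \<inter> (if j \<in> K then Bs j else UNIV)" for j
    have "a \<inter> b = cyl (J \<union> K) Cs" by (auto simp: a b cyl_def Cs_def split: if_splits)
    moreover have "\<forall>j\<in>J \<union> K. Cs j \<in> sets borel" using a b by (auto simp: Cs_def)
    ultimately show ?thesis using a b unfolding C_def by blast
  qed
  have "Int_stable P"
  proof (rule Int_stableI)
    fix a b assume ab: "a \<in> P" "b \<in> P"
    then consider "a \<in> C" "b \<in> C" | "a \<in> null_sets M" "b \<in> sets M" | "b \<in> null_sets M" "a \<in> sets M"
      using P_sets by (auto simp: P_def)
    then show "a \<inter> b \<in> P"
    proof cases
      case 1
      then show ?thesis using C_Int by (simp add: P_def)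
    next
      case 2
      then show ?thesis by (auto simp: P_def intro: null_set_Int2)
    next
      case 3
      then show ?thesis by (auto simp: P_def intro: null_set_Int1)
    qed
  qed
  moreover have "P \<subseteq> Pow (space M)" using P_sets sets.sets_into_space by blast
  moreover have "A \<in> sigma_sets (space M) P"
  proof -
    have "generated_sets M t Y \<subseteq> sigma_sets (space M) P"
      unfolding generated_sets_def
    proof (rule sigma_sets_mono)
      show "{Y s -` A \<inter> space M |s A. s \<in> {0..t} \<and> A \<in> sets borel} \<subseteq> sigma_sets (space M) P"
      proof clarify
        fix s and A :: "real set" assume s: "s \<in> {0..t}" "A \<in> sets borel"
        have "Y s -` A \<inter> space M = cyl {s} (\<lambda>_. A)" by (auto simp: cyl_def)
        then have "Y s -` A \<inter> space M \<in> P"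
          using s unfolding P_def C_def by (intro UnI1 CollectI exI[of _ "{s}"] exI[of _ "\<lambda>_. A"]) auto
        then show "Y s -` A \<inter> space M \<in> sigma_sets (space M) P" by (rule sigma_sets.Basic)
      qed
    qed
    moreover have "null_sets M \<subseteq> sigma_sets (space M) P" by (auto simp: P_def)
    ultimately show ?thesis using A sigma_sets_mono[of "generated_sets M t Y \<union> null_sets M" "space M" P] by blast
  qed
  ultimately show ?thesis
  proof (induction rule: sigma_sets_induct_disjoint)
    case (basic A)
    then consider J As where "A = cyl J As" "finite J" "J \<subseteq> {0..t}" "\<forall>j\<in>J. As j \<in> sets borel"
      | "A \<in> null_sets M" by (auto simp: P_def C_def)
    then show ?case
    proof cases
      case 1
      have "expectation (\<lambda>x. \<xi> x * indicator A x) = expectation (\<lambda>x. \<xi> x * (\<Prod>j\<in>J. indicator (As j) (Y j x)))"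
      proof (intro Bochner_Integration.integral_cong refl)
        fix x assume x: "x \<in> space M"
        have "(\<Prod>j\<in>J. indicator (As j) (Y j x)) = (indicator A x :: real)"
          using 1 x by (cases "x \<in> A") (auto simp: cyl_def indicator_def prod_zero_iff)
        then show "\<xi> x * indicator A x = \<xi> x * (\<Prod>j\<in>J. indicator (As j) (Y j x))" by simp
      qed
      also have "\<dots> = 0"
        using 1 by (intro gaussian_space_orthogonal_imp_product[OF G \<xi>] Y orth) auto
      finally show ?thesis .
    next
      case 2
      have "AE x in M. x \<notin> A" by (rule AE_not_in[OF 2])
      then show ?thesis by (intro integral_eq_zero_AE) (auto elim!: eventually_mono)
    qed
  next
    case empty
    then show ?case by simp
  next
    case (compl A)
    have "A \<in> sets M" using compl(1) P_sets sets.sigma_sets_subset by blast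
    then have i: "integrable M (\<lambda>x. \<xi> x * indicator A x)"
      by (intro integrable_real_mult_indicator \<xi>_int)
    \<comment> \<open>The product over no indices is 1, so this says that \<xi> has mean 0, as
      complements require.\<close>
    have "expectation (\<lambda>x. \<xi> x * (\<Prod>j\<in>{}. indicator UNIV (Y j x))) = 0"
      by (rule gaussian_space_orthogonal_imp_product[OF G \<xi>]) auto
    then have "expectation \<xi> = 0" by simp
    moreover have "expectation (\<lambda>x. \<xi> x * indicator (space M - A) x) = expectation (\<lambda>x. \<xi> x - \<xi> x * indicator A x)"
      by (intro Bochner_Integration.integral_cong) (auto simp: indicator_def)
    ultimately show ?case using compl(2) i \<xi>_int by simp
  next
    case (union A)
    have A: "A i \<in> sets M" for i using union(2) P_sets sets.sigma_sets_subset by blast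
    have "(\<lambda>n. expectation (\<lambda>x. \<xi> x * indicator (\<Union>i<n. A i) x)) \<longlonglongrightarrow> expectation (\<lambda>x. \<xi> x * indicator (\<Union>i. A i) x)"
    proof (rule integral_dominated_convergence[where w="\<lambda>x. \<bar>\<xi> x\<bar>"])
      show "AE x in M. (\<lambda>n. \<xi> x * indicator (\<Union>i<n. A i) x) \<longlonglongrightarrow> \<xi> x * indicator (\<Union>i. A i) x"
        by (intro AE_I2 tendsto_intros LIMSEQ_indicator_UN)
      show "(\<lambda>x. \<xi> x * indicator (\<Union>i. A i) x) \<in> borel_measurable M"
        "(\<lambda>x. \<xi> x * indicator (\<Union>i<n. A i) x) \<in> borel_measurable M" for n
        using A \<xi>_int by (auto intro!: borel_measurable_times borel_measurable_indicator)
    qed (use \<xi>_int in \<open>auto simp: indicator_def\<close>)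
    moreover have "expectation (\<lambda>x. \<xi> x * indicator (\<Union>i<n. A i) x) = 0" for n
    proof -
      have "(indicator (\<Union>i<n. A i) x :: real) = (\<Sum>i<n. indicator (A i) x)" for x
        using union(1) by (subst indicator_UN_disjoint) (auto simp: disjoint_family_on_def)
      then have "expectation (\<lambda>x. \<xi> x * indicator (\<Union>i<n. A i) x) = expectation (\<lambda>x. \<Sum>i<n. \<xi> x * indicator (A i) x)"
        by (simp only: sum_distrib_left)
      also have "\<dots> = (\<Sum>i<n. expectation (\<lambda>x. \<xi> x * indicator (A i) x))"
        by (intro Bochner_Integration.integral_sum integrable_real_mult_indicator A \<xi>_int)
      finally show ?thesis using union(3) by simp
    qed
    ultimately show ?case by (simp only: LIMSEQ_const_iff)
  qed
qed

lemma subalgebra_augmented_filtration: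
  assumes "\<And>s. s \<in> {0..t} \<Longrightarrow> Y s \<in> borel_measurable M"
  shows "subalgebra M (augmented_filtration M Y t)"
    and "sets (augmented_filtration M Y t) = sigma_sets (space M) (generated_sets M t Y \<union> null_sets M)"
    and "space (augmented_filtration M Y t) = space M"
proof -
  have "generated_sets M t Y \<subseteq> sets M"
    unfolding generated_sets_def using assms
    by (intro sets.sigma_sets_subset) (auto intro: measurable_sets)
  then have sub: "generated_sets M t Y \<union> null_sets M \<subseteq> sets M" by auto
  then have "generated_sets M t Y \<union> null_sets M \<subseteq> Pow (space M)" using sets.sets_into_space by blast
  then show s: "sets (augmented_filtration M Y t) = sigma_sets (space M) (generated_sets M t Y \<union> null_sets M)"
    and sp: "space (augmented_filtration M Y t) = space M"
    by (simp_all add: augmented_filtration_def)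
  show "subalgebra M (augmented_filtration M Y t)"
    unfolding subalgebra_def s sp using sets.sigma_sets_subset[OF sub] by simp
qed

text \<open>In a Gaussian space, the linear orthogonality of Z - p to the observations already
  implies orthogonality to every event that they generate.\<close>

lemma real_cond_exp_eq_projection:
  fixes Y :: "real \<Rightarrow> 'a \<Rightarrow> real"
  assumes G: "\<And>f. f \<in> closed_span M S \<Longrightarrow> gaussian M f"
    and Z: "Z \<in> closed_span M S" and p: "p \<in> closed_span M S" and Y: "\<And>s. s \<in> {0..t} \<Longrightarrow> Y s \<in> closed_span M S"
    and orth: "\<And>s. s \<in> {0..t} \<Longrightarrow> expectation (\<lambda>x. Y s x * (Z x - p x)) = 0"
    and p_meas: "p \<in> borel_measurable (augmented_filtration M Y t)"
  shows "AE x in M. real_cond_exp M (augmented_filtration M Y t) Z x = p x"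
proof -
  have Y_meas: "Y s \<in> borel_measurable M" if "s \<in> {0..t}" for s
    by (rule square_integrableD(1)[OF closed_spanD(1)[OF Y[OF that]]])
  have sub: "subalgebra M (augmented_filtration M Y t)"
      "sets (augmented_filtration M Y t) = sigma_sets (space M) (generated_sets M t Y \<union> null_sets M)"
    by (rule subalgebra_augmented_filtration; rule Y_meas; assumption)+
  interpret F: finite_measure_subalgebra M "augmented_filtration M Y t"
    by unfold_locales (rule sub(1))
  have int: "integrable M Z" "integrable M p"
    by (intro square_integrable_imp_integrable closed_spanD(1)[OF Z] closed_spanD(1)[OF p])+
  show ?thesis
  proof (rule F.real_cond_exp_charact[OF _ int p_meas])
    fix A assume A: "A \<in> sets (augmented_filtration M Y t)"
    then have A': "A \<in> sets M" using sub(1) by (auto simp: subalgebra_def)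
    have "expectation (\<lambda>x. (Z x - p x) * indicator A x) = 0"
      by (rule gaussian_space_orthogonal_imp_integral_zero[OF G closed_span_diff[OF Z p] Y])
         (use orth A sub(2) in \<open>auto simp: mult.commute\<close>)
    then have "expectation (\<lambda>x. Z x * indicator A x) = expectation (\<lambda>x. p x * indicator A x)"
      using integrable_real_mult_indicator[OF A' int(1)] integrable_real_mult_indicator[OF A' int(2)]
      by (simp add: left_diff_distrib)
    then show "(\<integral>x\<in>A. Z x \<partial>M) = (\<integral>x\<in>A. p x \<partial>M)"
      by (simp add: set_lebesgue_integral_def mult.commute)
  qed
qed

section \<open>Brownian motion as a Gaussian process with covariance min s t\<close>

lemma gaussian_cong_AE:
  assumes "gaussian M f" "g \<in> borel_measurable M" "AE x in M. f x = g x"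
  shows "gaussian M g"
proof -
  have f: "square_integrable M f" using assms(1) by (simp add: gaussian_def)
  note [measurable] = square_integrableD(1)[OF f] assms(2)
  have "square_integrable M g" by (rule square_integrable_AE[OF f assms(2,3)])
  moreover have "(CLINT x|M. iexp (f x)) = (CLINT x|M. iexp (g x))"
  proof (rule integral_cong_AE)
    show "AE x in M. iexp (f x) = iexp (g x)" using assms(3) by eventually_elim simp
  qed measurable
  moreover have "expectation (\<lambda>x. (f x)\<^sup>2) = expectation (\<lambda>x. (g x)\<^sup>2)"
  proof (rule integral_cong_AE)
    show "AE x in M. (f x)\<^sup>2 = (g x)\<^sup>2" using assms(3) by eventually_elim simp
  qed measurable
  ultimately show ?thesis using assms(1) by (simp add: gaussian_def)
qed

lemma gaussian_sum_indep:
  fixes f :: "'i \<Rightarrow> 'a \<Rightarrow> real"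
  assumes "finite I" "indep_vars (\<lambda>_. borel) f I" "\<And>i. i \<in> I \<Longrightarrow> gaussian M (f i)" "\<And>i. i \<in> I \<Longrightarrow> expectation (f i) = 0"
  shows "gaussian M (\<lambda>x. \<Sum>i\<in>I. f i x) \<and> expectation (\<lambda>x. \<Sum>i\<in>I. f i x) = 0"
  using assms
proof (induction I rule: finite_induct)
  case empty
  then show ?case using gaussian_AE_zero[of "\<lambda>_. 0"] by simp
next
  case (insert i I)
  have IH: "gaussian M (\<lambda>x. \<Sum>i\<in>I. f i x)" "expectation (\<lambda>x. \<Sum>i\<in>I. f i x) = 0"
    using insert.IH insert.prems indep_vars_subset[OF insert.prems(1)] by auto
  have i: "gaussian M (f i)" "expectation (f i) = 0" using insert.prems by auto
  have ind: "indep_var borel (f i) borel (\<lambda>x. \<Sum>i\<in>I. f i x)"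
    by (rule indep_vars_sum[OF insert.hyps insert.prems(1)])
  have int: "integrable M (f i)" "integrable M (\<lambda>x. \<Sum>i\<in>I. f i x)"
    using i IH by (auto simp: gaussian_def intro!: square_integrable_imp_integrable)
  have "expectation (\<lambda>x. f i x * (\<Sum>i\<in>I. f i x)) = 0"
    using indep_var_lebesgue_integral[OF ind int] i by simp
  then have "gaussian M (\<lambda>x. f i x + (\<Sum>i\<in>I. f i x))"
    by (intro gaussian_add_indep i IH ind)
  moreover have "expectation (\<lambda>x. f i x + (\<Sum>i\<in>I. f i x)) = 0"
    using int i IH by simp
  ultimately show ?case using insert.hyps by simp
qed

text \<open>Summation by parts along the sorted times turns a combination of values into one of
  independent increments.\<close>

lemma brownian_motion_gaussian:
  assumes B: "brownian_motion M T B" and "0 \<le> T" and J: "finite J" "J \<subseteq> {0..T}"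
  shows "gaussian M (\<lambda>x. \<Sum>t\<in>J. d t * B t x) \<and> expectation (\<lambda>x. \<Sum>t\<in>J. d t * B t x) = 0"
proof -
  have B_meas: "B t \<in> borel_measurable M" if "t \<in> {0..T}" for t
    using B that by (auto simp: brownian_motion_def)
  define xs where "xs = sorted_list_of_set J"
  define n where "n = length xs"
  have xs: "set xs = J" "sorted xs" "distinct xs" using J by (auto simp: xs_def)
  \<comment> \<open>The sorted times are preceded by 0, where B vanishes almost surely, and followed
    by T forever, so that p is monotone on all natural numbers with values in [0, T]. The first n
    increments end at the sorted times.\<close>
  define p where "p i = (if i = 0 then 0 else if i \<le> n then xs ! (i - 1) else T)" for i
  have xs_mem: "xs ! i \<in> {0..T}" if "i < n" for i
    using that xs(1) J(2) nth_mem[of i xs] by (auto simp: n_def)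
  have p_mem: "p i \<in> {0..T}" for i
    using xs_mem[of "i - 1"] \<open>0 \<le> T\<close> by (auto simp: p_def)
  have p_mono: "mono p"
  proof (rule mono_iff_le_Suc[THEN iffD2], rule allI)
    fix i
    consider "i = 0" | "0 < i" "Suc i \<le> n" | "0 < i" "\<not> Suc i \<le> n" by linarith
    then show "p i \<le> p (Suc i)"
    proof cases
      case 1
      then show ?thesis using p_mem[of 1] by (simp add: p_def[of 0])
    next
      case 2
      then show ?thesis using sorted_nth_mono[OF xs(2), of "i - 1" i] by (simp add: p_def n_def)
    next
      case 3
      then have "p (Suc i) = T" by (simp add: p_def)
      then show ?thesis using p_mem[of i] by simp
    qed
  qed
  define \<Delta> where "\<Delta> i x = B (p (Suc i)) x - B (p i) x" for i x
  have "indep_vars (\<lambda>_. borel) \<Delta> {..<n}"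
    using B p_mono p_mem unfolding brownian_motion_def \<Delta>_def[abs_def] by blast
  \<comment> \<open>The i-th increment enters B at all sorted times of index i or more; its
    coefficient collects theirs.\<close>
  define e where "e i = (\<Sum>j\<in>{i..<n}. d (xs ! j))" for i
  have ind: "indep_vars (\<lambda>_. borel) (\<lambda>i x. e i * \<Delta> i x) {..<n}"
    by (rule indep_vars_compose2[where Y="\<lambda>i y. e i * y", OF \<open>indep_vars (\<lambda>_. borel) \<Delta> {..<n}\<close>]) simp
  have g: "gaussian M (\<lambda>x. e i * \<Delta> i x) \<and> expectation (\<lambda>x. e i * \<Delta> i x) = 0" for i
  proof (cases "e i = 0 \<or> p i = p (Suc i)")
    case True
    then have "(\<lambda>x. e i * \<Delta> i x) = (\<lambda>_. 0)" by (auto simp: \<Delta>_def)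
    then show ?thesis using gaussian_AE_zero[of "\<lambda>_. 0"] by (simp only:) simp
  next
    case False
    then have lt: "0 \<le> p i" "p i < p (Suc i)" "p (Suc i) \<le> T"
      using monoD[OF p_mono, of i "Suc i"] p_mem[of i] p_mem[of "Suc i"] by auto
    then have D: "distributed M lborel (\<Delta> i) (normal_density 0 (sqrt (p (Suc i) - p i)))"
      using B unfolding brownian_motion_def \<Delta>_def[abs_def] by blast
    have "distributed M lborel (\<lambda>x. 0 + e i * \<Delta> i x) (normal_density (0 + e i * 0) (\<bar>e i\<bar> * sqrt (p (Suc i) - p i)))"
      using False lt by (intro normal_density_affine[OF D]) auto
    then show ?thesis
      using normal_distributed_imp_gaussian[of "\<bar>e i\<bar> * sqrt (p (Suc i) - p i)" "\<lambda>x. e i * \<Delta> i x"] False lt by simp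
  qed
  let ?g = "\<lambda>x. \<Sum>i<n. e i * \<Delta> i x"
  have G: "gaussian M ?g \<and> expectation ?g = 0"
    by (rule gaussian_sum_indep[OF _ ind]) (use g in auto)
  have sum_J: "(\<Sum>t\<in>J. d t * B t x) = (\<Sum>j<n. d (xs ! j) * B (xs ! j) x)" for x
    unfolding xs(1)[symmetric]
    by (rule sum.reindex_bij_betw[symmetric]) (use bij_betw_nth[OF xs(3), of "{..<n}" "set xs"] in \<open>auto simp: n_def\<close>)
  have "AE x in M. B 0 x = 0" using B by (simp add: brownian_motion_def)
  then have "AE x in M. ?g x = (\<Sum>t\<in>J. d t * B t x)"
  proof eventually_elim
    case (elim x)
    have tel: "B (xs ! j) x = (\<Sum>i\<le>j. \<Delta> i x)" if "j < n" for j
    proof -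
      have "(\<Sum>i\<le>j. \<Delta> i x) = B (p (Suc j)) x - B (p 0) x"
        unfolding \<Delta>_def lessThan_Suc_atMost[symmetric] by (rule sum_lessThan_telescope)
      then show ?thesis using elim that by (simp add: p_def)
    qed
    have "(\<Sum>t\<in>J. d t * B t x) = (\<Sum>j<n. \<Sum>i\<le>j. d (xs ! j) * \<Delta> i x)"
      unfolding sum_J by (intro sum.cong) (simp_all add: tel sum_distrib_left)
    also have "\<dots> = (\<Sum>j<n. \<Sum>i<n. if i \<le> j then d (xs ! j) * \<Delta> i x else 0)"
      by (intro sum.cong refl sum.mono_neutral_cong_left) auto
    also have "\<dots> = (\<Sum>i<n. \<Sum>j<n. if i \<le> j then d (xs ! j) * \<Delta> i x else 0)"
      by (rule sum.swap)
    also have "\<dots> = (\<Sum>i<n. e i * \<Delta> i x)"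
      unfolding e_def sum_distrib_right
      by (intro sum.cong refl sum.mono_neutral_cong_right) auto
    finally show ?case by simp
  qed
  moreover have m: "(\<lambda>x. \<Sum>t\<in>J. d t * B t x) \<in> borel_measurable M"
    using B_meas J by (intro borel_measurable_sum borel_measurable_times) auto
  moreover have "?g \<in> borel_measurable M" using G by (auto simp: gaussian_def square_integrable_def)
  ultimately show ?thesis
    using gaussian_cong_AE[of ?g] integral_cong_AE[of ?g M "\<lambda>x. \<Sum>t\<in>J. d t * B t x"] G by auto
qed

lemma brownian_motion_covariance:
  assumes B: "brownian_motion M T B" and "0 \<le> T"
  shows "brownian_covariance M T B"
proof -
  have sq: "square_integrable M (B s)" if "s \<in> {0..T}" for s
    using brownian_motion_gaussian[OF assms, of "{s}" "\<lambda>_. 1"] that by (simp add: gaussian_def)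
  have inc: "expectation (\<lambda>x. (B t x - B s x)\<^sup>2) = t - s" if "0 \<le> s" "s \<le> t" "t \<le> T" for s t
  proof (cases "s = t")
    case False
    with that have "distributed M lborel (\<lambda>x. B t x - B s x) (normal_density 0 (sqrt (t - s)))"
      using B unfolding brownian_motion_def by auto
    from normal_distributed_imp_gaussian(3)[OF _ this] that False show ?thesis by simp
  qed simp
  have B0: "AE x in M. B 0 x = 0" using B by (simp add: brownian_motion_def)
  have var: "expectation (\<lambda>x. (B t x)\<^sup>2) = t" if "t \<in> {0..T}" for t
  proof -
    have "expectation (\<lambda>x. (B t x)\<^sup>2) = expectation (\<lambda>x. (B t x - B 0 x)\<^sup>2)"
    proof (rule integral_cong_AE)
      show "AE x in M. (B t x)\<^sup>2 = (B t x - B 0 x)\<^sup>2" using B0 by eventually_elim simp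
      have [measurable]: "B t \<in> borel_measurable M" "B 0 \<in> borel_measurable M"
        using sq[of t] sq[of 0] that by (auto simp: square_integrable_def)
      show "(\<lambda>x. (B t x)\<^sup>2) \<in> borel_measurable M" "(\<lambda>x. (B t x - B 0 x)\<^sup>2) \<in> borel_measurable M"
        by measurable
    qed
    then show ?thesis using inc[of 0 t] that by simp
  qed
  have cov: "expectation (\<lambda>x. B s x * B t x) = s" if "0 \<le> s" "s \<le> t" "t \<le> T" for s t
  proof -
    have "t - s = t - 2 * expectation (\<lambda>x. B t x * B s x) + s"
      using integral_square_diff[OF sq sq, of t s] inc[OF that] var[of s] var[of t] that by simp
    then show ?thesis by (simp add: mult.commute)
  qed
  have "expectation (\<lambda>x. B s x * B t x) = min s t" if "s \<in> {0..T}" "t \<in> {0..T}" for s t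
    using cov[of s t] cov[of t s] that by (cases "s \<le> t") (auto simp: mult.commute min_def)
  then show ?thesis using sq by (simp add: brownian_covariance_def)
qed

end

section \<open>The Gaussian space of signal and noise\<close>

context prob_space
begin

text \<open>Path continuity only gives almost sure convergence. For Gaussian increments dominated
  convergence of the bounded exponentials shows exp(-v/2) -> 1 for the variances v, and taking the
  logarithm gives v -> 0.\<close>

lemma gaussian_process_L2_continuous:
  assumes sq: "\<And>s. s \<in> A \<Longrightarrow> square_integrable M (W s)"
    and g: "\<And>s t. s \<in> A \<Longrightarrow> t \<in> A \<Longrightarrow> gaussian M (\<lambda>x. W t x - W s x)"
    and cont: "AE x in M. continuous_on A (\<lambda>t. W t x)"
  shows "L2_continuous_on M A W"
  unfolding L2_continuous_on_def L2_tendsto_def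
proof (intro allI impI conjI)
  fix s and r :: "nat \<Rightarrow> real" assume *: "(\<forall>k. r k \<in> A) \<and> s \<in> A \<and> r \<longlonglongrightarrow> s"
  show "square_integrable M (W s)" "square_integrable M (W (r k))" for k using * sq by auto
  have [measurable]: "W s \<in> borel_measurable M" "W (r k) \<in> borel_measurable M" for k
    using * sq by (auto simp: square_integrable_def)
  let ?v = "\<lambda>k. expectation (\<lambda>x. (W (r k) x - W s x)\<^sup>2)"
  have "(\<lambda>k. CLINT x|M. iexp (W (r k) x - W s x)) \<longlonglongrightarrow> (CLINT x|M. 1)"
  proof (rule integral_dominated_convergence[where w="\<lambda>_. 1"])
    show "AE x in M. (\<lambda>k. iexp (W (r k) x - W s x)) \<longlonglongrightarrow> 1"
      using cont
    proof eventually_elim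
      case (elim x)
      have "(\<lambda>k. W (r k) x) \<longlonglongrightarrow> W s x"
        using continuous_on_tendsto_compose[OF elim, of r s] * by simp
      then have "(\<lambda>k. iexp (W (r k) x - W s x)) \<longlonglongrightarrow> iexp (W s x - W s x)"
        by (intro tendsto_intros)
      then show ?case by simp
    qed
  qed (auto simp del: of_real_diff)
  then have "(\<lambda>k. complex_of_real (exp (- ?v k / 2))) \<longlonglongrightarrow> complex_of_real 1"
    using g * by (simp add: gaussian_def prob_space)
  then have "(\<lambda>k. exp (- ?v k / 2)) \<longlonglongrightarrow> 1" by (simp only: tendsto_of_real_iff)
  then have "(\<lambda>k. -2 * ln (exp (- ?v k / 2))) \<longlonglongrightarrow> -2 * ln 1"
    by (intro tendsto_intros) auto
  then show "?v \<longlonglongrightarrow> 0" by simp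
qed

lemma L2_continuous_on_bounded:
  assumes cont: "L2_continuous_on M {0..T} W"
  obtains K where "\<And>t. t \<in> {0..T} \<Longrightarrow> expectation (\<lambda>x. (W t x)\<^sup>2) \<le> K"
proof -
  have "continuous_on {0..T} (\<lambda>t. expectation (\<lambda>x. (W t x)\<^sup>2))"
    unfolding continuous_on_sequentially comp_def
    using L2_tendsto_square[OF L2_continuous_onD[OF cont]] by blast
  then have "compact ((\<lambda>t. expectation (\<lambda>x. (W t x)\<^sup>2)) ` {0..T})"
    by (rule compact_continuous_image) simp
  then have "bdd_above ((\<lambda>t. expectation (\<lambda>x. (W t x)\<^sup>2)) ` {0..T})"
    by (intro bounded_imp_bdd_above compact_imp_bounded)
  then obtain K where "\<forall>v\<in>(\<lambda>t. expectation (\<lambda>x. (W t x)\<^sup>2)) ` {0..T}. v \<le> K"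
    unfolding bdd_above_def by blast
  then show ?thesis by (intro that[of K]) auto
qed

end

locale gaussian_signal = prob_space M for M :: "'w measure" +
  fixes T :: real and X U B :: "real \<Rightarrow> 'w \<Rightarrow> real"
  assumes T: "0 < T"
    and XU_gaussian: "centered_gaussian_process M T (\<lambda>t \<omega>. (X t \<omega>, U t \<omega>))"
    and XU_continuous: "continuous_process M T (\<lambda>t \<omega>. (X t \<omega>, U t \<omega>))"
    and B: "brownian_motion M T B"
    and indep: "indep_set (generated_sets M T B) (generated_sets M T (\<lambda>t \<omega>. (X t \<omega>, U t \<omega>)))"
begin

abbreviation "base \<equiv> X ` {0..T} \<union> U ` {0..T} \<union> B ` {0..T}"

lemma B_covariance: "brownian_covariance M T B"
  using brownian_motion_covariance[OF B] T by simp

lemma XU_combination: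
  assumes "finite J" "J \<subseteq> {0..T}"
  shows "gaussian M (\<lambda>x. \<Sum>t\<in>J. a t * X t x + b t * U t x)"
    and "expectation (\<lambda>x. \<Sum>t\<in>J. a t * X t x + b t * U t x) = 0"
proof -
  have "centered_gaussian M (\<lambda>\<omega>. \<Sum>t\<in>J. (a t, b t) \<bullet> (X t \<omega>, U t \<omega>))"
    by (rule XU_gaussian[unfolded centered_gaussian_process_def, rule_format]) (use assms in auto)
  then have "centered_gaussian M (\<lambda>x. \<Sum>t\<in>J. a t * X t x + b t * U t x)"
    by (simp only: inner_Pair inner_real_def)
  from centered_gaussian_imp_gaussian[OF this]
  show "gaussian M (\<lambda>x. \<Sum>t\<in>J. a t * X t x + b t * U t x)"
    "expectation (\<lambda>x. \<Sum>t\<in>J. a t * X t x + b t * U t x) = 0" by auto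
qed

lemma B_square_integrable: "t \<in> {0..T} \<Longrightarrow> square_integrable M (B t)"
  by (rule bc_square_integrable[OF B_covariance])

lemma X_square_integrable: "t \<in> {0..T} \<Longrightarrow> square_integrable M (X t)"
  using XU_combination(1)[of "{t}" "\<lambda>_. 1" "\<lambda>_. 0"] by (simp add: gaussian_def)

lemma U_square_integrable: "t \<in> {0..T} \<Longrightarrow> square_integrable M (U t)"
  using XU_combination(1)[of "{t}" "\<lambda>_. 0" "\<lambda>_. 1"] by (simp add: gaussian_def)

lemma indep_combinations:
  assumes J: "finite J" "J \<subseteq> {0..T}" and K: "finite K" "K \<subseteq> {0..T}"
  shows "indep_var borel (\<lambda>x. \<Sum>t\<in>J. d t * B t x) borel (\<lambda>x. \<Sum>t\<in>K. a t * X t x + b t * U t x)"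
proof -
  have B_meas: "B t \<in> borel_measurable M" if "t \<in> {0..T}" for t
    using B_square_integrable[OF that] by (simp add: square_integrable_def)
  have X_meas: "X t \<in> borel_measurable M" if "t \<in> {0..T}" for t
    using X_square_integrable[OF that] by (simp add: square_integrable_def)
  have U_meas: "U t \<in> borel_measurable M" if "t \<in> {0..T}" for t
    using U_square_integrable[OF that] by (simp add: square_integrable_def)
  define gB where "gB = {B s -` A \<inter> space M |s A. s \<in> {0..T} \<and> A \<in> sets borel}"
  define gXU where "gXU = {(\<lambda>\<omega>. (X s \<omega>, U s \<omega>)) -` A \<inter> space M |s A. s \<in> {0..T} \<and> A \<in> sets borel}"
  define FB where "FB = sigma (space M) gB"
  define FXU where "FXU = sigma (space M) gXU"
  have gB_Pow: "gB \<subseteq> Pow (space M)" and gXU_Pow: "gXU \<subseteq> Pow (space M)" by (auto simp: gB_def gXU_def)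
  have FB: "sets FB = generated_sets M T B" "space FB = space M"
    using gB_Pow by (simp_all add: FB_def gB_def generated_sets_def)
  have FXU: "sets FXU = generated_sets M T (\<lambda>\<omega> x. (X \<omega> x, U \<omega> x))" "space FXU = space M"
    using gXU_Pow by (simp_all add: FXU_def gXU_def generated_sets_def)
  have B_FB: "B t \<in> borel_measurable FB" if "t \<in> {0..T}" for t
  proof (rule measurableI)
    fix A :: "real set" assume "A \<in> sets borel"
    then have "B t -` A \<inter> space M \<in> gB" using that unfolding gB_def by blast
    then show "B t -` A \<inter> space FB \<in> sets FB"
      unfolding FB(2) unfolding FB_def sets_measure_of[OF gB_Pow] by (rule sigma_sets.Basic)
  qed simp
  have XU_FXU: "(\<lambda>x. (X t x, U t x)) \<in> borel_measurable FXU" if "t \<in> {0..T}" for t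
  proof (rule measurableI)
    fix A :: "(real \<times> real) set" assume "A \<in> sets borel"
    then have "(\<lambda>x. (X t x, U t x)) -` A \<inter> space M \<in> gXU" using that unfolding gXU_def by blast
    then show "(\<lambda>x. (X t x, U t x)) -` A \<inter> space FXU \<in> sets FXU"
      unfolding FXU(2) unfolding FXU_def sets_measure_of[OF gXU_Pow] by (rule sigma_sets.Basic)
  qed simp
  have X_FXU: "X t \<in> borel_measurable FXU" and U_FXU: "U t \<in> borel_measurable FXU" if "t \<in> {0..T}" for t
  proof -
    have "(fst :: real \<times> real \<Rightarrow> real) \<in> borel_measurable borel" "(snd :: real \<times> real \<Rightarrow> real) \<in> borel_measurable borel"
      by (intro borel_measurable_continuous_onI continuous_intros)+
    from measurable_compose[OF XU_FXU[OF that] this(1)] measurable_compose[OF XU_FXU[OF that] this(2)]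
    show "X t \<in> borel_measurable FXU" "U t \<in> borel_measurable FXU" by simp_all
  qed
  let ?f = "\<lambda>x. \<Sum>t\<in>J. d t * B t x" and ?g = "\<lambda>x. \<Sum>t\<in>K. a t * X t x + b t * U t x"
  have f: "?f \<in> borel_measurable FB"
    using J by (intro borel_measurable_sum borel_measurable_times B_FB) auto
  have g: "?g \<in> borel_measurable FXU"
    using K by (intro borel_measurable_sum borel_measurable_add borel_measurable_times X_FXU U_FXU) auto
  have f': "sigma_sets (space M) {?f -` A \<inter> space M |A. A \<in> sets borel} \<subseteq> generated_sets M T B"
    unfolding FB(1)[symmetric] FB(2)[symmetric]
    by (intro sets.sigma_sets_subset) (use measurable_sets[OF f] in auto)
  have g': "sigma_sets (space M) {?g -` A \<inter> space M |A. A \<in> sets borel} \<subseteq> generated_sets M T (\<lambda>\<omega> x. (X \<omega> x, U \<omega> x))"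
    unfolding FXU(1)[symmetric] FXU(2)[symmetric]
    by (intro sets.sigma_sets_subset) (use measurable_sets[OF g] in auto)
  show ?thesis
    unfolding indep_var_eq
  proof (intro conjI)
    show "random_variable borel ?f"
      using J by (intro borel_measurable_sum borel_measurable_times B_meas) auto
    show "random_variable borel ?g"
      using K by (intro borel_measurable_sum borel_measurable_add borel_measurable_times X_meas U_meas) auto
    show "indep_set (sigma_sets (space M) {?f -` A \<inter> space M |A. A \<in> sets borel})
       (sigma_sets (space M) {?g -` A \<inter> space M |A. A \<in> sets borel})"
      using indep unfolding indep_set_def
      by (rule indep_sets_mono_sets) (use f' g' in \<open>auto split: bool.split\<close>)
  qed
qed

lemma combination_orthogonal:
  assumes J: "finite J" "J \<subseteq> {0..T}" and K: "finite K" "K \<subseteq> {0..T}"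
  shows "expectation (\<lambda>x. (\<Sum>t\<in>J. d t * B t x) * (\<Sum>t\<in>K. a t * X t x + b t * U t x)) = 0"
proof -
  have gB: "gaussian M (\<lambda>x. \<Sum>t\<in>J. d t * B t x) \<and> expectation (\<lambda>x. \<Sum>t\<in>J. d t * B t x) = 0"
    using brownian_motion_gaussian[OF B _ J] T by simp
  have "integrable M (\<lambda>x. \<Sum>t\<in>J. d t * B t x)"
    using gB by (auto simp: gaussian_def intro!: square_integrable_imp_integrable)
  moreover have "integrable M (\<lambda>x. \<Sum>t\<in>K. a t * X t x + b t * U t x)"
    using XU_combination(1)[OF K] by (auto simp: gaussian_def intro!: square_integrable_imp_integrable)
  ultimately show ?thesis
    using indep_var_lebesgue_integral[OF indep_combinations[OF J K]] gB by simp
qed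

lemma X_orthogonal_B: "s \<in> {0..T} \<Longrightarrow> t \<in> {0..T} \<Longrightarrow> expectation (\<lambda>x. X s x * B t x) = 0"
  using combination_orthogonal[of "{t}" "{s}" "\<lambda>_. 1" "\<lambda>_. 1" "\<lambda>_. 0"] by (simp add: mult.commute)

lemma U_orthogonal_B: "s \<in> {0..T} \<Longrightarrow> t \<in> {0..T} \<Longrightarrow> expectation (\<lambda>x. U s x * B t x) = 0"
  using combination_orthogonal[of "{t}" "{s}" "\<lambda>_. 1" "\<lambda>_. 0" "\<lambda>_. 1"] by (simp add: mult.commute)

definition combination :: "real set \<Rightarrow> (real \<Rightarrow> real \<times> real \<times> real) \<Rightarrow> 'w \<Rightarrow> real" where
  "combination J v x = (\<Sum>t\<in>J. v t \<bullet> (X t x, U t x, B t x))"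

lemma gaussian_combination:
  assumes J: "finite J" "J \<subseteq> {0..T}"
  shows "gaussian M (combination J v)"
proof -
  define a where "a t = fst (v t)" for t
  define b where "b t = fst (snd (v t))" for t
  define d where "d t = snd (snd (v t))" for t
  have v: "v t = (a t, b t, d t)" for t by (simp add: a_def b_def d_def)
  have eq: "combination J v = (\<lambda>x. (\<Sum>t\<in>J. d t * B t x) + (\<Sum>t\<in>J. a t * X t x + b t * U t x))"
    by (auto simp: combination_def v sum.distrib)
  show ?thesis
    unfolding eq
    using brownian_motion_gaussian[OF B _ J, of d] T
    by (intro gaussian_add_indep XU_combination(1) indep_combinations combination_orthogonal J) auto
qed

lemma combination_add:
  assumes "finite J" "finite K"
  shows "\<exists>w. \<forall>x. combination J v x + combination K u x = combination (J \<union> K) w x"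
proof -
  define w where "w t = (if t \<in> J then v t else 0) + (if t \<in> K then u t else 0)" for t
  have "combination (J \<union> K) w x = combination J v x + combination K u x" for x
  proof -
    let ?F = "\<lambda>t. (X t x, U t x, B t x)"
    have "combination (J \<union> K) w x
        = (\<Sum>t\<in>J \<union> K. (if t \<in> J then v t else 0) \<bullet> ?F t) + (\<Sum>t\<in>J \<union> K. (if t \<in> K then u t else 0) \<bullet> ?F t)"
      by (simp only: combination_def w_def inner_add_left sum.distrib)
    also have "(\<Sum>t\<in>J \<union> K. (if t \<in> J then v t else 0) \<bullet> ?F t) = combination J v x"
      unfolding combination_def using assms by (intro sum.mono_neutral_cong_right) auto
    also have "(\<Sum>t\<in>J \<union> K. (if t \<in> K then u t else 0) \<bullet> ?F t) = combination K u x"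
      unfolding combination_def using assms by (intro sum.mono_neutral_cong_right) auto
    finally show ?thesis .
  qed
  then show ?thesis by metis
qed

lemma combination_cmult: "c * combination J v x = combination J (\<lambda>t. c *\<^sub>R v t) x"
  by (simp add: combination_def sum_distrib_left)

lemma X_L2_continuous: "L2_continuous_on M {0..T} X"
proof (rule gaussian_process_L2_continuous[OF X_square_integrable])
  show "AE x in M. continuous_on {0..T} (\<lambda>t. X t x)"
    using XU_continuous unfolding continuous_process_def
    by eventually_elim (drule continuous_on_fst, simp)
  fix s t assume "s \<in> {0..T}" "t \<in> {0..T}"
  then show "gaussian M (\<lambda>x. X t x - X s x)"
    using XU_combination(1)[of "{s, t}" "\<lambda>r. if r = t then 1 else -1" "\<lambda>_. 0"] gaussian_AE_zero[of "\<lambda>_. 0"]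
    by (cases "s = t") auto
qed

lemma U_L2_continuous: "L2_continuous_on M {0..T} U"
proof (rule gaussian_process_L2_continuous[OF U_square_integrable])
  show "AE x in M. continuous_on {0..T} (\<lambda>t. U t x)"
    using XU_continuous unfolding continuous_process_def
    by eventually_elim (drule continuous_on_snd, simp)
  fix s t assume "s \<in> {0..T}" "t \<in> {0..T}"
  then show "gaussian M (\<lambda>x. U t x - U s x)"
    using XU_combination(1)[of "{s, t}" "\<lambda>_. 0" "\<lambda>r. if r = t then 1 else -1"] gaussian_AE_zero[of "\<lambda>_. 0"]
    by (cases "s = t") auto
qed

lemma B_L2_continuous: "L2_continuous_on M {0..T} B"
  by (rule bc_L2_continuous[OF B_covariance])

text \<open>Mean-square continuity reduces the span to countably many rational multiples of T, which
  makes sequential approximation available. Finite combinations are Gaussian by independence of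
  noise and signal, and so are their limits.\<close>

lemma closed_span_gaussian:
  assumes f: "f \<in> closed_span M base"
  shows "gaussian M f"
proof -
  define S where "S = range (\<lambda>n. X (T * unit_rat n)) \<union> range (\<lambda>n. U (T * unit_rat n)) \<union> range (\<lambda>n. B (T * unit_rat n))"
  have mem: "T * unit_rat n \<in> {0..T}" for n using T by (intro unit_rat_mult_mem) simp
  have "base \<subseteq> closed_span M S"
    using L2_continuous_on_closed_span[OF X_L2_continuous] L2_continuous_on_closed_span[OF U_L2_continuous]
      L2_continuous_on_closed_span[OF B_L2_continuous]
      closed_span_mono[of "range (\<lambda>n. X (T * unit_rat n))" S M] closed_span_mono[of "range (\<lambda>n. U (T * unit_rat n))" S M]
      closed_span_mono[of "range (\<lambda>n. B (T * unit_rat n))" S M]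
    unfolding S_def by blast
  then have f': "f \<in> closed_span M S" by (rule closed_span_trans[OF f])
  define W where "W = from_nat_into S"
  have "range W = S" unfolding W_def by (rule range_from_nat_into) (auto simp: S_def)
  have comb: "\<exists>J v. finite J \<and> J \<subseteq> {0..T} \<and> g = combination J v" if "g \<in> S" for g
  proof -
    obtain t where t: "t \<in> {0..T}" "g = X t \<or> g = U t \<or> g = B t"
      using \<open>g \<in> S\<close> mem unfolding S_def by blast
    have "combination {t} (\<lambda>_. (1, 0, 0)) = X t" "combination {t} (\<lambda>_. (0, 1, 0)) = U t"
      "combination {t} (\<lambda>_. (0, 0, 1)) = B t"
      by (auto simp: combination_def)
    with t show ?thesis by (metis empty_subsetI finite.emptyI finite.insertI insert_subset)
  qed
  have sq: "square_integrable M (W n)" for n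
  proof -
    have "W n \<in> S" using \<open>range W = S\<close> by blast
    then show ?thesis using comb gaussian_combination by (metis gaussian_def)
  qed
  obtain c where c: "L2_tendsto M (\<lambda>n x. \<Sum>j<n. c n j * W j x) f"
    using closed_span_range_approx[of W, OF sq] f' \<open>range W = S\<close> by blast
  \<comment> \<open>The partial sums are collected over one common finite set of times.\<close>
  have "\<exists>J v. finite J \<and> J \<subseteq> {0..T} \<and> (\<lambda>x. \<Sum>j<m. k j * W j x) = combination J v" for m and k :: "nat \<Rightarrow> real"
  proof (induction m)
    case 0
    show ?case by (rule exI[of _ "{}"]) (auto simp: combination_def)
  next
    case (Suc m)
    then obtain J v where J: "finite J" "J \<subseteq> {0..T}" "(\<lambda>x. \<Sum>j<m. k j * W j x) = combination J v" by blast
    have "W m \<in> S" using \<open>range W = S\<close> by blast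
    then obtain K u where K: "finite K" "K \<subseteq> {0..T}" "W m = combination K u" using comb by blast
    obtain w where "\<And>x. combination J v x + combination K (\<lambda>t. k m *\<^sub>R u t) x = combination (J \<union> K) w x"
      using combination_add[OF J(1) K(1)] by metis
    then have "(\<lambda>x. \<Sum>j<Suc m. k j * W j x) = combination (J \<union> K) w"
      using fun_cong[OF J(3)] by (simp add: K(3) combination_cmult fun_eq_iff)
    then show ?case using J K by (metis finite_UnI le_sup_iff)
  qed
  then have "gaussian M (\<lambda>x. \<Sum>j<n. c n j * W j x)" for n
    using gaussian_combination by metis
  then show ?thesis by (rule gaussian_limit[OF _ c])
qed

end

section \<open>Volterra kernels\<close>

lemma integral_lebesgue_on_FTC:
  fixes F f :: "real \<Rightarrow> real"
  assumes "0 \<le> s" and F: "\<And>x. DERIV F x :> f x" and f: "\<And>x. isCont f x"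
  shows "integrable (lebesgue_on {0..s}) f" "(LINT r|lebesgue_on {0..s}. f r) = F s - F 0"
proof -
  have f_borel: "f \<in> borel_measurable borel"
    by (intro borel_measurable_continuous_onI continuous_at_imp_continuous_on ballI f)
  have "has_bochner_integral lborel (\<lambda>x. f x * indicator {0..s} x) (F s - F 0)"
    using assms by (intro has_bochner_integral_FTC_Icc_real) auto
  then have *: "integrable lborel (\<lambda>x. f x * indicator {0..s} x)"
      "(LINT x|lborel. f x * indicator {0..s} x) = F s - F 0"
    by (auto simp: has_bochner_integral_iff)
  have m: "(\<lambda>x. f x * indicator {0..s} x) \<in> borel_measurable lborel" using f_borel by measurable
  have "integrable lebesgue (\<lambda>x. f x * indicator {0..s} x)"
    using *(1) integrable_completion[OF m] by simp
  then show "integrable (lebesgue_on {0..s}) f"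
    by (subst integrable_restrict_space) (simp_all add: mult.commute)
  have "(LINT r|lebesgue_on {0..s}. f r) = (LINT x|lebesgue. f x * indicator {0..s} x)"
    by (subst integral_restrict_space) (simp_all add: mult.commute)
  also have "\<dots> = F s - F 0" using integral_completion[OF m] *(2) by simp
  finally show "(LINT r|lebesgue_on {0..s}. f r) = F s - F 0" .
qed

lemma integral_lebesgue_on_power:
  assumes "0 \<le> s"
  shows "integrable (lebesgue_on {0..s}) (\<lambda>r. r ^ n)"
    and "(LINT r|lebesgue_on {0..s}. r ^ n) = s ^ Suc n / real (Suc n)"
proof -
  have d: "DERIV (\<lambda>x. x ^ Suc n / real (Suc n)) x :> x ^ n" for x :: real
    by (auto intro!: derivative_eq_intros simp del: power_Suc of_nat_Suc)
  have c: "isCont (\<lambda>x::real. x ^ n) x" for x by (intro continuous_intros)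
  show "integrable (lebesgue_on {0..s}) (\<lambda>r. r ^ n)"
    by (rule integral_lebesgue_on_FTC(1)[OF assms d c])
  show "(LINT r|lebesgue_on {0..s}. r ^ n) = s ^ Suc n / real (Suc n)"
    using integral_lebesgue_on_FTC(2)[OF assms d c] by simp
qed

text \<open>\<open>step\<close> accepts any integrable majorant b, so \<open>m\<close> itself may be
  non-measurable in time, and b must serve all indices j at once. Starting from the constant K, the
  majorants become K (C s)^n / n!, which tends to 0.\<close>

lemma gronwall_iteration:
  fixes m :: "'i \<Rightarrow> real \<Rightarrow> real"
  assumes C: "0 \<le> C" and bound: "\<And>i s. \<lbrakk>P i s; 0 \<le> s\<rbrakk> \<Longrightarrow> m i s \<le> K"
    and step: "\<And>i s b. \<lbrakk>P i s; 0 \<le> s; integrable (lebesgue_on {0..s}) b;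
        \<And>j r. \<lbrakk>P j r; 0 \<le> r; r \<le> s\<rbrakk> \<Longrightarrow> m j r \<le> b r\<rbrakk> \<Longrightarrow>
        m i s \<le> C * (LINT r|lebesgue_on {0..s}. b r)"
    and P: "P i s" "0 \<le> s"
  shows "m i s \<le> 0"
proof -
  have "\<forall>i s. P i s \<longrightarrow> 0 \<le> s \<longrightarrow> m i s \<le> K * ((C * s) ^ n / fact n)" for n
  proof (induction n)
    case 0
    then show ?case using bound by simp
  next
    case (Suc n)
    show ?case
    proof (intro allI impI)
      fix i s assume i: "P i s" "0 \<le> s"
      have int: "integrable (lebesgue_on {0..s}) (\<lambda>r. K * C ^ n / fact n * r ^ n)"
        by (intro integrable_mult_right integral_lebesgue_on_power(1) i)
      have "m i s \<le> C * (LINT r|lebesgue_on {0..s}. K * C ^ n / fact n * r ^ n)"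
      proof (rule step[OF i int])
        fix j r assume "P j r" "0 \<le> r"
        with Suc have "m j r \<le> K * ((C * r) ^ n / fact n)" by blast
        then show "m j r \<le> K * C ^ n / fact n * r ^ n" by (simp add: power_mult_distrib mult.assoc)
      qed
      also have "\<dots> = C * (K * C ^ n / fact n * (s ^ Suc n / real (Suc n)))"
        by (simp only: integral_mult_right_zero integral_lebesgue_on_power(2)[OF i(2)])
      also have "\<dots> = K * ((C * s) ^ Suc n / fact (Suc n))"
        by (simp add: power_mult_distrib mult_ac)
      finally show "m i s \<le> K * ((C * s) ^ Suc n / fact (Suc n))" .
    qed
  qed
  then have "m i s \<le> K * ((C * s) ^ n / fact n)" for n using P by blast
  moreover have "(\<lambda>n. K * ((C * s) ^ n / fact n)) \<longlonglongrightarrow> 0"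
    using summable_LIMSEQ_zero[OF summable_exp[of "C * s"]]
    by (intro tendsto_mult_right_zero) (simp add: divide_inverse mult.commute)
  ultimately show ?thesis using LIMSEQ_le_const by blast
qed

section \<open>Bounded Volterra kernels and the adjoint transform\<close>

lemma abs_mult_le_mult: "0 \<le> (K::real) \<Longrightarrow> \<bar>a\<bar> \<le> K \<Longrightarrow> \<bar>b\<bar> \<le> L \<Longrightarrow> \<bar>a * b\<bar> \<le> K * L"
  by (simp add: abs_mult mult_mono')

lemma square_add_le: "(a + b)\<^sup>2 \<le> 2 * a\<^sup>2 + 2 * (b::real)\<^sup>2"
  using zero_le_power2[of "a - b"] by (simp add: power2_sum power2_diff)

locale volterra_kernel =
  fixes T K :: real and l :: "real \<Rightarrow> real \<Rightarrow> real"
  assumes T: "0 < T"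
    and l_meas: "(\<lambda>(t, s). l t s) \<in> borel_measurable (restrict_space borel ({0..T} \<times> {0..T}))"
    and l_bound: "\<And>t s. t \<in> {0..T} \<Longrightarrow> s \<in> {0..T} \<Longrightarrow> \<bar>l t s\<bar> \<le> K"
    and l_zero: "\<And>t s. t \<in> {0..T} \<Longrightarrow> s \<in> {0..T} \<Longrightarrow> t < s \<Longrightarrow> l t s = 0"
begin

lemma K_nonneg: "0 \<le> K"
  using l_bound[of 0 0] T by auto

lemma l_measurable_compose:
  assumes "f \<in> borel_measurable N" "g \<in> borel_measurable N"
    "\<And>x. x \<in> space N \<Longrightarrow> f x \<in> {0..T}" "\<And>x. x \<in> space N \<Longrightarrow> g x \<in> {0..T}"
  shows "(\<lambda>x. l (f x) (g x)) \<in> borel_measurable N"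
proof -
  have "(\<lambda>x. (f x, g x)) \<in> N \<rightarrow>\<^sub>M restrict_space borel ({0..T} \<times> {0..T})"
    using assms by (intro measurable_restrict_space2 borel_measurable_Pair) auto
  from measurable_compose[OF this l_meas] show ?thesis by simp
qed

lemma l_section: "t \<in> {0..T} \<Longrightarrow> s \<le> T \<Longrightarrow> l t \<in> borel_measurable (lebesgue_on {0..s})"
  using l_measurable_compose[of "\<lambda>_. t" "lebesgue_on {0..s}" "\<lambda>u. u"]
  by (simp add: borel_measurable_lebesgue_onI)

lemma l_section_bounded: "t \<in> {0..T} \<Longrightarrow> s \<le> T \<Longrightarrow> square_integrable (lebesgue_on {0..s}) (l t)"
  by (intro finite_measure.square_integrable_bounded[where K=K] l_section) (auto intro: l_bound)

lemma l_pair: "s \<le> T \<Longrightarrow> s' \<le> T \<Longrightarrow> (\<lambda>(r, u). l r u) \<in> borel_measurable (lebesgue_on {0..s} \<Otimes>\<^sub>M lebesgue_on {0..s'})"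
  unfolding split_beta'
  by (intro l_measurable_compose measurable_compose[OF measurable_fst] measurable_compose[OF measurable_snd]
      borel_measurable_lebesgue_onI measurable_ident)
     (auto simp: space_pair_measure)

lemma integral_l_stop:
  assumes "0 \<le> r" "r \<le> s" "s \<le> t" "t \<le> T"
  shows "(LINT u|lebesgue_on {0..t}. l r u) = (LINT u|lebesgue_on {0..s}. l r u)"
proof -
  have a: "0 \<le> t" "0 \<le> s" "s \<le> T" using assms by auto
  show ?thesis
    unfolding integral_lebesgue_on_eq_indicator[OF a(1) assms(4)] integral_lebesgue_on_eq_indicator[OF a(2,3)]
    using assms by (intro Bochner_Integration.integral_cong refl) (auto simp: indicator_def l_zero)
qed

context
  fixes k :: "real \<Rightarrow> real" and Kk :: real
  assumes k: "k \<in> borel_measurable borel" and k_bound: "\<And>r. \<bar>k r\<bar> \<le> Kk"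
begin

text \<open>Integrating k against V = B - \<integral> \<alpha> ds and exchanging the integrals gives
  an integral against B whose integrand is this function: the identity minus the adjoint of the
  Volterra operator with kernel l.\<close>

definition adjoint_transform :: "real \<Rightarrow> real" where
  "adjoint_transform u = k u - (LINT r|lebesgue_on {0..T}. l r u * k r)"

lemma adjoint_square_integrable:
  assumes "u \<in> {0..T}"
  shows "square_integrable (lebesgue_on {0..T}) (\<lambda>r. l r u)"
  using assms
  by (intro finite_measure.square_integrable_bounded[where K=K] l_measurable_compose borel_measurable_lebesgue_onI)
     (auto intro: l_bound)

lemma k_square_integrable: "square_integrable (lebesgue_on {0..s}) k"
  by (intro finite_measure.square_integrable_bounded[where K=Kk] borel_measurable_lebesgue_onI k) (auto intro: k_bound)

lemma adjoint_transform_square_integrable: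
  assumes "s \<le> T"
  shows "square_integrable (lebesgue_on {0..s}) adjoint_transform"
proof -
  interpret L: finite_measure "lebesgue_on {0..T}" by simp
  have meas: "(\<lambda>u. LINT r|lebesgue_on {0..T}. l r u * k r) \<in> borel_measurable (lebesgue_on {0..s})"
  proof (rule L.borel_measurable_lebesgue_integral)
    have "(\<lambda>p. l (snd p) (fst p)) \<in> borel_measurable (lebesgue_on {0..s} \<Otimes>\<^sub>M lebesgue_on {0..T})"
      using assms by (intro l_measurable_compose measurable_compose[OF measurable_fst] measurable_compose[OF measurable_snd]
          borel_measurable_lebesgue_onI measurable_ident) (auto simp: space_pair_measure)
    moreover have "(\<lambda>p. k (snd p)) \<in> borel_measurable (lebesgue_on {0..s} \<Otimes>\<^sub>M lebesgue_on {0..T})"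
      by (intro measurable_compose[OF measurable_snd] borel_measurable_lebesgue_onI k)
    ultimately show "(\<lambda>(u, r). l r u * k r) \<in> borel_measurable (lebesgue_on {0..s} \<Otimes>\<^sub>M lebesgue_on {0..T})"
      by (simp add: split_beta')
  qed
  have Kk: "0 \<le> Kk" using k_bound[of 0] by linarith
  have "\<bar>LINT r|lebesgue_on {0..T}. l r u * k r\<bar> \<le> K * Kk * T" if "u \<in> {0..s}" for u
  proof -
    have u: "u \<in> {0..T}" using that assms by auto
    have int: "integrable (lebesgue_on {0..T}) (\<lambda>r. l r u * k r)"
      by (rule square_integrable_mult[OF adjoint_square_integrable[OF u] k_square_integrable])
    have "\<bar>LINT r|lebesgue_on {0..T}. l r u * k r\<bar> \<le> (LINT r|lebesgue_on {0..T}. \<bar>l r u * k r\<bar>)"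
      by (rule integral_abs_bound)
    also have "\<dots> \<le> (LINT r|lebesgue_on {0..T}. K * Kk)"
      using int l_bound u k_bound K_nonneg by (intro integral_mono) (auto intro!: abs_mult_le_mult)
    also have "\<dots> = K * Kk * T" using T by (simp add: measure_restrict_space)
    finally show ?thesis .
  qed
  then have "square_integrable (lebesgue_on {0..s}) (\<lambda>u. LINT r|lebesgue_on {0..T}. l r u * k r)"
    by (intro finite_measure.square_integrable_bounded[where K="K * Kk * T"] meas) auto
  then show ?thesis
    unfolding adjoint_transform_def[abs_def] by (intro square_integrable_diff k_square_integrable)
qed

lemma integral_adjoint_transform:
  assumes "0 \<le> s" "s \<le> T"
  shows "(LINT u|lebesgue_on {0..s}. adjoint_transform u)
    = (LINT r|lebesgue_on {0..s}. k r) - (LINT r|lebesgue_on {0..T}. (LINT u|lebesgue_on {0..s}. l r u) * k r)"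
proof -
  interpret L: finite_measure "lebesgue_on {0..T}" by simp
  interpret S: finite_measure "lebesgue_on {0..s}" by simp
  interpret P: pair_sigma_finite "lebesgue_on {0..T}" "lebesgue_on {0..s}" by unfold_locales
  interpret F: finite_measure "lebesgue_on {0..T} \<Otimes>\<^sub>M lebesgue_on {0..s}"
    by (rule finite_measure_pair_measure) simp_all
  have meas: "(\<lambda>(r, u). l r u * k r) \<in> borel_measurable (lebesgue_on {0..T} \<Otimes>\<^sub>M lebesgue_on {0..s})"
    using l_pair[of T s] assms
      measurable_compose[OF measurable_fst borel_measurable_lebesgue_onI[OF k], of "{0..T}" "lebesgue_on {0..s}"]
    by (simp add: split_beta')
  have "integrable (lebesgue_on {0..T} \<Otimes>\<^sub>M lebesgue_on {0..s}) (\<lambda>(r, u). l r u * k r)"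
  proof (rule F.integrable_const_bound[OF _ meas, where B="K * Kk"])
    show "AE p in lebesgue_on {0..T} \<Otimes>\<^sub>M lebesgue_on {0..s}. norm (case p of (r, u) \<Rightarrow> l r u * k r) \<le> K * Kk"
      using l_bound k_bound K_nonneg assms
      by (intro AE_I2) (auto simp: space_pair_measure intro!: abs_mult_le_mult)
  qed
  from P.Fubini_integral[OF this]
  have "(LINT u|lebesgue_on {0..s}. LINT r|lebesgue_on {0..T}. l r u * k r)
      = (LINT r|lebesgue_on {0..T}. (LINT u|lebesgue_on {0..s}. l r u) * k r)" by simp
  moreover have "integrable (lebesgue_on {0..s}) (\<lambda>u. LINT r|lebesgue_on {0..T}. l r u * k r)"
    using S.square_integrable_imp_integrable[OF square_integrable_diff[OF k_square_integrable adjoint_transform_square_integrable[OF assms(2)]]]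
    by (simp add: adjoint_transform_def)
  ultimately show ?thesis
    unfolding adjoint_transform_def[abs_def]
    using S.square_integrable_imp_integrable[OF k_square_integrable] by simp
qed

text \<open>The weight \<open>exp (c u)\<close> turns the Volterra part of the transform into a small perturbation.\<close>

lemma volterra_lower_bound:
  "(LINT r|lebesgue_on {0..T}. (k r)\<^sup>2)
     \<le> 4 * exp ((4 * K\<^sup>2 * T + 1) * T) * (LINT r|lebesgue_on {0..T}. (adjoint_transform r)\<^sup>2)"
proof -
  let ?L = "lebesgue_on {0..T}"
  \<comment> \<open>Chosen such that the factor 2 K^2 T / c of the Volterra part is at most 1/2;
    that part is then absorbed on the left, which doubles the constant 2 to 4.\<close>
  define c where "c = 4 * K\<^sup>2 * T + 1"
  have c: "0 < c" using T by (simp add: c_def add_nonneg_pos)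
  interpret L: finite_measure ?L by simp
  interpret P: pair_sigma_finite ?L ?L by unfold_locales
  interpret F: finite_measure "?L \<Otimes>\<^sub>M ?L"
    by (rule finite_measure_pair_measure) simp_all
  note [measurable] = k
  have Kk: "0 \<le> Kk" using k_bound[of 0] by linarith
  have exp_meas: "(\<lambda>u. exp (c * u)) \<in> borel_measurable ?L"
    by (rule borel_measurable_lebesgue_onI) measurable
  have exp_bound: "exp (c * u) \<le> exp (c * T)" if "u \<in> {0..T}" for u using that c by auto
  have wint: "integrable ?L (\<lambda>u. exp (c * u) * f u)" if "integrable ?L f" for f
  proof (rule Bochner_Integration.integrable_bound)
    show "integrable ?L (\<lambda>u. exp (c * T) * f u)" using that by simp
    show "(\<lambda>u. exp (c * u) * f u) \<in> borel_measurable ?L" using that exp_meas by auto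
    show "AE u in ?L. norm (exp (c * u) * f u) \<le> norm (exp (c * T) * f u)"
      using exp_bound by (intro AE_I2) (auto simp: abs_mult intro!: mult_right_mono)
  qed
  have k2: "integrable ?L (\<lambda>u. (k u)\<^sup>2)" using k_square_integrable[of T] by (simp add: square_integrable_def)
  have kt2: "integrable ?L (\<lambda>u. (adjoint_transform u)\<^sup>2)"
    using adjoint_transform_square_integrable[of T] by (simp add: square_integrable_def)
  let ?tail = "\<lambda>u. LINT r|?L. of_bool (u \<le> r) * (k r)\<^sup>2"
  have pair_meas: "(\<lambda>(r, u). exp (c * u) * (of_bool (u \<le> r) * (k r)\<^sup>2)) \<in> borel_measurable (?L \<Otimes>\<^sub>M ?L)"
  proof -
    have [measurable]: "fst \<in> borel_measurable (?L \<Otimes>\<^sub>M ?L)" "snd \<in> borel_measurable (?L \<Otimes>\<^sub>M ?L)"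
      using measurable_compose[OF measurable_fst borel_measurable_lebesgue_onI[OF measurable_ident]]
        measurable_compose[OF measurable_snd borel_measurable_lebesgue_onI[OF measurable_ident]] by auto
    show ?thesis unfolding split_beta' by measurable
  qed
  have pair: "integrable (?L \<Otimes>\<^sub>M ?L) (\<lambda>(r, u). exp (c * u) * (of_bool (u \<le> r) * (k r)\<^sup>2))"
  proof (rule F.integrable_const_bound[OF _ pair_meas, where B="exp (c * T) * Kk\<^sup>2"])
    have "(k r)\<^sup>2 \<le> Kk\<^sup>2" for r using power_mono[OF k_bound[of r], of 2] by simp
    then show "AE p in ?L \<Otimes>\<^sub>M ?L. norm (case p of (r, u) \<Rightarrow> exp (c * u) * (of_bool (u \<le> r) * (k r)\<^sup>2)) \<le> exp (c * T) * Kk\<^sup>2"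
      using exp_bound less_imp_le[OF c] by (intro AE_I2) (auto simp: space_pair_measure intro!: mult_mono)
  qed
  have tail_int: "integrable ?L (\<lambda>u. exp (c * u) * ?tail u)"
    using P.integrable_snd[OF pair] by simp
  \<comment> \<open>After exchanging the order of integration, the inner integral of exp(c u) over
    [0, r] is at most exp(c r) / c; this is where the gain 1/c originates.\<close>
  have tail: "(LINT u|?L. exp (c * u) * ?tail u) \<le> (LINT r|?L. exp (c * r) * (k r)\<^sup>2) / c"
  proof -
    have "(LINT u|?L. exp (c * u) * ?tail u) = (LINT u|?L. LINT r|?L. exp (c * u) * (of_bool (u \<le> r) * (k r)\<^sup>2))"
      by simp
    also have "\<dots> = (LINT r|?L. LINT u|?L. exp (c * u) * (of_bool (u \<le> r) * (k r)\<^sup>2))"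
      by (rule P.Fubini_integral[OF pair])
    also have "\<dots> \<le> (LINT r|?L. exp (c * r) * (k r)\<^sup>2 / c)"
    proof (rule integral_mono)
      show "integrable ?L (\<lambda>r. LINT u|?L. exp (c * u) * (of_bool (u \<le> r) * (k r)\<^sup>2))"
        using P.integrable_fst[OF pair] by simp
      show "integrable ?L (\<lambda>r. exp (c * r) * (k r)\<^sup>2 / c)" using wint[OF k2] by simp
      fix r assume "r \<in> space ?L"
      then have r: "0 \<le> r" "r \<le> T" by auto
      have d: "DERIV (\<lambda>u. exp (c * u) / c) u :> exp (c * u)" for u
        using c by (auto intro!: derivative_eq_intros)
      have "(LINT u|?L. exp (c * u) * (of_bool (u \<le> r) * (k r)\<^sup>2))
          = (k r)\<^sup>2 * (LINT u|?L. of_bool (u \<le> r) * exp (c * u))"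
        by (simp flip: integral_mult_right_zero add: mult_ac)
      also have "(LINT u|?L. of_bool (u \<le> r) * exp (c * u)) = (LINT u|?L. indicator {0<..r} u * exp (c * u))"
      proof (rule integral_cong_AE)
        have n0: "AE u in ?L. u \<noteq> 0"
          by (rule AE_restrict_space_iff[THEN iffD2])
             (use AE_completion[OF AE_lborel_singleton[of "0::real"]] in \<open>auto elim: eventually_mono\<close>)
        have "AE u in ?L. u \<in> {0..T}" by (rule AE_I2) simp
        then show "AE u in ?L. of_bool (u \<le> r) * exp (c * u) = indicator {0<..r} u * exp (c * u)"
          using n0 by eventually_elim (auto simp: indicator_def)
      qed (rule borel_measurable_lebesgue_onI, measurable)+
      also have "\<dots> = exp (c * r) / c - exp (c * 0) / c"
        using integral_lebesgue_on_FTC(2)[OF r(1) d] integral_lebesgue_on_eq_indicator[OF r] by simp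
      also have "(k r)\<^sup>2 * (exp (c * r) / c - exp (c * 0) / c) \<le> (k r)\<^sup>2 * (exp (c * r) / c)"
        using c by (intro mult_left_mono) auto
      finally show "(LINT u|?L. exp (c * u) * (of_bool (u \<le> r) * (k r)\<^sup>2)) \<le> exp (c * r) * (k r)\<^sup>2 / c"
        by (simp add: mult.commute)
    qed
    finally show ?thesis by simp
  qed
  \<comment> \<open>As \<open>l r u\<close> vanishes for r < u, only the values of k beyond u enter
    the integral, so Cauchy-Schwarz produces the tail of k instead of its full norm.\<close>
  have pointwise: "(k u)\<^sup>2 \<le> 2 * (adjoint_transform u)\<^sup>2 + 2 * (K\<^sup>2 * T * ?tail u)" if u: "u \<in> {0..T}" for u
  proof -
    have trunc: "square_integrable ?L (\<lambda>r. of_bool (u \<le> r) * k r)"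
      by (intro L.square_integrable_bounded[where K=Kk] borel_measurable_lebesgue_onI)
         (use k_bound Kk in auto)
    have "(LINT r|?L. l r u * k r) = (LINT r|?L. l r u * (of_bool (u \<le> r) * k r))"
      using u by (intro Bochner_Integration.integral_cong) (auto simp: l_zero)
    then have "(LINT r|?L. l r u * k r)\<^sup>2 \<le> (LINT r|?L. (l r u)\<^sup>2) * (LINT r|?L. (of_bool (u \<le> r) * k r)\<^sup>2)"
      using Cauchy_Schwarz_integral[OF adjoint_square_integrable[OF u] trunc] by simp
    also have "(LINT r|?L. (of_bool (u \<le> r) * k r)\<^sup>2) = ?tail u"
      by (intro Bochner_Integration.integral_cong) auto
    also have "(LINT r|?L. (l r u)\<^sup>2) * ?tail u \<le> (K\<^sup>2 * T) * ?tail u"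
    proof (rule mult_right_mono)
      have "(LINT r|?L. (l r u)\<^sup>2) \<le> (LINT r|?L. K\<^sup>2)"
        using adjoint_square_integrable[OF u] power_mono[OF l_bound[OF _ u], of _ 2]
        by (intro integral_mono) (auto simp: square_integrable_def)
      also have "\<dots> = K\<^sup>2 * T" using T by (simp add: measure_restrict_space)
      finally show "(LINT r|?L. (l r u)\<^sup>2) \<le> K\<^sup>2 * T" .
      show "0 \<le> ?tail u" by (intro Bochner_Integration.integral_nonneg) auto
    qed
    finally show ?thesis
      using square_add_le[of "adjoint_transform u" "LINT r|?L. l r u * k r"]
      by (simp add: adjoint_transform_def)
  qed
  define E where "E = (LINT u|?L. exp (c * u) * (k u)\<^sup>2)"
  have "E \<le> (LINT u|?L. exp (c * u) * (2 * (adjoint_transform u)\<^sup>2) + 2 * K\<^sup>2 * T * (exp (c * u) * ?tail u))"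
    unfolding E_def
  proof (rule integral_mono)
    show "integrable ?L (\<lambda>u. exp (c * u) * (2 * (adjoint_transform u)\<^sup>2) + 2 * K\<^sup>2 * T * (exp (c * u) * ?tail u))"
      by (intro Bochner_Integration.integrable_add wint integrable_mult_right kt2 tail_int)
    fix u assume "u \<in> space ?L"
    then have "exp (c * u) * (k u)\<^sup>2 \<le> exp (c * u) * (2 * (adjoint_transform u)\<^sup>2 + 2 * (K\<^sup>2 * T * ?tail u))"
      by (intro mult_left_mono pointwise) auto
    then show "exp (c * u) * (k u)\<^sup>2 \<le> exp (c * u) * (2 * (adjoint_transform u)\<^sup>2) + 2 * K\<^sup>2 * T * (exp (c * u) * ?tail u)"
      by (simp only: distrib_left mult_ac)
  qed (rule wint[OF k2])
  also have "\<dots> = 2 * (LINT u|?L. exp (c * u) * (adjoint_transform u)\<^sup>2) + 2 * K\<^sup>2 * T * (LINT u|?L. exp (c * u) * ?tail u)"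
    using Bochner_Integration.integral_add[OF integrable_mult_right[OF wint[OF kt2]] integrable_mult_right[OF tail_int], of 2 "2 * K\<^sup>2 * T"]
    by (simp only: integral_mult_right_zero mult.left_commute[of "exp _" 2])
  also have "\<dots> \<le> 2 * (exp (c * T) * (LINT u|?L. (adjoint_transform u)\<^sup>2)) + 2 * K\<^sup>2 * T * (E / c)"
  proof (intro add_mono mult_left_mono)
    have "(LINT u|?L. exp (c * u) * (adjoint_transform u)\<^sup>2) \<le> (LINT u|?L. exp (c * T) * (adjoint_transform u)\<^sup>2)"
      by (intro integral_mono wint kt2 integrable_mult_right mult_right_mono exp_bound) auto
    then show "(LINT u|?L. exp (c * u) * (adjoint_transform u)\<^sup>2) \<le> exp (c * T) * (LINT u|?L. (adjoint_transform u)\<^sup>2)"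
      by simp
    show "(LINT u|?L. exp (c * u) * ?tail u) \<le> E / c" using tail by (simp add: E_def)
  qed (use T in auto)
  finally have "E \<le> 2 * (exp (c * T) * (LINT u|?L. (adjoint_transform u)\<^sup>2)) + 2 * K\<^sup>2 * T * (E / c)" .
  moreover have "2 * K\<^sup>2 * T * (E / c) \<le> E / 2"
  proof -
    have "0 \<le> E" unfolding E_def by (intro Bochner_Integration.integral_nonneg) auto
    then have "4 * K\<^sup>2 * T * E \<le> c * E" by (intro mult_right_mono) (auto simp: c_def)
    then show ?thesis using c by (simp add: field_simps)
  qed
  moreover have "(LINT r|?L. (k r)\<^sup>2) \<le> E"
    unfolding E_def
  proof (rule integral_mono[OF k2 wint[OF k2]])
    fix u assume "u \<in> space ?L"
    then have "1 \<le> exp (c * u)" using c by simp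
    then show "(k u)\<^sup>2 \<le> exp (c * u) * (k u)\<^sup>2" using mult_right_mono[of 1 "exp (c * u)" "(k u)\<^sup>2"] by simp
  qed
  ultimately show ?thesis by (simp add: c_def)
qed

end

end

section \<open>Innovations\<close>

lemma (in prob_space) process_integral_L2_continuous:
  fixes W :: "real \<Rightarrow> 'a \<Rightarrow> real"
  assumes W: "measurable_process M T W"
    and W_sq: "\<And>t. t \<in> {0..T} \<Longrightarrow> square_integrable M (W t)"
    and W_bound: "\<And>t. t \<in> {0..T} \<Longrightarrow> expectation (\<lambda>x. (W t x)\<^sup>2) \<le> K"
  shows "L2_continuous_on M {0..T} (\<lambda>t x. LINT r|lebesgue_on {0..t}. W r x)"
  unfolding L2_continuous_on_def L2_tendsto_def
proof (intro allI impI conjI)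
  fix s and r :: "nat \<Rightarrow> real" assume *: "(\<forall>k. r k \<in> {0..T}) \<and> s \<in> {0..T} \<and> r \<longlonglongrightarrow> s"
  show "square_integrable M (\<lambda>x. LINT q|lebesgue_on {0..s}. W q x)"
    "square_integrable M (\<lambda>x. LINT q|lebesgue_on {0..r k}. W q x)" for k
    using * by (auto intro!: process_integral_square_integrable[OF W W_sq W_bound])
  let ?J = "\<lambda>t x. LINT q|lebesgue_on {0..t}. W q x"
  have le: "expectation (\<lambda>x. (?J t x - ?J u x)\<^sup>2) \<le> K * (t - u)\<^sup>2" if "t \<in> {0..T}" "u \<in> {0..T}" for t u
  proof (cases "u \<le> t")
    case True
    show ?thesis
      by (rule process_integral_increment_le[OF W W_sq W_bound]) (use True that in auto)
  next
    case False
    have "expectation (\<lambda>x. (?J u x - ?J t x)\<^sup>2) \<le> K * (u - t)\<^sup>2"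
      by (rule process_integral_increment_le[OF W W_sq W_bound]) (use False that in auto)
    then show ?thesis by (simp add: power2_commute)
  qed
  show "(\<lambda>k. expectation (\<lambda>x. (?J (r k) x - ?J s x)\<^sup>2)) \<longlonglongrightarrow> 0"
  proof (rule Lim_null_comparison)
    show "\<forall>\<^sub>F k in sequentially. norm (expectation (\<lambda>x. (?J (r k) x - ?J s x)\<^sup>2)) \<le> K * (r k - s)\<^sup>2"
      using le * by (intro always_eventually allI) simp
    have "(\<lambda>k. K * (r k - s)\<^sup>2) \<longlonglongrightarrow> K * (s - s)\<^sup>2"
      using * by (intro tendsto_intros) auto
    then show "(\<lambda>k. K * (r k - s)\<^sup>2) \<longlonglongrightarrow> 0" by simp
  qed
qed

text \<open>Increments of order 3/2 have difference quotients of order 1/2, so the derivative is 0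
  everywhere.\<close>

lemma constant_if_small_increments:
  fixes \<phi> :: "real \<Rightarrow> real"
  assumes inc: "\<And>s t. \<lbrakk>0 \<le> s; s \<le> t; t \<le> T\<rbrakk> \<Longrightarrow> \<bar>\<phi> t - \<phi> s\<bar> \<le> C * ((t - s) * sqrt (t - s))"
    and t: "t \<in> {0..T}"
  shows "\<phi> t = \<phi> 0"
proof -
  have "(\<phi> has_field_derivative 0) (at x within {0..T})" if x: "x \<in> {0..T}" for x
    unfolding has_field_derivative_iff
  proof (rule Lim_null_comparison)
    have "norm ((\<phi> y - \<phi> x) / (y - x)) \<le> C * sqrt \<bar>y - x\<bar>" if y: "y \<in> {0..T}" "y \<noteq> x" for y
    proof -
      have "\<bar>\<phi> y - \<phi> x\<bar> \<le> C * (\<bar>y - x\<bar> * sqrt \<bar>y - x\<bar>)"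
      proof (cases "x \<le> y")
        case True
        then show ?thesis using inc[of x y] x y by simp
      next
        case False
        then show ?thesis using inc[of y x] x y by (simp add: abs_minus_commute)
      qed
      then show ?thesis using y by (simp add: divide_le_eq mult.assoc mult.commute[of "sqrt _"])
    qed
    then show "\<forall>\<^sub>F y in at x within {0..T}. norm ((\<phi> y - \<phi> x) / (y - x)) \<le> C * sqrt \<bar>y - x\<bar>"
      by (auto simp: eventually_at_filter intro!: always_eventually)
    have "((\<lambda>y. C * sqrt \<bar>y - x\<bar>) \<longlongrightarrow> C * sqrt \<bar>x - x\<bar>) (at x within {0..T})"
      by (intro tendsto_intros)
    then show "((\<lambda>y. C * sqrt \<bar>y - x\<bar>) \<longlongrightarrow> 0) (at x within {0..T})" by simp
  qed
  then obtain c where "\<And>x. x \<in> {0..T} \<Longrightarrow> \<phi> x = c"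
    using has_field_derivative_zero_constant[of "{0..T}" \<phi>] by auto
  then show ?thesis using t by auto
qed

text \<open>Second-order data of an observation with drift \<theta>. In the application \<theta> is
  \<mu> X - \<alpha>, with X independent of B, so the correlation of \<theta>(r) with B(s) in
  \<open>\<theta>_B\<close> comes from \<alpha> alone; \<theta>h is a measurable version of the
  projection of the drift.\<close>

locale innovation = prob_space M + volterra_kernel T Kl l
  for M :: "'w measure" and T Kl :: real and l :: "real \<Rightarrow> real \<Rightarrow> real" +
  fixes B \<theta> Y \<theta>h \<nu> :: "real \<Rightarrow> 'w \<Rightarrow> real" and K :: real
  assumes B: "brownian_covariance M T B"
    and \<theta>: "measurable_process M T \<theta>"
    and \<theta>_sq: "\<And>t. t \<in> {0..T} \<Longrightarrow> square_integrable M (\<theta> t)"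
    and \<theta>_bound: "\<And>t. t \<in> {0..T} \<Longrightarrow> expectation (\<lambda>x. (\<theta> t x)\<^sup>2) \<le> K"
    and \<theta>_B: "\<And>r s. r \<in> {0..T} \<Longrightarrow> s \<in> {0..T} \<Longrightarrow>
        expectation (\<lambda>x. \<theta> r x * B s x) = - (LINT u|lebesgue_on {0..s}. l r u)"
    and Y_def: "\<And>t x. Y t x = B t x + (LINT r|lebesgue_on {0..t}. \<theta> r x)"
    and \<theta>h: "measurable_process M T \<theta>h"
    and \<theta>h_span: "\<And>t. t \<in> {0..T} \<Longrightarrow> \<theta>h t \<in> closed_span M (Y ` {0..t})"
    and \<theta>h_orth: "\<And>s t. 0 \<le> s \<Longrightarrow> s \<le> t \<Longrightarrow> t \<le> T \<Longrightarrow> expectation (\<lambda>x. Y s x * (\<theta> t x - \<theta>h t x)) = 0"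
    and \<nu>_def: "\<And>t x. \<nu> t x = Y t x - (LINT r|lebesgue_on {0..t}. \<theta>h r x)"
begin

lemma B_sq: "t \<in> {0..T} \<Longrightarrow> square_integrable M (B t)"
  by (rule bc_square_integrable[OF B])

lemma J_sq: "t \<in> {0..T} \<Longrightarrow> square_integrable M (\<lambda>x. LINT r|lebesgue_on {0..t}. \<theta> r x)"
  by (rule process_integral_square_integrable[OF \<theta> \<theta>_sq \<theta>_bound])

lemma Y_eq: "Y = (\<lambda>t x. B t x + (LINT r|lebesgue_on {0..t}. \<theta> r x))"
  by (simp add: Y_def fun_eq_iff)

lemma \<nu>_eq: "\<nu> = (\<lambda>t x. Y t x - (LINT r|lebesgue_on {0..t}. \<theta>h r x))"
  by (simp add: \<nu>_def fun_eq_iff)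

lemma Y_sq: "t \<in> {0..T} \<Longrightarrow> square_integrable M (Y t)"
  unfolding Y_eq by (intro square_integrable_add B_sq J_sq)

lemma \<theta>h_sq: "t \<in> {0..T} \<Longrightarrow> square_integrable M (\<theta>h t)"
  by (rule closed_spanD(1)[OF \<theta>h_span])

lemma Y_L2_continuous: "L2_continuous_on M {0..T} Y"
proof -
  have "L2_continuous_on M {0..T} (\<lambda>t x. LINT r|lebesgue_on {0..t}. \<theta> r x)"
    by (rule process_integral_L2_continuous[OF \<theta> \<theta>_sq \<theta>_bound])
  with bc_L2_continuous[OF B] show ?thesis
    unfolding L2_continuous_on_def Y_eq by (auto intro!: L2_tendsto_add)
qed

definition e :: "real \<Rightarrow> 'w \<Rightarrow> real" where
  "e t x = \<theta> t x - \<theta>h t x"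

lemma e_process: "measurable_process M T e"
  unfolding e_def[abs_def] by (rule measurable_process_diff[OF \<theta> \<theta>h])

lemma e_sq: "t \<in> {0..T} \<Longrightarrow> square_integrable M (e t)"
  unfolding e_def[abs_def] by (intro square_integrable_diff \<theta>_sq \<theta>h_sq)

lemma e_orth:
  assumes "0 \<le> s" "s \<le> t" "t \<le> T" and g: "g \<in> closed_span M (Y ` {0..s})"
  shows "expectation (\<lambda>x. g x * e t x) = 0"
proof (rule closed_spanD(2)[OF g])
  show "square_integrable M (e t)" using assms by (intro e_sq) auto
qed (use \<theta>h_orth assms in \<open>auto simp: e_def\<close>)

lemma \<theta>_split:
  assumes t: "t \<in> {0..T}"
  shows "expectation (\<lambda>x. (\<theta> t x)\<^sup>2) = expectation (\<lambda>x. (e t x)\<^sup>2) + expectation (\<lambda>x. (\<theta>h t x)\<^sup>2)"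
proof -
  have "expectation (\<lambda>x. e t x * \<theta>h t x) = 0"
    using e_orth[of t t "\<theta>h t"] \<theta>h_span[OF t] t by (simp add: mult.commute)
  moreover have "\<theta> t x = e t x + \<theta>h t x" for x by (simp add: e_def)
  ultimately show ?thesis
    using integral_square_add[OF e_sq[OF t] \<theta>h_sq[OF t]] by simp
qed

lemma
  assumes t: "t \<in> {0..T}"
  shows e_bound: "expectation (\<lambda>x. (e t x)\<^sup>2) \<le> K"
    and \<theta>h_bound: "expectation (\<lambda>x. (\<theta>h t x)\<^sup>2) \<le> K"
proof -
  have "0 \<le> expectation (\<lambda>x. (e t x)\<^sup>2)" "0 \<le> expectation (\<lambda>x. (\<theta>h t x)\<^sup>2)" by auto
  then show "expectation (\<lambda>x. (e t x)\<^sup>2) \<le> K" "expectation (\<lambda>x. (\<theta>h t x)\<^sup>2) \<le> K"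
    using \<theta>_split[OF t] \<theta>_bound[OF t] by linarith+
qed

lemma K_theta_nonneg: "0 \<le> K"
proof -
  have "0 \<le> expectation (\<lambda>x. (e 0 x)\<^sup>2)" by simp
  also have "\<dots> \<le> K" using T by (intro e_bound) auto
  finally show ?thesis .
qed

lemma \<nu>_AE:
  assumes t: "t \<in> {0..T}"
  shows "AE x in M. \<nu> t x = B t x + (LINT r|lebesgue_on {0..t}. e r x)"
proof -
  interpret L: finite_measure "lebesgue_on {0..T}" by simp
  have "AE x in M. square_integrable (lebesgue_on {0..T}) (\<lambda>r. \<theta> r x)"
    by (rule process_AE_path[OF \<theta> \<theta>_sq \<theta>_bound])
  moreover have "AE x in M. square_integrable (lebesgue_on {0..T}) (\<lambda>r. \<theta>h r x)"
    by (rule process_AE_path[OF \<theta>h \<theta>h_sq \<theta>h_bound])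
  ultimately show ?thesis
  proof eventually_elim
    case (elim x)
    have t': "0 \<le> t" "t \<le> T" using t by auto
    have i: "integrable (lebesgue_on {0..T}) (\<lambda>r. indicator {0<..t} r * \<theta> r x)"
      "integrable (lebesgue_on {0..T}) (\<lambda>r. indicator {0<..t} r * \<theta>h r x)"
      by (intro square_integrable_mult square_integrable_indicator_lebesgue_on elim)+
    have "(LINT r|lebesgue_on {0..t}. e r x) = (LINT r|lebesgue_on {0..t}. \<theta> r x) - (LINT r|lebesgue_on {0..t}. \<theta>h r x)"
      unfolding integral_lebesgue_on_eq_indicator[OF t'] e_def right_diff_distrib
      by (rule Bochner_Integration.integral_diff[OF i])
    then show ?case by (simp add: \<nu>_def Y_def)
  qed
qed

text \<open>The kernel l(r, u) vanishes for u > r, so the drift at time r is uncorrelated with later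
  noise.\<close>

lemma \<theta>_increment:
  assumes "0 \<le> r" "r \<le> s" "s \<le> t" "t \<le> T"
  shows "expectation (\<lambda>x. \<theta> r x * (B t x - B s x)) = 0"
proof -
  have m: "r \<in> {0..T}" "s \<in> {0..T}" "t \<in> {0..T}" using assms by auto
  have "expectation (\<lambda>x. \<theta> r x * (B t x - B s x)) = expectation (\<lambda>x. \<theta> r x * B t x) - expectation (\<lambda>x. \<theta> r x * B s x)"
    using square_integrable_mult[OF \<theta>_sq[OF m(1)] B_sq[OF m(3)]] square_integrable_mult[OF \<theta>_sq[OF m(1)] B_sq[OF m(2)]]
    by (simp add: right_diff_distrib)
  then show ?thesis
    using \<theta>_B[OF m(1,2)] \<theta>_B[OF m(1,3)] integral_l_stop[OF assms] by simp
qed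

lemma increment_sq: "s \<in> {0..T} \<Longrightarrow> t \<in> {0..T} \<Longrightarrow> square_integrable M (\<lambda>x. B t x - B s x)"
  by (intro square_integrable_diff B_sq)

text \<open>Observations up to s consist of noise and integrated drift up to s, and both parts are
  orthogonal to later noise increments.\<close>

lemma increment_orth:
  assumes "0 \<le> s" "s \<le> t" "t \<le> T" and g: "g \<in> closed_span M (Y ` {0..s})"
  shows "expectation (\<lambda>x. g x * (B t x - B s x)) = 0"
proof (rule closed_spanD(2)[OF g])
  have st: "s \<in> {0..T}" "t \<in> {0..T}" using assms by auto
  show sq: "square_integrable M (\<lambda>x. B t x - B s x)" by (rule increment_sq[OF st])
  fix g assume "g \<in> Y ` {0..s}"
  then obtain q where q: "q \<in> {0..s}" "g = Y q" by blast
  then have q': "q \<in> {0..T}" using assms by auto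
  have 1: "expectation (\<lambda>x. B q x * (B t x - B s x)) = 0"
    using square_integrable_mult[OF B_sq[OF q'] B_sq[OF st(2)]] square_integrable_mult[OF B_sq[OF q'] B_sq[OF st(1)]]
      bc_cov[OF B q' st(1)] bc_cov[OF B q' st(2)] q(1) assms
    by (simp add: right_diff_distrib)
  have "expectation (\<lambda>x. (LINT r|lebesgue_on {0..q}. \<theta> r x) * (B t x - B s x))
      = (LINT r|lebesgue_on {0..q}. expectation (\<lambda>x. \<theta> r x * (B t x - B s x)))"
    by (rule process_integral_mult[OF \<theta> \<theta>_sq \<theta>_bound _ sq]) (use q' in auto)
  also have "\<dots> = (LINT r|lebesgue_on {0..q}. 0)"
    using q assms by (intro Bochner_Integration.integral_cong refl \<theta>_increment) auto
  finally have 2: "expectation (\<lambda>x. (LINT r|lebesgue_on {0..q}. \<theta> r x) * (B t x - B s x)) = 0" by simp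
  show "expectation (\<lambda>x. g x * (B t x - B s x)) = 0"
    unfolding q(2) Y_def distrib_right
    using 1 2 square_integrable_mult[OF B_sq[OF q'] sq] square_integrable_mult[OF J_sq[OF q'] sq]
    by simp
qed

lemma \<nu>_span: "t \<in> {0..T} \<Longrightarrow> \<nu> t \<in> closed_span M (Y ` {0..t})"
  unfolding \<nu>_eq
proof (intro closed_span_diff)
  assume t: "t \<in> {0..T}"
  show "Y t \<in> closed_span M (Y ` {0..t})" using t by (intro closed_span_base Y_sq) auto
  show "(\<lambda>x. LINT r|lebesgue_on {0..t}. \<theta>h r x) \<in> closed_span M (Y ` {0..t})"
  proof (rule process_integral_closed_span[OF \<theta>h \<theta>h_sq \<theta>h_bound t])
    fix r assume r: "r \<in> {0..t}"
    then show "\<theta>h r \<in> closed_span M (Y ` {0..t})"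
      using \<theta>h_span[of r] closed_span_mono[of "Y ` {0..r}" "Y ` {0..t}" M] t by fastforce
  qed
qed

lemma \<nu>_sq: "t \<in> {0..T} \<Longrightarrow> square_integrable M (\<nu> t)"
  by (rule closed_spanD(1)[OF \<nu>_span])

lemma E_sq: "t \<in> {0..T} \<Longrightarrow> square_integrable M (\<lambda>x. LINT r|lebesgue_on {0..t}. e r x)"
  by (rule process_integral_square_integrable[OF e_process e_sq e_bound])

lemma \<nu>_increment_AE:
  assumes "s \<in> {0..T}" "t \<in> {0..T}"
  shows "AE x in M. \<nu> t x - \<nu> s x = (B t x - B s x) + ((LINT r|lebesgue_on {0..t}. e r x) - (LINT r|lebesgue_on {0..s}. e r x))"
  using \<nu>_AE[OF assms(1)] \<nu>_AE[OF assms(2)] by eventually_elim simp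

text \<open>The martingale property in its mean-square form: a later increment of \<nu> is noise
  after s plus integrated drift errors after s, and each of these is orthogonal to the observations
  up to s.\<close>

lemma \<nu>_increment_orth:
  assumes "0 \<le> s" "s \<le> t" "t \<le> T" and g: "g \<in> closed_span M (Y ` {0..s})"
  shows "expectation (\<lambda>x. g x * (\<nu> t x - \<nu> s x)) = 0"
proof -
  have st: "s \<in> {0..T}" "t \<in> {0..T}" using assms by auto
  note g' = closed_spanD(1)[OF g]
  let ?\<Delta> = "\<lambda>x. (LINT r|lebesgue_on {0..t}. e r x) - (LINT r|lebesgue_on {0..s}. e r x)"
  have \<Delta>_sq: "square_integrable M ?\<Delta>" by (intro square_integrable_diff E_sq st)
  have E: "expectation (\<lambda>x. (LINT r|lebesgue_on {0..q}. e r x) * g x) = (LINT r|lebesgue_on {0..T}. indicator {0<..q} r * expectation (\<lambda>x. e r x * g x))"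
    if "q \<in> {0..T}" for q
  proof -
    have q: "0 \<le> q" "q \<le> T" using that by auto
    show ?thesis
      unfolding integral_lebesgue_on_eq_indicator[OF q, symmetric]
      by (rule process_integral_mult[OF e_process e_sq e_bound q(2) g'])
  qed
  have "expectation (\<lambda>x. (LINT r|lebesgue_on {0..t}. e r x) * g x) = expectation (\<lambda>x. (LINT r|lebesgue_on {0..s}. e r x) * g x)"
    unfolding E[OF st(1)] E[OF st(2)]
  proof (intro Bochner_Integration.integral_cong refl)
    fix r assume r: "r \<in> space (lebesgue_on {0..T})"
    have "expectation (\<lambda>x. e r x * g x) = 0" if "s \<le> r"
      using e_orth[of s r g] that assms r by (simp add: mult.commute)
    then show "indicator {0<..t} r * expectation (\<lambda>x. e r x * g x) = indicator {0<..s} r * expectation (\<lambda>x. e r x * g x)"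
      using assms by (auto simp: indicator_def)
  qed
  then have 1: "expectation (\<lambda>x. g x * ?\<Delta> x) = 0"
    using square_integrable_mult[OF E_sq[OF st(1)] g'] square_integrable_mult[OF E_sq[OF st(2)] g']
    by (simp add: right_diff_distrib mult.commute)
  have "expectation (\<lambda>x. g x * (\<nu> t x - \<nu> s x)) = expectation (\<lambda>x. g x * (B t x - B s x) + g x * ?\<Delta> x)"
  proof (rule integral_cong_AE)
    note [measurable] = square_integrableD(1)[OF g'] square_integrableD(1)[OF \<nu>_sq[OF st(1)]] square_integrableD(1)[OF \<nu>_sq[OF st(2)]]
      square_integrableD(1)[OF \<Delta>_sq] square_integrableD(1)[OF increment_sq[OF st]]
    show "(\<lambda>x. g x * (\<nu> t x - \<nu> s x)) \<in> borel_measurable M" by measurable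
    show "(\<lambda>x. g x * (B t x - B s x) + g x * ?\<Delta> x) \<in> borel_measurable M" by measurable
    show "AE x in M. g x * (\<nu> t x - \<nu> s x) = g x * (B t x - B s x) + g x * ?\<Delta> x"
      using \<nu>_increment_AE[OF st] by eventually_elim (simp only: distrib_left)
  qed
  also have "\<dots> = expectation (\<lambda>x. g x * (B t x - B s x)) + expectation (\<lambda>x. g x * ?\<Delta> x)"
    by (intro Bochner_Integration.integral_add square_integrable_mult g' \<Delta>_sq increment_sq st)
  finally show ?thesis using 1 increment_orth[OF assms] by simp
qed

text \<open>The noise contributes exactly t - s. The error integral has mean square at most K (t -
  s)^2, so its cross term with the noise is of order 3/2. This cross term gives 2 sqrt K, and the
  square itself gives K sqrt T after one factor sqrt (t - s) is bounded by sqrt T.\<close>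

lemma \<nu>_increment_var:
  assumes "0 \<le> s" "s \<le> t" "t \<le> T"
  shows "\<bar>expectation (\<lambda>x. (\<nu> t x - \<nu> s x)\<^sup>2) - (t - s)\<bar> \<le> (2 * sqrt K + K * sqrt T) * ((t - s) * sqrt (t - s))"
proof -
  have st: "s \<in> {0..T}" "t \<in> {0..T}" using assms by auto
  let ?b = "\<lambda>x. B t x - B s x"
  let ?\<Delta> = "\<lambda>x. (LINT r|lebesgue_on {0..t}. e r x) - (LINT r|lebesgue_on {0..s}. e r x)"
  have \<Delta>_sq: "square_integrable M ?\<Delta>" by (intro square_integrable_diff E_sq st)
  note b_sq = increment_sq[OF st]
  have \<Delta>_le: "expectation (\<lambda>x. (?\<Delta> x)\<^sup>2) \<le> K * (t - s)\<^sup>2"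
    by (rule process_integral_increment_le[OF e_process e_sq e_bound assms])
  have b: "expectation (\<lambda>x. (?b x)\<^sup>2) = t - s" by (rule bc_increment[OF B assms])
  have "expectation (\<lambda>x. (\<nu> t x - \<nu> s x)\<^sup>2) = expectation (\<lambda>x. (?b x + ?\<Delta> x)\<^sup>2)"
  proof (rule integral_cong_AE)
    note [measurable] = square_integrableD(1)[OF \<nu>_sq[OF st(1)]] square_integrableD(1)[OF \<nu>_sq[OF st(2)]]
      square_integrableD(1)[OF \<Delta>_sq] square_integrableD(1)[OF b_sq]
    show "(\<lambda>x. (\<nu> t x - \<nu> s x)\<^sup>2) \<in> borel_measurable M" by measurable
    show "(\<lambda>x. (?b x + ?\<Delta> x)\<^sup>2) \<in> borel_measurable M" by measurable
    show "AE x in M. (\<nu> t x - \<nu> s x)\<^sup>2 = (?b x + ?\<Delta> x)\<^sup>2"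
      using \<nu>_increment_AE[OF st] by eventually_elim (simp only:)
  qed
  also have "\<dots> = (t - s) + 2 * expectation (\<lambda>x. ?b x * ?\<Delta> x) + expectation (\<lambda>x. (?\<Delta> x)\<^sup>2)"
    unfolding integral_square_add[OF b_sq \<Delta>_sq] b ..
  finally have eq: "expectation (\<lambda>x. (\<nu> t x - \<nu> s x)\<^sup>2)
      = (t - s) + 2 * expectation (\<lambda>x. ?b x * ?\<Delta> x) + expectation (\<lambda>x. (?\<Delta> x)\<^sup>2)" .
  have "0 \<le> expectation (\<lambda>x. (?\<Delta> x)\<^sup>2)" by simp
  with eq have le: "\<bar>expectation (\<lambda>x. (\<nu> t x - \<nu> s x)\<^sup>2) - (t - s)\<bar>
      \<le> 2 * \<bar>expectation (\<lambda>x. ?b x * ?\<Delta> x)\<bar> + expectation (\<lambda>x. (?\<Delta> x)\<^sup>2)"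
    by linarith
  have "\<bar>expectation (\<lambda>x. ?b x * ?\<Delta> x)\<bar> \<le> sqrt (t - s) * sqrt (expectation (\<lambda>x. (?\<Delta> x)\<^sup>2))"
    using Cauchy_Schwarz_abs[OF b_sq \<Delta>_sq] b by simp
  moreover have "sqrt (expectation (\<lambda>x. (?\<Delta> x)\<^sup>2)) \<le> sqrt K * (t - s)"
    using real_sqrt_le_mono[OF \<Delta>_le] assms by (simp add: real_sqrt_mult)
  then have "sqrt (t - s) * sqrt (expectation (\<lambda>x. (?\<Delta> x)\<^sup>2)) \<le> sqrt (t - s) * (sqrt K * (t - s))"
    using assms by (intro mult_left_mono) auto
  ultimately have cross: "\<bar>expectation (\<lambda>x. ?b x * ?\<Delta> x)\<bar> \<le> sqrt (t - s) * (sqrt K * (t - s))"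
    by linarith
  have "(t - s)\<^sup>2 \<le> (t - s) * (sqrt T * sqrt (t - s))"
  proof -
    have "sqrt (t - s) * sqrt (t - s) \<le> sqrt T * sqrt (t - s)"
      using assms by (intro mult_right_mono) auto
    then have "t - s \<le> sqrt T * sqrt (t - s)" using assms by simp
    then show ?thesis unfolding power2_eq_square using assms by (intro mult_left_mono) auto
  qed
  then have "K * (t - s)\<^sup>2 \<le> K * ((t - s) * (sqrt T * sqrt (t - s)))"
    using K_theta_nonneg by (intro mult_left_mono)
  with le cross \<Delta>_le have "\<bar>expectation (\<lambda>x. (\<nu> t x - \<nu> s x)\<^sup>2) - (t - s)\<bar>
      \<le> 2 * (sqrt (t - s) * (sqrt K * (t - s))) + K * ((t - s) * (sqrt T * sqrt (t - s)))"
    by linarith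
  also have "\<dots> = (2 * sqrt K + K * sqrt T) * ((t - s) * sqrt (t - s))"
  proof -
    have "2 * (c * (k * d)) + k' * (d * (z * c)) = (2 * k + k' * z) * (d * c)" for c k d z k' :: real
      by (simp add: algebra_simps)
    then show ?thesis .
  qed
  finally show ?thesis .
qed

text \<open>Orthogonal increments make E \<nu>(t)^2 - t additive over intervals, and its increments
  are of order 3/2, so it is constant and hence 0.\<close>

lemma \<nu>_covariance: "brownian_covariance M T \<nu>"
proof -
  have orth: "expectation (\<lambda>x. \<nu> s x * \<nu> t x) = expectation (\<lambda>x. (\<nu> s x)\<^sup>2)" if "0 \<le> s" "s \<le> t" "t \<le> T" for s t
  proof -
    have st: "s \<in> {0..T}" "t \<in> {0..T}" using that by auto
    have "expectation (\<lambda>x. \<nu> s x * (\<nu> t x - \<nu> s x)) = 0"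
      by (rule \<nu>_increment_orth[OF that \<nu>_span[OF st(1)]])
    then show ?thesis
      using square_integrable_mult[OF \<nu>_sq[OF st(1)] \<nu>_sq[OF st(1)]] square_integrable_mult[OF \<nu>_sq[OF st(1)] \<nu>_sq[OF st(2)]]
      by (simp add: right_diff_distrib power2_eq_square)
  qed
  define \<phi> where "\<phi> t = expectation (\<lambda>x. (\<nu> t x)\<^sup>2) - t" for t
  have inc: "\<bar>\<phi> t - \<phi> s\<bar> \<le> (2 * sqrt K + K * sqrt T) * ((t - s) * sqrt (t - s))" if "0 \<le> s" "s \<le> t" "t \<le> T" for s t
  proof -
    have st: "s \<in> {0..T}" "t \<in> {0..T}" using that by auto
    have "expectation (\<lambda>x. (\<nu> t x - \<nu> s x)\<^sup>2) = expectation (\<lambda>x. (\<nu> t x)\<^sup>2) - expectation (\<lambda>x. (\<nu> s x)\<^sup>2)"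
      using integral_square_diff[OF \<nu>_sq[OF st(2)] \<nu>_sq[OF st(1)]] orth[OF that] by (simp add: mult.commute)
    then show ?thesis using \<nu>_increment_var[OF that] by (simp add: \<phi>_def algebra_simps)
  qed
  have "\<phi> 0 = 0"
  proof -
    have z: "(0::real) \<in> {0..T}" using T by auto
    have e0: "(LINT r|lebesgue_on {0..0}. e r x) = 0" for x
      using integral_lebesgue_on_eq_indicator[of 0 0 "\<lambda>r. e r x"] by simp
    have "AE x in M. \<nu> 0 x = 0"
      using \<nu>_AE[OF z] bc_AE_zero[OF B less_imp_le[OF T]]
      by eventually_elim (simp only: e0 add_0_right)
    then have "expectation (\<lambda>x. (\<nu> 0 x)\<^sup>2) = 0"
      by (intro integral_eq_zero_AE) (auto elim: eventually_mono)
    then show ?thesis by (simp add: \<phi>_def)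
  qed
  then have var: "expectation (\<lambda>x. (\<nu> t x)\<^sup>2) = t" if "t \<in> {0..T}" for t
    using constant_if_small_increments[of T \<phi>, OF inc that] by (simp add: \<phi>_def)
  have "expectation (\<lambda>x. \<nu> s x * \<nu> t x) = min s t" if "s \<in> {0..T}" "t \<in> {0..T}" for s t
    using orth[of s t] orth[of t s] var[of s] var[of t] that
    by (cases "s \<le> t") (auto simp: mult.commute min_def)
  then show ?thesis using \<nu>_sq by (simp add: brownian_covariance_def)
qed

end

section \<open>The innovations generate the observations\<close>

lemma step_fun_bounded: "\<exists>K. \<forall>r. \<bar>step_fun L r\<bar> \<le> K"
proof (induction L)
  case Nil
  then show ?case by (intro exI[of _ 0]) simp
next
  case (Cons a L)
  obtain u v c where a: "a = (u, v, c)" by (cases a)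
  from Cons obtain K where K: "\<And>r. \<bar>step_fun L r\<bar> \<le> K" by blast
  have "\<bar>step_fun (a # L) r\<bar> \<le> \<bar>c\<bar> + K" for r
    using K[of r] by (simp only: a step_fun_Cons) (auto simp: indicator_def split: if_splits)
  then show ?case by blast
qed

lemma integral_lebesgue_on_mono_set:
  fixes f :: "real \<Rightarrow> real"
  assumes "0 \<le> s" "s \<le> t" and f: "integrable (lebesgue_on {0..t}) f" and pos: "\<And>r. 0 \<le> f r"
  shows "(LINT r|lebesgue_on {0..s}. f r) \<le> (LINT r|lebesgue_on {0..t}. f r)"
  unfolding integral_lebesgue_on_eq_indicator[OF assms(1,2)]
proof (rule integral_mono[OF _ f])
  have "{0<..s} \<in> sets (lebesgue_on {0..t})" using assms by (auto simp: sets_restrict_space_iff)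
  then have "integrable (lebesgue_on {0..t}) (\<lambda>r. indicator {0<..s} r *\<^sub>R f r)"
    using f by (rule integrable_mult_indicator)
  then show "integrable (lebesgue_on {0..t}) (\<lambda>r. indicator {0<..s} r * f r)" by (simp only: real_scaleR_def)
qed (use pos in \<open>auto simp: indicator_def\<close>)

context volterra_kernel
begin

lemma integral_l_square_integrable:
  assumes "s \<in> {0..T}" "t \<le> T"
  shows "square_integrable (lebesgue_on {0..t}) (\<lambda>u. LINT v|lebesgue_on {0..s}. l u v)"
proof -
  interpret S: finite_measure "lebesgue_on {0..s}" by simp
  have "\<bar>LINT v|lebesgue_on {0..s}. l u v\<bar> \<le> K * s" if u: "u \<in> {0..t}" for u
  proof -
    have u': "u \<in> {0..T}" "s \<le> T" using u assms by auto
    have int: "integrable (lebesgue_on {0..s}) (l u)"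
      by (rule S.square_integrable_imp_integrable[OF l_section_bounded[OF u']])
    have "\<bar>LINT v|lebesgue_on {0..s}. l u v\<bar> \<le> (LINT v|lebesgue_on {0..s}. \<bar>l u v\<bar>)"
      by (rule integral_abs_bound)
    also have "\<dots> \<le> (LINT v|lebesgue_on {0..s}. K)"
      using int l_bound u' assms by (intro integral_mono) auto
    finally show ?thesis using assms by (simp add: measure_restrict_space mult.commute)
  qed
  moreover have "(\<lambda>u. LINT v|lebesgue_on {0..s}. l u v) \<in> borel_measurable (lebesgue_on {0..t})"
    using l_pair[of t s] assms by (intro S.borel_measurable_lebesgue_integral) auto
  ultimately show ?thesis
    by (intro finite_measure.square_integrable_bounded[where K="K * s"]) auto
qed

end

context innovation
begin

lemma B_mult_Y:
  assumes s: "s \<in> {0..T}" and q: "q \<in> {0..T}"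
  shows "expectation (\<lambda>x. B s x * Y q x)
    = (LINT u|lebesgue_on {0..q}. indicator {0<..s} u - (LINT v|lebesgue_on {0..s}. l u v))"
proof -
  interpret Q: finite_measure "lebesgue_on {0..q}" by simp
  have q': "0 \<le> q" "q \<le> T" "q \<le> q" using q by auto
  have 1: "expectation (\<lambda>x. B s x * B q x) = (LINT u|lebesgue_on {0..q}. indicator {0<..s} u)"
  proof -
    have "(LINT u|lebesgue_on {0..q}. indicator {0<..s} u) = (LINT u|lebesgue_on {0..q}. indicator {0<..q} u * (indicator {0<..s} u :: real))"
      by (rule integral_lebesgue_on_eq_indicator[OF q'(1,3)])
    also have "\<dots> = (LINT u|lebesgue_on {0..q}. indicator {0<..min s q} u)"
      by (intro Bochner_Integration.integral_cong) (auto simp: indicator_def)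
    also have "\<dots> = min s q - 0"
      using s q by (intro integral_lebesgue_on_Ioc) auto
    finally show ?thesis using bc_cov[OF B s q] by simp
  qed
  have "expectation (\<lambda>x. (LINT r|lebesgue_on {0..q}. \<theta> r x) * B s x) = (LINT r|lebesgue_on {0..q}. expectation (\<lambda>x. \<theta> r x * B s x))"
    by (rule process_integral_mult[OF \<theta> \<theta>_sq \<theta>_bound q'(2) B_sq[OF s]])
  also have "\<dots> = (LINT r|lebesgue_on {0..q}. - (LINT v|lebesgue_on {0..s}. l r v))"
    using q s by (intro Bochner_Integration.integral_cong refl \<theta>_B) auto
  finally have 2: "expectation (\<lambda>x. B s x * (LINT r|lebesgue_on {0..q}. \<theta> r x)) = - (LINT r|lebesgue_on {0..q}. LINT v|lebesgue_on {0..s}. l r v)"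
    by (simp add: mult.commute)
  have "expectation (\<lambda>x. B s x * Y q x) = expectation (\<lambda>x. B s x * B q x) + expectation (\<lambda>x. B s x * (LINT r|lebesgue_on {0..q}. \<theta> r x))"
    unfolding Y_def distrib_left
    by (intro Bochner_Integration.integral_add square_integrable_mult B_sq J_sq s q)
  also have "\<dots> = (LINT u|lebesgue_on {0..q}. indicator {0<..s} u) - (LINT u|lebesgue_on {0..q}. LINT v|lebesgue_on {0..s}. l u v)"
    unfolding 1 2 by simp
  also have "\<dots> = (LINT u|lebesgue_on {0..q}. indicator {0<..s} u - (LINT v|lebesgue_on {0..s}. l u v))"
    by (intro Bochner_Integration.integral_diff[symmetric] Q.square_integrable_imp_integrable
        square_integrable_indicator_lebesgue_on integral_l_square_integrable s q'(2))
  finally show ?thesis .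
qed

text \<open>The noise component of the integral of a step function against Y, expressed through its
  density against B. The signal X leaves no trace in it, being uncorrelated with B.\<close>

lemma step_integral_Y_mult_B:
  assumes L: "steps_within T L" and s: "s \<in> {0..T}"
  shows "expectation (\<lambda>x. step_integral Y L x * B s x) = (LINT u|lebesgue_on {0..s}. adjoint_transform (step_fun L) u)"
proof -
  let ?L = "lebesgue_on {0..T}"
  interpret L: finite_measure ?L by simp
  have s': "0 \<le> s" "s \<le> T" "T \<le> T" using s by auto
  obtain Kk where Kk: "\<And>r. \<bar>step_fun L r\<bar> \<le> Kk" using step_fun_bounded by blast
  have sq1: "square_integrable ?L (indicator {0<..s} :: real \<Rightarrow> real)"
    by (rule square_integrable_indicator_lebesgue_on)
  have sq2: "square_integrable ?L (\<lambda>u. LINT v|lebesgue_on {0..s}. l u v)"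
    by (rule integral_l_square_integrable[OF s s'(3)])
  have "expectation (\<lambda>x. B s x * step_integral Y L x)
      = (LINT u|?L. (indicator {0<..s} u - (LINT v|lebesgue_on {0..s}. l u v)) * step_fun L u)"
  proof (rule integral_mult_step_integral[OF Y_sq B_sq[OF s] square_integrable_diff[OF sq1 sq2] _ L])
    show "expectation (\<lambda>x. B s x * Y q x) = (LINT u|lebesgue_on {0..q}. indicator {0<..s} u - (LINT v|lebesgue_on {0..s}. l u v))"
      if "q \<in> {0..T}" for q by (rule B_mult_Y[OF s that])
  qed
  also have "\<dots> = (LINT u|?L. indicator {0<..s} u * step_fun L u) - (LINT u|?L. (LINT v|lebesgue_on {0..s}. l u v) * step_fun L u)"
    unfolding left_diff_distrib
    by (intro Bochner_Integration.integral_diff square_integrable_mult sq1 sq2 square_integrable_step_fun)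
  also have "\<dots> = (LINT u|lebesgue_on {0..s}. adjoint_transform (step_fun L) u)"
    using integral_adjoint_transform[OF borel_measurable_step_fun Kk s'(1,2)]
      integral_lebesgue_on_eq_indicator[OF s'(1,2), of "step_fun L"] by simp
  finally show ?thesis by (simp add: mult.commute)
qed

definition step_const :: real where
  "step_const = 4 * exp ((4 * Kl\<^sup>2 * T + 1) * T)"

lemma step_const_nonneg: "0 \<le> step_const"
  by (simp add: step_const_def)

text \<open>By Bessel's inequality the norm of the integral is at least that of its noise component,
  and the Volterra transform is bounded below.\<close>

lemma step_integral_lower_bound:
  assumes L: "steps_within T L"
  shows "(LINT r|lebesgue_on {0..T}. (step_fun L r)\<^sup>2) \<le> step_const * expectation (\<lambda>x. (step_integral Y L x)\<^sup>2)"
proof -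
  have T': "0 \<le> T" "T \<le> T" using T by auto
  obtain Kk where Kk: "\<And>r. \<bar>step_fun L r\<bar> \<le> Kk" using step_fun_bounded by blast
  have "(LINT r|lebesgue_on {0..T}. (step_fun L r)\<^sup>2)
      \<le> step_const * (LINT r|lebesgue_on {0..T}. (adjoint_transform (step_fun L) r)\<^sup>2)"
    unfolding step_const_def by (rule volterra_lower_bound[OF borel_measurable_step_fun Kk])
  also have "\<dots> \<le> step_const * expectation (\<lambda>x. (step_integral Y L x)\<^sup>2)"
  proof (rule mult_left_mono[OF _ step_const_nonneg])
    show "(LINT r|lebesgue_on {0..T}. (adjoint_transform (step_fun L) r)\<^sup>2) \<le> expectation (\<lambda>x. (step_integral Y L x)\<^sup>2)"
      by (rule bc_bessel[OF B T' square_integrable_step_integral[OF Y_sq L]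
            adjoint_transform_square_integrable[OF borel_measurable_step_fun Kk T'(2)]
            step_integral_Y_mult_B[OF L]])
  qed
  finally show ?thesis .
qed

lemma Y_0_AE: "AE x in M. Y 0 x = 0"
proof -
  have "(LINT r|lebesgue_on {0..0}. \<theta> r x) = 0" for x
    using integral_lebesgue_on_eq_indicator[of 0 0 "\<lambda>r. \<theta> r x"] by simp
  then have "Y 0 x = B 0 x" for x by (simp only: Y_def add_0_right)
  then show ?thesis using bc_AE_zero[OF B less_imp_le[OF T]] by simp
qed

text \<open>On step integrals the functional given by \<xi> is the inner product of the integrand
  with m, and the integrand is controlled by the norm of the integral. Both sides are continuous in
  mean square, which extends the estimate to the closed span.\<close>

lemma Y_functional_bound:
  assumes r: "r \<in> {0..T}" and \<xi>: "square_integrable M \<xi>" and m: "square_integrable (lebesgue_on {0..r}) m"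
    and repr: "\<And>s. s \<in> {0..r} \<Longrightarrow> expectation (\<lambda>x. \<xi> x * Y s x) = (LINT q|lebesgue_on {0..s}. m q)"
    and \<eta>: "\<eta> \<in> closed_span M (Y ` {0..r})"
  shows "(expectation (\<lambda>x. \<eta> x * \<xi> x))\<^sup>2
    \<le> step_const * expectation (\<lambda>x. (\<eta> x)\<^sup>2) * (LINT q|lebesgue_on {0..r}. (m q)\<^sup>2)"
proof -
  have r': "0 \<le> r" "r \<le> T" using r by auto
  have Y_sq': "square_integrable M (Y s)" if "s \<in> {0..r}" for s using that r by (intro Y_sq) auto
  have cont: "L2_continuous_on M {0..r} Y"
    by (rule L2_continuous_on_subset[OF Y_L2_continuous]) (use r in auto)
  obtain L where L: "\<And>n. steps_within r (L n)" and lim: "L2_tendsto M (\<lambda>n. step_integral Y (L n)) \<eta>"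
    using L2_continuous_step_approx[OF finite_measure_axioms cont r'(1) Y_0_AE \<eta>] by blast
  let ?m2 = "LINT q|lebesgue_on {0..r}. (m q)\<^sup>2"
  have "(expectation (\<lambda>x. step_integral Y (L n) x * \<xi> x))\<^sup>2 \<le> step_const * expectation (\<lambda>x. (step_integral Y (L n) x)\<^sup>2) * ?m2" for n
  proof -
    have LT: "steps_within T (L n)" by (rule steps_within_mono[OF L r'(2)])
    have "expectation (\<lambda>x. \<xi> x * step_integral Y (L n) x) = (LINT q|lebesgue_on {0..r}. m q * step_fun (L n) q)"
      by (rule integral_mult_step_integral[OF Y_sq' \<xi> m repr L])
    then have "(expectation (\<lambda>x. step_integral Y (L n) x * \<xi> x))\<^sup>2
        \<le> ?m2 * (LINT q|lebesgue_on {0..r}. (step_fun (L n) q)\<^sup>2)"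
      using Cauchy_Schwarz_integral[OF m square_integrable_step_fun, of "L n"] by (simp add: mult.commute)
    also have "\<dots> \<le> ?m2 * (step_const * expectation (\<lambda>x. (step_integral Y (L n) x)\<^sup>2))"
    proof (rule mult_left_mono)
      have "(LINT q|lebesgue_on {0..r}. (step_fun (L n) q)\<^sup>2) \<le> (LINT q|lebesgue_on {0..T}. (step_fun (L n) q)\<^sup>2)"
        by (rule integral_lebesgue_on_mono_set[OF r' square_integrableD(2)[OF square_integrable_step_fun]]) simp
      also note step_integral_lower_bound[OF LT]
      finally show "(LINT q|lebesgue_on {0..r}. (step_fun (L n) q)\<^sup>2) \<le> step_const * expectation (\<lambda>x. (step_integral Y (L n) x)\<^sup>2)" .
    qed simp
    finally show ?thesis by (simp add: mult.commute)
  qed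
  moreover have "(\<lambda>n. (expectation (\<lambda>x. step_integral Y (L n) x * \<xi> x))\<^sup>2) \<longlonglongrightarrow> (expectation (\<lambda>x. \<eta> x * \<xi> x))\<^sup>2"
    by (intro tendsto_intros L2_tendsto_inner[OF lim \<xi>])
  moreover have "(\<lambda>n. step_const * expectation (\<lambda>x. (step_integral Y (L n) x)\<^sup>2) * ?m2)
      \<longlonglongrightarrow> step_const * expectation (\<lambda>x. (\<eta> x)\<^sup>2) * ?m2"
    by (intro tendsto_intros L2_tendsto_square[OF lim])
  ultimately show ?thesis by (intro LIMSEQ_le) auto
qed

text \<open>
  The innovations generate the observations: the estimate below makes \<open>r \<mapsto> E (\<xi> \<theta>h r)\<close> a solution
  of a homogeneous Volterra inequality whenever \<open>\<xi>\<close> is orthogonal to the innovations.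
\<close>

lemma Y_span:
  assumes t: "t \<in> {0..T}"
  shows "Y t \<in> closed_span M (\<nu> ` {0..t})"
proof (rule closed_spanI[OF Y_sq[OF t]])
  fix \<xi> assume \<xi>: "square_integrable M \<xi>" and "\<And>g. g \<in> \<nu> ` {0..t} \<Longrightarrow> expectation (\<lambda>x. g x * \<xi> x) = 0"
  then have orth: "expectation (\<lambda>x. \<nu> s x * \<xi> x) = 0" if "s \<in> {0..t}" for s using that by auto
  define m where "m r = expectation (\<lambda>x. \<theta>h r x * \<xi> x)" for r
  have m_sq_le: "(m r)\<^sup>2 \<le> K * expectation (\<lambda>x. (\<xi> x)\<^sup>2)" if r: "r \<in> {0..T}" for r
  proof -
    have "(m r)\<^sup>2 \<le> expectation (\<lambda>x. (\<theta>h r x)\<^sup>2) * expectation (\<lambda>x. (\<xi> x)\<^sup>2)"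
      unfolding m_def by (rule Cauchy_Schwarz_integral[OF \<theta>h_sq[OF r] \<xi>])
    also have "\<dots> \<le> K * expectation (\<lambda>x. (\<xi> x)\<^sup>2)"
      by (intro mult_right_mono \<theta>h_bound r) simp
    finally show ?thesis .
  qed
  have m_L2: "square_integrable (lebesgue_on {0..s}) m" if "s \<le> T" for s
  proof (rule finite_measure.square_integrable_bounded[OF finite_measure_lebesgue_on_Icc])
    show "m \<in> borel_measurable (lebesgue_on {0..s})"
      unfolding m_def[abs_def]
      by (rule borel_measurable_on_lebesgue_on[OF measurable_process_expectation[OF \<theta>h square_integrableD(1)[OF \<xi>]] that])
    show "\<bar>m r\<bar> \<le> sqrt (K * expectation (\<lambda>x. (\<xi> x)\<^sup>2))" if "r \<in> space (lebesgue_on {0..s})" for r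
      using real_sqrt_le_mono[OF m_sq_le[of r]] that \<open>s \<le> T\<close> by simp
  qed
  \<comment> \<open>Orthogonality of \<xi> to the innovations turns the definition of \<nu> into
    this representation by the integrated estimate.\<close>
  have Y_repr: "expectation (\<lambda>x. \<xi> x * Y s x) = (LINT q|lebesgue_on {0..s}. m q)" if s: "s \<in> {0..t}" for s
  proof -
    have s': "s \<in> {0..T}" "s \<le> T" using s t by auto
    let ?I = "\<lambda>x. LINT r|lebesgue_on {0..s}. \<theta>h r x"
    have I_sq: "square_integrable M ?I"
      by (rule process_integral_square_integrable[OF \<theta>h \<theta>h_sq \<theta>h_bound s'(1)])
    have "expectation (\<lambda>x. \<nu> s x * \<xi> x) = expectation (\<lambda>x. Y s x * \<xi> x) - expectation (\<lambda>x. ?I x * \<xi> x)"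
      unfolding \<nu>_def left_diff_distrib
      by (intro Bochner_Integration.integral_diff square_integrable_mult Y_sq s' \<xi> I_sq)
    moreover have "expectation (\<lambda>x. ?I x * \<xi> x) = (LINT q|lebesgue_on {0..s}. m q)"
      unfolding m_def by (rule process_integral_mult[OF \<theta>h \<theta>h_sq \<theta>h_bound s'(2) \<xi>])
    ultimately show ?thesis using orth[OF s] by (simp add: mult.commute)
  qed
  \<comment> \<open>\<open>\<theta>h r\<close> lies in the span of the observations up to r, so the
    functional bound involves m on [0, r] only; this makes the inequality of Volterra type.\<close>
  have m_vol: "(m r)\<^sup>2 \<le> step_const * K * (LINT q|lebesgue_on {0..r}. (m q)\<^sup>2)" if r: "r \<in> {0..t}" for r
  proof -
    have r': "r \<in> {0..T}" "r \<le> T" using r t by auto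
    have "(m r)\<^sup>2 \<le> step_const * expectation (\<lambda>x. (\<theta>h r x)\<^sup>2) * (LINT q|lebesgue_on {0..r}. (m q)\<^sup>2)"
      unfolding m_def[of r]
      by (rule Y_functional_bound[OF r'(1) \<xi> m_L2[OF r'(2)] Y_repr \<theta>h_span[OF r'(1)]]) (use r in auto)
    also have "\<dots> \<le> step_const * K * (LINT q|lebesgue_on {0..r}. (m q)\<^sup>2)"
      by (intro mult_right_mono mult_left_mono \<theta>h_bound r' step_const_nonneg Bochner_Integration.integral_nonneg) simp
    finally show ?thesis .
  qed
  have "(m r)\<^sup>2 \<le> 0" if r: "r \<in> {0..t}" for r
  proof (rule gronwall_iteration[where m="\<lambda>_::unit. \<lambda>r. (m r)\<^sup>2" and P="\<lambda>_ r. r \<le> t" and C="step_const * K"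
        and K="K * expectation (\<lambda>x. (\<xi> x)\<^sup>2)"])
    show "0 \<le> step_const * K" by (intro mult_nonneg_nonneg step_const_nonneg K_theta_nonneg)
    fix s assume s: "s \<le> t" "0 \<le> s"
    then show "(m s)\<^sup>2 \<le> K * expectation (\<lambda>x. (\<xi> x)\<^sup>2)" using t by (intro m_sq_le) auto
    fix b assume b: "integrable (lebesgue_on {0..s}) b" "\<And>j r. \<lbrakk>r \<le> t; 0 \<le> r; r \<le> s\<rbrakk> \<Longrightarrow> (m r)\<^sup>2 \<le> b r"
    have "(m s)\<^sup>2 \<le> step_const * K * (LINT q|lebesgue_on {0..s}. (m q)\<^sup>2)" using s by (intro m_vol) auto
    also have "\<dots> \<le> step_const * K * (LINT q|lebesgue_on {0..s}. b q)"
    proof (intro mult_left_mono integral_mono b(1))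
      show "integrable (lebesgue_on {0..s}) (\<lambda>q. (m q)\<^sup>2)"
        using m_L2[of s] s t by (auto simp: square_integrable_def)
    qed (use b(2) s in \<open>auto intro: mult_nonneg_nonneg step_const_nonneg K_theta_nonneg\<close>)
    finally show "(m s)\<^sup>2 \<le> step_const * K * (LINT q|lebesgue_on {0..s}. b q)" .
  qed (use r in auto)
  then have "(LINT q|lebesgue_on {0..t}. m q) = (LINT q|lebesgue_on {0..t}. 0)"
    by (intro Bochner_Integration.integral_cong) auto
  then show "expectation (\<lambda>x. Y t x * \<xi> x) = 0"
    using Y_repr[of t] t by (simp add: mult.commute)
qed

lemma Y_span_subset:
  assumes "t \<in> {0..T}"
  shows "closed_span M (Y ` {0..t}) \<subseteq> closed_span M (\<nu> ` {0..t})"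
proof
  fix f assume f: "f \<in> closed_span M (Y ` {0..t})"
  show "f \<in> closed_span M (\<nu> ` {0..t})"
  proof (rule closed_span_trans[OF f], clarify)
    fix s assume s: "s \<in> {0..t}"
    then have "Y s \<in> closed_span M (\<nu> ` {0..s})" using assms by (intro Y_span) auto
    moreover have "\<nu> ` {0..s} \<subseteq> \<nu> ` {0..t}" using s by auto
    ultimately show "Y s \<in> closed_span M (\<nu> ` {0..t})" using closed_span_mono by blast
  qed
qed

section \<open>The filter as a Wiener integral over the innovations\<close>

context
  fixes t :: real and Z p :: "'w \<Rightarrow> real" and b :: "real \<Rightarrow> real"
  assumes t: "t \<in> {0..T}" and Z: "square_integrable M Z"
    and p: "p \<in> closed_span M (Y ` {0..t})"
    and orth: "\<And>s. s \<in> {0..t} \<Longrightarrow> expectation (\<lambda>x. Y s x * (Z x - p x)) = 0"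
    and b: "square_integrable (lebesgue_on {0..t}) b"
    and Z_B: "\<And>s. s \<in> {0..t} \<Longrightarrow> expectation (\<lambda>x. Z x * B s x) = (LINT r|lebesgue_on {0..s}. b r)"
begin

lemma gain_square_integrable:
  assumes "s \<le> t"
  shows "square_integrable (lebesgue_on {0..s}) (\<lambda>r. expectation (\<lambda>x. Z x * e r x))"
proof (rule finite_measure.square_integrable_bounded[OF finite_measure_lebesgue_on_Icc])
  have sT: "s \<le> T" using assms t by auto
  have "(\<lambda>r. expectation (\<lambda>x. e r x * Z x)) \<in> borel_measurable (lebesgue_on {0..s})"
    by (rule borel_measurable_on_lebesgue_on[OF measurable_process_expectation[OF e_process square_integrableD(1)[OF Z]] sT])
  then show "(\<lambda>r. expectation (\<lambda>x. Z x * e r x)) \<in> borel_measurable (lebesgue_on {0..s})" by (simp add: mult.commute)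
  fix r assume "r \<in> space (lebesgue_on {0..s})"
  then have r: "r \<in> {0..T}" using sT by auto
  have "\<bar>expectation (\<lambda>x. Z x * e r x)\<bar> \<le> sqrt (expectation (\<lambda>x. (Z x)\<^sup>2)) * sqrt (expectation (\<lambda>x. (e r x)\<^sup>2))"
    by (rule Cauchy_Schwarz_abs[OF Z e_sq[OF r]])
  also have "\<dots> \<le> sqrt (expectation (\<lambda>x. (Z x)\<^sup>2)) * sqrt K"
    using e_bound[OF r] by (intro mult_left_mono) auto
  finally show "\<bar>expectation (\<lambda>x. Z x * e r x)\<bar> \<le> sqrt (expectation (\<lambda>x. (Z x)\<^sup>2)) * sqrt K" .
qed

text \<open>Since d\<nu> = dB + e dr, the density is the direct correlation b with the noise plus
  the correlation with the drift error.\<close>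

lemma signal_\<nu>:
  assumes s: "s \<in> {0..t}"
  shows "expectation (\<lambda>x. Z x * \<nu> s x) = (LINT r|lebesgue_on {0..s}. b r + expectation (\<lambda>x. Z x * e r x))"
proof -
  interpret S: finite_measure "lebesgue_on {0..s}" by simp
  have s': "s \<in> {0..T}" "s \<le> T" "0 \<le> s" "s \<le> t" using s t by auto
  have b_int: "integrable (lebesgue_on {0..s}) b"
    by (rule S.square_integrable_imp_integrable[OF square_integrable_lebesgue_on_subset[OF b s'(4)]])
  let ?I = "\<lambda>x. LINT r|lebesgue_on {0..s}. e r x"
  have "expectation (\<lambda>x. Z x * \<nu> s x) = expectation (\<lambda>x. Z x * B s x + Z x * ?I x)"
  proof (rule integral_cong_AE)
    note [measurable] = square_integrableD(1)[OF Z] square_integrableD(1)[OF \<nu>_sq[OF s'(1)]]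
      square_integrableD(1)[OF E_sq[OF s'(1)]] square_integrableD(1)[OF B_sq[OF s'(1)]]
    show "(\<lambda>x. Z x * \<nu> s x) \<in> borel_measurable M" by measurable
    show "(\<lambda>x. Z x * B s x + Z x * ?I x) \<in> borel_measurable M" by measurable
    show "AE x in M. Z x * \<nu> s x = Z x * B s x + Z x * ?I x"
      using \<nu>_AE[OF s'(1)] by eventually_elim (simp only: distrib_left)
  qed
  also have "\<dots> = expectation (\<lambda>x. Z x * B s x) + expectation (\<lambda>x. Z x * ?I x)"
    by (intro Bochner_Integration.integral_add square_integrable_mult Z B_sq E_sq s')
  also have "expectation (\<lambda>x. Z x * ?I x) = (LINT r|lebesgue_on {0..s}. expectation (\<lambda>x. Z x * e r x))"
    using process_integral_mult[OF e_process e_sq e_bound s'(2) Z] by (simp add: mult.commute)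
  also have "expectation (\<lambda>x. Z x * B s x) + (LINT r|lebesgue_on {0..s}. expectation (\<lambda>x. Z x * e r x))
     = (LINT r|lebesgue_on {0..s}. b r + expectation (\<lambda>x. Z x * e r x))"
    unfolding Z_B[OF s]
    by (intro Bochner_Integration.integral_add[symmetric] b_int S.square_integrable_imp_integrable gain_square_integrable s')
  finally show ?thesis .
qed

text \<open>The innovations lie in the span of the observations, to which Z - p is orthogonal; so p
  has the same density as Z.\<close>

lemma filter_\<nu>:
  assumes s: "s \<in> {0..t}"
  shows "expectation (\<lambda>x. p x * \<nu> s x) = (LINT r|lebesgue_on {0..s}. b r + expectation (\<lambda>x. Z x * e r x))"
proof -
  have s': "s \<in> {0..T}" using s t by auto
  note p_sq = closed_spanD(1)[OF p]
  have "expectation (\<lambda>x. \<nu> s x * (Z x - p x)) = 0"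
  proof (rule closed_spanD(2))
    show "\<nu> s \<in> closed_span M (Y ` {0..t})"
      using \<nu>_span[OF s'] closed_span_mono[of "Y ` {0..s}" "Y ` {0..t}" M] s by fastforce
    show "square_integrable M (\<lambda>x. Z x - p x)" by (rule square_integrable_diff[OF Z p_sq])
  qed (use orth in auto)
  then show ?thesis
    using square_integrable_mult[OF \<nu>_sq[OF s'] Z] square_integrable_mult[OF \<nu>_sq[OF s'] p_sq] signal_\<nu>[OF s]
    by (simp add: right_diff_distrib mult.commute)
qed

lemma filter_span: "p \<in> closed_span M (\<nu> ` {0..t})"
  using Y_span_subset[OF t] p by blast

lemma gain_L2: "square_integrable (lebesgue_on {0..t}) (\<lambda>r. b r + expectation (\<lambda>x. Z x * e r x))"
  by (intro square_integrable_add b gain_square_integrable order.refl)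

lemma filter_wiener_integral:
  "is_wiener_integral M \<nu> t (\<lambda>r. b r + expectation (\<lambda>x. Z x * e r x)) p"
  using bc_parseval(2)[OF \<nu>_covariance _ _ finite_measure_axioms filter_span gain_L2 filter_\<nu>] t by simp

text \<open>The later time argument of the Riccati equation enters through Z', for which a density
  on [0, t] is enough; only p has to belong to the span.\<close>

lemma filter_parseval:
  assumes "square_integrable M Z'" "square_integrable (lebesgue_on {0..t}) k"
    and "\<And>s. s \<in> {0..t} \<Longrightarrow> expectation (\<lambda>x. Z' x * \<nu> s x) = (LINT r|lebesgue_on {0..s}. k r)"
  shows "expectation (\<lambda>x. Z' x * p x) = (LINT r|lebesgue_on {0..t}. k r * (b r + expectation (\<lambda>x. Z x * e r x)))"
  using bc_parseval(3)[OF \<nu>_covariance _ _ finite_measure_axioms filter_span gain_L2 filter_\<nu> assms] t by simp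

end

end

section \<open>The Riccati equation\<close>

text \<open>Splits the quadratic term of the Riccati equation into products of components of two
  gain vectors.\<close>

lemma matrix_outer_sandwich:
  fixes A B :: "real ^ 'n ^ 'm"
  shows "A ** outer a a ** transpose B = outer (A *v a) (B *v a)"
proof -
  have "(\<Sum>k\<in>UNIV. (\<Sum>j\<in>UNIV. A $ i $ j * (a $ j * a $ k)) * B $ h $ k)
      = (\<Sum>j\<in>UNIV. A $ i $ j * a $ j) * (\<Sum>k\<in>UNIV. B $ h $ k * a $ k)" for i h
    by (simp add: sum_distrib_left sum_distrib_right mult_ac)
  then show ?thesis
    by (simp add: vec_eq_iff matrix_matrix_mult_def outer_def transpose_def matrix_vector_mult_def)
qed

lemma bounded_linear_matrix_nth: "bounded_linear (\<lambda>A :: real ^ 'n ^ 'm. A $ i $ j)"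
  by (intro bounded_linear_compose[OF bounded_linear_vec_nth bounded_linear_vec_nth])

lemma integrable_matrix_iff:
  fixes F :: "'a \<Rightarrow> real ^ 'n ^ 'm"
  shows "integrable N F \<longleftrightarrow> (\<forall>i j. integrable N (\<lambda>x. F x $ i $ j))"
proof
  assume "\<forall>i j. integrable N (\<lambda>x. F x $ i $ j)"
  then have "integrable N (\<lambda>x. F x \<bullet> b)" if "b \<in> Basis" for b
    using that by (auto simp: Basis_vec_def inner_axis)
  then have "integrable N (\<lambda>x. \<Sum>b\<in>Basis. (F x \<bullet> b) *\<^sub>R b)"
    by (intro Bochner_Integration.integrable_sum integrable_scaleR_left)
  then show "integrable N F" by (simp add: euclidean_representation)
qed (use integrable_bounded_linear[OF bounded_linear_matrix_nth] in blast)

lemma integral_matrix_nth: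
  fixes F :: "'a \<Rightarrow> real ^ 'n ^ 'm"
  assumes "integrable N F"
  shows "(LINT x|N. F x) $ i $ j = (LINT x|N. F x $ i $ j)"
  by (rule integral_bounded_linear[OF bounded_linear_matrix_nth assms, symmetric])

section \<open>A priori bounds and uniqueness for the Riccati equation\<close>

lemma nonneg_definite_diag:
  fixes A :: "real ^ 'n ^ 'n"
  assumes "nonneg_definite A"
  shows "0 \<le> A $ i $ i"
proof -
  have "0 \<le> axis i 1 \<bullet> (A *v axis i 1)" using assms by (simp add: nonneg_definite_def)
  also have "\<dots> = A $ i $ i"
    by (simp add: matrix_vector_mult_basis inner_axis' column_def)
  finally show ?thesis .
qed

context
  fixes T :: real and a :: "real \<Rightarrow> real ^ 'n" and D \<Gamma> :: "real \<Rightarrow> real \<Rightarrow> real ^ 'n ^ 'n" and C\<^sub>a C\<^sub>D C\<^sub>\<Gamma> :: real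
  assumes a_bound: "\<And>r i. r \<in> {0..T} \<Longrightarrow> \<bar>a r $ i\<bar> \<le> C\<^sub>a"
    and D_bound: "\<And>r t i. 0 \<le> r \<Longrightarrow> r \<le> t \<Longrightarrow> t \<le> T \<Longrightarrow> \<bar>(D t r *v a r) $ i\<bar> \<le> C\<^sub>D"
    and \<Gamma>_bound: "\<And>r t i j. 0 \<le> r \<Longrightarrow> r \<le> t \<Longrightarrow> t \<le> T \<Longrightarrow> \<bar>\<Gamma> t r $ i $ j\<bar> \<le> C\<^sub>\<Gamma>"
begin

definition gain :: "(real \<Rightarrow> real \<Rightarrow> real ^ 'n ^ 'n) \<Rightarrow> real \<Rightarrow> real \<Rightarrow> real ^ 'n" where
  "gain Q t r = (Q t r + D t r) *v a r"

lemma riccati_component: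
  assumes Q: "riccati_solution T a D \<Gamma> Q" and st: "0 \<le> s" "s \<le> t" "t \<le> T"
  shows "integrable (lebesgue_on {0..s}) (\<lambda>r. gain Q t r $ i * gain Q s r $ j)"
    and "Q t s $ i $ j = \<Gamma> t s $ i $ j - (LINT r|lebesgue_on {0..s}. gain Q t r $ i * gain Q s r $ j)"
proof -
  have eq: "(Q t r + D t r) ** outer (a r) (a r) ** transpose (Q s r + D s r) = outer (gain Q t r) (gain Q s r)" for r
    by (simp only: matrix_outer_sandwich gain_def)
  have "integrable (lebesgue_on {0..s})
          (\<lambda>r. (Q t r + D t r) ** outer (a r) (a r) ** transpose (Q s r + D s r)) \<and>
        Q t s = - (LINT r|lebesgue_on {0..s}.
                     (Q t r + D t r) ** outer (a r) (a r) ** transpose (Q s r + D s r)) + \<Gamma> t s"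
    by (rule Q[unfolded riccati_solution_def, rule_format]) (use st in simp)
  then have int: "integrable (lebesgue_on {0..s}) (\<lambda>r. outer (gain Q t r) (gain Q s r))"
    and Qeq: "Q t s = - (LINT r|lebesgue_on {0..s}. outer (gain Q t r) (gain Q s r)) + \<Gamma> t s"
    unfolding eq by (rule conjunct1, rule conjunct2)
  show "integrable (lebesgue_on {0..s}) (\<lambda>r. gain Q t r $ i * gain Q s r $ j)"
    using int integrable_matrix_iff[of "lebesgue_on {0..s}" "\<lambda>r. outer (gain Q t r) (gain Q s r)"]
    by (simp add: outer_def)
  show "Q t s $ i $ j = \<Gamma> t s $ i $ j - (LINT r|lebesgue_on {0..s}. gain Q t r $ i * gain Q s r $ j)"
    unfolding Qeq using integral_matrix_nth[OF int, of i j] by (simp add: outer_def)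
qed

context
  fixes Q :: "real \<Rightarrow> real \<Rightarrow> real ^ 'n ^ 'n"
  assumes Q: "riccati_solution T a D \<Gamma> Q" and Q_nonneg: "\<And>t. t \<in> {0..T} \<Longrightarrow> nonneg_definite (Q t t)"
begin

text \<open>On the diagonal the equation reads: integral of the squared gain =
  \<open>\<Gamma> t t $ i $ i - Q t t $ i $ i\<close>, and the subtracted entry is nonnegative. This
  is where nonnegative definiteness selects the solution.\<close>

lemma gain_L2_bound:
  assumes "0 \<le> s" "s \<le> t" "t \<le> T"
  shows "integrable (lebesgue_on {0..s}) (\<lambda>r. (gain Q t r $ i)\<^sup>2)"
    and "(LINT r|lebesgue_on {0..s}. (gain Q t r $ i)\<^sup>2) \<le> C\<^sub>\<Gamma>"
proof -
  have t: "0 \<le> t" "t \<le> t" "t \<in> {0..T}" using assms by auto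
  have int: "integrable (lebesgue_on {0..t}) (\<lambda>r. (gain Q t r $ i)\<^sup>2)"
    using riccati_component(1)[OF Q t(1,2) assms(3), of i i] by (simp add: power2_eq_square)
  then show "integrable (lebesgue_on {0..s}) (\<lambda>r. (gain Q t r $ i)\<^sup>2)"
    by (rule integrable_lebesgue_on_subset[OF _ assms(2)])
  have "(LINT r|lebesgue_on {0..s}. (gain Q t r $ i)\<^sup>2) \<le> (LINT r|lebesgue_on {0..t}. (gain Q t r $ i)\<^sup>2)"
    by (rule integral_lebesgue_on_mono_set[OF assms(1,2) int]) simp
  also have "\<dots> = \<Gamma> t t $ i $ i - Q t t $ i $ i"
    using riccati_component(2)[OF Q t(1,2) assms(3), of i i] by (simp add: power2_eq_square)
  also have "\<dots> \<le> C\<^sub>\<Gamma>"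
    using \<Gamma>_bound[OF t(1,2) assms(3), of i i] nonneg_definite_diag[OF Q_nonneg[OF t(3)], of i] by linarith
  finally show "(LINT r|lebesgue_on {0..s}. (gain Q t r $ i)\<^sup>2) \<le> C\<^sub>\<Gamma>" .
qed

text \<open>The product of two gain components is dominated by half the sum of their squares, so its
  integral is at most \<open>C\<^sub>\<Gamma>\<close>; the term \<Gamma> contributes the second
  \<open>C\<^sub>\<Gamma>\<close>.\<close>

lemma riccati_bounded:
  assumes st: "0 \<le> s" "s \<le> t" "t \<le> T"
  shows "\<bar>Q t s $ i $ j\<bar> \<le> 2 * C\<^sub>\<Gamma>"
proof -
  let ?x = "\<lambda>r. gain Q t r $ i" and ?y = "\<lambda>r. gain Q s r $ j"
  have s: "s \<le> s" "s \<le> T" using st by auto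
  note x = gain_L2_bound[OF st, of i] and y = gain_L2_bound[OF st(1) s, of j]
  have le: "\<bar>?x r * ?y r\<bar> \<le> (?x r)\<^sup>2 / 2 + (?y r)\<^sup>2 / 2" for r
  proof -
    have "0 \<le> (\<bar>?x r\<bar> - \<bar>?y r\<bar>)\<^sup>2" by simp
    then show ?thesis by (simp add: power2_diff abs_mult)
  qed
  have "\<bar>LINT r|lebesgue_on {0..s}. ?x r * ?y r\<bar> \<le> (LINT r|lebesgue_on {0..s}. \<bar>?x r * ?y r\<bar>)"
    by (rule integral_abs_bound)
  also have "\<dots> \<le> (LINT r|lebesgue_on {0..s}. (?x r)\<^sup>2 / 2 + (?y r)\<^sup>2 / 2)"
    using riccati_component(1)[OF Q st, of i j] x(1) y(1) le by (intro integral_mono) auto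
  also have "\<dots> \<le> C\<^sub>\<Gamma>" using x y by simp
  finally show ?thesis
    using riccati_component(2)[OF Q st, of i j] \<Gamma>_bound[OF st, of i j] by linarith
qed

text \<open>The direct term is controlled as the product \<open>D t s *v a s\<close>. In the
  application the entry l/\<mu> of D may be unbounded, since \<mu> can come close to 0, but
  multiplication by a restores the bounded kernel l.\<close>

lemma gain_bounded:
  assumes st: "0 \<le> s" "s \<le> t" "t \<le> T"
  shows "\<bar>gain Q t s $ i\<bar> \<le> real CARD('n) * (2 * C\<^sub>\<Gamma> * C\<^sub>a) + C\<^sub>D"
proof -
  have s: "s \<in> {0..T}" using st by auto
  have "\<bar>(Q t s *v a s) $ i\<bar> \<le> (\<Sum>j\<in>UNIV. \<bar>Q t s $ i $ j * a s $ j\<bar>)"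
    by (simp add: matrix_vector_mult_def)
  also have "\<dots> \<le> (\<Sum>j\<in>(UNIV :: 'n set). 2 * C\<^sub>\<Gamma> * C\<^sub>a)"
    using riccati_bounded[OF st] a_bound[OF s]
    by (intro sum_mono) (auto simp: abs_mult intro!: mult_mono')
  finally have "\<bar>(Q t s *v a s) $ i\<bar> \<le> real CARD('n) * (2 * C\<^sub>\<Gamma> * C\<^sub>a)" by simp
  then show ?thesis
    using D_bound[OF st, of i] by (simp add: gain_def matrix_vector_mult_add_rdistrib)
qed

end

text \<open>For bounded gains the quadratic term is Lipschitz in Q, so the distance of two solutions
  satisfies a linear Volterra inequality.\<close>

theorem riccati_unique:
  assumes Q1: "riccati_solution T a D \<Gamma> Q\<^sub>1" "\<And>t. t \<in> {0..T} \<Longrightarrow> nonneg_definite (Q\<^sub>1 t t)"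
    and Q2: "riccati_solution T a D \<Gamma> Q\<^sub>2" "\<And>t. t \<in> {0..T} \<Longrightarrow> nonneg_definite (Q\<^sub>2 t t)"
    and st: "0 \<le> s" "s \<le> t" "t \<le> T"
  shows "Q\<^sub>1 t s = Q\<^sub>2 t s"
proof -
  let ?n = "real CARD('n)"
  define Kg where "Kg = ?n * (2 * C\<^sub>\<Gamma> * C\<^sub>a) + C\<^sub>D"
  define m where "m t s = (\<Sum>i\<in>UNIV. \<Sum>j\<in>UNIV. \<bar>Q\<^sub>1 t s $ i $ j - Q\<^sub>2 t s $ i $ j\<bar>)" for t s
  have Ca: "0 \<le> C\<^sub>a" using a_bound[of 0 undefined] st by auto
  have g1: "\<bar>gain Q\<^sub>1 t r $ i\<bar> \<le> Kg" and g2: "\<bar>gain Q\<^sub>2 t r $ i\<bar> \<le> Kg"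
    if "0 \<le> r" "r \<le> t" "t \<le> T" for t r i
    unfolding Kg_def by (rule gain_bounded[OF Q1 that] gain_bounded[OF Q2 that]; assumption)+
  have Kg: "0 \<le> Kg" using g1[OF st, of undefined] by linarith
  have comp_le: "\<bar>Q\<^sub>1 t s $ i $ j - Q\<^sub>2 t s $ i $ j\<bar> \<le> m t s" for t s i j
  proof -
    have "\<bar>Q\<^sub>1 t s $ i $ j - Q\<^sub>2 t s $ i $ j\<bar> \<le> (\<Sum>j\<in>UNIV. \<bar>Q\<^sub>1 t s $ i $ j - Q\<^sub>2 t s $ i $ j\<bar>)"
      by (rule member_le_sum) auto
    also have "\<dots> \<le> m t s" unfolding m_def by (rule member_le_sum) (auto intro: sum_nonneg)
    finally show ?thesis .
  qed
  have gain_diff: "\<bar>gain Q\<^sub>1 t r $ i - gain Q\<^sub>2 t r $ i\<bar> \<le> C\<^sub>a * m t r" if r: "r \<in> {0..T}" for t r i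
  proof -
    have "gain Q\<^sub>1 t r $ i - gain Q\<^sub>2 t r $ i = (\<Sum>j\<in>UNIV. (Q\<^sub>1 t r $ i $ j - Q\<^sub>2 t r $ i $ j) * a r $ j)"
      by (simp add: gain_def matrix_vector_mult_def left_diff_distrib distrib_right sum_subtractf sum.distrib)
    also have "\<bar>\<dots>\<bar> \<le> (\<Sum>j\<in>UNIV. \<bar>(Q\<^sub>1 t r $ i $ j - Q\<^sub>2 t r $ i $ j) * a r $ j\<bar>)" by (rule sum_abs)
    also have "\<dots> \<le> (\<Sum>j\<in>UNIV. \<bar>Q\<^sub>1 t r $ i $ j - Q\<^sub>2 t r $ i $ j\<bar> * C\<^sub>a)"
      using a_bound[OF r] by (intro sum_mono) (auto simp: abs_mult intro!: mult_left_mono)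
    also have "\<dots> = (\<Sum>j\<in>UNIV. \<bar>Q\<^sub>1 t r $ i $ j - Q\<^sub>2 t r $ i $ j\<bar>) * C\<^sub>a" by (simp add: sum_distrib_right)
    also have "\<dots> \<le> m t r * C\<^sub>a"
    proof (rule mult_right_mono[OF _ Ca])
      show "(\<Sum>j\<in>UNIV. \<bar>Q\<^sub>1 t r $ i $ j - Q\<^sub>2 t r $ i $ j\<bar>) \<le> m t r"
        unfolding m_def by (rule member_le_sum) (auto intro: sum_nonneg)
    qed
    finally show ?thesis by (simp add: mult.commute)
  qed
  \<comment> \<open>The first time argument is the index of the iteration, since the equation at (t,
    s) involves both (t, r) and (s, r). The factor \<open>?n * ?n\<close> counts entries, 4
    \<open>C\<^sub>\<Gamma>\<close> is the sum of the a priori bounds of the two solutions, and 2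
    \<open>Kg * C\<^sub>a\<close> comes from the product rule for differences of gains.\<close>
  have "m t s \<le> 0"
  proof (rule gronwall_iteration[where P="\<lambda>t s. s \<le> t \<and> t \<le> T" and m=m and K="?n * (?n * (4 * C\<^sub>\<Gamma>))"
        and C="?n * (?n * (2 * Kg * C\<^sub>a))"])
    show "0 \<le> ?n * (?n * (2 * Kg * C\<^sub>a))" using Kg Ca by simp
    fix t s assume "s \<le> t \<and> t \<le> T" "0 \<le> s"
    then have st: "0 \<le> s" "s \<le> t" "t \<le> T" by auto
    have "\<bar>Q\<^sub>1 t s $ i $ j - Q\<^sub>2 t s $ i $ j\<bar> \<le> 4 * C\<^sub>\<Gamma>" for i j
    proof -
      have "\<bar>Q\<^sub>1 t s $ i $ j\<bar> \<le> 2 * C\<^sub>\<Gamma>" "\<bar>Q\<^sub>2 t s $ i $ j\<bar> \<le> 2 * C\<^sub>\<Gamma>"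
        by (rule riccati_bounded[OF Q1 st] riccati_bounded[OF Q2 st]; assumption)+
      then show ?thesis by linarith
    qed
    then have "m t s \<le> (\<Sum>i\<in>(UNIV :: 'n set). \<Sum>j\<in>(UNIV :: 'n set). 4 * C\<^sub>\<Gamma>)"
      unfolding m_def by (intro sum_mono)
    then show "m t s \<le> ?n * (?n * (4 * C\<^sub>\<Gamma>))" by simp
    fix b assume b: "integrable (lebesgue_on {0..s}) b"
      "\<And>j r. \<lbrakk>r \<le> j \<and> j \<le> T; 0 \<le> r; r \<le> s\<rbrakk> \<Longrightarrow> m j r \<le> b r"
    have s: "s \<le> s" "s \<le> T" using st by auto
    have "\<bar>Q\<^sub>1 t s $ i $ j - Q\<^sub>2 t s $ i $ j\<bar> \<le> 2 * Kg * C\<^sub>a * (LINT r|lebesgue_on {0..s}. b r)" for i j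
    proof -
      let ?d = "\<lambda>r. gain Q\<^sub>1 t r $ i * gain Q\<^sub>1 s r $ j - gain Q\<^sub>2 t r $ i * gain Q\<^sub>2 s r $ j"
      note i1 = riccati_component(1)[OF Q1(1) st, of i j] and i2 = riccati_component(1)[OF Q2(1) st, of i j]
      have "Q\<^sub>1 t s $ i $ j - Q\<^sub>2 t s $ i $ j = - (LINT r|lebesgue_on {0..s}. ?d r)"
        unfolding Bochner_Integration.integral_diff[OF i1 i2]
        using riccati_component(2)[OF Q1(1) st, of i j] riccati_component(2)[OF Q2(1) st, of i j] by simp
      then have "\<bar>Q\<^sub>1 t s $ i $ j - Q\<^sub>2 t s $ i $ j\<bar> \<le> (LINT r|lebesgue_on {0..s}. \<bar>?d r\<bar>)"
        using integral_abs_bound[of "lebesgue_on {0..s}" ?d] by simp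
      also have "\<dots> \<le> (LINT r|lebesgue_on {0..s}. 2 * Kg * C\<^sub>a * b r)"
      proof (rule integral_mono)
        fix r assume "r \<in> space (lebesgue_on {0..s})"
        then have r: "0 \<le> r" "r \<le> s" "r \<le> t" "r \<in> {0..T}" using st by auto
        have mt: "m t r \<le> b r" and ms: "m s r \<le> b r" using b(2) r st by auto
        have "?d r = (gain Q\<^sub>1 t r $ i - gain Q\<^sub>2 t r $ i) * gain Q\<^sub>1 s r $ j
            + gain Q\<^sub>2 t r $ i * (gain Q\<^sub>1 s r $ j - gain Q\<^sub>2 s r $ j)"
          by (simp add: algebra_simps)
        then have "\<bar>?d r\<bar> \<le> \<bar>gain Q\<^sub>1 t r $ i - gain Q\<^sub>2 t r $ i\<bar> * \<bar>gain Q\<^sub>1 s r $ j\<bar>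
            + \<bar>gain Q\<^sub>2 t r $ i\<bar> * \<bar>gain Q\<^sub>1 s r $ j - gain Q\<^sub>2 s r $ j\<bar>"
          by (simp only: abs_mult[symmetric] abs_triangle_ineq)
        also have "\<dots> \<le> (C\<^sub>a * b r) * Kg + Kg * (C\<^sub>a * b r)"
        proof (intro add_mono mult_mono')
          show "\<bar>gain Q\<^sub>1 t r $ i - gain Q\<^sub>2 t r $ i\<bar> \<le> C\<^sub>a * b r"
            by (rule order.trans[OF gain_diff[OF r(4)] mult_left_mono[OF mt Ca]])
          show "\<bar>gain Q\<^sub>1 s r $ j - gain Q\<^sub>2 s r $ j\<bar> \<le> C\<^sub>a * b r"
            by (rule order.trans[OF gain_diff[OF r(4)] mult_left_mono[OF ms Ca]])
        qed (use g1[OF r(1,2) s(2)] g2[OF r(1,3) st(3)] in auto)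
        finally show "\<bar>?d r\<bar> \<le> 2 * Kg * C\<^sub>a * b r" by (simp add: mult_ac)
      qed (use i1 i2 b(1) in auto)
      finally show ?thesis by simp
    qed
    then have "m t s \<le> (\<Sum>i\<in>(UNIV :: 'n set). \<Sum>j\<in>(UNIV :: 'n set). 2 * Kg * C\<^sub>a * (LINT r|lebesgue_on {0..s}. b r))"
      unfolding m_def by (intro sum_mono)
    then show "m t s \<le> ?n * (?n * (2 * Kg * C\<^sub>a)) * (LINT r|lebesgue_on {0..s}. b r)"
      by (simp add: mult.assoc)
  qed (use st in auto)
  then have "\<bar>Q\<^sub>1 t s $ i $ j - Q\<^sub>2 t s $ i $ j\<bar> \<le> 0" for i j using comp_le[of t s i j] by linarith
  then show ?thesis by (simp add: vec_eq_iff)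
qed

end

section \<open>The filter\<close>

text \<open>Completeness makes preimages that differ by a subset of a null set measurable.\<close>

lemma (in complete_measure) borel_measurable_AE:
  fixes f g :: "'a \<Rightarrow> real"
  assumes f: "f \<in> borel_measurable M" and eq: "AE x in M. f x = g x"
  shows "g \<in> borel_measurable M"
proof (rule measurableI)
  fix A :: "real set" assume A: "A \<in> sets borel"
  have sets: "f -` A \<inter> space M \<in> sets M" by (rule measurable_sets[OF f A])
  have ae: "AE x in M. x \<in> f -` A \<inter> space M \<longleftrightarrow> x \<in> g -` A \<inter> space M"
    using eq by eventually_elim auto
  show "g -` A \<inter> space M \<in> sets M"
    by (rule in_sets_AE[OF ae sets]) simp
qed simp

lemma integral_mult_cong_AE:
  fixes f g f' g' :: "'a \<Rightarrow> real"
  assumes "f \<in> borel_measurable M" "g \<in> borel_measurable M" "f' \<in> borel_measurable M" "g' \<in> borel_measurable M"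
    and "AE x in M. f x = f' x" "AE x in M. g x = g' x"
  shows "(LINT x|M. f x * g x) = (LINT x|M. f' x * g' x)"
proof (rule integral_cong_AE)
  show "AE x in M. f x * g x = f' x * g' x" using assms(5,6) by eventually_elim simp
qed (use assms in auto)

lemma square_integrable_cong:
  assumes "\<And>x. x \<in> space M \<Longrightarrow> f x = g x"
  shows "square_integrable M f \<longleftrightarrow> square_integrable M g"
  unfolding square_integrable_def
  using measurable_cong[of M f g borel] Bochner_Integration.integrable_cong[OF refl, of M "\<lambda>x. (f x)\<^sup>2" "\<lambda>x. (g x)\<^sup>2"] assms
  by simp

lemma step_integral_AE:
  assumes "\<And>s. s \<in> {0..t} \<Longrightarrow> AE x in M. V s x = W s x" "steps_within t L"
  shows "AE x in M. step_integral V L x = step_integral W L x"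
  using assms(2)
proof (induction L)
  case (Cons a L)
  obtain u v c where a: "a = (u, v, c)" by (cases a)
  with Cons.prems have uv: "u \<in> {0..t}" "v \<in> {0..t}" "steps_within t L" by auto
  show ?case
    using Cons.IH[OF uv(3)] assms(1)[OF uv(1)] assms(1)[OF uv(2)]
    by eventually_elim (simp only: a step_integral_Cons)
qed simp

text \<open>Transfers the result from the regularised innovation and the abstract gain to the
  processes and matrices of the theorem.\<close>

lemma is_wiener_integral_cong:
  assumes J: "is_wiener_integral M W t h J"
    and V: "\<And>s. s \<in> {0..t} \<Longrightarrow> V s \<in> borel_measurable M" "\<And>s. s \<in> {0..t} \<Longrightarrow> AE x in M. W s x = V s x"
    and h: "\<And>r. r \<in> {0..t} \<Longrightarrow> h r = k r"
  shows "is_wiener_integral M V t k J"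
proof -
  have W_sq: "square_integrable M (W s)" if "s \<in> {0..t}" for s
    using J that by (auto simp: is_wiener_integral_def)
  have V_sq: "square_integrable M (V s)" if "s \<in> {0..t}" for s
    by (rule square_integrable_AE[OF W_sq V(1,2)]; fact)
  have k_sq: "square_integrable (lebesgue_on {0..t}) k"
    using J h square_integrable_cong[of "lebesgue_on {0..t}" h k] by (simp add: is_wiener_integral_def)
  have J_sq: "square_integrable M J" using J by (simp add: is_wiener_integral_def)
  show ?thesis
    unfolding is_wiener_integral_def
  proof (intro conjI ballI allI impI k_sq J_sq V_sq)
    fix L :: "nat \<Rightarrow> (real \<times> real \<times> real) list"
    assume L: "(\<forall>n. \<forall>(u, v, c)\<in>set (L n). 0 \<le> u \<and> u \<le> v \<and> v \<le> t) \<and>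
       (\<lambda>n. LINT r|lebesgue_on {0..t}. (step_fun (L n) r - k r)\<^sup>2) \<longlonglongrightarrow> 0"
    then have within: "steps_within t (L n)" for n by (simp add: steps_within_def)
    have "(LINT r|lebesgue_on {0..t}. (step_fun (L n) r - k r)\<^sup>2) = (LINT r|lebesgue_on {0..t}. (step_fun (L n) r - h r)\<^sup>2)" for n
      using h by (intro Bochner_Integration.integral_cong) auto
    with L have "(\<lambda>n. LINT x|M. (step_integral W (L n) x - J x)\<^sup>2) \<longlonglongrightarrow> 0"
      using J by (simp add: is_wiener_integral_def)
    moreover have "(LINT x|M. (step_integral W (L n) x - J x)\<^sup>2) = (LINT x|M. (step_integral V (L n) x - J x)\<^sup>2)" for n
    proof (rule integral_cong_AE)
      note [measurable] = square_integrableD(1)[OF J_sq]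
        square_integrableD(1)[OF square_integrable_step_integral[OF W_sq within]]
        square_integrableD(1)[OF square_integrable_step_integral[OF V_sq within]]
      show "(\<lambda>x. (step_integral W (L n) x - J x)\<^sup>2) \<in> borel_measurable M" by measurable
      show "(\<lambda>x. (step_integral V (L n) x - J x)\<^sup>2) \<in> borel_measurable M" by measurable
      show "AE x in M. (step_integral W (L n) x - J x)\<^sup>2 = (step_integral V (L n) x - J x)\<^sup>2"
      proof -
        have "AE x in M. step_integral W (L n) x = step_integral V (L n) x"
          by (rule step_integral_AE[OF V(2) within])
        then show ?thesis by eventually_elim simp
      qed
    qed
    ultimately show "(\<lambda>n. LINT x|M. (step_integral V (L n) x - J x)\<^sup>2) \<longlonglongrightarrow> 0" by simp
  qed
qed

lemma borel_measurable_vecI: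
  fixes f :: "'a \<Rightarrow> real ^ 'n"
  assumes "\<And>i. (\<lambda>x. f x $ i) \<in> borel_measurable M"
  shows "f \<in> borel_measurable M"
proof (rule borel_measurable_euclidean_space[THEN iffD2], rule ballI)
  fix b :: "real ^ 'n" assume "b \<in> Basis"
  then show "(\<lambda>x. f x \<bullet> b) \<in> borel_measurable M"
    using assms by (auto simp: Basis_vec_def inner_axis)
qed

lemma borel_measurable_vec_nth' [measurable (raw)]:
  fixes f :: "'a \<Rightarrow> real ^ 'n"
  shows "f \<in> borel_measurable M \<Longrightarrow> (\<lambda>x. f x $ i) \<in> borel_measurable M"
  by (rule borel_measurable_continuous_on[of "\<lambda>v. v $ i"]) (intro continuous_intros)

text \<open>Preimages under \<open>f\<close> and \<open>g\<close> differ by two null sets, which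
  belong to the augmented \<sigma>-algebra. So the regularised observations stay adapted to the
  filtration of the original ones.\<close>

lemma in_sigma_with_null_sets:
  fixes f g :: "'a \<Rightarrow> real"
  assumes F: "sets F = sigma_sets (space M) (G \<union> null_sets M)" "space F = space M"
    and f: "f \<in> borel_measurable M" "f \<in> borel_measurable F" and g: "g \<in> borel_measurable M"
    and eq: "AE x in M. f x = g x"
  shows "g \<in> borel_measurable F"
proof (rule measurableI)
  fix A :: "real set" assume A: "A \<in> sets borel"
  let ?f = "f -` A \<inter> space M" and ?g = "g -` A \<inter> space M"
  have sets: "?f \<in> sets M" "?g \<in> sets M" using measurable_sets f(1) g A by auto
  have null: "N \<in> sets F" if "N \<in> null_sets M" for N
    unfolding F(1) using that by auto
  have "AE x in M. x \<notin> ?g - ?f" using eq by eventually_elim auto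
  then have n1: "?g - ?f \<in> null_sets M" using AE_iff_null_sets[of "?g - ?f" M] sets by blast
  have "AE x in M. x \<notin> ?f - ?g" using eq by eventually_elim auto
  then have n2: "?f - ?g \<in> null_sets M" using AE_iff_null_sets[of "?f - ?g" M] sets by blast
  have "?f \<in> sets F" using measurable_sets[OF f(2) A] F(2) by simp
  then have "(?f - (?f - ?g)) \<union> (?g - ?f) \<in> sets F"
    by (rule sets.Un[OF sets.Diff[OF _ null[OF n2]] null[OF n1]])
  also have "(?f - (?f - ?g)) \<union> (?g - ?f) = ?g" by auto
  finally show "g -` A \<inter> space F \<in> sets F" using F(2) by simp
qed simp

section \<open>The filtering model and its regularised processes\<close>

locale filtering = gaussian_signal M T X U B + complete_measure M + volterra_kernel T Kl l
  for M :: "'w measure" and T :: real and X U B :: "real \<Rightarrow> 'w \<Rightarrow> real"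
    and Kl :: real and l :: "real \<Rightarrow> real \<Rightarrow> real" +
  fixes \<mu> :: "real \<Rightarrow> real" and K\<mu> :: real and \<alpha> Y :: "real \<Rightarrow> 'w \<Rightarrow> real"
  assumes \<mu>_meas: "\<mu> \<in> borel_measurable (restrict_space borel {0..T})"
    and \<mu>_bound: "\<And>t. t \<in> {0..T} \<Longrightarrow> \<bar>\<mu> t\<bar> \<le> K\<mu>"
    and \<alpha>_process: "measurable_process M T \<alpha>"
    and \<alpha>_wiener: "\<And>t. t \<in> {0..T} \<Longrightarrow> is_wiener_integral M B t (l t) (\<alpha> t)"
    and Y: "\<And>t \<omega>. Y t \<omega> = (LINT s|lebesgue_on {0..t}. \<mu> s * X s \<omega>) + (B t \<omega> - (LINT s|lebesgue_on {0..t}. \<alpha> s \<omega>))"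
begin

lemma T_mem: "0 \<le> T" "0 \<in> {0..T}" "T \<le> T" using T by auto

text \<open>One null set fixed once for all processes and times, so that whole paths are modified
  consistently.\<close>

definition bad :: "'w set" where
  "bad = (SOME N. N \<in> null_sets M \<and> {x\<in>space M. \<not> (continuous_on {0..T} (\<lambda>t. (X t x, U t x)) \<and> continuous_on {0..T} (\<lambda>t. B t x))} \<subseteq> N)"

lemma bad:
  "bad \<in> null_sets M"
  "\<And>x. x \<in> space M \<Longrightarrow> x \<notin> bad \<Longrightarrow> continuous_on {0..T} (\<lambda>t. (X t x, U t x)) \<and> continuous_on {0..T} (\<lambda>t. B t x)"
proof -
  have "AE x in M. continuous_on {0..T} (\<lambda>t. (X t x, U t x)) \<and> continuous_on {0..T} (\<lambda>t. B t x)"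
    using XU_continuous B unfolding brownian_motion_def continuous_process_def by auto
  then obtain N where "N \<in> null_sets M" "{x\<in>space M. \<not> (continuous_on {0..T} (\<lambda>t. (X t x, U t x)) \<and> continuous_on {0..T} (\<lambda>t. B t x))} \<subseteq> N"
    unfolding eventually_ae_filter by blast
  then have *: "bad \<in> null_sets M \<and> {x\<in>space M. \<not> (continuous_on {0..T} (\<lambda>t. (X t x, U t x)) \<and> continuous_on {0..T} (\<lambda>t. B t x))} \<subseteq> bad"
    unfolding bad_def by (intro someI[of "\<lambda>N. N \<in> null_sets M \<and> _ \<subseteq> N"]) blast
  then show "bad \<in> null_sets M" by blast
  from * show "\<And>x. x \<in> space M \<Longrightarrow> x \<notin> bad \<Longrightarrow> continuous_on {0..T} (\<lambda>t. (X t x, U t x)) \<and> continuous_on {0..T} (\<lambda>t. B t x)"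
    by blast
qed

text \<open>Paths are continuous only almost surely, so the processes are modified on a null set to
  become jointly measurable.\<close>

definition regular :: "('w \<Rightarrow> real) \<Rightarrow> 'w \<Rightarrow> real" where
  "regular f x = (if x \<in> bad then 0 else f x)"

lemma regular_measurable: "f \<in> borel_measurable M \<Longrightarrow> regular f \<in> borel_measurable M"
  unfolding regular_def[abs_def] using bad(1) by (intro measurable_If_set) auto

lemma regular_AE: "AE x in M. \<forall>f. regular f x = f x"
  using AE_not_in[OF bad(1)] by eventually_elim (simp add: regular_def)

lemma regular_AE': "AE x in M. f x = regular f x"
  using regular_AE by eventually_elim simp

lemma regular_process:
  assumes "\<And>x. x \<in> space M \<Longrightarrow> x \<notin> bad \<Longrightarrow> continuous_on {0..T} (\<lambda>t. W t x)"
    and "\<And>t. t \<in> {0..T} \<Longrightarrow> square_integrable M (W t)"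
  shows "measurable_process M T (\<lambda>t. regular (W t))"
proof (rule measurable_process_if_continuous[OF _ _ T_mem(1)])
  fix x assume "x \<in> space M"
  then show "continuous_on {0..T} (\<lambda>t. regular (W t) x)"
    using assms(1)[of x] by (cases "x \<in> bad") (simp_all add: regular_def)
qed (use assms(2) in \<open>auto intro!: regular_measurable simp: square_integrable_def\<close>)

lemma X'_process: "measurable_process M T (\<lambda>t. regular (X t))"
  by (rule regular_process[OF _ X_square_integrable]) (use bad(2) continuous_on_fst in fastforce)+

lemma U'_process: "measurable_process M T (\<lambda>t. regular (U t))"
  by (rule regular_process[OF _ U_square_integrable]) (use bad(2) continuous_on_snd in fastforce)+

lemma B'_process: "measurable_process M T (\<lambda>t. regular (B t))"
  by (rule regular_process[OF _ B_square_integrable]) (use bad(2) in blast)+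

lemma regular_square_integrable:
  "square_integrable M f \<Longrightarrow> square_integrable M (regular f)"
  by (rule square_integrable_AE[OF _ regular_measurable regular_AE']) (auto simp: square_integrable_def)

lemma regular_integral_mult:
  assumes "square_integrable M f" "square_integrable M g"
  shows "expectation (\<lambda>x. f x * regular g x) = expectation (\<lambda>x. f x * g x)"
  using assms regular_measurable[of g] regular_AE'[of g]
  by (intro integral_mult_cong_AE) (auto simp: square_integrable_def elim: eventually_mono)

lemma regular_span: "f \<in> closed_span M S \<Longrightarrow> regular f \<in> closed_span M S"
  by (rule closed_span_AE[OF _ regular_measurable regular_AE'])
     (auto dest!: closed_spanD(1) simp: square_integrable_def)

lemma B'_covariance: "brownian_covariance M T (\<lambda>t. regular (B t))"
  unfolding brownian_covariance_def
proof (intro conjI ballI)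
  fix s t assume st: "s \<in> {0..T}" "t \<in> {0..T}"
  note sq = B_square_integrable[OF st(1)] B_square_integrable[OF st(2)]
  show "square_integrable M (regular (B s))" by (rule regular_square_integrable[OF sq(1)])
  have "expectation (\<lambda>x. regular (B s) x * regular (B t) x) = expectation (\<lambda>x. B t x * B s x)"
    using regular_integral_mult[OF regular_square_integrable[OF sq(1)] sq(2)] regular_integral_mult[OF sq(2) sq(1)]
    by (simp add: mult.commute)
  then show "expectation (\<lambda>x. regular (B s) x * regular (B t) x) = min s t"
    using bc_cov[OF B_covariance st(2,1)] by (simp add: min.commute)
qed

lemma \<alpha>_sq: "t \<in> {0..T} \<Longrightarrow> square_integrable M (\<alpha> t)"
  using \<alpha>_wiener by (auto simp: is_wiener_integral_def)

lemma \<alpha>_span: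
  assumes t: "t \<in> {0..T}"
  shows "\<alpha> t \<in> closed_span M base"
proof -
  have t': "0 \<le> t" "t \<le> T" using t by auto
  have "\<alpha> t \<in> closed_span M (B ` {0..t})"
    by (rule is_wiener_integral_bcD(1)[OF B_covariance t' \<alpha>_wiener[OF t]])
  moreover have "B ` {0..t} \<subseteq> base" using t by auto
  ultimately show ?thesis using closed_span_mono by blast
qed

lemma \<alpha>_B:
  assumes r: "r \<in> {0..T}" and s: "s \<in> {0..T}"
  shows "expectation (\<lambda>x. \<alpha> r x * B s x) = (LINT u|lebesgue_on {0..s}. l r u)"
proof -
  have r': "0 \<le> r" "r \<le> T" using r by auto
  show ?thesis
  proof (cases "s \<le> r")
    case True
    then show ?thesis using is_wiener_integral_bcD(2)[OF B_covariance r' \<alpha>_wiener[OF r]] s by simp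
  next
    case False
    then show ?thesis
      using is_wiener_integral_bcD(3)[OF B_covariance r' \<alpha>_wiener[OF r], of s] integral_l_stop[of r r s] s r by simp
  qed
qed

lemma \<alpha>_bound:
  assumes t: "t \<in> {0..T}"
  shows "expectation (\<lambda>x. (\<alpha> t x)\<^sup>2) \<le> Kl\<^sup>2 * T"
proof -
  have t': "0 \<le> t" "t \<le> T" using t by auto
  have "expectation (\<lambda>x. (\<alpha> t x)\<^sup>2) = (LINT r|lebesgue_on {0..t}. (l t r)\<^sup>2)"
    by (rule is_wiener_integral_bcD(4)[OF B_covariance t' \<alpha>_wiener[OF t]])
  also have "\<dots> \<le> (LINT r|lebesgue_on {0..t}. Kl\<^sup>2)"
    using l_section_bounded[OF t t'(2)] power_mono[OF l_bound[OF t], of _ 2] t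
    by (intro integral_mono) (auto simp: square_integrable_def)
  also have "\<dots> = Kl\<^sup>2 * t" using t by (simp add: measure_restrict_space)
  also have "\<dots> \<le> Kl\<^sup>2 * T" using t by (intro mult_left_mono) auto
  finally show ?thesis .
qed

text \<open>The components of Z with X and U regularised; \<alpha> is jointly measurable by
  assumption and stays as it is.\<close>

definition signal :: "3 \<Rightarrow> real \<Rightarrow> 'w \<Rightarrow> real" where
  "signal i t x = (vector [regular (X t) x, regular (U t) x, \<alpha> t x] :: real ^ 3) $ i"

lemma signal_simps:
  "signal 1 = (\<lambda>t. regular (X t))" "signal 2 = (\<lambda>t. regular (U t))" "signal 3 = \<alpha>"
  by (auto simp: signal_def fun_eq_iff)

lemma signal_process: "measurable_process M T (signal i)"
  using X'_process U'_process \<alpha>_process exhaust_3[of i] by (auto simp: signal_simps)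

lemma signal_span: "t \<in> {0..T} \<Longrightarrow> signal i t \<in> closed_span M base"
  using exhaust_3[of i] \<alpha>_span[of t]
    regular_span[OF closed_span_base[OF _ X_square_integrable], of t base]
    regular_span[OF closed_span_base[OF _ U_square_integrable], of t base]
  by (auto simp: signal_simps)

lemma signal_sq: "t \<in> {0..T} \<Longrightarrow> square_integrable M (signal i t)"
  by (rule closed_spanD(1)[OF signal_span])

lemma ex_signal_bound: "\<exists>K. \<forall>i. \<forall>t\<in>{0..T}. expectation (\<lambda>x. (signal i t x)\<^sup>2) \<le> K"
proof -
  obtain KX where KX: "\<And>t. t \<in> {0..T} \<Longrightarrow> expectation (\<lambda>x. (X t x)\<^sup>2) \<le> KX"
    using L2_continuous_on_bounded[OF X_L2_continuous] by blast
  obtain KU where KU: "\<And>t. t \<in> {0..T} \<Longrightarrow> expectation (\<lambda>x. (U t x)\<^sup>2) \<le> KU"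
    using L2_continuous_on_bounded[OF U_L2_continuous] by blast
  have reg: "expectation (\<lambda>x. (regular f x)\<^sup>2) = expectation (\<lambda>x. (f x)\<^sup>2)" if "square_integrable M f" for f
    unfolding power2_eq_square
    using regular_integral_mult[OF regular_square_integrable[OF that] that] regular_integral_mult[OF that that]
    by (simp add: mult.commute)
  have "expectation (\<lambda>x. (signal i t x)\<^sup>2) \<le> max KX (max KU (Kl\<^sup>2 * T))" if "t \<in> {0..T}" for i t
    using exhaust_3[of i] KX[OF that] KU[OF that] \<alpha>_bound[OF that] reg[OF X_square_integrable[OF that]] reg[OF U_square_integrable[OF that]]
    by (auto simp: signal_simps max_def)
  then show ?thesis by blast
qed

definition signal_const :: real where
  "signal_const = (SOME K. \<forall>i. \<forall>t\<in>{0..T}. expectation (\<lambda>x. (signal i t x)\<^sup>2) \<le> K)"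

lemma signal_bound: "t \<in> {0..T} \<Longrightarrow> expectation (\<lambda>x. (signal i t x)\<^sup>2) \<le> signal_const"
  unfolding signal_const_def using someI_ex[OF ex_signal_bound] by blast

text \<open>X and U are independent of B, so only \<alpha> is correlated with it; the integrand is
  the future \<open>D t r *v a r\<close> in components.\<close>

lemma signal_B:
  assumes t: "t \<in> {0..T}" and s: "s \<in> {0..T}"
  shows "expectation (\<lambda>x. signal i t x * regular (B s) x)
    = (LINT r|lebesgue_on {0..s}. (if i = 3 then l t r else 0))"
proof -
  have "expectation (\<lambda>x. signal i t x * regular (B s) x) = expectation (\<lambda>x. B s x * signal i t x)"
    using regular_integral_mult[OF signal_sq[OF t] B_square_integrable[OF s]] by (simp add: mult.commute)
  also have "\<dots> = (LINT r|lebesgue_on {0..s}. (if i = 3 then l t r else 0))"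
    using exhaust_3[of i] \<alpha>_B[OF t s] X_orthogonal_B[OF t s] U_orthogonal_B[OF t s]
      regular_integral_mult[OF B_square_integrable[OF s] X_square_integrable[OF t]]
      regular_integral_mult[OF B_square_integrable[OF s] U_square_integrable[OF t]]
    by (auto simp: signal_simps mult.commute)
  finally show ?thesis .
qed

text \<open>The scalar signal a* Z that the observation process integrates.\<close>

definition drift :: "real \<Rightarrow> 'w \<Rightarrow> real" where
  "drift t x = \<mu> t * regular (X t) x - \<alpha> t x"

lemma drift_process: "measurable_process M T drift"
  unfolding drift_def[abs_def]
  by (intro measurable_process_diff measurable_process_mult_fun X'_process \<alpha>_process \<mu>_meas)

lemma drift_eq: "drift t = (\<lambda>x. \<mu> t * signal 1 t x - signal 3 t x)"
  by (simp add: drift_def[abs_def] signal_simps)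

lemma drift_span: "t \<in> {0..T} \<Longrightarrow> drift t \<in> closed_span M base"
  unfolding drift_eq by (intro closed_span_diff closed_span_cmult signal_span)

lemma drift_sq: "t \<in> {0..T} \<Longrightarrow> square_integrable M (drift t)"
  by (rule closed_spanD(1)[OF drift_span])

definition drift_const :: real where
  "drift_const = 2 * (K\<mu>\<^sup>2 * signal_const) + 2 * signal_const"

lemma signal_const_nonneg: "0 \<le> signal_const"
proof -
  have "0 \<le> expectation (\<lambda>x. (signal 1 0 x)\<^sup>2)" by simp
  also have "\<dots> \<le> signal_const" by (rule signal_bound[OF T_mem(2)])
  finally show ?thesis .
qed

lemma drift_bound:
  assumes t: "t \<in> {0..T}"
  shows "expectation (\<lambda>x. (drift t x)\<^sup>2) \<le> drift_const"
proof -
  have "expectation (\<lambda>x. (drift t x)\<^sup>2) \<le> 2 * expectation (\<lambda>x. (\<mu> t * signal 1 t x)\<^sup>2) + 2 * expectation (\<lambda>x. (signal 3 t x)\<^sup>2)"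
    unfolding drift_eq by (intro integral_square_diff_le square_integrable_cmult signal_sq t)
  moreover have "expectation (\<lambda>x. (\<mu> t * signal 1 t x)\<^sup>2) \<le> K\<mu>\<^sup>2 * signal_const"
  proof -
    have "(\<mu> t)\<^sup>2 * expectation (\<lambda>x. (signal 1 t x)\<^sup>2) \<le> K\<mu>\<^sup>2 * signal_const"
      using power_mono[OF \<mu>_bound[OF t], of 2] signal_const_nonneg by (intro mult_mono signal_bound[OF t]) auto
    then show ?thesis by (simp add: power_mult_distrib)
  qed
  ultimately show ?thesis using signal_bound[OF t, of 3] by (simp add: drift_const_def)
qed

lemma drift_B:
  assumes r: "r \<in> {0..T}" and s: "s \<in> {0..T}"
  shows "expectation (\<lambda>x. drift r x * regular (B s) x) = - (LINT u|lebesgue_on {0..s}. l r u)"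
proof -
  note B_sq = regular_square_integrable[OF B_square_integrable[OF s]]
  have "expectation (\<lambda>x. drift r x * regular (B s) x)
      = expectation (\<lambda>x. \<mu> r * (signal 1 r x * regular (B s) x) - signal 3 r x * regular (B s) x)"
    by (simp add: drift_eq left_diff_distrib mult.assoc)
  also have "\<dots> = \<mu> r * expectation (\<lambda>x. signal 1 r x * regular (B s) x) - expectation (\<lambda>x. signal 3 r x * regular (B s) x)"
    using square_integrable_mult[OF signal_sq[OF r] B_sq] by simp
  finally show ?thesis using signal_B[OF r s] by simp
qed

definition Y' :: "real \<Rightarrow> 'w \<Rightarrow> real" where
  "Y' t x = regular (B t) x + (LINT r|lebesgue_on {0..t}. drift r x)"

lemma Y'_process: "measurable_process M T Y'"
  unfolding Y'_def[abs_def]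
  by (intro measurable_process_add B'_process measurable_process_integral drift_process)

lemma Y'_span:
  assumes t: "t \<in> {0..T}"
  shows "Y' t \<in> closed_span M base"
  unfolding Y'_def[abs_def]
proof (rule closed_span_add)
  show "regular (B t) \<in> closed_span M base"
    using t by (intro regular_span closed_span_base B_square_integrable) auto
  show "(\<lambda>x. LINT r|lebesgue_on {0..t}. drift r x) \<in> closed_span M base"
    by (rule process_integral_closed_span[OF drift_process drift_sq drift_bound t]) (use t in \<open>auto intro!: drift_span\<close>)
qed

lemma Y'_sq: "t \<in> {0..T} \<Longrightarrow> square_integrable M (Y' t)"
  by (rule closed_spanD(1)[OF Y'_span])

lemma Y'_AE:
  assumes t: "t \<in> {0..T}"
  shows "AE x in M. Y' t x = Y t x"
proof -
  have t': "0 \<le> t" "t \<le> T" using t by auto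
  have "AE x in M. square_integrable (lebesgue_on {0..T}) (\<lambda>r. drift r x)"
    by (rule process_AE_path[OF drift_process drift_sq drift_bound])
  moreover have "AE x in M. square_integrable (lebesgue_on {0..T}) (\<lambda>r. \<alpha> r x)"
    by (rule process_AE_path[OF \<alpha>_process \<alpha>_sq \<alpha>_bound])
  ultimately show ?thesis
    using regular_AE
  proof eventually_elim
    case (elim x)
    have i: "integrable (lebesgue_on {0..T}) (\<lambda>r. indicator {0<..t} r * drift r x)"
      "integrable (lebesgue_on {0..T}) (\<lambda>r. indicator {0<..t} r * \<alpha> r x)"
      by (intro square_integrable_mult square_integrable_indicator_lebesgue_on elim)+
    \<comment> \<open>Written as drift plus \<alpha>, whose paths are square integrable, so that the
      integral can be split.\<close>
    have "(LINT r|lebesgue_on {0..t}. \<mu> r * X r x) = (LINT r|lebesgue_on {0..t}. drift r x + \<alpha> r x)"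
      using elim by (simp add: drift_def)
    also have "\<dots> = (LINT r|lebesgue_on {0..t}. drift r x) + (LINT r|lebesgue_on {0..t}. \<alpha> r x)"
      unfolding integral_lebesgue_on_eq_indicator[OF t'] distrib_left
      by (rule Bochner_Integration.integral_add[OF i])
    finally show ?case using elim by (simp add: Y Y'_def)
  qed
qed

text \<open>On the exceptional null set the paths of X and hence of Y are arbitrary; measurability
  comes from the regularised process by completeness.\<close>

lemma Y_meas: "t \<in> {0..T} \<Longrightarrow> Y t \<in> borel_measurable M"
  by (rule borel_measurable_AE[OF square_integrableD(1)[OF Y'_sq] Y'_AE])

lemma Y_span: "t \<in> {0..T} \<Longrightarrow> Y t \<in> closed_span M base"
  by (rule closed_span_AE[OF Y'_span Y_meas Y'_AE])

lemma Y'_L2_continuous: "L2_continuous_on M {0..T} Y'"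
proof -
  have "L2_continuous_on M {0..T} (\<lambda>t x. LINT r|lebesgue_on {0..t}. drift r x)"
    by (rule process_integral_L2_continuous[OF drift_process drift_sq drift_bound])
  with bc_L2_continuous[OF B'_covariance] show ?thesis
    unfolding L2_continuous_on_def Y'_def[abs_def] by (auto intro!: L2_tendsto_add)
qed

text \<open>The projection is taken onto the countable family \<open>Y' (t * unit_rat n)\<close>,
  which is jointly measurable in t and, by mean-square continuity, has the same closed span as all
  observations up to t.\<close>

lemma ex_filter:
  "\<exists>p. measurable_process M T p \<and> (\<forall>t\<in>{0..T}. p t \<in> closed_span M (Y' ` {0..t}) \<and>
     (\<forall>s\<in>{0..t}. expectation (\<lambda>x. Y' s x * (signal i t x - p t x)) = 0) \<and>
     p t \<in> borel_measurable (augmented_filtration M Y t))"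
proof -
  let ?N = "restrict_space borel {0..T}"
  have mem: "t * unit_rat n \<in> {0..t}" if "t \<in> {0..T}" for t n
    using that by (intro unit_rat_mult_mem) auto
  have W_meas: "(\<lambda>(t, x). Y' (t * unit_rat n) x) \<in> borel_measurable (?N \<Otimes>\<^sub>M M)" for n
  proof -
    have "(\<lambda>t. t * unit_rat n) \<in> ?N \<rightarrow>\<^sub>M ?N"
    proof (rule measurable_restrict_space2)
      show "(\<lambda>t. t * unit_rat n) \<in> space ?N \<rightarrow> {0..T}"
        using mem by (fastforce simp: space_restrict_space)
      show "(\<lambda>t. t * unit_rat n) \<in> borel_measurable ?N"
        by (intro measurable_restrict_space1) measurable
    qed
    then have "(\<lambda>p. (fst p * unit_rat n, snd p)) \<in> ?N \<Otimes>\<^sub>M M \<rightarrow>\<^sub>M ?N \<Otimes>\<^sub>M M"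
      by (intro measurable_Pair measurable_compose[OF measurable_fst] measurable_snd)
    from measurable_compose[OF this Y'_process[unfolded measurable_process_def]] show ?thesis
      by (simp add: split_beta')
  qed
  have W_sq: "square_integrable M (Y' (t * unit_rat n))" if "t \<in> space ?N" for n t
  proof -
    have "t \<in> {0..T}" using that by (simp add: space_restrict_space)
    then show ?thesis using mem[of t n] by (intro Y'_sq) auto
  qed
  have Z_sq: "square_integrable M (signal i t)" if "t \<in> space ?N" for t
    using that by (intro signal_sq) (simp add: space_restrict_space)
  obtain p where p: "(\<lambda>(t, x). p t x) \<in> borel_measurable (?N \<Otimes>\<^sub>M M)"
    "\<And>t. t \<in> space ?N \<Longrightarrow> \<exists>c. L2_tendsto M (\<lambda>n x. \<Sum>j<n. c n j * Y' (t * unit_rat j) x) (p t)"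
    "\<And>t n. t \<in> space ?N \<Longrightarrow> expectation (\<lambda>x. Y' (t * unit_rat n) x * (signal i t x - p t x)) = 0"
    "\<And>t F. \<lbrakk>t \<in> space ?N; \<And>n. Y' (t * unit_rat n) \<in> borel_measurable F\<rbrakk> \<Longrightarrow> p t \<in> borel_measurable F"
  proof (rule ex_measurable_projection[of "\<lambda>n t. Y' (t * unit_rat n)" ?N "signal i",
          OF W_meas signal_process[unfolded measurable_process_def] W_sq Z_sq])
    fix q
    assume "(\<lambda>(t, x). q t x) \<in> borel_measurable (?N \<Otimes>\<^sub>M M)"
      and "\<And>t. t \<in> space ?N \<Longrightarrow> \<exists>c. L2_tendsto M (\<lambda>n x. \<Sum>j<n. c n j * Y' (t * unit_rat j) x) (q t)"
      and "\<And>t n. t \<in> space ?N \<Longrightarrow> expectation (\<lambda>x. Y' (t * unit_rat n) x * (signal i t x - q t x)) = 0"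
      and "\<And>t F. \<lbrakk>t \<in> space ?N; \<And>n. Y' (t * unit_rat n) \<in> borel_measurable F\<rbrakk> \<Longrightarrow> q t \<in> borel_measurable F"
    then show thesis by (rule that)
  qed
  show ?thesis
  proof (intro exI[of _ p] conjI ballI)
    show "measurable_process M T p" using p(1) by (simp add: measurable_process_def)
    fix t assume t: "t \<in> {0..T}"
    then have t': "t \<in> space ?N" by (simp add: space_restrict_space)
    have sub: "{0..t} \<subseteq> {0..T}" using t by auto
    obtain c where c: "L2_tendsto M (\<lambda>n x. \<Sum>j<n. c n j * Y' (t * unit_rat j) x) (p t)" using p(2)[OF t'] by blast
    show "p t \<in> closed_span M (Y' ` {0..t})"
      by (rule closed_span_limit[OF _ c])
         (intro closed_span_sum closed_span_cmult closed_span_base imageI Y'_sq mem[OF t] subsetD[OF sub])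
    \<comment> \<open>Each \<open>Y' (t * unit_rat n)\<close> agrees almost surely with the value of
      \<open>Y\<close>, and the augmentation absorbs the difference.\<close>
    show "p t \<in> borel_measurable (augmented_filtration M Y t)"
    proof (rule p(4)[OF t'])
      fix n
      let ?s = "t * unit_rat n"
      have s: "?s \<in> {0..t}" "?s \<in> {0..T}" using mem[OF t, of n] sub by auto
      have Y_meas': "Y s \<in> borel_measurable M" if "s \<in> {0..t}" for s using that sub by (intro Y_meas) auto
      have F: "sets (augmented_filtration M Y t) = sigma_sets (space M) (generated_sets M t Y \<union> null_sets M)"
          "space (augmented_filtration M Y t) = space M"
        by (rule subalgebra_augmented_filtration; rule Y_meas'; assumption)+
      show "Y' ?s \<in> borel_measurable (augmented_filtration M Y t)"
      proof (rule in_sigma_with_null_sets[OF F(1,2) Y_meas[OF s(2)] _ square_integrableD(1)[OF Y'_sq[OF s(2)]]])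
        show "Y ?s \<in> borel_measurable (augmented_filtration M Y t)"
        proof (rule measurableI)
          fix A :: "real set" assume "A \<in> sets borel"
          then have "Y ?s -` A \<inter> space M \<in> generated_sets M t Y"
            unfolding generated_sets_def using s(1) by (intro sigma_sets.Basic) blast
          then show "Y ?s -` A \<inter> space (augmented_filtration M Y t) \<in> sets (augmented_filtration M Y t)"
            unfolding F by (intro sigma_sets.Basic) simp
        qed simp
        show "AE x in M. Y ?s x = Y' ?s x" using Y'_AE[OF s(2)] by eventually_elim simp
      qed
    qed
    fix s assume s: "s \<in> {0..t}"
    have "Y' s \<in> closed_span M (range (\<lambda>n. Y' (t * unit_rat n)))"
      by (rule L2_continuous_on_closed_span[OF L2_continuous_on_subset[OF Y'_L2_continuous sub] s])
    then show "expectation (\<lambda>x. Y' s x * (signal i t x - p t x)) = 0"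
    proof (rule closed_spanD(2))
      show "square_integrable M (\<lambda>x. signal i t x - p t x)"
        by (rule square_integrable_diff[OF signal_sq[OF t] L2_tendstoD(2)[OF c]])
    qed (use p(3)[OF t'] in auto)
  qed
qed

end

section \<open>Gain and error of a measurable version of the filter\<close>

lemma integral_outer_nth:
  fixes f :: "'a \<Rightarrow> real ^ 'm" and g :: "'a \<Rightarrow> real ^ 'n"
  assumes "\<And>i. square_integrable M (\<lambda>x. f x $ i)" "\<And>j. square_integrable M (\<lambda>x. g x $ j)"
  shows "(LINT x|M. outer (f x) (g x)) $ i $ j = (LINT x|M. f x $ i * g x $ j)"
proof -
  have "integrable M (\<lambda>x. outer (f x) (g x))"
    unfolding integrable_matrix_iff outer_def using square_integrable_mult[OF assms] by simp
  from integral_matrix_nth[OF this] show ?thesis by (simp add: outer_def)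
qed

text \<open>An arbitrary jointly measurable version of the projections, not only the constructed
  one: the innovation depends on the version through its time integral, and the theorem speaks of
  all versions.\<close>

locale filtering_version = filtering +
  fixes p :: "3 \<Rightarrow> real \<Rightarrow> 'a \<Rightarrow> real"
  assumes p_process: "\<And>i. measurable_process M T (p i)"
    and p_span: "\<And>i t. t \<in> {0..T} \<Longrightarrow> p i t \<in> closed_span M (Y' ` {0..t})"
    and p_orth: "\<And>i s t. t \<in> {0..T} \<Longrightarrow> s \<in> {0..t} \<Longrightarrow> expectation (\<lambda>x. Y' s x * (signal i t x - p i t x)) = 0"
begin

definition drift_hat :: "real \<Rightarrow> 'a \<Rightarrow> real" where
  "drift_hat t x = \<mu> t * p 1 t x - p 3 t x"

definition \<nu> :: "real \<Rightarrow> 'a \<Rightarrow> real" where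
  "\<nu> t x = Y' t x - (LINT r|lebesgue_on {0..t}. drift_hat r x)"

lemma p_sq: "t \<in> {0..T} \<Longrightarrow> square_integrable M (p i t)"
  by (rule closed_spanD(1)[OF p_span])

sublocale I: innovation M T Kl l "\<lambda>t. regular (B t)" drift Y' drift_hat \<nu> drift_const
proof unfold_locales
  show "measurable_process M T drift_hat"
    unfolding drift_hat_def[abs_def]
    by (intro measurable_process_diff measurable_process_mult_fun p_process \<mu>_meas)
  show "drift_hat t \<in> closed_span M (Y' ` {0..t})" if "t \<in> {0..T}" for t
    unfolding drift_hat_def[abs_def] by (intro closed_span_diff closed_span_cmult p_span that)
  fix s t assume st: "0 \<le> s" "s \<le> t" "t \<le> T"
  then have m: "s \<in> {0..T}" "t \<in> {0..T}" "s \<in> {0..t}" by auto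
  have sq: "square_integrable M (\<lambda>x. signal i t x - p i t x)" for i
    by (rule square_integrable_diff[OF signal_sq[OF m(2)] p_sq[OF m(2)]])
  have "expectation (\<lambda>x. Y' s x * (drift t x - drift_hat t x))
      = expectation (\<lambda>x. \<mu> t * (Y' s x * (signal 1 t x - p 1 t x)) - Y' s x * (signal 3 t x - p 3 t x))"
    by (intro Bochner_Integration.integral_cong) (simp_all add: drift_eq drift_hat_def algebra_simps)
  also have "\<dots> = \<mu> t * expectation (\<lambda>x. Y' s x * (signal 1 t x - p 1 t x)) - expectation (\<lambda>x. Y' s x * (signal 3 t x - p 3 t x))"
    using square_integrable_mult[OF Y'_sq[OF m(1)] sq] by simp
  finally show "expectation (\<lambda>x. Y' s x * (drift t x - drift_hat t x)) = 0"
    using p_orth[OF m(2,3)] by simp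
qed (simp_all add: B'_covariance drift_process drift_sq drift_bound drift_B Y'_def \<nu>_def)

text \<open>The i-th component of (P(t,r) + D(t,r)) a(r), written as the density of E (Z(t)
  \<nu>(r)): the direct noise term plus the correlation with the drift error
  \<open>I.e\<close>.\<close>

definition gain :: "3 \<Rightarrow> real \<Rightarrow> real \<Rightarrow> real" where
  "gain i t r = (if i = 3 then l t r else 0) + expectation (\<lambda>x. signal i t x * I.e r x)"

lemma direct_gain_sq:
  "t \<in> {0..T} \<Longrightarrow> s \<le> T \<Longrightarrow> square_integrable (lebesgue_on {0..s}) (\<lambda>r. if i = 3 then l t r else 0)"
  using l_section_bounded[of t s] by (cases "i = 3") simp_all

lemma signal_B_le:
  "t \<in> {0..T} \<Longrightarrow> s \<in> {0..t} \<Longrightarrow> expectation (\<lambda>x. signal i t x * regular (B s) x)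
    = (LINT r|lebesgue_on {0..s}. (if i = 3 then l t r else 0))"
  by (rule signal_B) auto

lemma gain_eq:
  assumes t: "t \<in> {0..T}" and s: "s \<in> {0..T}"
  shows "gain i t s = (if i = 3 then l t s else 0)
    + (\<mu> s * expectation (\<lambda>x. signal i t x * (signal 1 s x - p 1 s x)) - expectation (\<lambda>x. signal i t x * (signal 3 s x - p 3 s x)))"
proof -
  have sq: "square_integrable M (\<lambda>x. signal j s x - p j s x)" for j
    by (rule square_integrable_diff[OF signal_sq[OF s] p_sq[OF s]])
  have "expectation (\<lambda>x. signal i t x * I.e s x)
      = expectation (\<lambda>x. \<mu> s * (signal i t x * (signal 1 s x - p 1 s x)) - signal i t x * (signal 3 s x - p 3 s x))"
    by (intro Bochner_Integration.integral_cong) (simp_all add: I.e_def drift_eq drift_hat_def algebra_simps)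
  also have "\<dots> = \<mu> s * expectation (\<lambda>x. signal i t x * (signal 1 s x - p 1 s x)) - expectation (\<lambda>x. signal i t x * (signal 3 s x - p 3 s x))"
    using square_integrable_mult[OF signal_sq[OF t] sq] by simp
  finally show ?thesis by (simp add: gain_def)
qed

context
  fixes t :: real
  assumes t: "t \<in> {0..T}"
begin

lemma t_le: "t \<le> T" using t by simp

lemma gain_sq: "square_integrable (lebesgue_on {0..t}) (gain i t)"
  unfolding gain_def[abs_def]
  by (rule I.gain_L2[OF t signal_sq[OF t] p_span[OF t] p_orth[OF t] direct_gain_sq[OF t t_le] signal_B_le[OF t]])

lemma wiener: "is_wiener_integral M \<nu> t (gain i t) (p i t)"
  unfolding gain_def[abs_def]
  by (rule I.filter_wiener_integral[OF t signal_sq[OF t] p_span[OF t] p_orth[OF t] direct_gain_sq[OF t t_le] signal_B_le[OF t]])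

lemma signal_\<nu>: "s \<in> {0..t} \<Longrightarrow> expectation (\<lambda>x. signal i t x * \<nu> s x) = (LINT r|lebesgue_on {0..s}. gain i t r)"
  unfolding gain_def
  by (rule I.signal_\<nu>[OF t signal_sq[OF t] p_span[OF t] p_orth[OF t] direct_gain_sq[OF t t_le] signal_B_le[OF t]])

end

text \<open>Parseval for the densities of Z(t) and of the filter at the earlier time s; subtracted
  from \<open>\<Gamma>\<close>, it is the Riccati equation.\<close>

lemma signal_filter:
  assumes "0 \<le> s" "s \<le> t" "t \<le> T"
  shows "expectation (\<lambda>x. signal i t x * p j s x) = (LINT r|lebesgue_on {0..s}. gain i t r * gain j s r)"
proof -
  have m: "s \<in> {0..T}" "t \<in> {0..T}" using assms by auto
  have "expectation (\<lambda>x. signal i t x * p j s x)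
      = (LINT r|lebesgue_on {0..s}. gain i t r * ((if j = 3 then l s r else 0) + expectation (\<lambda>x. signal j s x * I.e r x)))"
  proof (rule I.filter_parseval[OF m(1) signal_sq[OF m(1)] p_span[OF m(1)] p_orth[OF m(1)] direct_gain_sq[OF m(1) t_le[OF m(1)]] signal_B_le[OF m(1)]])
    show "square_integrable M (signal i t)" by (rule signal_sq[OF m(2)])
    show "square_integrable (lebesgue_on {0..s}) (gain i t)"
      by (rule square_integrable_lebesgue_on_subset[OF gain_sq[OF m(2)] assms(2)])
    show "expectation (\<lambda>x. signal i t x * \<nu> q x) = (LINT r|lebesgue_on {0..q}. gain i t r)" if "q \<in> {0..s}" for q
      by (rule signal_\<nu>[OF m(2)]) (use that assms in auto)
  qed
  then show ?thesis by (simp add: gain_def)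
qed

text \<open>The filter is orthogonal to its own error, so P(t,t) is the covariance matrix of the
  error; symmetry and nonnegativity follow from this form.\<close>

lemma error_orthogonal:
  assumes t: "t \<in> {0..T}"
  shows "expectation (\<lambda>x. signal i t x * (signal j t x - p j t x)) = expectation (\<lambda>x. (signal i t x - p i t x) * (signal j t x - p j t x))"
proof -
  have sq: "square_integrable M (\<lambda>x. signal j t x - p j t x)" for j
    by (rule square_integrable_diff[OF signal_sq[OF t] p_sq[OF t]])
  have "expectation (\<lambda>x. p i t x * (signal j t x - p j t x)) = 0"
    by (rule closed_spanD(2)[OF p_span[OF t] sq]) (use p_orth[OF t] in auto)
  moreover have "expectation (\<lambda>x. (signal i t x - p i t x) * (signal j t x - p j t x))
      = expectation (\<lambda>x. signal i t x * (signal j t x - p j t x)) - expectation (\<lambda>x. p i t x * (signal j t x - p j t x))"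
    unfolding left_diff_distrib[of _ "p i t _"]
    by (intro Bochner_Integration.integral_diff square_integrable_mult signal_sq p_sq sq t)
  ultimately show ?thesis by simp
qed

end

context filtering
begin

text \<open>Span and orthogonality are properties at a fixed time and survive almost sure changes;
  joint measurability has to be given separately.\<close>

lemma filtering_versionI:
  assumes q: "filtering_version M T X U B Kl l \<mu> K\<mu> \<alpha> Y q"
    and p: "\<And>i. measurable_process M T (p i)" "\<And>i t. t \<in> {0..T} \<Longrightarrow> AE x in M. p i t x = q i t x"
  shows "filtering_version M T X U B Kl l \<mu> K\<mu> \<alpha> Y p"
proof -
  interpret Q: filtering_version M T X U B Kl l \<mu> K\<mu> \<alpha> Y q by fact
  have p_meas: "p i t \<in> borel_measurable M" if "t \<in> {0..T}" for i t
    by (rule measurable_process_section[OF p(1) that])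
  show ?thesis
  proof (unfold_locales, rule p(1))
    fix i t assume t: "t \<in> {0..T}"
    have eq: "AE x in M. q i t x = p i t x" using p(2)[OF t, of i] by eventually_elim simp
    show "p i t \<in> closed_span M (Y' ` {0..t})"
      by (rule closed_span_AE[OF Q.p_span[OF t] p_meas[OF t] eq])
    fix s assume s: "s \<in> {0..t}"
    then have s': "s \<in> {0..T}" using t by auto
    note [measurable] = square_integrableD(1)[OF Y'_sq[OF s']] square_integrableD(1)[OF signal_sq[OF t]]
      p_meas[OF t] square_integrableD(1)[OF Q.p_sq[OF t]]
    have "expectation (\<lambda>x. Y' s x * (signal i t x - p i t x)) = expectation (\<lambda>x. Y' s x * (signal i t x - q i t x))"
    proof (rule integral_cong_AE)
      show "AE x in M. Y' s x * (signal i t x - p i t x) = Y' s x * (signal i t x - q i t x)"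
        using eq by eventually_elim simp
    qed measurable
    then show "expectation (\<lambda>x. Y' s x * (signal i t x - p i t x)) = 0" using Q.p_orth[OF t s] by simp
  qed
qed

text \<open>The second clause is stated for every measurable Z that agrees almost surely with the
  regularised signal, so that it covers the original components of Z.\<close>

lemma ex_filtering_version:
  obtains q where "filtering_version M T X U B Kl l \<mu> K\<mu> \<alpha> Y q"
    and "\<And>i t Z. \<lbrakk>t \<in> {0..T}; Z \<in> borel_measurable M; AE x in M. signal i t x = Z x\<rbrakk> \<Longrightarrow>
      AE x in M. real_cond_exp M (augmented_filtration M Y t) Z x = q i t x"
proof -
  from choice[OF allI[OF ex_filter]] obtain q where q_all:
    "\<forall>i. measurable_process M T (q i) \<and> (\<forall>t\<in>{0..T}. q i t \<in> closed_span M (Y' ` {0..t}) \<and>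
     (\<forall>s\<in>{0..t}. expectation (\<lambda>x. Y' s x * (signal i t x - q i t x)) = 0) \<and>
     q i t \<in> borel_measurable (augmented_filtration M Y t))" ..
  then have q: "\<And>i. measurable_process M T (q i)"
      "\<And>i t. t \<in> {0..T} \<Longrightarrow> q i t \<in> closed_span M (Y' ` {0..t})"
      "\<And>i t s. t \<in> {0..T} \<Longrightarrow> s \<in> {0..t} \<Longrightarrow> expectation (\<lambda>x. Y' s x * (signal i t x - q i t x)) = 0"
      "\<And>i t. t \<in> {0..T} \<Longrightarrow> q i t \<in> borel_measurable (augmented_filtration M Y t)"
    by blast+
  have "filtering_version M T X U B Kl l \<mu> K\<mu> \<alpha> Y q"
    by unfold_locales (rule q; assumption)+
  then interpret Q: filtering_version M T X U B Kl l \<mu> K\<mu> \<alpha> Y q .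
  have "AE x in M. real_cond_exp M (augmented_filtration M Y t) Z x = q i t x"
    if t: "t \<in> {0..T}" and Z: "Z \<in> borel_measurable M" and eq: "AE x in M. signal i t x = Z x" for i t Z
  proof (rule real_cond_exp_eq_projection[OF closed_span_gaussian, where Y=Y and S=base])
    show Z_span: "Z \<in> closed_span M base" by (rule closed_span_AE[OF signal_span[OF t] Z eq])
    show "q i t \<in> closed_span M base"
      by (rule closed_span_trans[OF q(2)[OF t]]) (use t in \<open>auto intro!: Y'_span\<close>)
    show "Y s \<in> closed_span M base" if "s \<in> {0..t}" for s using that t by (intro Y_span) auto
    show "q i t \<in> borel_measurable (augmented_filtration M Y t)" by (rule q(4)[OF t])
    fix s assume s: "s \<in> {0..t}"
    then have s': "s \<in> {0..T}" using t by auto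
    note [measurable] = square_integrableD(1)[OF Y'_sq[OF s']] square_integrableD(1)[OF signal_sq[OF t]]
      Z Y_meas[OF s'] square_integrableD(1)[OF Q.p_sq[OF t]]
    have "expectation (\<lambda>x. Y s x * (Z x - q i t x)) = expectation (\<lambda>x. Y' s x * (signal i t x - q i t x))"
    proof (rule integral_cong_AE)
      show "AE x in M. Y s x * (Z x - q i t x) = Y' s x * (signal i t x - q i t x)"
        using eq Y'_AE[OF s'] by eventually_elim simp
    qed measurable
    then show "expectation (\<lambda>x. Y s x * (Z x - q i t x)) = 0" using q(3)[OF t s] by simp
  qed
  with Q.filtering_version_axioms show ?thesis by (rule that)
qed

end

text \<open>Zhat is determined only separately for each t, which leaves its time integral open. The
  filter equation is therefore asserted for every jointly measurable version Zh, and the existence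
  of one keeps this from being vacuous. The stochastic integral is a Wiener integral, because its
  integrand is deterministic, against the innovation Y - \<integral> a* Zh dr. Uniqueness concerns
  the values with s \<le> t only.\<close>

theorem theorem3p1:
  fixes M :: "'w measure" and T :: real
    and X U B \<alpha> V Y :: "real \<Rightarrow> 'w \<Rightarrow> real"
    and l :: "real \<Rightarrow> real \<Rightarrow> real" and \<mu> :: "real \<Rightarrow> real"
    and Z Zhat :: "real \<Rightarrow> 'w \<Rightarrow> real ^ 3"
    and P D \<Gamma> :: "real \<Rightarrow> real \<Rightarrow> real ^ 3 ^ 3" and a :: "real \<Rightarrow> real ^ 3"
  assumes "prob_space M" and "complete_measure M"
    and "0 < T"
    and "centered_gaussian_process M T (\<lambda>t \<omega>. (X t \<omega>, U t \<omega>))"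
    and "continuous_process M T (\<lambda>t \<omega>. (X t \<omega>, U t \<omega>))"
    and "brownian_motion M T B"
    and "prob_space.indep_set M
           (generated_sets M T B) (generated_sets M T (\<lambda>t \<omega>. (X t \<omega>, U t \<omega>)))"
    and "(\<lambda>(t, s). l t s) \<in> borel_measurable (restrict_space borel ({0..T} \<times> {0..T}))"
    and "bounded ((\<lambda>(t, s). l t s) ` ({0..T} \<times> {0..T}))"
    and "\<And>t s. t \<in> {0..T} \<Longrightarrow> s \<in> {0..T} \<Longrightarrow> t < s \<Longrightarrow> l t s = 0"
    and "\<mu> \<in> borel_measurable (restrict_space borel {0..T})"
    and "bounded (\<mu> ` {0..T})"
    and "\<And>t. t \<in> {0..T} \<Longrightarrow> \<mu> t \<noteq> 0"
    and "measurable_process M T \<alpha>"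
    and "\<And>t. t \<in> {0..T} \<Longrightarrow> is_wiener_integral M B t (l t) (\<alpha> t)"
    and "\<And>t \<omega>. V t \<omega> = B t \<omega> - (LINT s|lebesgue_on {0..t}. \<alpha> s \<omega>)"
    and "\<And>t \<omega>. Y t \<omega> = (LINT s|lebesgue_on {0..t}. \<mu> s * X s \<omega>) + V t \<omega>"
    and "\<And>t \<omega>. Z t \<omega> = vector [X t \<omega>, U t \<omega>, \<alpha> t \<omega>]"
    and "\<And>t \<omega>. Zhat t \<omega> =
           (\<chi> i. real_cond_exp M (augmented_filtration M Y t) (\<lambda>\<omega>'. Z t \<omega>' $ i) \<omega>)"
    and "\<And>t s. P t s = (LINT \<omega>|M. outer (Z t \<omega>) (Z s \<omega> - Zhat s \<omega>))"
    and "\<And>t s. \<Gamma> t s = (LINT \<omega>|M. outer (Z t \<omega>) (Z s \<omega>))"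
    and "\<And>t s. D t s = vector [vector [0, 0, 0], vector [0, 0, 0], vector [l t s / \<mu> s, 0, 0]]"
    and "\<And>s. a s = vector [\<mu> s, 0, -1]"
  shows
    "(\<exists>Zh. measurable_process M T Zh \<and> (\<forall>t\<in>{0..T}. AE \<omega> in M. Zh t \<omega> = Zhat t \<omega>)) \<and>
     (\<forall>Zh. measurable_process M T Zh \<and> (\<forall>t\<in>{0..T}. AE \<omega> in M. Zh t \<omega> = Zhat t \<omega>) \<longrightarrow>
        (\<forall>t\<in>{0..T}. \<forall>i.
           is_wiener_integral M
             (\<lambda>s \<omega>. Y s \<omega> - (LINT r|lebesgue_on {0..s}. a r \<bullet> Zh r \<omega>))
             t (\<lambda>s. ((P t s + D t s) *v a s) $ i) (\<lambda>\<omega>. Zh t \<omega> $ i))) \<and>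
     riccati_solution T a D \<Gamma> P \<and>
     (\<forall>t\<in>{0..T}. transpose (P t t) = P t t \<and> nonneg_definite (P t t)) \<and>
     (\<forall>Q. riccati_solution T a D \<Gamma> Q \<and>
          (\<forall>t\<in>{0..T}. transpose (Q t t) = Q t t \<and> nonneg_definite (Q t t)) \<longrightarrow>
          (\<forall>s t. 0 \<le> s \<and> s \<le> t \<and> t \<le> T \<longrightarrow> Q t s = P t s))"
proof -
  interpret prob_space M by fact
  interpret complete_measure M by fact
  obtain Kl where Kl: "\<And>t s. t \<in> {0..T} \<Longrightarrow> s \<in> {0..T} \<Longrightarrow> \<bar>l t s\<bar> \<le> Kl"
  proof -
    obtain K where "\<forall>v\<in>(\<lambda>(t, s). l t s) ` ({0..T} \<times> {0..T}). norm v \<le> K"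
      using assms(9) unfolding bounded_iff by blast
    then show ?thesis by (intro that[of K]) force
  qed
  obtain K\<mu> where K\<mu>: "\<And>t. t \<in> {0..T} \<Longrightarrow> \<bar>\<mu> t\<bar> \<le> K\<mu>"
  proof -
    obtain K where "\<forall>v\<in>\<mu> ` {0..T}. norm v \<le> K" using assms(12) unfolding bounded_iff by blast
    then show ?thesis by (intro that[of K]) force
  qed
  have Y_eq: "Y t \<omega> = (LINT s|lebesgue_on {0..t}. \<mu> s * X s \<omega>)
      + (B t \<omega> - (LINT s|lebesgue_on {0..t}. \<alpha> s \<omega>))" for t \<omega>
    by (simp only: assms(16,17))
  interpret filtering M T X U B Kl l \<mu> K\<mu> \<alpha> Y
    by unfold_locales (fact assms Kl K\<mu> Y_eq)+
  note mu_nonzero = assms(13)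
  note Z_def = assms(18) and Zhat_def = assms(19) and P_def = assms(20) and \<Gamma>_def = assms(21)
    and D_def = assms(22) and a_def = assms(23)
  obtain q where q_version: "filtering_version M T X U B Kl l \<mu> K\<mu> \<alpha> Y q"
    and q_cond: "\<And>i t Z. \<lbrakk>t \<in> {0..T}; Z \<in> borel_measurable M; AE x in M. signal i t x = Z x\<rbrakk> \<Longrightarrow>
      AE x in M. real_cond_exp M (augmented_filtration M Y t) Z x = q i t x"
    using ex_filtering_version by blast
  interpret Q: filtering_version M T X U B Kl l \<mu> K\<mu> \<alpha> Y q by (rule q_version)
  have Z_AE: "AE x in M. signal i t x = Z t x $ i" for i t
    using regular_AE by eventually_elim (simp add: Z_def signal_def)
  have Z_meas: "(\<lambda>x. Z t x $ i) \<in> borel_measurable M" if "t \<in> {0..T}" for i t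
    by (rule borel_measurable_AE[OF square_integrableD(1)[OF signal_sq[OF that]] Z_AE])
  have Z_sq: "square_integrable M (\<lambda>x. Z t x $ i)" if "t \<in> {0..T}" for i t
    by (rule square_integrable_AE[OF signal_sq[OF that] Z_meas[OF that] Z_AE])
  have Zhat_AE: "AE x in M. q i t x = Zhat t x $ i" if t: "t \<in> {0..T}" for i t
    using q_cond[OF t Z_meas[OF t, of i] Z_AE[of i t]] by eventually_elim (simp add: Zhat_def)
  have Zhat_meas: "(\<lambda>x. Zhat t x $ i) \<in> borel_measurable M" if "t \<in> {0..T}" for i t
    by (rule borel_measurable_AE[OF square_integrableD(1)[OF Q.p_sq[OF that]] Zhat_AE[OF that]])
  have Zhat_sq: "square_integrable M (\<lambda>x. Zhat t x $ i)" if "t \<in> {0..T}" for i t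
    by (rule square_integrable_AE[OF Q.p_sq[OF that] Zhat_meas[OF that] Zhat_AE[OF that]])
  have P_nth: "P t s $ i $ j = expectation (\<lambda>x. signal i t x * (signal j s x - q j s x))"
    if ts: "t \<in> {0..T}" "s \<in> {0..T}" for t s i j
  proof -
    have sq: "square_integrable M (\<lambda>x. (Z s x - Zhat s x) $ j)" for j
      unfolding vector_minus_component by (intro square_integrable_diff Z_sq Zhat_sq ts)
    have "P t s $ i $ j = expectation (\<lambda>x. Z t x $ i * (Z s x - Zhat s x) $ j)"
      unfolding P_def by (rule integral_outer_nth[OF Z_sq[OF ts(1)] sq])
    also have "\<dots> = expectation (\<lambda>x. signal i t x * (signal j s x - q j s x))"
    proof (rule integral_cong_AE)
      note [measurable] = Z_meas[OF ts(1)] square_integrableD(1)[OF sq] square_integrableD(1)[OF signal_sq[OF ts(1)]]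
        square_integrableD(1)[OF signal_sq[OF ts(2)]] square_integrableD(1)[OF Q.p_sq[OF ts(2)]]
      show "(\<lambda>x. Z t x $ i * (Z s x - Zhat s x) $ j) \<in> borel_measurable M"
        by (intro borel_measurable_times Z_meas[OF ts(1)] square_integrableD(1)[OF sq])
      show "(\<lambda>x. signal i t x * (signal j s x - q j s x)) \<in> borel_measurable M" by measurable
      show "AE x in M. Z t x $ i * (Z s x - Zhat s x) $ j = signal i t x * (signal j s x - q j s x)"
        using Z_AE[of i t] Z_AE[of j s] Zhat_AE[OF ts(2), of j] by eventually_elim simp
    qed
    finally show ?thesis .
  qed
  have \<Gamma>_nth: "\<Gamma> t s $ i $ j = expectation (\<lambda>x. signal i t x * signal j s x)"
    if ts: "t \<in> {0..T}" "s \<in> {0..T}" for t s i j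
  proof -
    have "\<Gamma> t s $ i $ j = expectation (\<lambda>x. Z t x $ i * Z s x $ j)"
      unfolding \<Gamma>_def by (rule integral_outer_nth[OF Z_sq[OF ts(1)] Z_sq[OF ts(2)]])
    also have "\<dots> = expectation (\<lambda>x. signal i t x * signal j s x)"
      using Z_AE[of i t] Z_AE[of j s]
      by (intro integral_mult_cong_AE Z_meas ts square_integrableD(1)[OF signal_sq])
         (auto elim: eventually_mono)
    finally show ?thesis .
  qed
  \<comment> \<open>The nonvanishing of \<mu> is used here: it cancels, and D(t,s) a(s) becomes the
    density of the correlation between Z(t) and B.\<close>
  have Da: "(D t s *v a s) $ i = (if i = 3 then l t s else 0)" if "s \<in> {0..T}" for t s i
    using mu_nonzero[OF that] exhaust_3[of i]
    by (auto simp: D_def a_def matrix_vector_mult_def sum_3 vector_3)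
  have gain_nth: "((P t s + D t s) *v a s) $ i
      = (if i = 3 then l t s else 0) + (\<mu> s * P t s $ i $ 1 - P t s $ i $ 3)"
    if "s \<in> {0..T}" for t s i
  proof -
    have "(P t s *v a s) $ i = \<mu> s * P t s $ i $ 1 - P t s $ i $ 3"
      by (simp add: a_def matrix_vector_mult_def sum_3 vector_3)
    then show ?thesis using Da[OF that] by (simp add: matrix_vector_mult_add_rdistrib)
  qed
  have gain_Q: "((P t s + D t s) *v a s) $ i = Q.gain i t s" if "t \<in> {0..T}" "s \<in> {0..T}" for t s i
    unfolding gain_nth[OF that(2)] Q.gain_eq[OF that] P_nth[OF that] ..

  have existence: "\<exists>Zh. measurable_process M T Zh \<and> (\<forall>t\<in>{0..T}. AE \<omega> in M. Zh t \<omega> = Zhat t \<omega>)"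
  proof (intro exI[of _ "\<lambda>t x. \<chi> i. q i t x"] conjI ballI)
    show "measurable_process M T (\<lambda>t x. (\<chi> i. q i t x) :: real ^ 3)"
      unfolding measurable_process_def split_beta'
    proof (rule borel_measurable_vecI)
      fix i
      show "(\<lambda>z. ((\<chi> i. q i (fst z) (snd z)) :: real ^ 3) $ i) \<in> borel_measurable (restrict_space borel {0..T} \<Otimes>\<^sub>M M)"
        using Q.p_process[of i] by (simp add: measurable_process_def split_beta')
    qed
    fix t assume "t \<in> {0..T}"
    then have "AE x in M. \<forall>i. q i t x = Zhat t x $ i" using Zhat_AE by (intro AE_all_countable[THEN iffD2]) auto
    then show "AE x in M. (\<chi> i. q i t x) = Zhat t x" by eventually_elim (simp add: vec_eq_iff)
  qed

  have filter: "is_wiener_integral M (\<lambda>s \<omega>. Y s \<omega> - (LINT r|lebesgue_on {0..s}. a r \<bullet> Zh r \<omega>))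
             t (\<lambda>s. ((P t s + D t s) *v a s) $ i) (\<lambda>\<omega>. Zh t \<omega> $ i)"
    if Zh: "measurable_process M T Zh" "\<forall>t\<in>{0..T}. AE \<omega> in M. Zh t \<omega> = Zhat t \<omega>" and t: "t \<in> {0..T}" for Zh t i
  proof -
    define p where "p i t x = Zh t x $ i" for i t x
    have p_AE: "AE x in M. p i t x = q i t x" if "t \<in> {0..T}" for i t
      using Zh(2)[rule_format, OF that] Zhat_AE[OF that, of i] by eventually_elim (simp add: p_def)
    have p_process: "measurable_process M T (p i)" for i
      using borel_measurable_vec_nth'[OF Zh(1)[unfolded measurable_process_def], of i]
      by (simp add: measurable_process_def p_def split_beta')
    \<comment> \<open>The given version has an innovation of its own, so the theory is instantiated
      afresh for it; its gain is matched with P below, since P depends on the almost sure class of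
      the filter at each time only.\<close>
    interpret V: filtering_version M T X U B Kl l \<mu> K\<mu> \<alpha> Y p
      by (rule filtering_versionI[OF q_version p_process p_AE])
    have inner: "a r \<bullet> Zh r x = V.drift_hat r x" for r x
      by (simp add: a_def V.drift_hat_def p_def inner_vec_def sum_3 vector_3)
    have "is_wiener_integral M (\<lambda>s \<omega>. Y s \<omega> - (LINT r|lebesgue_on {0..s}. a r \<bullet> Zh r \<omega>))
             t (\<lambda>s. ((P t s + D t s) *v a s) $ i) (p i t)"
    proof (rule is_wiener_integral_cong[OF V.wiener[OF t]])
      fix s assume s: "s \<in> {0..t}"
      then have s': "s \<in> {0..T}" using t by auto
      show AE: "AE x in M. V.\<nu> s x = Y s x - (LINT r|lebesgue_on {0..s}. a r \<bullet> Zh r x)"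
        unfolding inner V.\<nu>_def using Y'_AE[OF s'] by eventually_elim simp
      show "(\<lambda>x. Y s x - (LINT r|lebesgue_on {0..s}. a r \<bullet> Zh r x)) \<in> borel_measurable M"
        by (rule borel_measurable_AE[OF square_integrableD(1)[OF V.I.\<nu>_sq[OF s']] AE])
      have "P t s $ i $ j = expectation (\<lambda>x. signal i t x * (signal j s x - p j s x))" for j
      proof -
        note [measurable] = square_integrableD(1)[OF signal_sq[OF t]] square_integrableD(1)[OF signal_sq[OF s']]
          square_integrableD(1)[OF Q.p_sq[OF s']] square_integrableD(1)[OF V.p_sq[OF s']]
        have "expectation (\<lambda>x. signal i t x * (signal j s x - q j s x)) = expectation (\<lambda>x. signal i t x * (signal j s x - p j s x))"
        proof (rule integral_cong_AE)
          show "AE x in M. signal i t x * (signal j s x - q j s x) = signal i t x * (signal j s x - p j s x)"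
            using p_AE[OF s', of j] by eventually_elim simp
        qed measurable
        then show ?thesis using P_nth[OF t s'] by simp
      qed
      then show "V.gain i t s = ((P t s + D t s) *v a s) $ i"
        unfolding gain_nth[OF s'] V.gain_eq[OF t s'] by simp
    qed
    then show ?thesis by (simp add: p_def[abs_def])
  qed

  have riccati: "riccati_solution T a D \<Gamma> P"
    unfolding riccati_solution_def matrix_outer_sandwich
  proof (intro allI impI conjI)
    fix s t assume "0 \<le> s \<and> s \<le> t \<and> t \<le> T"
    then have st: "0 \<le> s" "s \<le> t" "t \<le> T" and m: "s \<in> {0..T}" "t \<in> {0..T}" by auto
    let ?F = "\<lambda>r. outer ((P t r + D t r) *v a r) ((P s r + D s r) *v a r)"
    have F_nth: "?F r $ i $ j = Q.gain i t r * Q.gain j s r" if "r \<in> {0..s}" for r i j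
    proof -
      have "r \<in> {0..T}" using that m by auto
      then show ?thesis using gain_Q m by (simp add: outer_def)
    qed
    have "integrable (lebesgue_on {0..s}) (\<lambda>r. ?F r $ i $ j)" for i j
    proof -
      have "integrable (lebesgue_on {0..s}) (\<lambda>r. Q.gain i t r * Q.gain j s r)"
        by (intro square_integrable_mult Q.gain_sq m square_integrable_lebesgue_on_subset[OF Q.gain_sq[OF m(2)] st(2)])
      then show ?thesis
        using F_nth Bochner_Integration.integrable_cong[of "lebesgue_on {0..s}" "lebesgue_on {0..s}" "\<lambda>r. ?F r $ i $ j"] by simp
    qed
    then show int: "integrable (lebesgue_on {0..s}) ?F"
      unfolding integrable_matrix_iff by (intro allI)
    have "P t s $ i $ j = - (LINT r|lebesgue_on {0..s}. ?F r) $ i $ j + \<Gamma> t s $ i $ j" for i j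
    proof -
      have "(LINT r|lebesgue_on {0..s}. ?F r) $ i $ j = (LINT r|lebesgue_on {0..s}. ?F r $ i $ j)"
        by (rule integral_matrix_nth[OF int])
      also have "\<dots> = (LINT r|lebesgue_on {0..s}. Q.gain i t r * Q.gain j s r)"
        by (intro Bochner_Integration.integral_cong refl F_nth) simp
      also have "\<dots> = expectation (\<lambda>x. signal i t x * q j s x)"
        by (rule Q.signal_filter[OF st, symmetric])
      finally show ?thesis
        using square_integrable_mult[OF signal_sq[OF m(2)] signal_sq[OF m(1)], of i j]
          square_integrable_mult[OF signal_sq[OF m(2)] Q.p_sq[OF m(1)], of i j]
        by (simp add: P_nth[OF m(2,1)] \<Gamma>_nth[OF m(2,1)] right_diff_distrib)
    qed
    then show "P t s = - (LINT r|lebesgue_on {0..s}. ?F r) + \<Gamma> t s" by (simp add: vec_eq_iff)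
  qed

  have error: "transpose (P t t) = P t t \<and> nonneg_definite (P t t)" if t: "t \<in> {0..T}" for t
  proof -
    \<comment> \<open>The estimation error at time t; the quadratic form of P(t,t) at v is the
      second moment of the combination of its components with weights v.\<close>
    define d where "d i x = signal i t x - q i t x" for i x
    have d_sq: "square_integrable M (d i)" for i
      unfolding d_def[abs_def] by (rule square_integrable_diff[OF signal_sq[OF t] Q.p_sq[OF t]])
    have P: "P t t $ i $ j = expectation (\<lambda>x. d i x * d j x)" for i j
      unfolding P_nth[OF t t] d_def by (rule Q.error_orthogonal[OF t])
    have "0 \<le> v \<bullet> (P t t *v v)" for v
    proof -
      have "0 \<le> expectation (\<lambda>x. (\<Sum>i\<in>UNIV. v $ i * d i x)\<^sup>2)" by simp
      also have "\<dots> = expectation (\<lambda>x. \<Sum>i\<in>UNIV. \<Sum>j\<in>UNIV. v $ i * v $ j * (d i x * d j x))"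
        by (intro Bochner_Integration.integral_cong) (simp_all add: power2_eq_square sum_product mult_ac)
      also have "\<dots> = (\<Sum>i\<in>UNIV. \<Sum>j\<in>UNIV. v $ i * v $ j * expectation (\<lambda>x. d i x * d j x))"
        using square_integrable_mult[OF d_sq d_sq] by (simp add: Bochner_Integration.integral_sum)
      also have "\<dots> = v \<bullet> (P t t *v v)"
        by (simp add: inner_vec_def matrix_vector_mult_def P sum_distrib_left mult_ac)
      finally show ?thesis .
    qed
    then show ?thesis
      by (simp add: nonneg_definite_def transpose_def vec_eq_iff P mult.commute)
  qed

  have unique: "Q t s = P t s"
    if Q: "riccati_solution T a D \<Gamma> Q" "\<forall>t\<in>{0..T}. transpose (Q t t) = Q t t \<and> nonneg_definite (Q t t)"
      and st: "0 \<le> s" "s \<le> t" "t \<le> T" for Q s t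
  proof (rule riccati_unique[OF _ _ _ Q(1) _ riccati])
    show "\<bar>a r $ i\<bar> \<le> max K\<mu> 1" if "r \<in> {0..T}" for r i
      using exhaust_3[of i] K\<mu>[OF that] by (auto simp: a_def vector_3)
    show "\<bar>(D t r *v a r) $ i\<bar> \<le> Kl" if "0 \<le> r" "r \<le> t" "t \<le> T" for r t i
      using Da[of r t i] Kl[of t r] K_nonneg that by simp
    show "\<bar>\<Gamma> t r $ i $ j\<bar> \<le> signal_const" if "0 \<le> r" "r \<le> t" "t \<le> T" for r t i j
    proof -
      have m: "t \<in> {0..T}" "r \<in> {0..T}" using that by auto
      have "\<bar>\<Gamma> t r $ i $ j\<bar> \<le> sqrt (expectation (\<lambda>x. (signal i t x)\<^sup>2)) * sqrt (expectation (\<lambda>x. (signal j r x)\<^sup>2))"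
        unfolding \<Gamma>_nth[OF m] by (rule Cauchy_Schwarz_abs[OF signal_sq[OF m(1)] signal_sq[OF m(2)]])
      also have "\<dots> \<le> sqrt signal_const * sqrt signal_const"
        by (intro mult_mono real_sqrt_le_mono signal_bound m real_sqrt_ge_zero signal_const_nonneg) simp
      finally show ?thesis using signal_const_nonneg by simp
    qed
  qed (use Q error st in auto)

  show ?thesis
    using existence filter riccati error unique by blast
qed

end
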